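(* Let $K=(0,1)^2$ be the unit square with edges parallel to the axes, $M=P_k(\partial K)^2$, $\Sigma_g=Q_k(K;\mathbb S)$, $V_g=Q_k(K)^2$, where $k\ge1$. Then $$I_M(\Sigma_g\times V_g)=\begin{cases}6&k=1,\\9&k=2,\\10&k\ge3,\end{cases}\qquad I_S(\Sigma_g\times V_g)=3.$$ Moreover, let $\xi_4$ satisfy conditions (L.1)–(L.3) with $i=4$ and let $B_i$ satisfy conditions (H.1)–(H.3) for $i=2,3,4$, and define $$\delta\Sigma_{\mathrm{fillM}}=\begin{cases}J\,\mathrm{span}\{B_2,B_3,B_4,\xi_4^2,\xi_4^2(1-x),\xi_4^2(1-y)\}&k=1,\\[2pt] J\,\mathrm{span}\{B_2,B_3,B_4,B_4x,\xi_4^2(1-x),\xi_4^2(1-y),\xi_4^2(1-x)(1-y),\xi_4^2(1-x)^2,\xi_4^2(1-y)^2\}&k=2,\\[2pt] J\,\mathrm{span}\{B_2,B_3,B_4,B_4x,\xi_4^2(1-x)^{k-1},\xi_4^2(1-y)^{k-1},\\ \qquad\xi_4^2(1-x)^{k-1}(1-y),\xi_4^2(1-x)(1-y)^{k-1},\xi_4^2(1-x)^k,\xi_4^2(1-y)^k\}&k\ge3,\end{cases}$$ $$\delta\Sigma_{\mathrm{fillV}}=\mathrm{span}\left\{\begin{bmatrix}x^{k+1}y^{k-1}&0\\0&0\end{bmatrix},\begin{bmatrix}x^{k+1}y^k&0\\0&0\end{bmatrix},\begin{bmatrix}0&0\\0&x^ky^{k+1}\end{bmatrix}\right\}.$$ Then: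 (i) $\nabla\cdot\delta\Sigma_{\mathrm{fillM}}=\{0\}$, $\gamma\,\delta\Sigma_{\mathrm{fillM}}\subset M$, $\gamma\,\delta\Sigma_{\mathrm{fillM}}\cap\gamma\Sigma_{g,s}=\{0\}$, and $\dim\delta\Sigma_{\mathrm{fillM}}=\dim\gamma\,\delta\Sigma_{\mathrm{fillM}}=I_M(\Sigma_g\times V_g)$; (ii) $\nabla\cdot\delta\Sigma_{\mathrm{fillV}}\subset V_g$, $\nabla\cdot\delta\Sigma_{\mathrm{fillV}}\cap\nabla\cdot\Sigma_g=\{0\}$, $\gamma\,\delta\Sigma_{\mathrm{fillV}}\subset M$, and $\dim\delta\Sigma_{\mathrm{fillV}}=\dim\nabla\cdot\delta\Sigma_{\mathrm{fillV}}=I_S(\Sigma_g\times V_g)$.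
   Context: $\mathbb S$: symmetric $2\times2$ real matrices. $P_k(\partial K)^2$: vector functions on $\partial K$ whose restriction to each edge is polynomial of degree $\le k$ (no continuity at vertices). $Q_k$: polynomials of degree $\le k$ in each variable. The vertices, counter-clockwise, are $\mathrm v_1=(0,1),\mathrm v_2=(0,0),\mathrm v_3=(1,0),\mathrm v_4=(1,1)$; edge $\mathrm e_i$ connects $\mathrm v_i$ and $\mathrm v_{i+1}$ (indices modulo $4$), with outward unit normal $n_i$. $\lambda_1=x,\lambda_2=y,\lambda_3=1-x,\lambda_4=1-y$ ($\lambda_i$ is the linear function vanishing on $\mathrm e_i$ with maximum $1$ on $\overline K$). Airy stress operator: $J\phi=\begin{pmatrix}\partial_{yy}\phi&-\partial_{xy}\phi\\-\partial_{xy}\phi&\partial_{xx}\phi\end{pmatrix}$, applied to $H^2$-conforming scalar fields; $J\,\mathrm{span}\{\dots\}$ is the image of the span. Conditions on $\xi_i$: (L.1) $\xi_i|_{\mathrm e_j}\in P_1(\mathrm e_j)$ for all $j$; (L.2) $\xi_i(\mathrm v_j)=\delta_{ij}$ for all $j$; (L.3) $\frac{\partial\xi_i}{\partial n_j}|_{\mathrm e_j}\in P_0(\mathrm e_j)$ for all $j$. Conditions on $B_i$: (H.1) $B_i|_{\mathrm e_j}=0$ for all $j$; (H.2) $\frac{\partial B_i}{\partial n_j}|_{\mathrm e_j}=0$ for all $j\ne i$; (H.3) $\frac{\partial B_i}{\partial n_i}|_{\mathrm e_i}=\lambda_{i-1}\lambda_{i+1}$. The functions are assumed regular enough that the scalar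 fields to which $J$ is applied are in $H^2(K)$. $\gamma S=\{\tau n|_{\partial K}:\tau\in S\}$ (normal trace), $\nabla\cdot$ is the row-wise divergence, $\epsilon(v)=\frac12(\nabla v+\nabla v^T)$, $\Sigma_{g,s}=\{\tau\in\Sigma_g:\nabla\cdot\tau=0\}$. $I_M(\Sigma\times V)=\dim M-\dim\{\tau n|_{\partial K}:\tau\in\Sigma,\nabla\cdot\tau=0\}-\dim\{v|_{\partial K}:v\in V,\epsilon(v)=0\}$; $I_S(\Sigma\times V)=\dim V-\dim\nabla\cdot\Sigma$. *)

theory Defs
  imports "HOL-Analysis.Analysis" "HOL-Computational_Algebra.Polynomial"
begin

section \<open>Geometry of the unit square\<close>

text \<open>
  Vertices and edges are indexed by the type \<open>4\<close>, whose arithmetic is modulo 4 (so that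
  \<open>4 = 0\<close> and \<open>4 + 1 = 1\<close>).
\<close>

definition K :: "(real^2) set" where
  "K = {p. 0 < p$1 \<and> p$1 < 1 \<and> 0 < p$2 \<and> p$2 < 1}"

definition vertex :: "4 \<Rightarrow> real^2" where
  "vertex i = (if i = 1 then vector [0, 1] else if i = 2 then vector [0, 0]
               else if i = 3 then vector [1, 0] else vector [1, 1])"

text \<open>All edges have length 1, so this is the arc-length parametrisation of the edge over
  \<open>{0..1}\<close>.\<close>

definition edge :: "4 \<Rightarrow> real \<Rightarrow> real^2" where
  "edge i t = vertex i + t *\<^sub>R (vertex (i + 1) - vertex i)"

definition nrm :: "4 \<Rightarrow> real^2" where
  "nrm i = (if i = 1 then vector [-1, 0] else if i = 2 then vector [0, -1]
            else if i = 3 then vector [1, 0] else vector [0, 1])"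

definition lam :: "4 \<Rightarrow> real^2 \<Rightarrow> real" where
  "lam i p = (if i = 1 then p$1 else if i = 2 then p$2
              else if i = 3 then 1 - p$1 else 1 - p$2)"


section \<open>Functions on \<open>K\<close> and on its boundary, modulo null sets\<close>

definition ae_eq_K :: "(real^2 \<Rightarrow> 'b) \<Rightarrow> (real^2 \<Rightarrow> 'b) \<Rightarrow> bool" where
  "ae_eq_K f g \<longleftrightarrow> (AE p in lebesgue_on K. f p = g p)"

definition ae_eq_bd :: "(real^2 \<Rightarrow> 'b) \<Rightarrow> (real^2 \<Rightarrow> 'b) \<Rightarrow> bool" where
  "ae_eq_bd f g \<longleftrightarrow> (\<forall>i. AE t in lebesgue_on {0..1}. f (edge i t) = g (edge i t))"

lemma equivp_ae_eq_K: "equivp (ae_eq_K :: (real^2 \<Rightarrow> 'b) \<Rightarrow> _)"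
proof (rule equivpI)
  show "reflp (ae_eq_K :: (real^2 \<Rightarrow> 'b) \<Rightarrow> _)" by (auto simp: reflp_def ae_eq_K_def)
  show "symp (ae_eq_K :: (real^2 \<Rightarrow> 'b) \<Rightarrow> _)" by (auto simp: symp_def ae_eq_K_def eq_commute)
  show "transp (ae_eq_K :: (real^2 \<Rightarrow> 'b) \<Rightarrow> _)"
  proof (rule transpI)
    fix f g h :: "real^2 \<Rightarrow> 'b" assume "ae_eq_K f g" "ae_eq_K g h"
    then show "ae_eq_K f h" unfolding ae_eq_K_def by eventually_elim simp
  qed
qed

lemma equivp_ae_eq_bd: "equivp (ae_eq_bd :: (real^2 \<Rightarrow> 'b) \<Rightarrow> _)"
proof (rule equivpI)
  show "reflp (ae_eq_bd :: (real^2 \<Rightarrow> 'b) \<Rightarrow> _)" by (auto simp: reflp_def ae_eq_bd_def)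
  show "symp (ae_eq_bd :: (real^2 \<Rightarrow> 'b) \<Rightarrow> _)" by (auto simp: symp_def ae_eq_bd_def eq_commute)
  show "transp (ae_eq_bd :: (real^2 \<Rightarrow> 'b) \<Rightarrow> _)"
  proof (rule transpI)
    fix f g h :: "real^2 \<Rightarrow> 'b" assume a: "ae_eq_bd f g" "ae_eq_bd g h"
    show "ae_eq_bd f h" unfolding ae_eq_bd_def
    proof
      fix i
      from a have "AE t in lebesgue_on {0..1}. f (edge i t) = g (edge i t)"
        "AE t in lebesgue_on {0..1}. g (edge i t) = h (edge i t)" by (simp_all add: ae_eq_bd_def)
      then show "AE t in lebesgue_on {0..1}. f (edge i t) = h (edge i t)" by eventually_elim simp
    qed
  qed
qed

lemma ae_eq_K_cong1: "ae_eq_K f g \<Longrightarrow> ae_eq_K (\<lambda>p. h (f p)) (\<lambda>p. h (g p))"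
  unfolding ae_eq_K_def by (erule eventually_mono) simp

lemma ae_eq_K_cong2:
  assumes "ae_eq_K f g" "ae_eq_K f' g'"
  shows "ae_eq_K (\<lambda>p. h (f p) (f' p)) (\<lambda>p. h (g p) (g' p))"
  using assms unfolding ae_eq_K_def by eventually_elim simp

lemma ae_eq_bd_cong2:
  assumes "ae_eq_bd f g" "ae_eq_bd f' g'"
  shows "ae_eq_bd (\<lambda>p. h (f p) (f' p)) (\<lambda>p. h (g p) (g' p))"
  unfolding ae_eq_bd_def
proof
  fix i
  from assms have "AE t in lebesgue_on {0..1}. f (edge i t) = g (edge i t)"
    "AE t in lebesgue_on {0..1}. f' (edge i t) = g' (edge i t)" by (simp_all add: ae_eq_bd_def)
  then show "AE t in lebesgue_on {0..1}. h (f (edge i t)) (f' (edge i t)) =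
      h (g (edge i t)) (g' (edge i t))" by eventually_elim simp
qed

lemma ae_eq_bd_cong1: "ae_eq_bd f g \<Longrightarrow> ae_eq_bd (\<lambda>p. h (f p)) (\<lambda>p. h (g p))"
  using ae_eq_bd_cong2[of f g f g "\<lambda>x _. h x"] by simp

quotient_type 'b fld = "real^2 \<Rightarrow> 'b" / ae_eq_K
  by (rule equivp_ae_eq_K)

quotient_type 'b bdfld = "real^2 \<Rightarrow> 'b" / ae_eq_bd
  by (rule equivp_ae_eq_bd)

abbreviation on_K :: "(real^2 \<Rightarrow> 'b) \<Rightarrow> 'b fld" where "on_K \<equiv> abs_fld"
abbreviation on_bd :: "(real^2 \<Rightarrow> 'b) \<Rightarrow> 'b bdfld" where "on_bd \<equiv> abs_bdfld"

instantiation fld :: (real_vector) real_vector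
begin

lift_definition zero_fld :: "'a fld" is "\<lambda>p. 0" .
lift_definition plus_fld :: "'a fld \<Rightarrow> 'a fld \<Rightarrow> 'a fld" is "\<lambda>f g p. f p + g p"
  by (rule ae_eq_K_cong2)
lift_definition minus_fld :: "'a fld \<Rightarrow> 'a fld \<Rightarrow> 'a fld" is "\<lambda>f g p. f p - g p"
  by (rule ae_eq_K_cong2)
lift_definition uminus_fld :: "'a fld \<Rightarrow> 'a fld" is "\<lambda>f p. - f p"
  by (rule ae_eq_K_cong1)
lift_definition scaleR_fld :: "real \<Rightarrow> 'a fld \<Rightarrow> 'a fld" is "\<lambda>c f p. c *\<^sub>R f p"
  by (rule ae_eq_K_cong1)

instance
  by standard (transfer, simp add: ae_eq_K_def algebra_simps)+

end

instantiation bdfld :: (real_vector) real_vector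
begin

lift_definition zero_bdfld :: "'a bdfld" is "\<lambda>p. 0" .
lift_definition plus_bdfld :: "'a bdfld \<Rightarrow> 'a bdfld \<Rightarrow> 'a bdfld" is "\<lambda>f g p. f p + g p"
  by (rule ae_eq_bd_cong2)
lift_definition minus_bdfld :: "'a bdfld \<Rightarrow> 'a bdfld \<Rightarrow> 'a bdfld" is "\<lambda>f g p. f p - g p"
  by (rule ae_eq_bd_cong2)
lift_definition uminus_bdfld :: "'a bdfld \<Rightarrow> 'a bdfld" is "\<lambda>f p. - f p"
  by (rule ae_eq_bd_cong1)
lift_definition scaleR_bdfld :: "real \<Rightarrow> 'a bdfld \<Rightarrow> 'a bdfld" is "\<lambda>c f p. c *\<^sub>R f p"
  by (rule ae_eq_bd_cong1)

instance
  by standard (transfer, simp add: ae_eq_bd_def algebra_simps)+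

end

text \<open>Below, \<open>rep_fld u\<close> and \<open>rep_bdfld m\<close> are arbitrary representatives of a class; all uses
  are invariant under changes on null sets (Lebesgue measure is complete).\<close>

definition L2 :: "'b::euclidean_space fld set" where
  "L2 = {u. rep_fld u \<in> borel_measurable (lebesgue_on K) \<and>
            integrable (lebesgue_on K) (\<lambda>p. (norm (rep_fld u p))\<^sup>2)}"

definition L2_bd :: "'b::euclidean_space bdfld set" where
  "L2_bd = {m. \<forall>i. (\<lambda>t. rep_bdfld m (edge i t)) \<in> borel_measurable (lebesgue_on {0..1}) \<and>
            integrable (lebesgue_on {0..1}) (\<lambda>t. (norm (rep_bdfld m (edge i t)))\<^sup>2)}"


section \<open>Weak derivatives, \<open>H\<^sup>2(K)\<close>, divergence and normal trace\<close>

definition pd :: "2 \<Rightarrow> (real^2 \<Rightarrow> real) \<Rightarrow> real^2 \<Rightarrow> real" where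
  "pd j f p = frechet_derivative f (at p) (axis j 1)"

definition grad :: "(real^2 \<Rightarrow> real) \<Rightarrow> real^2 \<Rightarrow> real^2" where
  "grad f p = (\<chi> j. pd j f p)"

definition C1 :: "(real^2 \<Rightarrow> real) set" where
  "C1 = {f. (\<forall>p. f differentiable (at p)) \<and> (\<forall>j. continuous_on UNIV (pd j f))}"

definition C1c :: "(real^2 \<Rightarrow> real) set" where
  "C1c = {f \<in> C1. \<exists>C. compact C \<and> C \<subseteq> K \<and> (\<forall>p. p \<notin> C \<longrightarrow> f p = 0)}"

definition has_wpd :: "2 \<Rightarrow> real fld \<Rightarrow> real fld \<Rightarrow> bool" where
  "has_wpd j u g \<longleftrightarrow> u \<in> L2 \<and> g \<in> L2 \<and>
     (\<forall>\<psi>\<in>C1c. (LINT p|lebesgue_on K. rep_fld u p * pd j \<psi> p)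
             = - (LINT p|lebesgue_on K. rep_fld g p * \<psi> p))"

definition wpd :: "2 \<Rightarrow> real fld \<Rightarrow> real fld" where
  "wpd j u = (THE g. has_wpd j u g)"

definition H1 :: "real fld set" where
  "H1 = {u. \<forall>j. \<exists>g. has_wpd j u g}"

definition H2 :: "real fld set" where
  "H2 = {u \<in> H1. \<forall>j. wpd j u \<in> H1}"

definition airy :: "real fld \<Rightarrow> (real^2^2) fld" where
  "airy \<phi> = on_K (\<lambda>p. vector
     [vector [rep_fld (wpd 2 (wpd 2 \<phi>)) p, - rep_fld (wpd 1 (wpd 2 \<phi>)) p],
      vector [- rep_fld (wpd 1 (wpd 2 \<phi>)) p, rep_fld (wpd 1 (wpd 1 \<phi>)) p]])"

definition has_wdiv :: "(real^2^2) fld \<Rightarrow> (real^2) fld \<Rightarrow> bool" where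
  "has_wdiv \<tau> d \<longleftrightarrow> \<tau> \<in> L2 \<and> d \<in> L2 \<and>
     (\<forall>i. \<forall>\<psi>\<in>C1c. (LINT p|lebesgue_on K. (rep_fld \<tau> p $ i) \<bullet> grad \<psi> p)
                 = - (LINT p|lebesgue_on K. (rep_fld d p $ i) * \<psi> p))"

definition wdiv :: "(real^2^2) fld \<Rightarrow> (real^2) fld" where
  "wdiv \<tau> = (THE d. has_wdiv \<tau> d)"

text \<open>
  The normal trace \<open>\<tau> n\<close> on the boundary of a field \<open>\<tau>\<close> in \<open>H(div)\<close>, defined as usual by
  Green's formula, row by row; no smoothness of \<open>\<tau>\<close> up to the boundary is needed.  For \<open>\<tau>\<close>
  continuous up to the boundary it is the pointwise product \<open>\<tau> *v nrm i\<close> on the i-th edge.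
\<close>

definition has_ntrace :: "(real^2^2) fld \<Rightarrow> (real^2) bdfld \<Rightarrow> bool" where
  "has_ntrace \<tau> m \<longleftrightarrow> m \<in> L2_bd \<and> (\<exists>d. has_wdiv \<tau> d \<and>
     (\<forall>i. \<forall>\<psi>\<in>C1.
        (LINT p|lebesgue_on K. (rep_fld \<tau> p $ i) \<bullet> grad \<psi> p + (rep_fld d p $ i) * \<psi> p)
        = (\<Sum>j\<in>UNIV. LINT t|lebesgue_on {0..1}.
              (rep_bdfld m (edge j t) $ i) * \<psi> (edge j t))))"

definition ntrace :: "(real^2^2) fld \<Rightarrow> (real^2) bdfld" where
  "ntrace \<tau> = (THE m. has_ntrace \<tau> m)"

definition symgrad :: "(real^2) fld \<Rightarrow> (real^2^2) fld" where
  "symgrad v = on_K (\<lambda>p. \<chi> i j.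
     (rep_fld (wpd j (on_K (\<lambda>q. rep_fld v q $ i))) p +
      rep_fld (wpd i (on_K (\<lambda>q. rep_fld v q $ j))) p) / 2)"

text \<open>Restriction to the boundary of a class with a representative continuous on the closed
  square (the restriction does not depend on which one is taken).\<close>

definition restr_bd :: "(real^2) fld \<Rightarrow> (real^2) bdfld" where
  "restr_bd v = on_bd (SOME f. continuous_on (closure K) f \<and> on_K f = v)"


section \<open>Polynomial spaces and the two indices\<close>

definition Qpoly :: "nat \<Rightarrow> (real^2 \<Rightarrow> real) set" where
  "Qpoly k = {f. \<exists>c. \<forall>p. f p = (\<Sum>i\<le>k. \<Sum>j\<le>k. c i j * (p$1)^i * (p$2)^j)}"

definition Sigma_g :: "nat \<Rightarrow> (real^2^2) fld set" where
  "Sigma_g k = {on_K \<tau> |\<tau>. (\<forall>i j. (\<lambda>p. \<tau> p $ i $ j) \<in> Qpoly k) \<and>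
                             (\<forall>p. transpose (\<tau> p) = \<tau> p)}"

definition V_g :: "nat \<Rightarrow> (real^2) fld set" where
  "V_g k = {on_K v |v. \<forall>i. (\<lambda>p. v p $ i) \<in> Qpoly k}"

text \<open>The edges are taken without their end points, so that nothing is imposed at the
  vertices.\<close>

definition Ppoly_edge :: "nat \<Rightarrow> 4 \<Rightarrow> (real^2 \<Rightarrow> real) set" where
  "Ppoly_edge k i = {f. \<exists>q::real poly. degree q \<le> k \<and> (\<forall>t\<in>{0<..<1}. f (edge i t) = poly q t)}"

definition Mspace :: "nat \<Rightarrow> (real^2) bdfld set" where
  "Mspace k = {on_bd \<mu> |\<mu>. \<forall>i c. (\<lambda>p. \<mu> p $ c) \<in> Ppoly_edge k i}"

definition divfree :: "(real^2^2) fld set \<Rightarrow> (real^2^2) fld set" where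
  "divfree S = {\<tau>\<in>S. wdiv \<tau> = 0}"

definition I_M :: "(real^2) bdfld set \<Rightarrow> (real^2^2) fld set \<Rightarrow> (real^2) fld set \<Rightarrow> int" where
  "I_M M S V = int (dim M) - int (dim (ntrace ` divfree S))
               - int (dim (restr_bd ` {v\<in>V. symgrad v = 0}))"

definition I_S :: "(real^2^2) fld set \<Rightarrow> (real^2) fld set \<Rightarrow> int" where
  "I_S S V = int (dim V) - int (dim (wdiv ` S))"


section \<open>The functions \<open>\<xi>\<^sub>i\<close> and \<open>B\<^sub>i\<close>, and the filling spaces\<close>

text \<open>
  The outward normal derivative of \<open>f\<close> on the i-th edge equals \<open>g\<close>: one-sided derivative from
  inside the square, at almost every point of the edge.  The functions \<open>\<xi>\<^sub>i\<close>, and in general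
  \<open>B\<^sub>i\<close>, are not smooth at the vertices.
\<close>

definition has_nderiv :: "4 \<Rightarrow> (real^2 \<Rightarrow> real) \<Rightarrow> (real^2 \<Rightarrow> real) \<Rightarrow> bool" where
  "has_nderiv i f g \<longleftrightarrow> (AE t in lebesgue_on {0..1}.
     ((\<lambda>s. f (edge i t + s *\<^sub>R nrm i)) has_real_derivative g (edge i t)) (at_left 0))"

text \<open>
  Continuity on the closed square makes the boundary restrictions meaningful.  It is the only
  regularity asked of \<open>\<xi>\<^sub>i\<close> itself: no function satisfying the conditions is in \<open>H\<^sup>2(K)\<close>, only
  products such as its square are.
\<close>

definition cond_L :: "4 \<Rightarrow> (real^2 \<Rightarrow> real) \<Rightarrow> bool" where
  "cond_L i \<xi> \<longleftrightarrow> continuous_on (closure K) \<xi> \<and>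
     (\<forall>j. \<xi> \<in> Ppoly_edge 1 j) \<and>
     (\<forall>j. \<xi> (vertex j) = (if j = i then 1 else 0)) \<and>
     (\<forall>j. \<exists>g\<in>Ppoly_edge 0 j. has_nderiv j \<xi> g)"

definition cond_H :: "4 \<Rightarrow> (real^2 \<Rightarrow> real) \<Rightarrow> bool" where
  "cond_H i B \<longleftrightarrow> continuous_on (closure K) B \<and>
     (\<forall>j. \<forall>t\<in>{0..1}. B (edge j t) = 0) \<and>
     (\<forall>j. j \<noteq> i \<longrightarrow> has_nderiv j B (\<lambda>p. 0)) \<and>
     has_nderiv i B (\<lambda>p. lam (i - 1) p * lam (i + 1) p)"

definition fillM_gen :: "nat \<Rightarrow> (real^2 \<Rightarrow> real) \<Rightarrow> (4 \<Rightarrow> real^2 \<Rightarrow> real) \<Rightarrow> real fld set" where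
  "fillM_gen k \<xi> B = on_K `
    (if k = 1 then
       {B 2, B 3, B 4,
        \<lambda>p. (\<xi> p)\<^sup>2, \<lambda>p. (\<xi> p)\<^sup>2 * (1 - p$1), \<lambda>p. (\<xi> p)\<^sup>2 * (1 - p$2)}
     else if k = 2 then
       {B 2, B 3, B 4, \<lambda>p. B 4 p * p$1,
        \<lambda>p. (\<xi> p)\<^sup>2 * (1 - p$1), \<lambda>p. (\<xi> p)\<^sup>2 * (1 - p$2),
        \<lambda>p. (\<xi> p)\<^sup>2 * (1 - p$1) * (1 - p$2),
        \<lambda>p. (\<xi> p)\<^sup>2 * (1 - p$1)\<^sup>2, \<lambda>p. (\<xi> p)\<^sup>2 * (1 - p$2)\<^sup>2}
     else
       {B 2, B 3, B 4, \<lambda>p. B 4 p * p$1,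
        \<lambda>p. (\<xi> p)\<^sup>2 * (1 - p$1)^(k - 1), \<lambda>p. (\<xi> p)\<^sup>2 * (1 - p$2)^(k - 1),
        \<lambda>p. (\<xi> p)\<^sup>2 * (1 - p$1)^(k - 1) * (1 - p$2),
        \<lambda>p. (\<xi> p)\<^sup>2 * (1 - p$1) * (1 - p$2)^(k - 1),
        \<lambda>p. (\<xi> p)\<^sup>2 * (1 - p$1)^k, \<lambda>p. (\<xi> p)\<^sup>2 * (1 - p$2)^k})"

definition fillM :: "nat \<Rightarrow> (real^2 \<Rightarrow> real) \<Rightarrow> (4 \<Rightarrow> real^2 \<Rightarrow> real) \<Rightarrow> (real^2^2) fld set" where
  "fillM k \<xi> B = airy ` span (fillM_gen k \<xi> B)"

definition fillV :: "nat \<Rightarrow> (real^2^2) fld set" where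
  "fillV k = span
    {on_K (\<lambda>p. vector [vector [(p$1)^(k + 1) * (p$2)^(k - 1), 0], vector [0, 0]]),
     on_K (\<lambda>p. vector [vector [(p$1)^(k + 1) * (p$2)^k, 0], vector [0, 0]]),
     on_K (\<lambda>p. vector [vector [0, 0], vector [0, (p$1)^k * (p$2)^(k + 1)]])}"

end

theory Submission imports Defs begin

text \<open>
  A divergence-free polynomial stress is \<open>J \<phi>\<close> for a polynomial \<open>\<phi>\<close> with explicitly restricted exponents, and the
  normal trace of \<open>J \<phi>\<close> depends only on the value and the normal derivative of \<open>\<phi>\<close> on the edges, so
  both indices reduce to counting coefficients.  The functions defining \<open>fillM\<close> are only in \<open>H\<^sup>2\<close>, and the point is that
  the weak normal trace of \<open>J \<phi>\<close> is still given edge by edge by the same formula, without point masses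
  at the vertices.  This is shown by slicing: on almost every line the first derivatives of \<open>\<phi>\<close> are absolutely
  continuous, and any vertex contribution is killed by test functions that equal \<open>1\<close> at a vertex while
  their gradients tend to \<open>0\<close> weakly in \<open>L\<^sup>2\<close>.  A combination of the functions in \<open>fillM\<close> whose trace is that of a
  polynomial potential vanishes, as one sees from the coefficients of highest degree on opposite edges
  and from the mixed derivatives at the vertices.
\<close>

section \<open>Functions on the square as functions on the plane\<close>

definition vec2 :: "real \<times> real \<Rightarrow> real^2" where
  "vec2 z = vector [fst z, snd z]"

lemma vec2_nth [simp]: "vec2 z $ 1 = fst z" "vec2 z $ 2 = snd z"
  by (simp_all add: vec2_def)

lemma vec2_coords [simp]: "vec2 (p $ 1, p $ 2) = p"
  by (simp add: vec_eq_iff forall_2)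

lemma vec2_alt: "vec2 z = fst z *\<^sub>R axis 1 1 + snd z *\<^sub>R axis 2 1"
  by (simp add: vec_eq_iff forall_2 axis_def)

lemma continuous_on_vec2 [continuous_intros]:
  "continuous_on S f \<Longrightarrow> continuous_on S (\<lambda>x. vec2 (f x))"
  unfolding vec2_alt by (intro continuous_intros)

lemma vec2_measurable [measurable]: "vec2 \<in> borel_measurable borel"
  using continuous_on_vec2[OF continuous_on_id] by (intro borel_measurable_continuous_onI)

lemma coords_measurable [measurable]: "(\<lambda>p::real^2. (p $ 1, p $ 2)) \<in> borel_measurable borel"
  by (intro borel_measurable_continuous_onI continuous_intros)

lemma Basis_real2: "(Basis :: (real^2) set) = {axis 1 1, axis 2 1}"
  by (auto simp: Basis_vec_def UNIV_2)

lemma lborel_eq_distr_vec2: "(lborel :: (real^2) measure) = distr lborel borel vec2"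
proof (rule lborel_eqI)
  fix l u :: "real^2"
  assume le: "\<And>b. b \<in> Basis \<Longrightarrow> l \<bullet> b \<le> u \<bullet> b"
  have le': "l $ 1 \<le> u $ 1" "l $ 2 \<le> u $ 2"
    using le[of "axis 1 1"] le[of "axis 2 1"] by (simp_all add: Basis_real2 inner_axis)
  have ne: "axis 1 (1::real) \<noteq> (axis 2 1 :: real^2)" by (simp add: axis_eq_axis)
  have eq: "vec2 -` box l u = box (l$1, l$2) (u$1, u$2)"
    by (auto simp: mem_box Basis_real2 inner_axis Basis_prod_def)
  have "emeasure (distr lborel borel vec2) (box l u) = emeasure lborel (box (l$1, l$2) (u$1, u$2))"
    by (subst emeasure_distr) (simp_all add: eq)
  also have "\<dots> = (\<Prod>b\<in>Basis. ((u$1, u$2) - (l$1, l$2)) \<bullet> b)"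
    using le' by (subst emeasure_lborel_box) (auto simp: Basis_prod_def)
  also have "\<dots> = (\<Prod>b\<in>Basis. (u - l) \<bullet> b)"
    using ne by (simp add: Basis_real2 Basis_prod_def inner_axis prod.insert algebra_simps)
  finally show "emeasure (distr lborel borel vec2) (box l u) = (\<Prod>b\<in>Basis. (u - l) \<bullet> b)" .
qed simp

lemma lborel_eq_distr_coords:
  "(lborel :: (real \<times> real) measure) = distr lborel borel (\<lambda>p::real^2. (p $ 1, p $ 2))"
  by (subst lborel_eq_distr_vec2, subst distr_distr) (simp_all add: comp_def distr_id2)

definition Q :: "(real \<times> real) set" where "Q = {0<..<1} \<times> {0<..<1}"

lemma Q_iff: "z \<in> Q \<longleftrightarrow> 0 < fst z \<and> fst z < 1 \<and> 0 < snd z \<and> snd z < 1"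
  by (cases z) (auto simp: Q_def)

lemma vec2_in_K [simp]: "vec2 z \<in> K \<longleftrightarrow> z \<in> Q"
  by (simp add: K_def Q_iff)

lemma Q_measurable [measurable]: "Q \<in> sets borel"
  unfolding Q_def by (intro borel_open open_Times) auto

lemma K_eq_box: "K = box 0 (vector [1, 1])"
  by (auto simp: K_def mem_box_cart forall_2)

lemma open_K: "open K"
  unfolding K_eq_box by (rule open_box)

lemma closure_K: "closure K = {p. 0 \<le> p$1 \<and> p$1 \<le> 1 \<and> 0 \<le> p$2 \<and> p$2 \<le> 1}"
proof -
  have "closure K = cbox 0 (vector [1, 1])"
    unfolding K_eq_box by (rule closure_box) (auto simp: box_ne_empty Basis_real2 inner_axis)
  then show ?thesis by (auto simp: set_eq_iff mem_box_cart forall_2)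
qed

lemma K_lebesgue [measurable]: "K \<in> sets lebesgue" using open_K by simp

lemma emeasure_Q: "emeasure lborel Q = 1"
  unfolding Q_def lborel_prod[symmetric]
  by (subst lborel.emeasure_pair_measure_Times) auto

lemma AE_K_iff: "(AE p in lebesgue_on K. P p) \<longleftrightarrow> (AE z in lborel. z \<in> Q \<longrightarrow> P (vec2 z))"
proof -
  have "(AE p in lebesgue_on K. P p) \<longleftrightarrow> (AE p in lborel. p \<in> K \<longrightarrow> P p)"
    by (simp add: AE_restrict_space_iff AE_completion_iff)
  also have "\<dots> \<longleftrightarrow> (AE z in lborel. z \<in> Q \<longrightarrow> P (vec2 z))"
  proof
    assume "AE p in lborel. p \<in> K \<longrightarrow> P p"
    then have "AE p in distr lborel borel vec2. p \<in> K \<longrightarrow> P p"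
      by (subst lborel_eq_distr_vec2[symmetric])
    from AE_distrD[OF _ this] show "AE z in lborel. z \<in> Q \<longrightarrow> P (vec2 z)" by simp
  next
    assume "AE z in lborel. z \<in> Q \<longrightarrow> P (vec2 z)"
    then have "AE z in distr lborel borel (\<lambda>p::real^2. (p $ 1, p $ 2)). z \<in> Q \<longrightarrow> P (vec2 z)"
      by (subst lborel_eq_distr_coords[symmetric])
    from AE_distrD[OF _ this] show "AE p in lborel. p \<in> K \<longrightarrow> P p"
      by (simp add: Q_iff K_def)
  qed
  finally show ?thesis .
qed

definition plane_rep :: "(real^2 \<Rightarrow> real) \<Rightarrow> (real \<times> real \<Rightarrow> real) \<Rightarrow> bool" where
  "plane_rep F f \<longleftrightarrow> F \<in> borel_measurable (lebesgue_on K) \<and> f \<in> borel_measurable borel \<and>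
     (\<forall>z. z \<notin> Q \<longrightarrow> f z = 0) \<and> (AE p in lebesgue_on K. F p = f (p $ 1, p $ 2))"

lemma plane_rep_exists:
  assumes "F \<in> borel_measurable (lebesgue_on K)"
  obtains f where "plane_rep F f"
proof -
  have "(\<lambda>p. if p \<in> K then F p else 0) \<in> borel_measurable lebesgue"
    using assms by (simp add: borel_measurable_if)
  from completion_ex_borel_measurable_real[OF this]
  obtain g where g: "g \<in> borel_measurable lborel"
    "AE p in lborel. (if p \<in> K then F p else 0) = g p" by auto
  have "plane_rep F (\<lambda>z. indicator Q z * g (vec2 z))"
    unfolding plane_rep_def
  proof (intro conjI)
    have [measurable]: "g \<in> borel_measurable borel" using g(1) by simp
    show "(\<lambda>z. indicator Q z * g (vec2 z)) \<in> borel_measurable borel" by measurable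
    show "AE p in lebesgue_on K. F p = indicator Q (p $ 1, p $ 2) * g (vec2 (p $ 1, p $ 2))"
      using g(2) by (auto simp: AE_restrict_space_iff AE_completion_iff Q_iff K_def elim: eventually_mono)
  qed (use assms in auto)
  then show ?thesis ..
qed

lemma plane_rep_integral:
  assumes "plane_rep F f"
  shows "(LINT p|lebesgue_on K. F p) = (LINT z|lborel. f z)"
    and "integrable (lebesgue_on K) F \<longleftrightarrow> integrable lborel f"
proof -
  have [measurable]: "f \<in> borel_measurable borel" and F: "F \<in> borel_measurable (lebesgue_on K)"
    and ae: "AE p in lebesgue_on K. F p = f (p $ 1, p $ 2)" and 0: "\<And>z. z \<notin> Q \<Longrightarrow> f z = 0"
    using assms by (auto simp: plane_rep_def)
  let ?g = "\<lambda>p::real^2. f (p $ 1, p $ 2)"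
  have gb [measurable]: "?g \<in> borel_measurable borel" by measurable
  have gl: "?g \<in> borel_measurable lebesgue" using gb
    by (simp add: measurable_completion)
  have gK: "?g \<in> borel_measurable (lebesgue_on K)" using gl by (rule measurable_restrict_space1)
  have "?g p = 0" if "p \<notin> K" for p
    using 0[of "(p $ 1, p $ 2)"] that by (auto simp: Q_iff K_def)
  then have ind: "(\<lambda>p. indicator K p *\<^sub>R ?g p) = ?g"
    by (auto simp: fun_eq_iff indicator_def)
  have "(LINT p|lebesgue_on K. F p) = (LINT p|lebesgue_on K. ?g p)"
    by (rule integral_cong_AE[OF F gK ae])
  also have "\<dots> = (LINT p|lebesgue. ?g p)"
    by (subst integral_restrict_space) (auto simp: ind simp del: real_scaleR_def)
  also have "\<dots> = (LINT p|lborel. ?g p)" by (rule integral_completion) simp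
  also have "\<dots> = (LINT z|lborel. f z)"
    by (subst lborel_eq_distr_vec2, subst integral_distr) simp_all
  finally show "(LINT p|lebesgue_on K. F p) = (LINT z|lborel. f z)" .
  have "integrable (lebesgue_on K) F \<longleftrightarrow> integrable (lebesgue_on K) ?g"
    by (rule integrable_cong_AE[OF F gK ae])
  also have "\<dots> \<longleftrightarrow> integrable lebesgue ?g"
    by (subst integrable_restrict_space) (auto simp: ind simp del: real_scaleR_def)
  also have "\<dots> \<longleftrightarrow> integrable lborel ?g" by (rule integrable_completion) simp
  also have "\<dots> \<longleftrightarrow> integrable lborel f"
    by (subst lborel_eq_distr_vec2, subst integrable_distr_eq) simp_all
  finally show "integrable (lebesgue_on K) F \<longleftrightarrow> integrable lborel f" .
qed

lemma plane_rep_mult_continuous: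
  assumes "plane_rep F f" "continuous_on UNIV \<psi>"
  shows "plane_rep (\<lambda>p. F p * \<psi> p) (\<lambda>z. f z * \<psi> (vec2 z))"
proof -
  have [measurable]: "\<psi> \<in> borel_measurable borel"
    using assms(2) by (rule borel_measurable_continuous_onI)
  have "\<psi> \<in> borel_measurable (lebesgue_on K)"
    by (intro measurable_restrict_space1 measurable_completion) simp
  moreover have [measurable]: "f \<in> borel_measurable borel" using assms(1) by (auto simp: plane_rep_def)
  ultimately show ?thesis using assms(1)
    by (auto simp: plane_rep_def elim: eventually_mono)
qed

lemma plane_rep_square: "plane_rep F f \<Longrightarrow> plane_rep (\<lambda>p. (F p)\<^sup>2) (\<lambda>z. (f z)\<^sup>2)"
  by (auto simp: plane_rep_def elim: eventually_mono)

lemma integrable_if_square_integrable: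
  fixes f :: "real \<times> real \<Rightarrow> real"
  assumes [measurable]: "f \<in> borel_measurable borel" and 0: "\<And>z. z \<notin> Q \<Longrightarrow> f z = 0"
    and sq: "integrable lborel (\<lambda>z. (f z)\<^sup>2)"
  shows "integrable lborel f"
proof (rule Bochner_Integration.integrable_bound)
  have "integrable lborel (indicator Q :: real \<times> real \<Rightarrow> real)"
    by (rule integrable_real_indicator) (simp_all add: emeasure_Q)
  then show "integrable lborel (\<lambda>z. indicator Q z + (f z)\<^sup>2)" using sq by simp
  have "\<bar>x\<bar> \<le> 1 + x\<^sup>2" for x :: real
    using zero_le_power2[of "\<bar>x\<bar> - 1"] by (simp add: power2_eq_square algebra_simps abs_mult_self_eq)
  then show "AE z in lborel. norm (f z) \<le> norm (indicator Q z + (f z)\<^sup>2)"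
    using 0 by (intro AE_I2) (auto simp: indicator_def)
qed simp

definition L2_rep :: "real fld \<Rightarrow> (real \<times> real \<Rightarrow> real) \<Rightarrow> bool" where
  "L2_rep u f \<longleftrightarrow> plane_rep (rep_fld u) f \<and> integrable lborel (\<lambda>z. (f z)\<^sup>2)"

lemma L2_rep_exists: 
  assumes "u \<in> L2" obtains f where "L2_rep u f"
proof -
  obtain f where f: "plane_rep (rep_fld u) f"
    using assms by (auto simp: L2_def intro: plane_rep_exists)
  have "L2_rep u f" using f plane_rep_integral(2)[OF plane_rep_square[OF f]] assms by (auto simp: L2_def L2_rep_def)
  then show ?thesis ..
qed

lemma L2_rep_integrable: "L2_rep u f \<Longrightarrow> integrable lborel f"
  by (rule integrable_if_square_integrable) (auto simp: L2_rep_def plane_rep_def)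

lemma L2_rep_L2: "L2_rep u f \<Longrightarrow> u \<in> L2"
  using plane_rep_integral(2)[OF plane_rep_square[of "rep_fld u" f]]
  by (auto simp: L2_def L2_rep_def plane_rep_def)

lemma rep_on_K: "ae_eq_K (rep_fld (on_K f)) f"
  by (simp add: fld.abs_eq_iff[symmetric] Quotient3_abs_rep[OF Quotient3_fld])

lemma AE_eq_0_if_boxes:
  fixes f :: "'a::euclidean_space \<Rightarrow> real"
  assumes f: "integrable lborel f"
    and box: "\<And>a b. (LINT x|lborel. indicator (box a b) x * f x) = 0"
  shows "AE x in lborel. f x = 0"
proof -
  have [measurable]: "f \<in> borel_measurable borel" using f by auto
  have inj: "x = y" if "enn2real x = enn2real y" "x \<noteq> \<infinity>" "y \<noteq> \<infinity>" for x y :: ennreal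
    using that by (metis ennreal_enn2real less_top infinity_ennreal_def)
  have eq0: "r = 0" if "ennreal r = ennreal (- r)" for r :: real
    using that by (cases "r \<ge> 0") (auto simp: ennreal_neg ennreal_eq_0_iff eq_commute[of 0])
  let ?P = "density lborel (\<lambda>x. ennreal (f x))" and ?N = "density lborel (\<lambda>x. ennreal (- f x))"
  have eq: "emeasure ?P (box a b) = emeasure ?N (box a b)" and fin: "emeasure ?P (box a b) \<noteq> \<infinity>" for a b
  proof -
    let ?g = "\<lambda>x. indicator (box a b) x * f x"
    have g: "integrable lborel ?g"
      by (rule Bochner_Integration.integrable_bound[OF f]) (auto simp: indicator_def)
    have P: "emeasure ?P (box a b) = (\<integral>\<^sup>+x. ennreal (?g x) \<partial>lborel)"
      by (subst emeasure_density) (auto intro!: nn_integral_cong simp: indicator_def)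
    have N: "emeasure ?N (box a b) = (\<integral>\<^sup>+x. ennreal (- ?g x) \<partial>lborel)"
      by (subst emeasure_density) (auto intro!: nn_integral_cong simp: indicator_def)
    have finP: "(\<integral>\<^sup>+x. ennreal (?g x) \<partial>lborel) \<noteq> \<infinity>" and finN: "(\<integral>\<^sup>+x. ennreal (- ?g x) \<partial>lborel) \<noteq> \<infinity>"
      using g by (auto simp: real_integrable_def)
    have "enn2real (\<integral>\<^sup>+x. ennreal (?g x) \<partial>lborel) = enn2real (\<integral>\<^sup>+x. ennreal (- ?g x) \<partial>lborel)"
      using box[of a b] real_lebesgue_integral_def[OF g] by simp
    then show "emeasure ?P (box a b) = emeasure ?N (box a b)"
      unfolding P N using finP finN by (rule inj)
    show "emeasure ?P (box a b) \<noteq> \<infinity>" unfolding P by (rule finP)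
  qed
  have "?P = ?N"
  proof (rule measure_eqI_generator_eq)
    show "Int_stable (range (\<lambda>(a, b). box a b :: 'a set))"
      by (auto simp: Int_stable_def box_Int_box)
    show "range (\<lambda>n::nat. box (- real n *\<^sub>R One) (real n *\<^sub>R One) :: 'a set) \<subseteq> range (\<lambda>(a, b). box a b)"
      by auto
    show "(\<Union>n::nat. box (- real n *\<^sub>R One) (real n *\<^sub>R One) :: 'a set) = UNIV"
      by (simp add: UN_box_eq_UNIV)
    show "sets ?P = sigma_sets UNIV (range (\<lambda>(a, b). box a b :: 'a set))"
      "sets ?N = sigma_sets UNIV (range (\<lambda>(a, b). box a b :: 'a set))"
      by (simp_all add: borel_eq_box)
  qed (use eq fin in auto)
  then have "AE x in lborel. ennreal (f x) = ennreal (- f x)"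
    by (intro sigma_finite_measure.density_unique[OF sigma_finite_lborel]) auto
  then show ?thesis
    by eventually_elim (rule eq0)
qed

section \<open>Test functions\<close>

definition bump :: "nat \<Rightarrow> real \<Rightarrow> real \<Rightarrow> real \<Rightarrow> real" where
  "bump n c d t = 1 - (1 - (max 0 (t - c))^3 * (max 0 (d - t))^3)^n"

lemma bump_r_bounds:
  assumes "0 \<le> c" "d \<le> 1"
  shows "0 \<le> (max 0 (t - c))^3 * (max 0 (d - t))^3" "(max 0 (t - c))^3 * (max 0 (d - t))^3 \<le> (1::real)"
    "(max 0 (t - c))^3 * (max 0 (d - t))^3 > 0 \<longleftrightarrow> c < t \<and> t < d"
proof -
  show "0 \<le> (max 0 (t - c))^3 * (max 0 (d - t))^3" by simp
  show "(max 0 (t - c))^3 * (max 0 (d - t))^3 \<le> (1::real)"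
  proof (cases "c < t \<and> t < d")
    case True
    then have "(max 0 (t - c))^3 \<le> 1" "(max 0 (d - t))^3 \<le> 1"
      using assms by (auto intro!: power_le_one)
    then show ?thesis by (simp add: mult_le_one)
  qed (auto simp: max_def)
qed (auto simp: max_def zero_less_mult_iff)

lemma bump_bounds: "0 \<le> c \<Longrightarrow> d \<le> 1 \<Longrightarrow> 0 \<le> bump n c d t \<and> bump n c d t \<le> 1"
  using bump_r_bounds[of c d t] by (simp add: bump_def power_le_one)

lemma bump_outside: "\<not> (c < t \<and> t < d) \<Longrightarrow> bump n c d t = 0"
  by (auto simp: bump_def max_def)

lemma bump_tendsto:
  assumes "0 \<le> c" "d \<le> 1"
  shows "(\<lambda>n. bump n c d t) \<longlonglongrightarrow> indicator {c<..<d} t"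
proof (cases "c < t \<and> t < d")
  case True
  then have "0 < (max 0 (t - c))^3 * (max 0 (d - t))^3" "(max 0 (t - c))^3 * (max 0 (d - t))^3 \<le> (1::real)"
    using bump_r_bounds[OF assms, of t] by auto
  then have "(\<lambda>n. (1 - (max 0 (t - c))^3 * (max 0 (d - t))^3)^n) \<longlonglongrightarrow> 0"
    by (intro LIMSEQ_power_zero) auto
  then have "(\<lambda>n. bump n c d t) \<longlonglongrightarrow> 1 - 0" unfolding bump_def by (intro tendsto_diff tendsto_const)
  then show ?thesis using True by simp
next
  case False
  then show ?thesis by (simp add: bump_outside)
qed

lemma has_real_derivative_max0_power:
  fixes t :: real assumes "k \<ge> 1"
  shows "((\<lambda>t. (max 0 t)^(Suc k)) has_real_derivative real (Suc k) * (max 0 t)^k) (at t)"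
proof -
  consider "t < 0" | "t > 0" | "t = 0" by linarith
  then show ?thesis
  proof cases
    case 1
    have "((\<lambda>t. 0) has_real_derivative real (Suc k) * (max 0 t)^k) (at t)"
      using 1 assms by (auto simp: max_def power_0_left)
    then show ?thesis
      by (rule has_field_derivative_transform_within_open[where S="{..<0}"]) (use 1 in \<open>auto simp: max_def\<close>)
  next
    case 2
    have "((\<lambda>t. t^(Suc k)) has_real_derivative real (Suc k) * (max 0 t)^k) (at t)"
      using 2 DERIV_pow[of "Suc k" t UNIV] by (simp add: max_def)
    then show ?thesis
      by (rule has_field_derivative_transform_within_open[where S="{0<..}"]) (use 2 in \<open>auto simp: max_def\<close>)
  next
    case 3
    have "((\<lambda>h. (max 0 h)^k * (if h > 0 then 1 else 0)) \<longlongrightarrow> (0::real)) (at 0)"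
    proof (rule Lim_null_comparison)
      show "\<forall>\<^sub>F h in at 0. norm ((max 0 h)^k * (if h > 0 then 1 else (0::real))) \<le> (max 0 h)^k"
        by (auto intro!: always_eventually)
      have "((\<lambda>h::real. (max 0 h)^k) \<longlongrightarrow> (max 0 0)^k) (at 0)" by (intro tendsto_intros)
      then show "((\<lambda>h::real. (max 0 h)^k) \<longlongrightarrow> 0) (at 0)" using assms by (simp add: power_0_left)
    qed
    moreover have "\<forall>\<^sub>F h in at 0. (max 0 h)^k * (if h > 0 then 1 else (0::real)) = ((max 0 (0 + h))^(Suc k) - (max 0 0)^(Suc k)) / h"
      using assms by (auto simp: max_def eventually_at_filter)
    ultimately have "((\<lambda>h::real. ((max 0 (0 + h))^(Suc k) - (max 0 0)^(Suc k)) / h) \<longlongrightarrow> 0) (at 0)"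
      by (rule Lim_transform_eventually)
    then show ?thesis using 3 assms by (simp add: DERIV_def power_0_left)
  qed
qed

lemma bump_C2:
  obtains b' b'' where "\<And>t. (bump n c d has_real_derivative b' t) (at t)"
    "\<And>t. (b' has_real_derivative b'' t) (at t)" "continuous_on UNIV b''"
    "\<And>t. t \<notin> {c..d} \<Longrightarrow> b' t = 0"
proof -
  define u where "u k t = (max 0 (t - c))^k" for k and t :: real
  define v where "v k t = (max 0 (d - t))^k" for k and t :: real
  have u: "(u (Suc k) has_real_derivative real (Suc k) * u k t) (at t)" if "k \<ge> 1" for k t
    unfolding u_def
  proof -
    have "((\<lambda>t. t - c) has_real_derivative 1) (at t)" by (auto intro!: derivative_eq_intros)
    from DERIV_chain2[OF has_real_derivative_max0_power[OF that] this]
    show "((\<lambda>t. max 0 (t - c) ^ Suc k) has_real_derivative real (Suc k) * max 0 (t - c) ^ k) (at t)"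
      by (simp only: mult_1_right)
  qed
  have v: "(v (Suc k) has_real_derivative - real (Suc k) * v k t) (at t)" if "k \<ge> 1" for k t
    unfolding v_def
  proof -
    have "((\<lambda>t. d - t) has_real_derivative -1) (at t)" by (auto intro!: derivative_eq_intros)
    from DERIV_chain2[OF has_real_derivative_max0_power[OF that] this]
    show "((\<lambda>t. max 0 (d - t) ^ Suc k) has_real_derivative - real (Suc k) * max 0 (d - t) ^ k) (at t)"
      by (simp only: mult_minus1_right mult_minus_left)
  qed
  have [continuous_intros]: "continuous_on UNIV (u k)" "continuous_on UNIV (v k)" for k
    unfolding u_def v_def by (intro continuous_intros)+
  define r where "r t = u 3 t * v 3 t" for t
  define r' where "r' t = 3 * u 2 t * v 3 t - 3 * u 3 t * v 2 t" for t
  define r'' where "r'' t = 6 * u 1 t * v 3 t - 18 * u 2 t * v 2 t + 6 * u 3 t * v 1 t" for t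
  have r: "(r has_real_derivative r' t) (at t)" for t
    using DERIV_mult[OF u[of 2 t] v[of 2 t]] by (simp add: r_def[abs_def] r'_def algebra_simps eval_nat_numeral)
  have "((\<lambda>t. 3 * (u 2 t * v 3 t) - 3 * (u 3 t * v 2 t)) has_real_derivative r'' t) (at t)" for t
    using DERIV_diff[OF DERIV_cmult[OF DERIV_mult[OF u[of 1 t] v[of 2 t]], of 3]
      DERIV_cmult[OF DERIV_mult[OF u[of 2 t] v[of 1 t]], of 3]]
    by (simp add: r''_def algebra_simps eval_nat_numeral)
  then have r2: "(r' has_real_derivative r'' t) (at t)" for t
    unfolding r'_def by (simp add: mult.assoc)
  have cr'': "continuous_on UNIV r''" unfolding r''_def by (intro continuous_intros)
  have cr: "continuous_on UNIV r" unfolding r_def by (intro continuous_intros)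
  have cr': "continuous_on UNIV r'" unfolding r'_def by (intro continuous_intros)
  define b' where "b' t = real n * (1 - r t)^(n - 1) * r' t" for t
  define b'' where "b'' t = real n * (real (n - 1) * (1 - r t)^(n - 1 - 1) * (- r' t) * r' t
     + (1 - r t)^(n - 1) * r'' t)" for t
  have b: "bump n c d = (\<lambda>t. 1 - (1 - r t)^n)" by (simp add: fun_eq_iff bump_def r_def u_def v_def)
  show ?thesis
  proof
    show "(bump n c d has_real_derivative b' t) (at t)" for t
      unfolding b b'_def by (auto intro!: derivative_eq_intros r)
    show "(b' has_real_derivative b'' t) (at t)" for t
      unfolding b'_def b''_def by (auto intro!: derivative_eq_intros r r2 simp: algebra_simps)
    show "continuous_on UNIV b''" unfolding b''_def by (intro continuous_intros cr cr' cr'')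
    show "b' t = 0" if "t \<notin> {c..d}" for t
      using that by (auto simp: b'_def r'_def u_def v_def max_def)
  qed
qed

lemma borel_measurable_fst_snd [measurable]:
  "fst \<in> borel_measurable (borel :: (real \<times> real) measure)"
  "snd \<in> borel_measurable (borel :: (real \<times> real) measure)"
  by (auto intro!: borel_measurable_continuous_onI continuous_intros)

lemma tensor_bump_AE_0:
  fixes f :: "real \<times> real \<Rightarrow> real"
  assumes f: "integrable lborel f" and 0: "\<And>z. z \<notin> Q \<Longrightarrow> f z = 0"
    and bump: "\<And>n c d c' d'. 0 < c \<Longrightarrow> c < d \<Longrightarrow> d < 1 \<Longrightarrow> 0 < c' \<Longrightarrow> c' < d' \<Longrightarrow> d' < 1 \<Longrightarrow>
      (LINT z|lborel. f z * (bump n c d (fst z) * bump n c' d' (snd z))) = 0"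
  shows "AE z in lborel. f z = 0"
proof (rule AE_eq_0_if_boxes[OF f])
  have [measurable]: "f \<in> borel_measurable borel" using f by auto
  have [measurable]: "bump n c d \<in> borel_measurable borel" for n c d
    unfolding bump_def by (intro borel_measurable_continuous_onI continuous_intros)
  have A: "(LINT z|lborel. f z * (indicator {c<..<d} (fst z) * indicator {c'<..<d'} (snd z))) = 0"
    if "0 < c" "d < 1" "0 < c'" "d' < 1" for c d c' d'
  proof (cases "c < d \<and> c' < d'")
    case True
    have "(\<lambda>n. LINT z|lborel. f z * (bump n c d (fst z) * bump n c' d' (snd z)))
      \<longlonglongrightarrow> (LINT z|lborel. f z * (indicator {c<..<d} (fst z) * indicator {c'<..<d'} (snd z)))"
    proof (rule integral_dominated_convergence[where w="\<lambda>z. norm (f z)"])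
      show "AE z in lborel. (\<lambda>n. f z * (bump n c d (fst z) * bump n c' d' (snd z)))
        \<longlonglongrightarrow> f z * (indicator {c<..<d} (fst z) * indicator {c'<..<d'} (snd z))"
        using that by (intro AE_I2 tendsto_intros bump_tendsto) auto
      show "AE z in lborel. norm (f z * (bump n c d (fst z) * bump n c' d' (snd z))) \<le> norm (f z)" for n
        using that bump_bounds[of c d n] bump_bounds[of c' d' n]
        by (intro AE_I2) (simp add: abs_mult mult_left_le mult_le_one)
    qed (measurable, measurable, use f in simp)
    then show ?thesis using that True by (simp add: bump LIMSEQ_const_iff)
  next
    case False
    then have "indicator {c<..<d} (fst z) * indicator {c'<..<d'} (snd z) = (0::real)" for z :: "real \<times> real"
      by (auto simp: indicator_def)
    then show ?thesis by (simp only: mult_zero_right integral_zero)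
  qed
  fix a b :: "real \<times> real"
  define e where "e n = 1 / (real n + 2)" for n :: nat
  have e: "e n > 0" for n by (simp add: e_def)
  have e0: "e \<longlonglongrightarrow> 0" unfolding e_def
    using LIMSEQ_ignore_initial_segment[OF lim_1_over_n[where 'a=real], of 2] by (simp add: add.commute)
  define lo where "lo n x = max 0 x + e n" for n and x :: real
  define hi where "hi n x = min 1 x - e n" for n and x :: real
  have lo: "(\<lambda>n. lo n x) \<longlonglongrightarrow> max 0 x" and hi: "(\<lambda>n. hi n x) \<longlonglongrightarrow> min 1 x" for x
    using tendsto_add[OF tendsto_const e0, of "max 0 x"] tendsto_diff[OF tendsto_const e0, of "min 1 x"]
    by (simp_all add: lo_def hi_def)
  have ind: "(\<lambda>n. indicator {lo n x<..<hi n y} t :: real) \<longlonglongrightarrow> indicator {max 0 x<..<min 1 y} t" for x y t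
  proof (cases "max 0 x < t \<and> t < min 1 y")
    case True
    have "\<forall>\<^sub>F n in sequentially. lo n x < t" "\<forall>\<^sub>F n in sequentially. t < hi n y"
      using True order_tendstoD(2)[OF lo, of x t] order_tendstoD(1)[OF hi, of t y] by auto
    then have "\<forall>\<^sub>F n in sequentially. indicator {lo n x<..<hi n y} t = (indicator {max 0 x<..<min 1 y} t :: real)"
      by eventually_elim (use True in auto)
    then show ?thesis by (rule tendsto_eventually)
  next
    case False
    then have "(\<lambda>n. indicator {lo n x<..<hi n y} t) = (\<lambda>_. 0::real)"
      using e by (auto simp: indicator_def lo_def hi_def fun_eq_iff) (smt (verit) e)+
    moreover have "indicator {max 0 x<..<min 1 y} t = (0::real)" using False by (auto simp: indicator_def)
    ultimately show ?thesis by (simp only: tendsto_const)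
  qed
  have "(\<lambda>n. LINT z|lborel. f z * (indicator {lo n (fst a)<..<hi n (fst b)} (fst z) * indicator {lo n (snd a)<..<hi n (snd b)} (snd z)))
      \<longlonglongrightarrow> (LINT z|lborel. f z * (indicator {max 0 (fst a)<..<min 1 (fst b)} (fst z) * indicator {max 0 (snd a)<..<min 1 (snd b)} (snd z)))"
  proof (rule integral_dominated_convergence[where w="\<lambda>z. norm (f z)"])
    show "AE z in lborel. (\<lambda>n. f z * (indicator {lo n (fst a)<..<hi n (fst b)} (fst z) * indicator {lo n (snd a)<..<hi n (snd b)} (snd z)))
      \<longlonglongrightarrow> f z * (indicator {max 0 (fst a)<..<min 1 (fst b)} (fst z) * indicator {max 0 (snd a)<..<min 1 (snd b)} (snd z))"
      by (intro AE_I2 tendsto_intros ind)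
    show "AE z in lborel. norm (f z * (indicator {lo n (fst a)<..<hi n (fst b)} (fst z) * indicator {lo n (snd a)<..<hi n (snd b)} (snd z))) \<le> norm (f z)" for n
      by (auto simp: indicator_def)
  qed (measurable, measurable, use f in simp)
  moreover have "(LINT z|lborel. f z * (indicator {lo n (fst a)<..<hi n (fst b)} (fst z) * indicator {lo n (snd a)<..<hi n (snd b)} (snd z))) = 0" for n
    using e[of n] by (intro A) (auto simp: lo_def hi_def)
  moreover have "f z * (indicator {max 0 (fst a)<..<min 1 (fst b)} (fst z) * indicator {max 0 (snd a)<..<min 1 (snd b)} (snd z))
     = indicator (box a b) z * f z" for z
    using 0[of z] by (cases z; cases a; cases b) (auto simp: indicator_def Q_iff mem_box Basis_prod_def)
  ultimately show "(LINT z|lborel. indicator (box a b) z * f z) = 0"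
    by (simp add: LIMSEQ_const_iff)
qed

lemma plane_fubini:
  fixes f :: "real \<times> real \<Rightarrow> real"
  assumes "integrable lborel f"
  shows "AE x in lborel. integrable lborel (\<lambda>y. f (x, y))"
    and "integrable lborel (\<lambda>x. LINT y|lborel. f (x, y))"
    and "(LINT x|lborel. LINT y|lborel. f (x, y)) = (LINT z|lborel. f z)"
  using lborel_pair.AE_integrable_fst'[of f] lborel_pair.integrable_fst'[of f]
    lborel_pair.integral_fst'[of f] assms by (simp_all add: lborel_prod)

lemma plane_AE: "(AE z in lborel. P z) \<Longrightarrow> AE x in lborel. AE y in lborel. P (x::real, y::real)"
  using lborel_pair.AE_pair[of P] unfolding lborel_prod .

lemma plane_AE_I:
  assumes "Measurable.pred (borel :: (real \<times> real) measure) P"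
    and "AE x in lborel. AE y in lborel. P (x, y)"
  shows "AE z in lborel. P (z :: real \<times> real)"
  using lborel_pair.AE_pair_measure[of P] assms unfolding lborel_prod by (simp add: pred_def)

lemma AE_fst: 
  assumes "AE x in lborel. P (x::real)"
  shows "AE z in lborel. P (fst (z :: real \<times> real))"
proof -
  obtain N where N: "{x. \<not> P x} \<subseteq> N" "emeasure lborel N = 0" "N \<in> sets lborel"
    using AE_E[OF assms] by auto
  have [measurable]: "N \<in> sets borel" using N by simp
  have "AE x in lborel. x \<notin> N" using N by (intro AE_not_in) (auto simp: null_sets_def)
  then have "AE z in lborel. fst (z :: real \<times> real) \<notin> N"
    by (intro plane_AE_I) (measurable, auto)
  then show ?thesis by (rule AE_mp) (use N in auto)
qed

lemma lborel_swap: "(lborel :: (real \<times> real) measure) = distr lborel borel prod.swap"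
proof -
  have "lborel \<Otimes>\<^sub>M lborel = distr (lborel \<Otimes>\<^sub>M lborel :: (real \<times> real) measure) (lborel \<Otimes>\<^sub>M lborel) (\<lambda>(x, y). (y, x :: real))"
    by (rule lborel_pair.distr_pair_swap)
  then have "(lborel :: (real \<times> real) measure) = distr lborel lborel (\<lambda>(x, y). (y, x))"
    by (simp add: lborel_prod)
  also have "\<dots> = distr lborel borel prod.swap"
    by (rule distr_cong) auto
  finally show ?thesis .
qed

lemma swap_measurable [measurable]: "prod.swap \<in> borel_measurable (borel :: (real \<times> real) measure)"
  by (rule borel_measurable_continuous_onI) (simp add: continuous_on_swap)

lemma plane_swap:
  fixes f :: "real \<times> real \<Rightarrow> real"
  assumes [measurable]: "f \<in> borel_measurable borel"
  shows "(LINT z|lborel. f (prod.swap z)) = (LINT z|lborel. f z)"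
    and "integrable lborel (\<lambda>z. f (prod.swap z)) \<longleftrightarrow> integrable lborel f"
proof -
  show "(LINT z|lborel. f (prod.swap z)) = (LINT z|lborel. f z)"
    by (subst (2) lborel_swap, subst integral_distr) simp_all
  show "integrable lborel (\<lambda>z. f (prod.swap z)) \<longleftrightarrow> integrable lborel f"
    by (subst (2) lborel_swap, subst integrable_distr_eq) simp_all
qed

lemma AE_swap:
  assumes "AE z in lborel. P (z :: real \<times> real)"
  shows "AE z in lborel. P (prod.swap z)"
proof -
  have "AE z in distr lborel borel prod.swap. P z" using assms by (subst lborel_swap[symmetric])
  then show ?thesis by (intro AE_distrD[of prod.swap lborel borel]) simp_all
qed

lemma integrable_tensor:
  fixes u v :: "real \<Rightarrow> real"
  assumes "integrable lborel u" "integrable lborel v"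
  shows "integrable lborel (\<lambda>z. u (fst z) * v (snd z))"
proof -
  have [measurable]: "u \<in> borel_measurable borel" "v \<in> borel_measurable borel" using assms by auto
  have "integrable (lborel \<Otimes>\<^sub>M lborel) (\<lambda>z. u (fst z) * v (snd z))"
    using assms by (intro lborel_pair.Fubini_integrable) (auto simp: abs_mult)
  then show ?thesis by (simp add: lborel_prod)
qed

definition primitive :: "(real \<Rightarrow> real) \<Rightarrow> real \<Rightarrow> real" where
  "primitive g y = (LINT t|lborel. (if 0 < t \<and> t \<le> y then g t else 0))"

lemma integrable_restrict:
  fixes g :: "real \<Rightarrow> real"
  assumes "integrable lborel g"
  shows "integrable lborel (\<lambda>t. if c < t \<and> t \<le> y then g t else 0)"
proof -
  have [measurable]: "g \<in> borel_measurable borel" using assms by auto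
  show ?thesis by (rule Bochner_Integration.integrable_bound[OF assms]) auto
qed

lemma integral_FTC_01:
  assumes F: "\<And>x. (F has_real_derivative f x) (at x)" and "continuous_on UNIV f" "a \<le> b"
  shows "(LINT x|lborel. indicator {a<..<b} x * f x) = F b - F a"
    and "integrable lborel (\<lambda>x. indicator {a<..<b} x * f x)"
proof -
  have cont: "isCont f x" for x using assms by (simp add: continuous_on_eq_continuous_at)
  have [measurable]: "f \<in> borel_measurable borel" using assms by (intro borel_measurable_continuous_onI)
  have ae: "AE x in lborel. f x * indicator {a..b} x = indicator {a<..<b} x * f x"
    using AE_lborel_singleton[of a] AE_lborel_singleton[of b]
    by eventually_elim (auto simp: indicator_def)
  have "has_bochner_integral lborel (\<lambda>x. f x * indicator {a..b} x) (F b - F a)"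
    by (rule has_bochner_integral_FTC_Icc_real) (use assms cont in auto)
  then have "has_bochner_integral lborel (\<lambda>x. indicator {a<..<b} x * f x) (F b - F a)"
    by (subst (asm) has_bochner_integral_cong_AE[OF _ _ ae]) auto
  then show "(LINT x|lborel. indicator {a<..<b} x * f x) = F b - F a"
    "integrable lborel (\<lambda>x. indicator {a<..<b} x * f x)"
    by (auto simp: has_bochner_integral_iff)
qed

lemma bounded_on_01:
  assumes "continuous_on UNIV (f :: real \<Rightarrow> real)"
  obtains M where "M \<ge> 0" "\<And>x. 0 \<le> x \<Longrightarrow> x \<le> 1 \<Longrightarrow> \<bar>f x\<bar> \<le> M"
proof -
  have "compact (f ` {0..1})" using assms by (intro compact_continuous_image) (auto intro: continuous_on_subset)
  then obtain M where M: "\<And>y. y \<in> f ` {0..1} \<Longrightarrow> \<bar>y\<bar> \<le> M" by (metis compact_imp_bounded bounded_real)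
  show ?thesis by (rule that[of "max M 0"]) (use M in \<open>auto simp: le_max_iff_disj\<close>)
qed

lemma primitive_by_parts:
  assumes g: "integrable lborel g" and g0: "\<And>t. t \<notin> {0<..<1} \<Longrightarrow> g t = 0"
    and b: "\<And>x. (b has_real_derivative b' x) (at x)" and b': "continuous_on UNIV b'"
  shows "(LINT y|lborel. indicator {0<..<1} y * (primitive g y * b' y)) = (LINT t|lborel. g t * (b 1 - b t))"
proof -
  have [measurable]: "g \<in> borel_measurable borel" "b' \<in> borel_measurable borel"
    using g b' by (auto intro: borel_measurable_continuous_onI)
  obtain M where M: "M \<ge> 0" "\<And>x. 0 \<le> x \<Longrightarrow> x \<le> 1 \<Longrightarrow> \<bar>b' x\<bar> \<le> M"
    using bounded_on_01[OF b'] by blast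
  define h where "h y t = indicator {0<..<1} y * (b' y * (if 0 < t \<and> t \<le> y then g t else 0))" for y t
  have i1: "integrable lborel (indicator {0<..<1} :: real \<Rightarrow> real)" by (rule integrable_real_indicator) auto
  have "integrable lborel (\<lambda>z::real \<times> real. (M * indicator {0<..<1} (fst z)) * \<bar>g (snd z)\<bar>)"
    using integrable_tensor[of "\<lambda>x. M * indicator {0<..<1} x" "\<lambda>t. \<bar>g t\<bar>"] i1 g by simp
  then have h: "integrable lborel (\<lambda>z. h (fst z) (snd z))"
  proof (rule Bochner_Integration.integrable_bound)
    show "AE z in lborel. norm (h (fst z) (snd z)) \<le> norm ((M * indicator {0<..<1} (fst z)) * \<bar>g (snd z)\<bar>)"
      using M by (intro AE_I2) (auto simp: h_def indicator_def abs_mult intro!: mult_right_mono)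
    show "(\<lambda>z. h (fst z) (snd z)) \<in> borel_measurable lborel" unfolding h_def by measurable
  qed
  have "(LINT y|lborel. indicator {0<..<1} y * (primitive g y * b' y)) = (LINT y|lborel. LINT t|lborel. h y t)"
    unfolding primitive_def h_def by (intro Bochner_Integration.integral_cong) (auto simp: mult_ac)
  also have "\<dots> = (LINT t|lborel. LINT y|lborel. h y t)"
    using lborel_pair.Fubini_integral[of h] h by (simp add: lborel_prod case_prod_unfold)
  also have "\<dots> = (LINT t|lborel. g t * (b 1 - b t))"
  proof (rule Bochner_Integration.integral_cong[OF refl])
    fix t :: real
    show "(LINT y|lborel. h y t) = g t * (b 1 - b t)"
    proof (cases "t \<in> {0<..<1}")
      case True
      have "(LINT y|lborel. h y t) = (LINT y|lborel. g t * (indicator {t<..<1} y * b' y))"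
      proof (rule integral_cong_AE)
        show "AE y in lborel. h y t = g t * (indicator {t<..<1} y * b' y)"
          using AE_lborel_singleton[of t] by eventually_elim (use True in \<open>auto simp: h_def indicator_def\<close>)
      qed (auto simp: h_def)
      then show ?thesis using integral_FTC_01(1)[OF b b', of t 1] True by simp
    next
      case False
      then have "h y t = 0" for y by (simp add: g0 h_def)
      then show ?thesis using False by (simp add: g0)
    qed
  qed
  finally show ?thesis .
qed

definition test_fun :: "(real \<Rightarrow> real) \<Rightarrow> (real \<Rightarrow> real) \<Rightarrow> bool" where
  "test_fun a a' \<longleftrightarrow> (\<forall>t. (a has_real_derivative a' t) (at t)) \<and> continuous_on UNIV a' \<and>
     (\<exists>c d. 0 < c \<and> c < d \<and> d < 1 \<and> (\<forall>t. t \<notin> {c..d} \<longrightarrow> a t = 0))"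

lemma continuous_antiderivative:
  fixes f :: "real \<Rightarrow> real"
  assumes "continuous_on UNIV f"
  obtains F where "\<And>x. (F has_real_derivative f x) (at x)"
  using einterval_antiderivative[of "-\<infinity>" "\<infinity>" f] assms
  by (auto simp: continuous_on_eq_continuous_at has_real_derivative_iff_has_vector_derivative)

lemma test_fun_bump:
  assumes "0 < c" "c < d" "d < 1"
  obtains b' where "test_fun (bump n c d) b'"
proof -
  obtain b' b'' where b: "\<And>t. (bump n c d has_real_derivative b' t) (at t)"
    "\<And>t. (b' has_real_derivative b'' t) (at t)" using bump_C2 by metis
  have "continuous_on UNIV b'" using b(2) by (auto intro!: DERIV_isCont continuous_at_imp_continuous_on)
  then have "test_fun (bump n c d) b'" using b(1) assms by (force simp: test_fun_def bump_outside)
  then show ?thesis ..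
qed

lemma test_fun_continuous: "test_fun a a' \<Longrightarrow> continuous_on UNIV a"
  by (auto simp: test_fun_def intro!: DERIV_isCont continuous_at_imp_continuous_on)

lemma continuous_bump: "continuous_on UNIV (bump n c d)"
  unfolding bump_def by (intro continuous_intros)

lemma test_fun_zero_mean:
  assumes cont: "continuous_on UNIV \<theta>" and supp: "0 < c" "c < d" "d < 1" "\<And>t. t \<notin> {c..d} \<Longrightarrow> \<theta> t = 0"
    and mean: "(LINT t|lborel. \<theta> t) = 0"
  obtains \<eta> where "test_fun \<eta> \<theta>"
proof -
  obtain F where F: "\<And>x. (F has_real_derivative \<theta> x) (at x)" using continuous_antiderivative[OF cont] by blast
  have "(LINT t|lborel. \<theta> t) = (LINT x|lborel. indicator {0<..<1} x * \<theta> x)"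
  proof (rule Bochner_Integration.integral_cong[OF refl])
    show "\<theta> t = indicator {0<..<1} t * \<theta> t" for t
      using supp(1-3) supp(4)[of t] by (cases "t \<in> {c..d}") auto
  qed
  then have eq: "F 1 = F 0" using integral_FTC_01(1)[OF F cont, of 0 1] mean by simp
  have const: "F x = F y" if "x \<le> y" "y \<le> c \<or> d \<le> x" for x y
  proof (cases "x < y")
    case True
    show ?thesis
    proof (rule DERIV_isconst2[OF True, symmetric])
      show "continuous_on {x..y} F" using F by (meson DERIV_isCont continuous_at_imp_continuous_on)
      show "(F has_real_derivative 0) (at t)" if "x < t" "t < y" for t
        using F[of t] supp(4)[of t] that \<open>y \<le> c \<or> d \<le> x\<close> by auto
    qed (use True in auto)
  qed (use that in auto)
  have "test_fun (\<lambda>t. F t - F 0) \<theta>"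
  proof -
    have "((\<lambda>t. F t - F 0) has_real_derivative \<theta> t) (at t)" for t
      using F by (auto intro!: derivative_eq_intros)
    moreover have "F t - F 0 = 0" if "t \<notin> {c..d}" for t
      using that const[of t 0] const[of 0 t] const[of t 1] const[of 1 t] supp eq
      by (smt (verit) atLeastAtMost_iff)
    ultimately show ?thesis using supp(1-3) cont unfolding test_fun_def by blast
  qed
  then show ?thesis ..
qed

section \<open>Weak derivatives along almost every line\<close>

definition weak_dy :: "(real \<times> real \<Rightarrow> real) \<Rightarrow> (real \<times> real \<Rightarrow> real) \<Rightarrow> bool" where
  "weak_dy f g \<longleftrightarrow> integrable lborel f \<and> integrable lborel g \<and> (\<forall>z. z \<notin> Q \<longrightarrow> f z = 0 \<and> g z = 0) \<and>
     (\<forall>a a' b b'. test_fun a a' \<longrightarrow> test_fun b b' \<longrightarrow>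
       (LINT z|lborel. f z * (a (fst z) * b' (snd z))) = - (LINT z|lborel. g z * (a (fst z) * b (snd z))))"

definition primitive_y :: "(real \<times> real \<Rightarrow> real) \<Rightarrow> real \<times> real \<Rightarrow> real" where
  "primitive_y g z = indicator Q z * primitive (\<lambda>t. g (fst z, t)) (snd z)"

lemma primitive_measurable [measurable]:
  assumes [measurable]: "g \<in> borel_measurable (borel :: (real \<times> real) measure)"
  shows "(\<lambda>z. primitive (\<lambda>t. g (fst z, t)) (snd z)) \<in> borel_measurable (borel :: (real \<times> real) measure)"
  unfolding primitive_def by measurable

lemma integrable_primitive_y:
  assumes g: "integrable lborel g"
  shows "integrable lborel (primitive_y g)"
proof -
  have [measurable]: "g \<in> borel_measurable borel" using g by auto
  have i1: "integrable lborel (indicator {0<..<1} :: real \<Rightarrow> real)" by (rule integrable_real_indicator) auto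
  have n: "integrable lborel (\<lambda>z. \<bar>g z\<bar>)" using g by auto
  have "integrable lborel (\<lambda>z::real \<times> real. (LINT t|lborel. \<bar>g (fst z, t)\<bar>) * indicator {0<..<1} (snd z))"
    using integrable_tensor[OF plane_fubini(2)[OF n] i1] by simp
  then show ?thesis
  proof (rule Bochner_Integration.integrable_bound)
    show "AE z in lborel. norm (primitive_y g z) \<le> norm ((LINT t|lborel. \<bar>g (fst z, t)\<bar>) * indicator {0<..<1} (snd z))"
      using AE_fst[OF plane_fubini(1)[OF g]]
    proof eventually_elim
      case (elim z)
      have "norm (primitive (\<lambda>t. g (fst z, t)) (snd z)) \<le> (LINT t|lborel. norm (if 0 < t \<and> t \<le> snd z then g (fst z, t) else 0))"
        unfolding primitive_def by (rule integral_norm_bound)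
      also have "\<dots> \<le> (LINT t|lborel. \<bar>g (fst z, t)\<bar>)"
        by (rule integral_mono) (use elim integrable_restrict[OF elim] in auto)
      finally show ?case by (auto simp: primitive_y_def indicator_def Q_iff)
    qed
    show "primitive_y g \<in> borel_measurable lborel" unfolding primitive_y_def by measurable
  qed
qed

lemma integrable_Q_mult:
  fixes h \<phi> :: "real \<times> real \<Rightarrow> real"
  assumes h: "integrable lborel h" and h0: "\<And>z. z \<notin> Q \<Longrightarrow> h z = 0" and \<phi>: "continuous_on UNIV \<phi>"
  shows "integrable lborel (\<lambda>z. h z * \<phi> z)"
proof -
  have "compact (\<phi> ` cbox (0, 0) (1, 1))"
    using \<phi> by (intro compact_continuous_image compact_cbox) (auto intro: continuous_on_subset)
  then obtain M where M: "\<And>z. z \<in> cbox (0, 0) (1, 1) \<Longrightarrow> \<bar>\<phi> z\<bar> \<le> M"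
    by (metis compact_imp_bounded bounded_real imageI)
  have [measurable]: "\<phi> \<in> borel_measurable borel" "h \<in> borel_measurable borel"
    using \<phi> h by (auto intro: borel_measurable_continuous_onI)
  have "integrable lborel (\<lambda>z. h z * M)" using h by simp
  then show ?thesis
  proof (rule Bochner_Integration.integrable_bound)
    show "AE z in lborel. norm (h z * \<phi> z) \<le> norm (h z * M)"
    proof (rule AE_I2)
      fix z :: "real \<times> real"
      have "\<bar>\<phi> z\<bar> \<le> \<bar>M\<bar>" if "z \<in> Q"
        using M[of z] that by (cases z) (auto simp: Q_iff mem_box Basis_prod_def)
      then show "norm (h z * \<phi> z) \<le> norm (h z * M)"
        using h0[of z] by (cases "z \<in> Q") (auto simp: abs_mult intro!: mult_left_mono)
    qed
  qed measurable
qed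

lemma primitive_y_parts:
  assumes g: "integrable lborel g" and g0: "\<And>z. z \<notin> Q \<Longrightarrow> g z = 0"
    and b: "\<And>x. (b has_real_derivative b' x) (at x)" "continuous_on UNIV b'"
    and a: "continuous_on UNIV a"
  shows "(LINT z|lborel. primitive_y g z * (a (fst z) * b' (snd z))) = (LINT z|lborel. g z * (a (fst z) * (b 1 - b (snd z))))"
    and "integrable lborel (\<lambda>z. primitive_y g z * (a (fst z) * b' (snd z)))"
proof -
  have [measurable]: "g \<in> borel_measurable borel" "b' \<in> borel_measurable borel" "a \<in> borel_measurable borel" 
    using g b a by (auto intro: borel_measurable_continuous_onI)
  have cb: "continuous_on UNIV b" using b(1) by (auto intro!: DERIV_isCont continuous_at_imp_continuous_on)
  then have [measurable]: "b \<in> borel_measurable borel" by (intro borel_measurable_continuous_onI)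
  have ip: "integrable lborel (\<lambda>z. primitive_y g z * (a (fst z) * b' (snd z)))"
    by (rule integrable_Q_mult[OF integrable_primitive_y[OF g]])
      (auto simp: primitive_y_def intro!: continuous_intros continuous_on_compose2[OF a] continuous_on_compose2[OF b(2)])
  then show "integrable lborel (\<lambda>z. primitive_y g z * (a (fst z) * b' (snd z)))" .
  have ig: "integrable lborel (\<lambda>z. g z * (a (fst z) * (b 1 - b (snd z))))"
    by (rule integrable_Q_mult[OF g g0])
      (auto intro!: continuous_intros continuous_on_compose2[OF a] continuous_on_compose2[OF cb])
  have "(LINT z|lborel. primitive_y g z * (a (fst z) * b' (snd z))) = (LINT x|lborel. LINT y|lborel. primitive_y g (x, y) * (a x * b' y))"
    using plane_fubini(3)[OF ip] by simp
  also have "\<dots> = (LINT x|lborel. LINT y|lborel. g (x, y) * (a x * (b 1 - b y)))"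
  proof (rule integral_cong_AE)
    show "AE x in lborel. (LINT y|lborel. primitive_y g (x, y) * (a x * b' y)) = (LINT y|lborel. g (x, y) * (a x * (b 1 - b y)))"
      using plane_fubini(1)[OF g]
    proof eventually_elim
      case (elim x)
      show ?case
      proof (cases "0 < x \<and> x < 1")
        case True
        have "(LINT y|lborel. primitive_y g (x, y) * (a x * b' y)) = (LINT y|lborel. a x * (indicator {0<..<1} y * (primitive (\<lambda>t. g (x, t)) y * b' y)))"
          by (rule Bochner_Integration.integral_cong) (use True in \<open>auto simp: primitive_y_def indicator_def Q_iff\<close>)
        also have "\<dots> = a x * (LINT t|lborel. g (x, t) * (b 1 - b t))"
          using primitive_by_parts[OF elim _ b] g0 by (simp add: Q_iff)
        also have "\<dots> = (LINT y|lborel. g (x, y) * (a x * (b 1 - b y)))"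
          by (subst integral_mult_right_zero[symmetric]) (simp add: mult_ac)
        finally show ?thesis .
      qed (auto simp: primitive_y_def Q_iff g0)
    qed
  qed (use plane_fubini(2)[OF ip] plane_fubini(2)[OF ig] in auto)
  also have "\<dots> = (LINT z|lborel. g z * (a (fst z) * (b 1 - b (snd z))))"
    using plane_fubini(3)[OF ig] by simp
  finally show "(LINT z|lborel. primitive_y g z * (a (fst z) * b' (snd z))) = (LINT z|lborel. g z * (a (fst z) * (b 1 - b (snd z))))" .
qed

lemma integral_tensor:
  fixes u v :: "real \<Rightarrow> real"
  assumes "integrable lborel u" "integrable lborel v"
  shows "(LINT z|lborel. u (fst z) * v (snd z)) = (LINT x|lborel. u x) * (LINT y|lborel. v y)"
  using plane_fubini(3)[OF integrable_tensor[OF assms]] by simp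

lemma bump_integral_pos: "(LINT t|lborel. bump 1 (1/4) (3/4) t) > 0"
proof -
  let ?e = "bump 1 (1/4) (3/4)"
  have nn: "?e t \<ge> 0" for t using bump_bounds[of "1/4" "3/4" 1 t] by simp
  have [measurable]: "?e \<in> borel_measurable borel" by (intro borel_measurable_continuous_onI continuous_bump)
  have i: "integrable lborel ?e"
  proof (rule Bochner_Integration.integrable_bound[where f="indicator {0..1::real}"])
    show "AE t in lborel. norm (?e t) \<le> norm (indicator {0..1::real} t :: real)"
      using bump_bounds[of "1/4" "3/4" 1] bump_outside[of "1/4" _ "3/4" 1]
      by (intro AE_I2) (auto simp: indicator_def)
  qed (auto intro: integrable_real_indicator simp del: One_nat_def)
  have "(LINT t|lborel. ?e t) \<noteq> 0"
  proof
    assume "(LINT t|lborel. ?e t) = 0"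
    then have ae0: "AE t in lborel. ?e t = 0" using integral_nonneg_eq_0_iff_AE[OF i] nn by simp
    have pos: "?e t > 0" if "1/4 < t" "t < 3/4" for t
      using bump_r_bounds(3)[of "1/4" "3/4" t] that by (simp add: bump_def)
    from ae0 have "AE t in lborel. t \<notin> {1/4<..<3/4::real}"
    proof eventually_elim
      case (elim t)
      then show ?case using pos[of t] by (auto simp del: One_nat_def)
    qed
    then have "emeasure lborel {1/4<..<3/4::real} = 0" by (subst (asm) AE_iff_measurable[of "{1/4<..<3/4}"]) auto
    then show False by simp
  qed
  moreover have "(LINT t|lborel. ?e t) \<ge> 0" by (rule Bochner_Integration.integral_nonneg) (rule nn)
  ultimately show ?thesis by linarith
qed

lemma integrable_compact_support_01:
  assumes "continuous_on UNIV (f :: real \<Rightarrow> real)" "\<And>t. t \<notin> {0<..<1} \<Longrightarrow> f t = 0"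
  shows "integrable lborel f"
proof -
  obtain F where "\<And>x. (F has_real_derivative f x) (at x)" using continuous_antiderivative[OF assms(1)] by blast
  from integral_FTC_01(2)[OF this assms(1), of 0 1]
  have "integrable lborel (\<lambda>x. indicator {0<..<1} x * f x)" by simp
  moreover have "(\<lambda>x. indicator {0<..<1} x * f x) = f" using assms(2) by (auto simp: fun_eq_iff indicator_def)
  ultimately show ?thesis by simp
qed

text \<open>The du Bois-Reymond argument: the difference of \<open>f\<close> and the primitive of \<open>g\<close> has vanishing
  weak derivative, so integrating it against \<open>\<theta>\<close> only sees the mean of \<open>\<theta>\<close>.\<close>

lemma weak_dy_primitive:
  assumes wd: "weak_dy f g"
  obtains \<gamma> where "integrable lborel \<gamma>"
    "AE z in lborel. z \<in> Q \<longrightarrow> f z = \<gamma> (fst z) + primitive (\<lambda>t. g (fst z, t)) (snd z)"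
proof -
  have f: "integrable lborel f" and g: "integrable lborel g" and f0: "\<And>z. z \<notin> Q \<Longrightarrow> f z = 0"
    and g0: "\<And>z. z \<notin> Q \<Longrightarrow> g z = 0" using wd by (auto simp: weak_dy_def)
  define r where "r z = f z - primitive_y g z" for z
  have r: "integrable lborel r" unfolding r_def using f integrable_primitive_y[OF g] by simp
  have r0: "r z = 0" if "z \<notin> Q" for z using that f0 by (simp add: r_def primitive_y_def)
  have [measurable]: "r \<in> borel_measurable borel" using r by auto
  define m where "m = (LINT t|lborel. bump 1 (1/4) (3/4) t)"
  have m: "m > 0" using bump_integral_pos by (simp add: m_def)
  define e where "e t = bump 1 (1/4) (3/4) t / m" for t
  have ce: "continuous_on UNIV e" unfolding e_def using m by (intro continuous_intros continuous_bump) auto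
  have e1: "(LINT t|lborel. e t) = 1" using m by (simp add: e_def m_def)
  have e0: "e t = 0" if "t \<notin> {1/4..3/4}" for t using that by (auto simp: e_def bump_outside)
  define \<gamma> where "\<gamma> x = (LINT y|lborel. r (x, y) * e y)" for x
  have re: "integrable lborel (\<lambda>z. r z * e (snd z))"
    by (rule integrable_Q_mult[OF r]) (auto simp: r0 intro!: continuous_on_compose2[OF ce] continuous_intros)
  have \<gamma>: "integrable lborel \<gamma>" unfolding \<gamma>_def using plane_fubini(2)[OF re] by simp
  then have [measurable]: "\<gamma> \<in> borel_measurable borel" by auto
  have \<gamma>0: "\<gamma> x = 0" if "x \<notin> {0<..<1}" for x
  proof -
    have "r (x, y) = 0" for y using that by (intro r0) (auto simp: Q_iff)
    then show ?thesis by (simp add: \<gamma>_def)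
  qed
  define s where "s z = r z - \<gamma> (fst z) * indicator {0<..<1} (snd z)" for z
  have i1: "integrable lborel (indicator {0<..<1} :: real \<Rightarrow> real)" by (rule integrable_real_indicator) auto
  have s: "integrable lborel s" unfolding s_def using r integrable_tensor[OF \<gamma> i1] by simp
  have s0: "s z = 0" if "z \<notin> Q" for z using that r0[of z] \<gamma>0[of "fst z"] by (auto simp: s_def Q_iff indicator_def)
  have "AE z in lborel. s z = 0"
  proof (rule tensor_bump_AE_0[OF s s0])
    fix n :: nat and c d c' d' :: real
    assume b: "0 < c" "c < d" "d < 1" "0 < c'" "c' < d'" "d' < 1"
    let ?a = "bump n c d" and ?b = "bump n c' d'"
    have ca: "continuous_on UNIV ?a" and cb: "continuous_on UNIV ?b" by (rule continuous_bump)+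
    obtain a' where a': "test_fun ?a a'" using test_fun_bump[OF b(1-3)] by blast
    define k where "k = (LINT t|lborel. ?b t)"
    have ib: "integrable lborel ?b"
      by (rule integrable_compact_support_01[OF cb]) (use b in \<open>auto simp: bump_outside\<close>)
    have ie: "integrable lborel e"
      by (rule integrable_compact_support_01[OF ce]) (rule e0, auto)
    have mean: "(LINT t|lborel. ?b t - k * e t) = 0" using ib ie e1 by (simp add: k_def)
    have cont: "continuous_on UNIV (\<lambda>t. ?b t - k * e t)" by (intro continuous_intros cb ce)
    have lim: "0 < min c' (1/4)" "min c' (1/4) < max d' (3/4)" "max d' (3/4) < 1" using b by auto
    have supp: "?b t - k * e t = 0" if "t \<notin> {min c' (1/4)..max d' (3/4)}" for t
    proof -
      have "t \<notin> {1/4..3/4}" "\<not> (c' < t \<and> t < d')" using that by auto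
      then show ?thesis using e0[of t] by (simp add: bump_outside)
    qed
    obtain \<eta> where \<eta>: "test_fun \<eta> (\<lambda>t. ?b t - k * e t)"
      using test_fun_zero_mean[OF cont lim supp mean] by blast
    have \<eta>1: "\<eta> 1 = 0" and d\<eta>: "\<And>t. (\<eta> has_real_derivative (?b t - k * e t)) (at t)"
      and c\<eta>': "continuous_on UNIV (\<lambda>t. ?b t - k * e t)" using \<eta> by (auto simp: test_fun_def)
    have I: "integrable lborel (\<lambda>z. h z * (?a (fst z) * v (snd z)))"
      if "integrable lborel h" "\<And>z. z \<notin> Q \<Longrightarrow> h z = 0" "continuous_on UNIV v" for h and v :: "real \<Rightarrow> real"
      by (rule integrable_Q_mult[OF that(1,2)])
        (auto intro!: continuous_intros continuous_on_compose2[OF ca] continuous_on_compose2[OF that(3)])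
    have "(LINT z|lborel. f z * (?a (fst z) * (?b (snd z) - k * e (snd z)))) = - (LINT z|lborel. g z * (?a (fst z) * \<eta> (snd z)))"
      using wd[unfolded weak_dy_def, THEN conjunct2, THEN conjunct2, THEN conjunct2, rule_format, OF a' \<eta>] .
    moreover have "(LINT z|lborel. primitive_y g z * (?a (fst z) * (?b (snd z) - k * e (snd z)))) = - (LINT z|lborel. g z * (?a (fst z) * \<eta> (snd z)))"
      using primitive_y_parts(1)[OF g g0 d\<eta> c\<eta>' ca] \<eta>1 by simp
    ultimately have "(LINT z|lborel. r z * (?a (fst z) * (?b (snd z) - k * e (snd z)))) = 0"
      using Bochner_Integration.integral_diff[OF I[OF f f0 c\<eta>'] primitive_y_parts(2)[OF g g0 d\<eta> c\<eta>' ca]]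
      by (simp add: r_def left_diff_distrib)
    moreover have "(LINT z|lborel. r z * (?a (fst z) * (?b (snd z) - k * e (snd z)))) =
       (LINT z|lborel. r z * (?a (fst z) * ?b (snd z))) - k * (LINT z|lborel. r z * (?a (fst z) * e (snd z)))"
      using Bochner_Integration.integral_diff[OF I[OF r r0 cb] integrable_mult_right[OF I[OF r r0 ce], of k]]
      by (simp add: algebra_simps)
    ultimately have R: "(LINT z|lborel. r z * (?a (fst z) * ?b (snd z))) = k * (LINT z|lborel. r z * (?a (fst z) * e (snd z)))"
      by simp
    have ba: "\<bar>?a x\<bar> \<le> 1" for x using bump_bounds[of c d n x] b by auto
    have [measurable]: "?a \<in> borel_measurable borel" using ca by (rule borel_measurable_continuous_onI)
    have i\<gamma>a: "integrable lborel (\<lambda>x. \<gamma> x * ?a x)"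
      by (rule Bochner_Integration.integrable_bound[OF \<gamma>]) (auto simp: abs_mult intro!: mult_left_le ba)
    have "(LINT z|lborel. r z * (?a (fst z) * e (snd z))) = (LINT x|lborel. LINT y|lborel. r (x, y) * (?a x * e y))"
      using plane_fubini(3)[OF I[OF r r0 ce]] by simp
    also have "\<dots> = (LINT x|lborel. \<gamma> x * ?a x)"
    proof (rule Bochner_Integration.integral_cong[OF refl])
      fix x
      have "(LINT y|lborel. r (x, y) * (?a x * e y)) = (LINT y|lborel. ?a x * (r (x, y) * e y))"
        by (simp add: mult_ac)
      then show "(LINT y|lborel. r (x, y) * (?a x * e y)) = \<gamma> x * ?a x" by (simp add: \<gamma>_def)
    qed
    finally have G: "(LINT z|lborel. r z * (?a (fst z) * e (snd z))) = (LINT x|lborel. \<gamma> x * ?a x)" .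
    have eq: "s z * (?a (fst z) * ?b (snd z)) = r z * (?a (fst z) * ?b (snd z)) - (\<gamma> (fst z) * ?a (fst z)) * ?b (snd z)" for z
      using b by (cases "snd z \<in> {0<..<1}") (auto simp: s_def algebra_simps bump_outside)
    show "(LINT z|lborel. s z * (?a (fst z) * ?b (snd z))) = 0"
      unfolding eq
      using Bochner_Integration.integral_diff[OF I[OF r r0 cb] integrable_tensor[OF i\<gamma>a ib]]
        integral_tensor[OF i\<gamma>a ib] R G by (simp add: k_def)
  qed
  then have "AE z in lborel. z \<in> Q \<longrightarrow> f z = \<gamma> (fst z) + primitive (\<lambda>t. g (fst z, t)) (snd z)"
    by eventually_elim (auto simp: s_def r_def primitive_y_def Q_iff)
  with \<gamma> show ?thesis ..
qed

lemma AE_eq_continuous_closure: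
  fixes f g :: "'a::euclidean_space \<Rightarrow> 'b::real_normed_vector"
  assumes "open S" "continuous_on (closure S) f" "continuous_on (closure S) g"
    and ae: "AE x in lborel. x \<in> S \<longrightarrow> f x = g x" and x: "x \<in> closure S"
  shows "f x = g x"
proof -
  have c: "continuous_on S (\<lambda>x. f x - g x)"
    using assms(2,3)[THEN continuous_on_subset[OF _ closure_subset]] by (intro continuous_intros)
  have op: "open {x \<in> S. f x - g x \<noteq> 0}"
  proof -
    have "{x \<in> S. f x - g x \<noteq> 0} = S \<inter> (\<lambda>x. f x - g x) -` (- {0})" by auto
    then show ?thesis using continuous_open_preimage[OF c \<open>open S\<close>, of "- {0}"] by auto
  qed
  have "{x \<in> S. f x - g x \<noteq> 0} \<in> null_sets lborel"
    using ae op by (intro AE_iff_null_sets[THEN iffD2]) (auto elim: eventually_mono)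
  then have "negligible {x \<in> S. f x - g x \<noteq> 0}"
    using null_sets_completionI negligible_iff_null_sets by blast
  then have "{x \<in> S. f x - g x \<noteq> 0} = {}" using open_not_negligible[OF op] by blast
  then have "f y - g y = 0" if "y \<in> S" for y using that by auto
  then have "f x - g x = 0"
    using continuous_constant_on_closure[of S "\<lambda>x. f x - g x" 0 x] assms(2,3) x
    by (auto intro: continuous_intros)
  then show ?thesis by simp
qed

lemma AE_eq_01:
  fixes f g :: "real \<Rightarrow> real"
  assumes "continuous_on {0..1} f" "continuous_on {0..1} g"
    and "AE x in lborel. x \<in> {0<..<1} \<longrightarrow> f x = g x" and "x \<in> {0..1}"
  shows "f x = g x"
  using AE_eq_continuous_closure[of "{0<..<1::real}" f g x] assms by simp

lemma continuous_primitive: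
  assumes g: "integrable lborel g"
  shows "continuous_on UNIV (primitive g)"
proof (rule continuous_on_sequentiallyI)
  fix u :: "nat \<Rightarrow> real" and a assume u: "u \<longlonglongrightarrow> a"
  have [measurable]: "g \<in> borel_measurable borel" using g by auto
  show "(\<lambda>n. primitive g (u n)) \<longlonglongrightarrow> primitive g a"
    unfolding primitive_def
  proof (rule integral_dominated_convergence[where w="\<lambda>t. \<bar>g t\<bar>"])
    show "AE t in lborel. (\<lambda>n. if 0 < t \<and> t \<le> u n then g t else 0) \<longlonglongrightarrow> (if 0 < t \<and> t \<le> a then g t else 0)"
      using AE_lborel_singleton[of a]
    proof eventually_elim
      case (elim t)
      have "\<forall>\<^sub>F n in sequentially. (t \<le> u n) = (t \<le> a)"
      proof (cases "t < a")
        case True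
        with order_tendstoD(1)[OF u True] show ?thesis by (auto elim: eventually_mono)
      next
        case False
        with elim have "a < t" by simp
        with order_tendstoD(2)[OF u this] show ?thesis by (auto elim: eventually_mono)
      qed
      then have "\<forall>\<^sub>F n in sequentially. (if 0 < t \<and> t \<le> u n then g t else 0) = (if 0 < t \<and> t \<le> a then g t else 0)"
        by eventually_elim auto
      then show ?case by (rule tendsto_eventually)
    qed
  qed (use g in auto)
qed

lemma primitive_cong_AE:
  assumes "AE t in lborel. t \<in> {0<..<1} \<longrightarrow> f t = g t" "y \<le> 1"
    and [measurable]: "f \<in> borel_measurable borel" "g \<in> borel_measurable borel"
  shows "primitive f y = primitive g y"
  unfolding primitive_def
proof (rule integral_cong_AE)
  show "AE t in lborel. (if 0 < t \<and> t \<le> y then f t else 0) = (if 0 < t \<and> t \<le> y then g t else 0)"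
    using assms(1) AE_lborel_singleton[of 1] by eventually_elim (use assms(2) in auto)
qed auto

lemma primitive_continuous_FTC:
  assumes C: "\<And>x. (C has_real_derivative c x) (at x)" "continuous_on UNIV c" and "0 \<le> y"
  shows "primitive c y = C y - C 0"
proof -
  have [measurable]: "c \<in> borel_measurable borel" using C by (intro borel_measurable_continuous_onI)
  have "primitive c y = (LINT x|lborel. indicator {0<..<y} x * c x)"
    unfolding primitive_def
  proof (rule integral_cong_AE)
    show "AE t in lborel. (if 0 < t \<and> t \<le> y then c t else 0) = indicator {0<..<y} t * c t"
      using AE_lborel_singleton[of y] by eventually_elim auto
  qed auto
  then show ?thesis using integral_FTC_01(1)[OF C(1,2) \<open>0 \<le> y\<close>] by simp
qed

lemma primitive_zero_AE:
  assumes g: "integrable lborel g" and 0: "\<And>y. 0 \<le> y \<Longrightarrow> y \<le> 1 \<Longrightarrow> primitive g y = 0"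
  shows "AE t in lborel. t \<in> {0<..<1} \<longrightarrow> g t = 0"
proof -
  have [measurable]: "g \<in> borel_measurable borel" using g by auto
  have i: "integrable lborel (\<lambda>t. indicator {0<..<1} t * g t)"
    by (rule Bochner_Integration.integrable_bound[OF g]) (auto simp: indicator_def)
  have "AE t in lborel. indicator {0<..<1} t * g t = 0"
  proof (rule AE_eq_0_if_boxes[OF i])
    fix a b :: real
    define l u where "l = min 1 (max 0 a)" and "u = max l (min 1 b)"
    have lu: "0 \<le> l" "l \<le> u" "u \<le> 1" by (auto simp: l_def u_def)
    have "(LINT t|lborel. indicator (box a b) t * (indicator {0<..<1} t * g t)) =
       (LINT t|lborel. (if 0 < t \<and> t \<le> u then g t else 0) - (if 0 < t \<and> t \<le> l then g t else 0))"
    proof (rule integral_cong_AE)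
      show "AE t in lborel. indicator (box a b) t * (indicator {0<..<1} t * g t) =
         (if 0 < t \<and> t \<le> u then g t else 0) - (if 0 < t \<and> t \<le> l then g t else 0)"
        using AE_lborel_singleton[of l] AE_lborel_singleton[of u] AE_lborel_singleton[of 1]
      proof eventually_elim
        case (elim t)
        then have "t \<in> box a b \<and> t \<in> {0<..<1} \<longleftrightarrow> 0 < t \<and> t \<le> u \<and> \<not> t \<le> l"
          unfolding l_def u_def box_real greaterThanLessThan_iff by linarith
        with lu show ?case by (auto simp: indicator_def)
      qed
    qed auto
    also have "\<dots> = primitive g u - primitive g l"
      unfolding primitive_def using integrable_restrict[OF g] by (intro Bochner_Integration.integral_diff) auto
    finally show "(LINT t|lborel. indicator (box a b) t * (indicator {0<..<1} t * g t)) = 0"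
      using 0 lu by simp
  qed
  then show ?thesis by eventually_elim auto
qed

definition trace_y :: "(real \<times> real \<Rightarrow> real) \<Rightarrow> (real \<times> real \<Rightarrow> real) \<Rightarrow> (real \<Rightarrow> real) \<Rightarrow> (real \<Rightarrow> real) \<Rightarrow> bool" where
  "trace_y w h \<alpha> \<beta> \<longleftrightarrow> (\<forall>\<rho> \<rho>'. continuous_on UNIV \<rho> \<longrightarrow> continuous_on UNIV \<rho>' \<longrightarrow>
     (\<forall>x y. ((\<lambda>y. \<rho> (x, y)) has_real_derivative \<rho>' (x, y)) (at y)) \<longrightarrow>
     (LINT z|lborel. h z * \<rho> z) =
       (LINT x|lborel. indicator {0<..<1} x * (\<beta> x * \<rho> (x, 1) - \<alpha> x * \<rho> (x, 0))) - (LINT z|lborel. w z * \<rho>' z))"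

lemma primitive_0 [simp]: "primitive g 0 = 0"
proof -
  have "(\<lambda>t. if 0 < t \<and> t \<le> 0 then g t else 0) = (\<lambda>_. 0)" by (auto simp: fun_eq_iff)
  then show ?thesis by (simp add: primitive_def)
qed

lemma primitive_1: "(\<And>t. t \<notin> {0<..<1} \<Longrightarrow> g t = 0) \<Longrightarrow> primitive g 1 = (LINT t|lborel. g t)"
  unfolding primitive_def by (intro Bochner_Integration.integral_cong) auto

lemma traceyI:
  assumes w: "integrable lborel w" and h: "integrable lborel h"
    and w0: "\<And>z. z \<notin> Q \<Longrightarrow> w z = 0" and h0: "\<And>z. z \<notin> Q \<Longrightarrow> h z = 0"
    and eq: "AE z in lborel. z \<in> Q \<longrightarrow> w z = \<gamma> (fst z) + primitive (\<lambda>t. h (fst z, t)) (snd z)"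
    and \<alpha>: "AE x in lborel. x \<in> {0<..<1} \<longrightarrow> \<gamma> x = \<alpha> x"
    and \<beta>: "AE x in lborel. x \<in> {0<..<1} \<longrightarrow> \<gamma> x + primitive (\<lambda>t. h (x, t)) 1 = \<beta> x"
    and c: "continuous_on UNIV \<alpha>" "continuous_on UNIV \<beta>"
  shows "trace_y w h \<alpha> \<beta>"
  unfolding trace_y_def
proof (intro allI impI)
  fix \<rho> \<rho>' :: "real \<times> real \<Rightarrow> real"
  assume \<rho>: "continuous_on UNIV \<rho>" and \<rho>': "continuous_on UNIV \<rho>'"
    and d: "\<forall>x y. ((\<lambda>y. \<rho> (x, y)) has_real_derivative \<rho>' (x, y)) (at y)"
  have cx: "continuous_on UNIV (\<lambda>y. \<rho>' (x, y))" for x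
    by (rule continuous_on_compose2[OF \<rho>']) (auto intro!: continuous_intros)
  have ih: "integrable lborel (\<lambda>z. h z * \<rho> z)" by (rule integrable_Q_mult[OF h h0 \<rho>])
  have iw: "integrable lborel (\<lambda>z. w z * \<rho>' z)" by (rule integrable_Q_mult[OF w w0 \<rho>'])
  have [measurable]: "\<alpha> \<in> borel_measurable borel" "\<beta> \<in> borel_measurable borel" "\<rho> \<in> borel_measurable borel"
    "h \<in> borel_measurable borel" "w \<in> borel_measurable borel" "\<rho>' \<in> borel_measurable borel"
    using c \<rho> \<rho>' h w by (auto intro: borel_measurable_continuous_onI)
  have "(LINT z|lborel. h z * \<rho> z) + (LINT z|lborel. w z * \<rho>' z) =
     (LINT x|lborel. (LINT y|lborel. h (x, y) * \<rho> (x, y)) + (LINT y|lborel. w (x, y) * \<rho>' (x, y)))"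
    using plane_fubini(3)[OF ih] plane_fubini(3)[OF iw]
      Bochner_Integration.integral_add[OF plane_fubini(2)[OF ih] plane_fubini(2)[OF iw]] by simp
  also have "\<dots> = (LINT x|lborel. indicator {0<..<1} x * (\<beta> x * \<rho> (x, 1) - \<alpha> x * \<rho> (x, 0)))"
  proof (rule integral_cong_AE)
    show "AE x in lborel. (LINT y|lborel. h (x, y) * \<rho> (x, y)) + (LINT y|lborel. w (x, y) * \<rho>' (x, y))
      = indicator {0<..<1} x * (\<beta> x * \<rho> (x, 1) - \<alpha> x * \<rho> (x, 0))"
      using plane_fubini(1)[OF h] plane_fubini(1)[OF ih] plane_AE[OF eq] \<alpha> \<beta>
    proof eventually_elim
      case (elim x)
      show ?case
      proof (cases "x \<in> {0<..<1}")
        case True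
        let ?h = "\<lambda>t. h (x, t)" and ?r = "\<lambda>y. \<rho> (x, y)" and ?r' = "\<lambda>y. \<rho>' (x, y)"
        have h0': "?h t = 0" if "t \<notin> {0<..<1}" for t using that by (intro h0) (auto simp: Q_iff)
        have cp: "continuous_on UNIV (primitive ?h)" by (rule continuous_primitive[OF elim(1)])
        have i1: "integrable lborel (\<lambda>y. indicator {0<..<1} y * ?r' y)"
          and I1: "(LINT y|lborel. indicator {0<..<1} y * ?r' y) = ?r 1 - ?r 0"
          using integral_FTC_01[of ?r ?r' 0 1] d cx[of x] by auto
        have cpr: "continuous_on UNIV (\<lambda>y. primitive ?h y * ?r' y)" by (intro continuous_intros cp cx)
        obtain F where F: "\<And>y. (F has_real_derivative primitive ?h y * ?r' y) (at y)"
          using continuous_antiderivative[OF cpr] by blast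
        have i2: "integrable lborel (\<lambda>y. indicator {0<..<1} y * (primitive ?h y * ?r' y))"
          using integral_FTC_01(2)[OF F cpr, of 0 1] by simp
        have hr: "integrable lborel (\<lambda>y. ?h y * ?r y)" using elim(2) .
        have "(LINT y|lborel. indicator {0<..<1} y * (primitive ?h y * ?r' y)) = (LINT t|lborel. ?h t * (?r 1 - ?r t))"
          by (rule primitive_by_parts[OF elim(1) h0' _ cx]) (use d in auto)
        also have "\<dots> = (LINT t|lborel. ?r 1 * ?h t - ?h t * ?r t)" by (simp add: algebra_simps)
        also have "\<dots> = ?r 1 * (LINT t|lborel. ?h t) - (LINT t|lborel. ?h t * ?r t)"
          using Bochner_Integration.integral_diff[OF integrable_mult_right[OF elim(1), of "?r 1"] hr] by simp
        finally have P: "(LINT y|lborel. indicator {0<..<1} y * (primitive ?h y * ?r' y)) =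
          ?r 1 * primitive ?h 1 - (LINT t|lborel. ?h t * ?r t)" using primitive_1[of ?h] h0' by simp
        have "(LINT y|lborel. w (x, y) * ?r' y) = (LINT y|lborel. \<gamma> x * (indicator {0<..<1} y * ?r' y) + indicator {0<..<1} y * (primitive ?h y * ?r' y))"
        proof (rule integral_cong_AE)
          show "AE y in lborel. w (x, y) * ?r' y = \<gamma> x * (indicator {0<..<1} y * ?r' y) + indicator {0<..<1} y * (primitive ?h y * ?r' y)"
            using elim(3)
          proof eventually_elim
            case (elim y)
            then show ?case using True w0[of "(x, y)"] by (cases "y \<in> {0<..<1}") (auto simp: Q_iff algebra_simps)
          qed
        qed (use i1 i2 in auto)
        also have "\<dots> = \<gamma> x * (?r 1 - ?r 0) + (?r 1 * primitive ?h 1 - (LINT t|lborel. ?h t * ?r t))"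
          using Bochner_Integration.integral_add[OF integrable_mult_right[OF i1, of "\<gamma> x"] i2] I1 P by simp
        finally have "(LINT y|lborel. ?h y * ?r y) + (LINT y|lborel. w (x, y) * ?r' y) = (\<gamma> x + primitive ?h 1) * ?r 1 - \<gamma> x * ?r 0"
          by (simp add: algebra_simps)
        then show ?thesis using elim(4,5) True by simp
      next
        case False
        then have "h (x, y) = 0" "w (x, y) = 0" for y by (auto intro!: h0 w0 simp: Q_iff)
        then show ?thesis using False by simp
      qed
    qed
    show "(\<lambda>x. (LINT y|lborel. h (x, y) * \<rho> (x, y)) + (LINT y|lborel. w (x, y) * \<rho>' (x, y))) \<in> borel_measurable lborel"
      using plane_fubini(2)[OF ih] plane_fubini(2)[OF iw] by auto
    show "(\<lambda>x. indicator {0<..<1} x * (\<beta> x * \<rho> (x, 1) - \<alpha> x * \<rho> (x, 0))) \<in> borel_measurable lborel"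
      by measurable
  qed
  finally show "(LINT z|lborel. h z * \<rho> z) =
       (LINT x|lborel. indicator {0<..<1} x * (\<beta> x * \<rho> (x, 1) - \<alpha> x * \<rho> (x, 0))) - (LINT z|lborel. w z * \<rho>' z)"
    by simp
qed

lemma continuous_on_section:
  assumes "continuous_on ({0..1} \<times> {0..1}) \<phi>" "x \<in> {0..1}"
  shows "continuous_on {0..1} (\<lambda>y. \<phi> (x, y))" "continuous_on {0..1} (\<lambda>y. \<phi> (y, x))"
  using assms by (auto intro!: continuous_on_compose2[OF assms(1)] continuous_intros)

lemma weak_dy_continuous_primitive:
  assumes \<phi>: "continuous_on ({0..1} \<times> {0..1}) \<phi>" and wd: "weak_dy (\<lambda>z. indicator Q z * \<phi> z) w"
  shows "AE x in lborel. x \<in> {0<..<1} \<longrightarrow> (\<forall>y\<in>{0..1}. \<phi> (x, y) = \<phi> (x, 0) + primitive (\<lambda>t. w (x, t)) y)"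
proof -
  have w: "integrable lborel w" using wd by (auto simp: weak_dy_def)
  obtain \<gamma> where "integrable lborel \<gamma>" "AE z in lborel. z \<in> Q \<longrightarrow> indicator Q z * \<phi> z = \<gamma> (fst z) + primitive (\<lambda>t. w (fst z, t)) (snd z)"
    by (rule weak_dy_primitive[OF wd])
  from plane_AE[OF this(2)] plane_fubini(1)[OF w] show ?thesis
  proof eventually_elim
    case (elim x)
    show ?case
    proof
      assume x: "x \<in> {0<..<1}"
      have e: "\<phi> (x, y) = \<gamma> x + primitive (\<lambda>t. w (x, t)) y" if "y \<in> {0..1}" for y
      proof (rule AE_eq_01[OF _ _ _ that])
        show "continuous_on {0..1} (\<lambda>y. \<phi> (x, y))" using x by (intro continuous_on_section(1)[OF \<phi>]) auto
        show "continuous_on {0..1} (\<lambda>y. \<gamma> x + primitive (\<lambda>t. w (x, t)) y)"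
          using continuous_on_subset[OF continuous_primitive[OF elim(2)]] by (intro continuous_intros) auto
        show "AE y in lborel. y \<in> {0<..<1} \<longrightarrow> \<phi> (x, y) = \<gamma> x + primitive (\<lambda>t. w (x, t)) y"
          using elim(1) by eventually_elim (use x in \<open>auto simp: Q_iff\<close>)
      qed
      show "\<forall>y\<in>{0..1}. \<phi> (x, y) = \<phi> (x, 0) + primitive (\<lambda>t. w (x, t)) y"
        using e e[of 0] by simp
    qed
  qed
qed

text \<open>On almost every vertical line \<open>\<phi>\<close> is twice differentiable with an absolutely continuous
  derivative, which identifies the trace of \<open>w\<close> with the one-sided derivative of \<open>\<phi>\<close>.\<close>

lemma trace_y_normal:
  assumes \<phi>: "continuous_on ({0..1} \<times> {0..1}) \<phi>" and wd: "weak_dy (\<lambda>z. indicator Q z * \<phi> z) w" and wh: "weak_dy w h"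
    and \<alpha>: "AE x in lborel. x \<in> {0<..<1} \<longrightarrow> ((\<lambda>y. \<phi> (x, y)) has_real_derivative \<alpha> x) (at_right 0)"
    and \<beta>: "AE x in lborel. x \<in> {0<..<1} \<longrightarrow> ((\<lambda>y. \<phi> (x, y)) has_real_derivative \<beta> x) (at_left 1)"
    and c: "continuous_on UNIV \<alpha>" "continuous_on UNIV \<beta>"
  shows "trace_y w h \<alpha> \<beta>"
proof -
  have w: "integrable lborel w" and h: "integrable lborel h" and w0: "\<And>z. z \<notin> Q \<Longrightarrow> w z = 0"
    and h0: "\<And>z. z \<notin> Q \<Longrightarrow> h z = 0" using wh by (auto simp: weak_dy_def)
  obtain \<gamma> where "integrable lborel \<gamma>" and \<gamma>: "AE z in lborel. z \<in> Q \<longrightarrow> w z = \<gamma> (fst z) + primitive (\<lambda>t. h (fst z, t)) (snd z)"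
    by (rule weak_dy_primitive[OF wh])
  have "AE x in lborel. x \<in> {0<..<1} \<longrightarrow> \<gamma> x = \<alpha> x \<and> \<gamma> x + primitive (\<lambda>t. h (x, t)) 1 = \<beta> x"
    using weak_dy_continuous_primitive[OF \<phi> wd] plane_AE[OF \<gamma>] plane_fubini(1)[OF w] plane_fubini(1)[OF h] \<alpha> \<beta>
  proof eventually_elim
    case (elim x)
    show ?case
    proof
      assume x: "x \<in> {0<..<1}"
      let ?c = "\<lambda>y. \<gamma> x + primitive (\<lambda>t. h (x, t)) y"
      have cc: "continuous_on UNIV ?c" by (intro continuous_intros continuous_primitive[OF elim(4)])
      obtain C where C: "\<And>y. (C has_real_derivative ?c y) (at y)" using continuous_antiderivative[OF cc] by blast
      define b where "b = \<phi> (x, 0)"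
      have e: "\<phi> (x, y) = b + (C y - C 0)" if "y \<in> {0..1}" for y
      proof -
        have "primitive (\<lambda>t. w (x, t)) y = primitive ?c y"
        proof (rule primitive_cong_AE)
          show "AE t in lborel. t \<in> {0<..<1} \<longrightarrow> w (x, t) = ?c t"
            using elim(2) by eventually_elim (use x in \<open>auto simp: Q_iff\<close>)
        qed (use that elim(3) cc in \<open>auto intro: borel_measurable_continuous_onI\<close>)
        also have "\<dots> = C y - C 0" by (rule primitive_continuous_FTC[OF C cc]) (use that in auto)
        finally show ?thesis unfolding b_def using elim(1)[rule_format, OF x that] by (simp only:)
      qed
      have dC: "((\<lambda>y. b + (C y - C 0)) has_real_derivative ?c y) (at y)" for y
        using C[of y] by (auto intro!: derivative_eq_intros)
      have "((\<lambda>y. \<phi> (x, y)) has_real_derivative ?c 0) (at 0 within {0..1})"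
        by (rule has_field_derivative_transform_within[OF has_field_derivative_at_within[OF dC], of 1]) (auto simp: e)
      then have d0: "((\<lambda>y. \<phi> (x, y)) has_real_derivative ?c 0) (at_right 0)"
        using at_within_Icc_at_right[of 0 "1::real"] by simp
      have A: "?c 0 = \<alpha> x"
        using tendsto_unique[OF trivial_limit_at_right_real d0[unfolded has_field_derivative_iff]
          elim(5)[rule_format, OF x, unfolded has_field_derivative_iff]] .
      have "((\<lambda>y. \<phi> (x, y)) has_real_derivative ?c 1) (at 1 within {0..1})"
        by (rule has_field_derivative_transform_within[OF has_field_derivative_at_within[OF dC], of 1]) (auto simp: e)
      then have d1: "((\<lambda>y. \<phi> (x, y)) has_real_derivative ?c 1) (at_left 1)"
        using at_within_Icc_at_left[of 0 "1::real"] by simp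
      have "?c 1 = \<beta> x"
        using tendsto_unique[OF trivial_limit_at_left_real d1[unfolded has_field_derivative_iff]
          elim(6)[rule_format, OF x, unfolded has_field_derivative_iff]] .
      with A show "\<gamma> x = \<alpha> x \<and> \<gamma> x + primitive (\<lambda>t. h (x, t)) 1 = \<beta> x" by simp
    qed
  qed
  then show ?thesis
    by (intro traceyI[OF w h w0 h0 \<gamma> _ _ c]) (auto elim: eventually_mono)
qed

lemma AE_approach:
  assumes ae: "AE x in lborel. x \<in> {0<..<1} \<longrightarrow> P x" and e: "e \<in> {0..1::real}"
  obtains u where "u \<longlonglongrightarrow> e" "\<forall>n. u n \<in> {0<..<1}" "\<forall>n. P (u n :: real)"
proof -
  have ex: "\<exists>x. l < x \<and> x < r \<and> P x" if "0 \<le> l" "l < r" "r \<le> 1" for l r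
  proof (rule ccontr)
    assume neg: "\<not> ?thesis"
    from ae have "AE x in lborel. x \<notin> {l<..<r}"
      by eventually_elim (use that neg in auto)
    then have "emeasure lborel {l<..<r} = 0" by (subst (asm) AE_iff_measurable[of "{l<..<r}"]) auto
    with that show False by simp
  qed
  define d where "d n = 1 / (real n + 2)" for n :: nat
  have d: "0 < d n" "d n < 1" for n by (auto simp: d_def)
  have d0: "d \<longlonglongrightarrow> 0" unfolding d_def
    using LIMSEQ_ignore_initial_segment[OF lim_1_over_n[where 'a=real], of 2] by (simp add: add.commute)
  have "\<exists>x. max 0 (e - d n) < x \<and> x < min 1 (e + d n) \<and> P x" for n
    using d[of n] e by (intro ex) auto
  then obtain u where u: "\<And>n. max 0 (e - d n) < u n \<and> u n < min 1 (e + d n) \<and> P (u n)" by metis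
  show ?thesis
  proof
    have "(\<lambda>n. u n - e) \<longlonglongrightarrow> 0"
    proof (rule Lim_null_comparison[OF always_eventually d0], rule allI)
      fix n
      have "e - d n < u n" "u n < e + d n" using u[of n] by auto
      then show "norm (u n - e) \<le> d n" by (simp add: abs_le_iff)
    qed
    then show "u \<longlonglongrightarrow> e" by (simp add: LIM_zero_iff)
  qed (use u in auto)
qed

lemma trace_y_tangential_end:
  assumes \<phi>: "continuous_on ({0..1} \<times> {0..1}) \<phi>" and wd: "weak_dy (\<lambda>z. indicator Q z * \<phi> z) w"
    and h: "integrable lborel h" and h0: "\<And>z. z \<notin> Q \<Longrightarrow> h z = 0" and \<delta>: "integrable lborel \<delta>"
    and eq: "AE z in lborel. z \<in> Q \<longrightarrow> w z = \<delta> (snd z) + primitive (\<lambda>s. h (s, snd z)) (fst z)"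
    and e: "e \<in> {0..1}" and p: "\<And>y. y \<in> {0..1} \<Longrightarrow> \<phi> (e, y) = p y"
    and p': "\<And>y. (p has_real_derivative \<beta> y) (at y)" "continuous_on UNIV \<beta>"
  shows "AE t in lborel. t \<in> {0<..<1} \<longrightarrow> \<delta> t + primitive (\<lambda>s. h (s, t)) e = \<beta> t"
proof -
  have w: "integrable lborel w" using wd by (auto simp: weak_dy_def)
  have [measurable]: "h \<in> borel_measurable borel" "\<delta> \<in> borel_measurable borel" "w \<in> borel_measurable borel"
    using h \<delta> w by auto
  have [measurable]: "\<beta> \<in> borel_measurable borel" using p'(2) by (rule borel_measurable_continuous_onI)
  have hs: "integrable lborel (\<lambda>z. h (prod.swap z))" using h by (subst plane_swap) auto
  have hn: "integrable lborel (\<lambda>z. \<bar>h (prod.swap z)\<bar>)" using hs by auto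
  have D: "integrable lborel (\<lambda>t. LINT s|lborel. \<bar>h (s, t)\<bar>)" using plane_fubini(2)[OF hn] by simp
  have sec: "AE t in lborel. integrable lborel (\<lambda>s. h (s, t))" using plane_fubini(1)[OF hs] by simp
  have [measurable]: "(\<lambda>t. primitive (\<lambda>s. h (s, t)) x) \<in> borel_measurable borel" for x
    unfolding primitive_def by measurable
  have bd: "AE t in lborel. \<bar>primitive (\<lambda>s. h (s, t)) x\<bar> \<le> (LINT s|lborel. \<bar>h (s, t)\<bar>)" for x
    using sec
  proof eventually_elim
    case (elim t)
    have "norm (primitive (\<lambda>s. h (s, t)) x) \<le> (LINT s|lborel. norm (if 0 < s \<and> s \<le> x then h (s, t) else 0))"
      unfolding primitive_def by (rule integral_norm_bound)
    also have "\<dots> \<le> (LINT s|lborel. \<bar>h (s, t)\<bar>)"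
      by (rule integral_mono) (use elim integrable_restrict[OF elim] in auto)
    finally show ?case by simp
  qed
  have ip: "integrable lborel (\<lambda>t. primitive (\<lambda>s. h (s, t)) x)" for x
  proof (rule Bochner_Integration.integrable_bound[OF D])
    show "AE t in lborel. norm (primitive (\<lambda>s. h (s, t)) x) \<le> norm (LINT s|lborel. \<bar>h (s, t)\<bar>)"
      using bd[of x] by eventually_elim auto
  qed measurable
  define k where "k x t = \<delta> t + primitive (\<lambda>s. h (s, t)) x" for x t
  have k: "integrable lborel (k x)" for x unfolding k_def using \<delta> ip by simp
  then have [measurable]: "k x \<in> borel_measurable borel" for x by auto
  have lines: "AE x in lborel. x \<in> {0<..<1} \<longrightarrow> (\<forall>y\<in>{0..1}. \<phi> (x, y) = \<phi> (x, 0) + primitive (k x) y)"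
    using weak_dy_continuous_primitive[OF \<phi> wd] plane_AE[OF eq] plane_fubini(1)[OF w]
  proof eventually_elim
    case (elim x)
    show ?case
    proof (intro impI ballI)
      fix y assume x: "x \<in> {0<..<1}" and y: "y \<in> {0..1::real}"
      have "primitive (\<lambda>t. w (x, t)) y = primitive (k x) y"
      proof (rule primitive_cong_AE)
        show "AE t in lborel. t \<in> {0<..<1} \<longrightarrow> w (x, t) = k x t"
          using elim(2) by eventually_elim (use x in \<open>auto simp: Q_iff k_def\<close>)
      qed (use y elim(3) k in auto)
      then show "\<phi> (x, y) = \<phi> (x, 0) + primitive (k x) y" using elim(1)[rule_format, OF x y] by (simp only:)
    qed
  qed
  obtain u where u: "u \<longlonglongrightarrow> e" "\<forall>n. u n \<in> {0<..<1}"
    "\<forall>n. \<forall>y\<in>{0..1}. \<phi> (u n, y) = \<phi> (u n, 0) + primitive (k (u n)) y"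
    by (rule AE_approach[OF lines e])
  have P: "primitive (k e) y = p y - p 0" if y: "y \<in> {0..1}" for y
  proof (rule LIMSEQ_unique)
    have lim: "(\<lambda>n. \<phi> (u n, y)) \<longlonglongrightarrow> \<phi> (e, y)" if "y \<in> {0..1}" for y
    proof -
      have "continuous_on {0..1} (\<lambda>x. \<phi> (x, y))" by (rule continuous_on_section(2)[OF \<phi> that])
      then show ?thesis
        by (rule continuous_on_tendsto_compose[OF _ u(1)]) (use e u(2) in \<open>auto intro!: always_eventually simp: less_imp_le\<close>)
    qed
    have "(\<lambda>n. \<phi> (u n, y) - \<phi> (u n, 0)) \<longlonglongrightarrow> p y - p 0"
      using tendsto_diff[OF lim[OF y] lim[of 0]] p[OF y] p[of 0] by simp
    moreover have "\<phi> (u n, y) - \<phi> (u n, 0) = primitive (k (u n)) y" for n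
      using u(3)[rule_format, OF y, of n] by linarith
    ultimately show "(\<lambda>n. primitive (k (u n)) y) \<longlonglongrightarrow> p y - p 0" by (simp only:)
    show "(\<lambda>n. primitive (k (u n)) y) \<longlonglongrightarrow> primitive (k e) y"
      unfolding primitive_def[of "k _"]
    proof (rule integral_dominated_convergence[where w="\<lambda>t. \<bar>\<delta> t\<bar> + (LINT s|lborel. \<bar>h (s, t)\<bar>)"])
      show "AE t in lborel. (\<lambda>n. if 0 < t \<and> t \<le> y then k (u n) t else 0) \<longlonglongrightarrow> (if 0 < t \<and> t \<le> y then k e t else 0)"
        using sec
      proof eventually_elim
        case (elim t)
        have "(\<lambda>n. primitive (\<lambda>s. h (s, t)) (u n)) \<longlonglongrightarrow> primitive (\<lambda>s. h (s, t)) e"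
          by (rule continuous_on_tendsto_compose[OF continuous_primitive[OF elim] u(1)]) auto
        then show ?case by (auto simp: k_def intro!: tendsto_intros)
      qed
      show "AE t in lborel. norm (if 0 < t \<and> t \<le> y then k (u n) t else 0) \<le> \<bar>\<delta> t\<bar> + (LINT s|lborel. \<bar>h (s, t)\<bar>)" for n
        using bd[of "u n"]
      proof eventually_elim
        case (elim t)
        have "\<bar>k (u n) t\<bar> \<le> \<bar>\<delta> t\<bar> + \<bar>primitive (\<lambda>s. h (s, t)) (u n)\<bar>" unfolding k_def by (rule abs_triangle_ineq)
        with elim show ?case by auto
      qed
      show "integrable lborel (\<lambda>t. \<bar>\<delta> t\<bar> + (LINT s|lborel. \<bar>h (s, t)\<bar>))" using \<delta> D by auto
    qed auto
  qed
  have i\<beta>: "integrable lborel (\<lambda>t. indicator {0<..<1} t * \<beta> t)" using integral_FTC_01(2)[OF p', of 0 1] by simp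
  have "AE t in lborel. t \<in> {0<..<1} \<longrightarrow> k e t - indicator {0<..<1} t * \<beta> t = 0"
  proof (rule primitive_zero_AE)
    show "integrable lborel (\<lambda>t. k e t - indicator {0<..<1} t * \<beta> t)" using k i\<beta> by simp
    fix y :: real assume y: "0 \<le> y" "y \<le> 1"
    have "primitive (\<lambda>t. k e t - indicator {0<..<1} t * \<beta> t) y = primitive (k e) y - primitive (\<lambda>t. indicator {0<..<1} t * \<beta> t) y"
      unfolding primitive_def
      by (subst Bochner_Integration.integral_diff[symmetric])
        (auto intro!: integrable_restrict k i\<beta> Bochner_Integration.integral_cong)
    also have "primitive (\<lambda>t. indicator {0<..<1} t * \<beta> t) y = primitive \<beta> y"
      by (rule primitive_cong_AE) (use y in auto)
    also have "\<dots> = p y - p 0" by (rule primitive_continuous_FTC[OF p' y(1)])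
    finally show "primitive (\<lambda>t. k e t - indicator {0<..<1} t * \<beta> t) y = 0" using P[of y] y by simp
  qed
  then show ?thesis by eventually_elim (auto simp: k_def)
qed

section \<open>Green's formula for the rows of an Airy field\<close>

definition weak_dx :: "(real \<times> real \<Rightarrow> real) \<Rightarrow> (real \<times> real \<Rightarrow> real) \<Rightarrow> bool" where
  "weak_dx f g \<longleftrightarrow> weak_dy (\<lambda>z. f (prod.swap z)) (\<lambda>z. g (prod.swap z))"

lemma trace_y_tangential:
  assumes \<phi>: "continuous_on ({0..1} \<times> {0..1}) \<phi>" and wd: "weak_dy (\<lambda>z. indicator Q z * \<phi> z) w" and wh: "weak_dx w h"
    and p: "\<And>y. y \<in> {0..1} \<Longrightarrow> \<phi> (0, y) = p y" "\<And>y. y \<in> {0..1} \<Longrightarrow> \<phi> (1, y) = q y"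
    and p': "\<And>y. (p has_real_derivative \<alpha> y) (at y)" "continuous_on UNIV \<alpha>"
    and q': "\<And>y. (q has_real_derivative \<beta> y) (at y)" "continuous_on UNIV \<beta>"
  shows "trace_y (\<lambda>z. w (prod.swap z)) (\<lambda>z. h (prod.swap z)) \<alpha> \<beta>"
proof -
  have sw: "integrable lborel (\<lambda>z. w (prod.swap z))" "integrable lborel (\<lambda>z. h (prod.swap z))"
    and s0: "\<And>z. z \<notin> Q \<Longrightarrow> w (prod.swap z) = 0" "\<And>z. z \<notin> Q \<Longrightarrow> h (prod.swap z) = 0"
    using wh by (auto simp: weak_dx_def weak_dy_def)
  have h: "integrable lborel h"
    using plane_swap(2)[of "\<lambda>z. h (prod.swap z)"] sw by simp
  have h0: "h z = 0" if "z \<notin> Q" for z using s0(2)[of "prod.swap z"] that by (auto simp: Q_iff)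
  obtain \<delta> where \<delta>: "integrable lborel \<delta>"
    "AE z in lborel. z \<in> Q \<longrightarrow> w (prod.swap z) = \<delta> (fst z) + primitive (\<lambda>t. h (prod.swap (fst z, t))) (snd z)"
    by (rule weak_dy_primitive[OF wh[unfolded weak_dx_def]])
  have eq: "AE z in lborel. z \<in> Q \<longrightarrow> w z = \<delta> (snd z) + primitive (\<lambda>s. h (s, snd z)) (fst z)"
    using AE_swap[OF \<delta>(2)] by eventually_elim (auto simp: Q_iff)
  show ?thesis
  proof (rule traceyI[OF sw s0 \<delta>(2) _ _ p'(2) q'(2)])
    show "AE x in lborel. x \<in> {0<..<1} \<longrightarrow> \<delta> x = \<alpha> x"
      using trace_y_tangential_end[OF \<phi> wd h h0 \<delta>(1) eq _ p(1) p'] by simp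
    show "AE x in lborel. x \<in> {0<..<1} \<longrightarrow> \<delta> x + primitive (\<lambda>t. h (prod.swap (x, t))) 1 = \<beta> x"
      using trace_y_tangential_end[OF \<phi> wd h h0 \<delta>(1) eq _ p(2) q'] by simp
  qed
qed

definition I01 :: "(real \<Rightarrow> real) \<Rightarrow> real" where
  "I01 f = (LINT t|lborel. indicator {0<..<1} t * f t)"

lemma integrable_01:
  fixes f :: "real \<Rightarrow> real"
  assumes f: "continuous_on UNIV f" shows "integrable lborel (\<lambda>t. indicator {0<..<1} t * f t)"
proof -
  obtain F where F: "\<And>x. (F has_real_derivative f x) (at x)" using continuous_antiderivative[OF f] by blast
  show ?thesis using integral_FTC_01(2)[OF F f, of 0 1] by simp
qed

lemma I01_FTC: "(\<And>x. (F has_real_derivative f x) (at x)) \<Longrightarrow> continuous_on UNIV f \<Longrightarrow> I01 f = F 1 - F 0"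
  unfolding I01_def using integral_FTC_01(1)[of F f 0 1] by simp

lemma I01_add: "continuous_on UNIV f \<Longrightarrow> continuous_on UNIV g \<Longrightarrow> I01 (\<lambda>t. f t + g t) = I01 f + I01 g"
  unfolding I01_def by (simp add: distrib_left integrable_01)

lemma I01_diff: "continuous_on UNIV f \<Longrightarrow> continuous_on UNIV g \<Longrightarrow> I01 (\<lambda>t. f t - g t) = I01 f - I01 g"
  unfolding I01_def by (simp add: right_diff_distrib integrable_01)

lemma I01_minus: "I01 (\<lambda>t. - f t) = - I01 f"
  unfolding I01_def by simp

lemma I01_reflect: "I01 (\<lambda>t. f (1 - t)) = I01 f"
proof -
  have "(LINT t|lborel. indicator {0<..<1} t * f t) = \<bar>-1\<bar> *\<^sub>R (LINT t|lborel. indicator {0<..<1} (1 + -1 * t) * f (1 + -1 * t))"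
    by (rule lborel_integral_real_affine) simp
  also have "\<dots> = (LINT t|lborel. indicator {0<..<1} t * f (1 - t))"
    by (auto simp: indicator_def intro!: Bochner_Integration.integral_cong)
  finally show ?thesis by (simp add: I01_def)
qed

lemma I01_parts:
  assumes "\<And>x. (f has_real_derivative f' x) (at x)" "continuous_on UNIV f'"
    and "\<And>x. (g has_real_derivative g' x) (at x)" "continuous_on UNIV g'"
  shows "I01 (\<lambda>t. f t * g' t) = f 1 * g 1 - f 0 * g 0 - I01 (\<lambda>t. f' t * g t)"
proof -
  have c: "continuous_on UNIV f" "continuous_on UNIV g"
    using assms by (auto intro!: DERIV_isCont continuous_at_imp_continuous_on)
  have "((\<lambda>t. f t * g t) has_real_derivative f x * g' x + f' x * g x) (at x)" for x
    using DERIV_mult[OF assms(1)[of x] assms(3)[of x]] by (simp add: algebra_simps)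
  moreover have "continuous_on UNIV (\<lambda>t. f t * g' t + f' t * g t)"
    using assms c by (intro continuous_intros)
  ultimately have "I01 (\<lambda>t. f t * g' t + f' t * g t) = f 1 * g 1 - f 0 * g 0"
    by (rule I01_FTC)
  then show ?thesis using assms c by (subst (asm) I01_add) (auto intro!: continuous_intros)
qed

lemma joint_antiderivative:
  fixes f :: "real \<times> real \<Rightarrow> real"
  assumes f: "continuous_on UNIV f"
  obtains \<Phi> where "continuous_on UNIV \<Phi>" "\<And>x y. ((\<lambda>y. \<Phi> (x, y)) has_real_derivative f (x, y)) (at y)"
proof -
  define \<Phi> where "\<Phi> z = integral (cbox 0 1) (\<lambda>s. snd z * f (fst z, snd z * s))" for z
  have c: "continuous_on UNIV \<Phi>"
    unfolding \<Phi>_def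
    by (rule integral_continuous_on_param)
      (auto simp: case_prod_unfold intro!: continuous_intros continuous_on_compose2[OF f])
  have "((\<lambda>y. \<Phi> (x, y)) has_real_derivative f (x, y)) (at y)" for x y
  proof -
    have "continuous_on UNIV (\<lambda>t. f (x, t))" by (intro continuous_on_compose2[OF f] continuous_intros) auto
    then obtain F where F: "\<And>t. (F has_real_derivative f (x, t)) (at t)"
      using continuous_antiderivative by blast
    have "\<Phi> (x, y) = F y - F 0" for y
    proof -
      have "((\<lambda>s. F (y * s)) has_real_derivative y * f (x, y * s)) (at s)" for s
      proof -
        have "((\<lambda>s. y * s) has_real_derivative y) (at s)" by (auto intro!: derivative_eq_intros)
        from DERIV_chain2[OF F this] show ?thesis by (simp add: mult.commute)
      qed
      then have "((\<lambda>s. y * f (x, y * s)) has_integral F (y * 1) - F (y * 0)) {0..1}"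
        by (intro fundamental_theorem_of_calculus)
          (auto simp: has_real_derivative_iff_has_vector_derivative[symmetric] intro: has_field_derivative_at_within)
      then have "integral {0..1} (\<lambda>s. y * f (x, y * s)) = F (y * 1) - F (y * 0)" by (rule integral_unique)
      then show ?thesis by (simp add: \<Phi>_def)
    qed
    then show ?thesis using F[of y] by (auto intro!: derivative_eq_intros)
  qed
  with c show ?thesis by (rule that)
qed

lemma difference_quotient:
  fixes F f :: "real \<times> real \<Rightarrow> real"
  assumes d: "\<And>x y. ((\<lambda>y. F (x, y)) has_real_derivative f (x, y)) (at y)" and f: "continuous_on UNIV f"
  obtains M where "\<And>n x y. x \<in> {0..1} \<Longrightarrow> y \<in> {0..1} \<Longrightarrow>
      \<bar>(F (x, y + inverse (real (Suc n))) - F (x, y)) / inverse (real (Suc n))\<bar> \<le> M"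
    "\<And>x y. (\<lambda>n. (F (x, y + inverse (real (Suc n))) - F (x, y)) / inverse (real (Suc n))) \<longlonglongrightarrow> f (x, y)"
proof -
  have "compact (f ` ({0..1} \<times> {0..2}))"
    by (intro compact_continuous_image continuous_on_subset[OF f] compact_Times) auto
  then obtain M where M: "\<And>z. z \<in> {0..1} \<times> {0..2} \<Longrightarrow> \<bar>f z\<bar> \<le> M"
    by (metis compact_imp_bounded bounded_real imageI)
  show ?thesis
  proof
    fix n and x y :: real assume xy: "x \<in> {0..1}" "y \<in> {0..1}"
    define e where "e = inverse (real (Suc n))"
    have e: "0 < e" "e \<le> 1" by (auto simp: e_def field_simps)
    obtain \<xi> where "y < \<xi>" "\<xi> < y + e" "F (x, y + e) - F (x, y) = (y + e - y) * f (x, \<xi>)"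
      using MVT2[of y "y + e" "\<lambda>y. F (x, y)" "\<lambda>y. f (x, y)"] d e by auto
    then show "\<bar>(F (x, y + inverse (real (Suc n))) - F (x, y)) / inverse (real (Suc n))\<bar> \<le> M"
      using M[of "(x, \<xi>)"] xy e unfolding e_def[symmetric] by simp
  next
    fix x y
    have "((\<lambda>h. (F (x, y + h) - F (x, y)) / h) \<longlongrightarrow> f (x, y)) (at 0)" using d[of x y] by (simp add: DERIV_def)
    moreover have "filterlim (\<lambda>n. inverse (real (Suc n))) (at 0) sequentially"
      using LIMSEQ_inverse_real_of_nat by (auto simp: filterlim_at)
    ultimately show "(\<lambda>n. (F (x, y + inverse (real (Suc n))) - F (x, y)) / inverse (real (Suc n))) \<longlonglongrightarrow> f (x, y)"
      by (rule filterlim_compose)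
  qed
qed

text \<open>For \<open>\<psi>\<close> of class \<open>C\<^sup>2\<close> the two traces would suffice, the terms with the mixed derivative of \<open>\<psi>\<close>
  cancelling; for \<open>C\<^sup>1\<close> functions the two partial derivatives are replaced by Steklov averages
  in the second variable, which have a common mixed derivative.\<close>

lemma green_row_raw:
  assumes t2: "trace_y w h2 \<alpha>0 \<alpha>1" and t1: "trace_y (\<lambda>z. w (prod.swap z)) (\<lambda>z. h1 (prod.swap z)) \<beta>0 \<beta>1"
    and i: "integrable lborel w" "integrable lborel h1" "integrable lborel h2"
    and z: "\<And>z. z \<notin> Q \<Longrightarrow> w z = 0" "\<And>z. z \<notin> Q \<Longrightarrow> h1 z = 0" "\<And>z. z \<notin> Q \<Longrightarrow> h2 z = 0"
    and c: "continuous_on UNIV \<alpha>0" "continuous_on UNIV \<alpha>1" "continuous_on UNIV \<beta>0" "continuous_on UNIV \<beta>1"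
    and x: "\<And>x y. ((\<lambda>x. \<psi> (x, y)) has_real_derivative \<psi>x (x, y)) (at x)"
    and y: "\<And>x y. ((\<lambda>y. \<psi> (x, y)) has_real_derivative \<psi>y (x, y)) (at y)"
    and cx: "continuous_on UNIV \<psi>x" and cy: "continuous_on UNIV \<psi>y" and c\<psi>: "continuous_on UNIV \<psi>"
  shows "(LINT z|lborel. h2 z * \<psi>x z) - (LINT z|lborel. h1 z * \<psi>y z) =
    I01 (\<lambda>x. \<alpha>1 x * \<psi>x (x, 1) - \<alpha>0 x * \<psi>x (x, 0)) - I01 (\<lambda>y. \<beta>1 y * \<psi>y (1, y) - \<beta>0 y * \<psi>y (0, y))"
proof -
  obtain \<Phi> where \<Phi>: "continuous_on UNIV \<Phi>" "\<And>x y. ((\<lambda>y. \<Phi> (x, y)) has_real_derivative \<psi>x (x, y)) (at y)"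
    using joint_antiderivative[OF cx] by blast
  define e where "e n = inverse (real (Suc n))" for n
  have e: "e n > 0" for n by (simp add: e_def)
  define D where "D F n z = (F (fst z, snd z + e n) - F z) / e n" for F :: "real \<times> real \<Rightarrow> real" and n z
  obtain M1 where M1: "\<And>n x y. x \<in> {0..1} \<Longrightarrow> y \<in> {0..1} \<Longrightarrow> \<bar>D \<Phi> n (x, y)\<bar> \<le> M1"
    and L1: "\<And>x y. (\<lambda>n. D \<Phi> n (x, y)) \<longlonglongrightarrow> \<psi>x (x, y)"
    using difference_quotient[OF \<Phi>(2) cx] unfolding D_def e_def fst_conv snd_conv by blast
  obtain M2 where M2: "\<And>n x y. x \<in> {0..1} \<Longrightarrow> y \<in> {0..1} \<Longrightarrow> \<bar>D \<psi> n (x, y)\<bar> \<le> M2"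
    and L2: "\<And>x y. (\<lambda>n. D \<psi> n (x, y)) \<longlonglongrightarrow> \<psi>y (x, y)"
    using difference_quotient[OF y cy] unfolding D_def e_def fst_conv snd_conv by blast
  have cD: "continuous_on UNIV (D F n)" if "continuous_on UNIV F" for F n
    unfolding D_def using e[of n]
    by (intro continuous_intros continuous_on_compose2[OF that]) (auto intro!: continuous_intros that)
  have d1: "((\<lambda>y. D \<Phi> n (x, y)) has_real_derivative D \<psi>x n (x, y)) (at y)" for n x y
  proof -
    have "((\<lambda>y. \<Phi> (x, y + e n)) has_real_derivative \<psi>x (x, y + e n)) (at y)"
      using \<Phi>(2)[of x "y + e n"] by (simp add: DERIV_shift)
    from DERIV_cdivide[OF DERIV_diff[OF this \<Phi>(2)[of x y]], of "e n"] show ?thesis by (simp add: D_def)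
  qed
  have d2: "((\<lambda>x. D \<psi> n (x, y)) has_real_derivative D \<psi>x n (x, y)) (at x)" for n x y
    using DERIV_cdivide[OF DERIV_diff[OF x[of "y + e n" x] x[of y x]], of "e n"] by (simp add: D_def)
  have [measurable]: "h1 \<in> borel_measurable borel" "h2 \<in> borel_measurable borel" "w \<in> borel_measurable borel"
    using i by auto
  have m [measurable]: "D \<Phi> n \<in> borel_measurable borel" "D \<psi> n \<in> borel_measurable borel" "D \<psi>x n \<in> borel_measurable borel" for n
    using cD \<Phi>(1) c\<psi> cx by (auto intro: borel_measurable_continuous_onI)
  have [measurable]: "\<psi>x \<in> borel_measurable borel" "\<psi>y \<in> borel_measurable borel"
    using cx cy by (auto intro: borel_measurable_continuous_onI)
  have [measurable]: "\<alpha>0 \<in> borel_measurable borel" "\<alpha>1 \<in> borel_measurable borel" "\<beta>0 \<in> borel_measurable borel" "\<beta>1 \<in> borel_measurable borel"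
    using c by (auto intro: borel_measurable_continuous_onI)
  have E1: "(LINT z|lborel. h2 z * D \<Phi> n z) = I01 (\<lambda>x. \<alpha>1 x * D \<Phi> n (x, 1) - \<alpha>0 x * D \<Phi> n (x, 0)) - (LINT z|lborel. w z * D \<psi>x n z)" for n
    using t2 cD[OF \<Phi>(1), of n] cD[OF cx, of n] d1 unfolding trace_y_def I01_def by blast
  have sc: "continuous_on UNIV (\<lambda>z. F (prod.swap z))" if "continuous_on UNIV F" for F :: "real \<times> real \<Rightarrow> real"
    by (intro continuous_on_compose2[OF that] continuous_on_swap) auto
  have E2: "(LINT z|lborel. h1 z * D \<psi> n z) = I01 (\<lambda>y. \<beta>1 y * D \<psi> n (1, y) - \<beta>0 y * D \<psi> n (0, y)) - (LINT z|lborel. w z * D \<psi>x n z)" for n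
  proof -
    have "(LINT z|lborel. h1 (prod.swap z) * D \<psi> n (prod.swap z)) = I01 (\<lambda>y. \<beta>1 y * D \<psi> n (1, y) - \<beta>0 y * D \<psi> n (0, y)) - (LINT z|lborel. w (prod.swap z) * D \<psi>x n (prod.swap z))"
      using t1[unfolded trace_y_def, rule_format, OF sc[OF cD[OF c\<psi>, of n]] sc[OF cD[OF cx, of n]]] d2 by (simp add: I01_def)
    then show ?thesis
      using plane_swap(1)[of "\<lambda>z. h1 z * D \<psi> n z"] plane_swap(1)[of "\<lambda>z. w z * D \<psi>x n z"] by simp
  qed
  have Lim2: "(\<lambda>n. LINT z|lborel. h z * G n z) \<longlonglongrightarrow> (LINT z|lborel. h z * g z)"
    if h: "integrable lborel h" "\<And>z. z \<notin> Q \<Longrightarrow> h z = 0" and G: "\<And>n x y. x \<in> {0..1} \<Longrightarrow> y \<in> {0..1} \<Longrightarrow> \<bar>G n (x, y)\<bar> \<le> M"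
      and L: "\<And>x y. (\<lambda>n. G n (x, y)) \<longlonglongrightarrow> g (x, y)" and [measurable]: "\<And>n. G n \<in> borel_measurable borel" "g \<in> borel_measurable borel"
    for h g :: "real \<times> real \<Rightarrow> real" and G and M :: real
  proof (rule integral_dominated_convergence[where w="\<lambda>z. \<bar>h z\<bar> * M"])
    show "AE z in lborel. (\<lambda>n. h z * G n z) \<longlonglongrightarrow> h z * g z"
    proof (rule AE_I2)
      fix z :: "real \<times> real"
      show "(\<lambda>n. h z * G n z) \<longlonglongrightarrow> h z * g z"
        using L[of "fst z" "snd z"] by (intro tendsto_intros) simp
    qed
    show "AE z in lborel. norm (h z * G n z) \<le> \<bar>h z\<bar> * M" for n
    proof (rule AE_I2)
      fix z :: "real \<times> real"
      show "norm (h z * G n z) \<le> \<bar>h z\<bar> * M"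
        using G[of "fst z" "snd z" n] h(2)[of z] by (cases "z \<in> Q") (auto simp: abs_mult Q_iff intro!: mult_left_mono)
    qed
  qed (use h in auto)
  have Lim1: "(\<lambda>n. I01 (\<lambda>t. a t * G n t - b t * H n t)) \<longlonglongrightarrow> I01 (\<lambda>t. a t * g t - b t * k t)"
    if ab: "continuous_on UNIV a" "continuous_on UNIV b" and G: "\<And>n t. t \<in> {0..1} \<Longrightarrow> \<bar>G n t\<bar> \<le> M" and H: "\<And>n t. t \<in> {0..1} \<Longrightarrow> \<bar>H n t\<bar> \<le> M"
      and L: "\<And>t. (\<lambda>n. G n t) \<longlonglongrightarrow> g t" "\<And>t. (\<lambda>n. H n t) \<longlonglongrightarrow> k t"
      and [measurable]: "\<And>n. G n \<in> borel_measurable borel" "\<And>n. H n \<in> borel_measurable borel" "g \<in> borel_measurable borel" "k \<in> borel_measurable borel"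
    for a b g k :: "real \<Rightarrow> real" and G H and M :: real
    unfolding I01_def
  proof (rule integral_dominated_convergence[where w="\<lambda>t. indicator {0<..<1} t * ((\<bar>a t\<bar> + \<bar>b t\<bar>) * M)"])
    have [measurable]: "a \<in> borel_measurable borel" "b \<in> borel_measurable borel" using ab by (auto intro: borel_measurable_continuous_onI)
    show "AE t in lborel. (\<lambda>n. indicator {0<..<1} t * (a t * G n t - b t * H n t)) \<longlonglongrightarrow> indicator {0<..<1} t * (a t * g t - b t * k t)"
      by (intro AE_I2 tendsto_intros L)
    show "AE t in lborel. norm (indicator {0<..<1} t * (a t * G n t - b t * H n t)) \<le> indicator {0<..<1} t * ((\<bar>a t\<bar> + \<bar>b t\<bar>) * M)" for n
    proof (rule AE_I2)
      fix t :: real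
      show "norm (indicator {0<..<1} t * (a t * G n t - b t * H n t)) \<le> indicator {0<..<1} t * ((\<bar>a t\<bar> + \<bar>b t\<bar>) * M)"
      proof (cases "t \<in> {0<..<1}")
        case True
        have "\<bar>a t * G n t - b t * H n t\<bar> \<le> \<bar>a t\<bar> * \<bar>G n t\<bar> + \<bar>b t\<bar> * \<bar>H n t\<bar>"
          by (metis abs_mult abs_triangle_ineq4)
        also have "\<dots> \<le> \<bar>a t\<bar> * M + \<bar>b t\<bar> * M" using True G[of t n] H[of t n] by (intro add_mono mult_left_mono) auto
        finally show ?thesis using True by (simp add: distrib_right)
      qed simp
    qed
    show "integrable lborel (\<lambda>t. indicator {0<..<1} t * ((\<bar>a t\<bar> + \<bar>b t\<bar>) * M))"
      by (intro integrable_01 continuous_intros ab)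
    show "(\<lambda>t. indicator {0<..<1} t * (a t * g t - b t * k t)) \<in> borel_measurable lborel" by measurable
    show "(\<lambda>t. indicator {0<..<1} t * (a t * G n t - b t * H n t)) \<in> borel_measurable lborel" for n by measurable
  qed
  have "(\<lambda>n. (LINT z|lborel. h2 z * D \<Phi> n z) - (LINT z|lborel. h1 z * D \<psi> n z))
     \<longlonglongrightarrow> (LINT z|lborel. h2 z * \<psi>x z) - (LINT z|lborel. h1 z * \<psi>y z)"
    by (intro tendsto_diff Lim2[where G="\<lambda>n. D \<Phi> n" and g=\<psi>x and M=M1, OF i(3) z(3) M1 L1] Lim2[where G="\<lambda>n. D \<psi> n" and g=\<psi>y and M=M2, OF i(2) z(2) M2 L2]) measurable
  moreover have "(\<lambda>n. (LINT z|lborel. h2 z * D \<Phi> n z) - (LINT z|lborel. h1 z * D \<psi> n z))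
     \<longlonglongrightarrow> I01 (\<lambda>x. \<alpha>1 x * \<psi>x (x, 1) - \<alpha>0 x * \<psi>x (x, 0)) - I01 (\<lambda>y. \<beta>1 y * \<psi>y (1, y) - \<beta>0 y * \<psi>y (0, y))"
  proof -
    have "(\<lambda>n. I01 (\<lambda>x. \<alpha>1 x * D \<Phi> n (x, 1) - \<alpha>0 x * D \<Phi> n (x, 0)) - I01 (\<lambda>y. \<beta>1 y * D \<psi> n (1, y) - \<beta>0 y * D \<psi> n (0, y)))
     \<longlonglongrightarrow> I01 (\<lambda>x. \<alpha>1 x * \<psi>x (x, 1) - \<alpha>0 x * \<psi>x (x, 0)) - I01 (\<lambda>y. \<beta>1 y * \<psi>y (1, y) - \<beta>0 y * \<psi>y (0, y))"
    proof (intro tendsto_diff)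
      show "(\<lambda>n. I01 (\<lambda>x. \<alpha>1 x * D \<Phi> n (x, 1) - \<alpha>0 x * D \<Phi> n (x, 0))) \<longlonglongrightarrow> I01 (\<lambda>x. \<alpha>1 x * \<psi>x (x, 1) - \<alpha>0 x * \<psi>x (x, 0))"
        by (rule Lim1[OF c(2,1), where M=M1]) (use M1 L1 in \<open>auto\<close>)
      show "(\<lambda>n. I01 (\<lambda>y. \<beta>1 y * D \<psi> n (1, y) - \<beta>0 y * D \<psi> n (0, y))) \<longlonglongrightarrow> I01 (\<lambda>y. \<beta>1 y * \<psi>y (1, y) - \<beta>0 y * \<psi>y (0, y))"
        by (rule Lim1[OF c(4,3), where M=M2]) (use M2 L2 in \<open>auto\<close>)
    qed
    then show ?thesis by (simp add: E1 E2)
  qed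
  ultimately show ?thesis by (rule LIMSEQ_unique)
qed

lemma I01_affine_power:
  assumes "(a, b) = (0, 1) \<or> (a, b) = (1, -1 :: real)"
  shows "I01 (\<lambda>t. (a + b * t)^m) = 1 / (real m + 1)"
proof -
  have b: "b \<noteq> 0" using assms by auto
  have "((\<lambda>t. (a + b * t)^(Suc m) / (b * (real m + 1))) has_real_derivative (a + b * x)^m) (at x)" for x
  proof -
    have "((\<lambda>t. a + b * t) has_real_derivative b) (at x)" by (auto intro!: derivative_eq_intros)
    from DERIV_cdivide[OF DERIV_power[OF this, of "Suc m"], of "b * (real m + 1)"] show ?thesis
      using b by (simp add: add.commute)
  qed
  then have "I01 (\<lambda>t. (a + b * t)^m) = (a + b * 1)^(Suc m) / (b * (real m + 1)) - (a + b * 0)^(Suc m) / (b * (real m + 1))"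
    by (rule I01_FTC) (intro continuous_intros)
  then show ?thesis using assms by (auto simp: field_simps)
qed

lemma integral_Q_tensor:
  assumes "continuous_on UNIV u" "continuous_on UNIV v"
  shows "(LINT z|lborel. indicator Q z * (u (fst z) * v (snd z))) = I01 u * I01 v"
    and "integrable lborel (\<lambda>z. indicator Q z * (u (fst z) * v (snd z)))"
proof -
  have eq: "indicator Q z * (u (fst z) * v (snd z)) = (indicator {0<..<1} (fst z) * u (fst z)) * (indicator {0<..<1} (snd z) * v (snd z))" for z
    by (auto simp: indicator_def Q_iff)
  show "(LINT z|lborel. indicator Q z * (u (fst z) * v (snd z))) = I01 u * I01 v"
    "integrable lborel (\<lambda>z. indicator Q z * (u (fst z) * v (snd z)))"
    unfolding eq I01_def using integral_tensor[OF integrable_01[OF assms(1)] integrable_01[OF assms(2)]]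
      integrable_tensor[OF integrable_01[OF assms(1)] integrable_01[OF assms(2)]] by blast+
qed

text \<open>The gradients of the corner functions \<open>x\<^sup>n y\<^sup>n\<close> are bounded in \<open>L\<^sup>2\<close> and tend to \<open>0\<close> in \<open>L\<^sup>1\<close>,
  hence weakly in \<open>L\<^sup>2\<close>.\<close>

lemma corner_gradient_null:
  assumes h: "integrable lborel h" "integrable lborel (\<lambda>z. (h z)\<^sup>2)" and h0: "\<And>z. z \<notin> Q \<Longrightarrow> h z = 0"
    and ab: "(a, b) = (0, 1) \<or> (a, b) = (1, -1 :: real)" and cd: "(c, d) = (0, 1) \<or> (c, d) = (1, -1 :: real)"
  shows "(\<lambda>n. LINT z|lborel. h z * (real n * (a + b * fst z)^(n - 1) * (c + d * snd z)^n)) \<longlonglongrightarrow> 0"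
proof (rule LIMSEQ_I)
  fix \<epsilon> :: real assume \<epsilon>: "0 < \<epsilon>"
  have [measurable]: "h \<in> borel_measurable borel" using h by auto
  have "(\<lambda>N. LINT z|lborel. (if \<bar>h z\<bar> > real N then (h z)\<^sup>2 else 0)) \<longlonglongrightarrow> (LINT z|(lborel :: (real \<times> real) measure). (0::real))"
  proof (rule integral_dominated_convergence[where w="\<lambda>z. (h z)\<^sup>2"])
    show "AE z in lborel. (\<lambda>N. if \<bar>h z\<bar> > real N then (h z)\<^sup>2 else 0) \<longlonglongrightarrow> 0"
    proof (rule AE_I2)
      fix z
      obtain N0 :: nat where "\<bar>h z\<bar> \<le> real N0" using real_arch_simple by blast
      then have "\<forall>\<^sub>F N in sequentially. (if \<bar>h z\<bar> > real N then (h z)\<^sup>2 else 0) = 0"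
        by (intro eventually_sequentiallyI[of N0]) auto
      then show "(\<lambda>N. if \<bar>h z\<bar> > real N then (h z)\<^sup>2 else 0) \<longlonglongrightarrow> 0" by (rule tendsto_eventually)
    qed
  qed (use h in auto)
  then obtain N where N: "(LINT z|lborel. (if \<bar>h z\<bar> > real N then (h z)\<^sup>2 else 0)) < \<epsilon>\<^sup>2 / 4"
    using order_tendstoD(2)[of _ 0 sequentially "\<epsilon>\<^sup>2 / 4"] \<epsilon>
    by (auto simp: eventually_sequentially)
  obtain n0 :: nat where n0: "real N * 4 / \<epsilon> < real n0" using reals_Archimedean2 by blast
  have "norm ((LINT z|lborel. h z * (real n * (a + b * fst z)^(n - 1) * (c + d * snd z)^n)) - 0) < \<epsilon>" if n: "n \<ge> max 1 n0" for n
  proof -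
    define X where "X t = a + b * t" for t
    define Y where "Y t = c + d * t" for t
    have XY: "0 < X t" "0 < Y t" if "0 < t" "t < 1" for t using that ab cd by (auto simp: X_def Y_def)
    have cX: "continuous_on UNIV (\<lambda>t. X t ^ m)" "continuous_on UNIV (\<lambda>t. Y t ^ m)" for m
      unfolding X_def Y_def by (intro continuous_intros)+
    have iX: "I01 (\<lambda>t. X t ^ m) = 1 / (real m + 1)" "I01 (\<lambda>t. Y t ^ m) = 1 / (real m + 1)" for m
      unfolding X_def Y_def by (rule I01_affine_power[OF ab] I01_affine_power[OF cd])+
    define k where "k z = real n * (X (fst z)^(n - 1) * Y (snd z)^n)" for z
    have ck: "continuous_on UNIV k" unfolding k_def X_def Y_def by (intro continuous_intros)
    have k0: "0 \<le> k z" if "z \<in> Q" for z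
      using that XY[of "fst z"] XY[of "snd z"] by (auto simp: k_def Q_iff intro!: mult_nonneg_nonneg zero_le_power)
    have k1: "integrable lborel (\<lambda>z. indicator Q z * k z)" "(LINT z|lborel. indicator Q z * k z) = 1 / (real n + 1)"
    proof -
      have eq: "indicator Q z * k z = real n * (indicator Q z * (X (fst z)^(n - 1) * Y (snd z)^n))" for z
        by (simp add: k_def)
      show "integrable lborel (\<lambda>z. indicator Q z * k z)" "(LINT z|lborel. indicator Q z * k z) = 1 / (real n + 1)"
        unfolding eq using integral_Q_tensor[OF cX(1)[of "n - 1"] cX(2)[of n]] iX n by (simp_all add: of_nat_diff)
    qed
    have k2: "integrable lborel (\<lambda>z. indicator Q z * (k z)\<^sup>2)" "(LINT z|lborel. indicator Q z * (k z)\<^sup>2) \<le> 1"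
    proof -
      have eq: "indicator Q z * (k z)\<^sup>2 = (real n)\<^sup>2 * (indicator Q z * (X (fst z)^(2 * (n - 1)) * Y (snd z)^(2 * n)))" for z
        by (simp add: k_def power_mult_distrib power_mult[symmetric] mult.commute[of 2])
      show "integrable lborel (\<lambda>z. indicator Q z * (k z)\<^sup>2)"
        unfolding eq using integral_Q_tensor(2)[OF cX(1)[of "2 * (n - 1)"] cX(2)[of "2 * n"]] by simp
      have "(LINT z|lborel. indicator Q z * (k z)\<^sup>2) = (real n)\<^sup>2 * (1 / (2 * real n - 1) * (1 / (2 * real n + 1)))"
        unfolding eq using integral_Q_tensor(1)[OF cX(1)[of "2 * (n - 1)"] cX(2)[of "2 * n"]] iX n by (simp add: of_nat_diff)
      also have "\<dots> \<le> 1"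
      proof -
        have "1 \<le> (real n)\<^sup>2" "0 < (2 * real n - 1) * (2 * real n + 1)" using n by (auto intro!: mult_pos_pos)
        moreover have "(2 * real n - 1) * (2 * real n + 1) = 4 * (real n)\<^sup>2 - 1" by (simp add: algebra_simps power2_eq_square)
        ultimately show ?thesis by (simp add: field_simps)
      qed
      finally show "(LINT z|lborel. indicator Q z * (k z)\<^sup>2) \<le> 1" .
    qed
    have ih: "integrable lborel (\<lambda>z. if \<bar>h z\<bar> > real N then (h z)\<^sup>2 else 0)"
      by (rule Bochner_Integration.integrable_bound[OF h(2)]) auto
    have "norm (LINT z|lborel. h z * k z) \<le> (LINT z|lborel. norm (h z * k z))" by (rule integral_norm_bound)
    also have "\<dots> \<le> (LINT z|lborel. real N * (indicator Q z * k z) + (1 / \<epsilon> * (if \<bar>h z\<bar> > real N then (h z)\<^sup>2 else 0) + \<epsilon> / 4 * (indicator Q z * (k z)\<^sup>2)))"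
    proof (rule integral_mono)
      show "integrable lborel (\<lambda>z. norm (h z * k z))" using integrable_Q_mult[OF h(1) h0 ck] by auto
      show "integrable lborel (\<lambda>z. real N * (indicator Q z * k z) + (1 / \<epsilon> * (if \<bar>h z\<bar> > real N then (h z)\<^sup>2 else 0) + \<epsilon> / 4 * (indicator Q z * (k z)\<^sup>2)))"
        using k1(1) k2(1) ih by (intro Bochner_Integration.integrable_add integrable_mult_right) auto
      fix z :: "real \<times> real"
      show "norm (h z * k z) \<le> real N * (indicator Q z * k z) + (1 / \<epsilon> * (if \<bar>h z\<bar> > real N then (h z)\<^sup>2 else 0) + \<epsilon> / 4 * (indicator Q z * (k z)\<^sup>2))"
      proof (cases "z \<in> Q")
        case True
        have A: "\<bar>h z\<bar> * k z \<le> 1 / \<epsilon> * (h z)\<^sup>2 + \<epsilon> / 4 * (k z)\<^sup>2"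
        proof -
          have "0 \<le> (\<bar>h z\<bar> - \<epsilon> / 2 * k z)\<^sup>2 / \<epsilon>" using \<epsilon> by simp
          also have "\<dots> = 1 / \<epsilon> * (h z)\<^sup>2 + \<epsilon> / 4 * (k z)\<^sup>2 - \<bar>h z\<bar> * k z"
            using \<epsilon> by (simp add: power2_eq_square field_simps)
          finally show ?thesis by simp
        qed
        have B: "\<bar>h z\<bar> * k z \<le> real N * k z" if "\<bar>h z\<bar> \<le> real N"
          using that k0[OF True] by (rule mult_right_mono)
        have C: "0 \<le> real N * k z" "0 \<le> \<epsilon> / 4 * (k z)\<^sup>2" using k0[OF True] \<epsilon> by auto
        have eq: "norm (h z * k z) = \<bar>h z\<bar> * k z" using k0[OF True] by (simp add: abs_mult)
        show ?thesis
        proof (cases "\<bar>h z\<bar> > real N")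
          case True
          then show ?thesis unfolding eq using add_increasing[OF C(1) A] \<open>z \<in> Q\<close> by simp
        next
          case False
          then show ?thesis unfolding eq using B C \<open>z \<in> Q\<close> by simp
        qed
      qed (use h0 \<epsilon> in \<open>auto simp: power2_eq_square\<close>)
    qed
    also have "\<dots> = real N / (real n + 1) + (1 / \<epsilon> * (LINT z|lborel. (if \<bar>h z\<bar> > real N then (h z)\<^sup>2 else 0)) + \<epsilon> / 4 * (LINT z|lborel. indicator Q z * (k z)\<^sup>2))"
      using k1 k2(1) ih by (simp add: Bochner_Integration.integral_add del: Bochner_Integration.integral_mult_right)
    also have "\<dots> < \<epsilon> / 4 + (\<epsilon> / 4 + \<epsilon> / 4)"
    proof (rule add_strict_mono[OF _ add_less_le_mono])
      show "real N / (real n + 1) < \<epsilon> / 4" using n0 n \<epsilon> by (simp add: field_simps) (smt (verit) mult_left_mono of_nat_mono)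
      show "1 / \<epsilon> * (LINT z|lborel. (if \<bar>h z\<bar> > real N then (h z)\<^sup>2 else 0)) < \<epsilon> / 4"
        using N \<epsilon> by (simp add: field_simps power2_eq_square)
      show "\<epsilon> / 4 * (LINT z|lborel. indicator Q z * (k z)\<^sup>2) \<le> \<epsilon> / 4" using k2(2) \<epsilon> by simp
    qed
    finally show ?thesis using \<epsilon> by (simp add: k_def X_def Y_def mult.assoc)
  qed
  then show "\<exists>no. \<forall>n\<ge>no. norm ((LINT z|lborel. h z * (real n * (a + b * fst z)^(n - 1) * (c + d * snd z)^n)) - 0) < \<epsilon>"
    by blast
qed


lemma I01_null:
  assumes c: "continuous_on UNIV c" and G: "\<And>n t. t \<in> {0<..<1} \<Longrightarrow> \<bar>G n t\<bar> \<le> 1"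
    and L: "\<And>t. t \<in> {0<..<1} \<Longrightarrow> (\<lambda>n. G n t) \<longlonglongrightarrow> 0" and m: "\<And>n. continuous_on UNIV (G n)"
  shows "(\<lambda>n. I01 (\<lambda>t. c t * G n t)) \<longlonglongrightarrow> 0"
proof -
  have [measurable]: "c \<in> borel_measurable borel" "G n \<in> borel_measurable borel" for n
    using c m by (auto intro: borel_measurable_continuous_onI)
  have "(\<lambda>n. LINT t|lborel. indicator {0<..<1} t * (c t * G n t)) \<longlonglongrightarrow> (LINT t|(lborel :: real measure). (0::real))"
  proof (rule integral_dominated_convergence[where w="\<lambda>t. indicator {0<..<1} t * \<bar>c t\<bar>"])
    show "AE t in lborel. (\<lambda>n. indicator {0<..<1} t * (c t * G n t)) \<longlonglongrightarrow> 0"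
    proof (rule AE_I2)
      fix t :: real
      show "(\<lambda>n. indicator {0<..<1} t * (c t * G n t)) \<longlonglongrightarrow> 0"
        using tendsto_mult_right_zero[OF L[of t], of "c t"] by (cases "t \<in> {0<..<1}") auto
    qed
    show "AE t in lborel. norm (indicator {0<..<1} t * (c t * G n t)) \<le> indicator {0<..<1} t * \<bar>c t\<bar>" for n
    proof (rule AE_I2)
      fix t :: real
      show "norm (indicator {0<..<1} t * (c t * G n t)) \<le> indicator {0<..<1} t * \<bar>c t\<bar>"
        using G[of t n] by (cases "t \<in> {0<..<1}") (auto simp: abs_mult intro!: mult_left_le)
    qed
    show "integrable lborel (\<lambda>t. indicator {0<..<1} t * \<bar>c t\<bar>)"
      by (intro integrable_01 continuous_intros c)
  qed measurable
  then show ?thesis by (simp add: I01_def)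
qed

theorem green_row:
  assumes t2: "trace_y w h2 \<alpha>0 \<alpha>1" and t1: "trace_y (\<lambda>z. w (prod.swap z)) (\<lambda>z. h1 (prod.swap z)) \<beta>0 \<beta>1"
    and i: "integrable lborel w" "integrable lborel h1" "integrable lborel h2"
    and sq: "integrable lborel (\<lambda>z. (h1 z)\<^sup>2)" "integrable lborel (\<lambda>z. (h2 z)\<^sup>2)"
    and z: "\<And>z. z \<notin> Q \<Longrightarrow> w z = 0" "\<And>z. z \<notin> Q \<Longrightarrow> h1 z = 0" "\<And>z. z \<notin> Q \<Longrightarrow> h2 z = 0"
    and d: "\<And>t. (\<alpha>0 has_real_derivative \<alpha>0' t) (at t)" "\<And>t. (\<alpha>1 has_real_derivative \<alpha>1' t) (at t)"
      "\<And>t. (\<beta>0 has_real_derivative \<beta>0' t) (at t)" "\<And>t. (\<beta>1 has_real_derivative \<beta>1' t) (at t)"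
    and c': "continuous_on UNIV \<alpha>0'" "continuous_on UNIV \<alpha>1'" "continuous_on UNIV \<beta>0'" "continuous_on UNIV \<beta>1'"
    and x: "\<And>x y. ((\<lambda>x. \<psi> (x, y)) has_real_derivative \<psi>x (x, y)) (at x)"
    and y: "\<And>x y. ((\<lambda>y. \<psi> (x, y)) has_real_derivative \<psi>y (x, y)) (at y)"
    and cx: "continuous_on UNIV \<psi>x" and cy: "continuous_on UNIV \<psi>y" and c\<psi>: "continuous_on UNIV \<psi>"
  shows "(LINT z|lborel. h2 z * \<psi>x z) - (LINT z|lborel. h1 z * \<psi>y z) =
    I01 (\<lambda>x. \<alpha>0' x * \<psi> (x, 0)) - I01 (\<lambda>x. \<alpha>1' x * \<psi> (x, 1))
    + I01 (\<lambda>y. \<beta>1' y * \<psi> (1, y)) - I01 (\<lambda>y. \<beta>0' y * \<psi> (0, y))"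
proof -
  have c: "continuous_on UNIV \<alpha>0" "continuous_on UNIV \<alpha>1" "continuous_on UNIV \<beta>0" "continuous_on UNIV \<beta>1"
    using d by (auto intro!: DERIV_isCont continuous_at_imp_continuous_on)
  define R where "R \<psi> = I01 (\<lambda>x. \<alpha>0' x * \<psi> (x, 0)) - I01 (\<lambda>x. \<alpha>1' x * \<psi> (x, 1))
    + I01 (\<lambda>y. \<beta>1' y * \<psi> (1, y)) - I01 (\<lambda>y. \<beta>0' y * \<psi> (0, y))" for \<psi> :: "real \<times> real \<Rightarrow> real"
  define J11 J01 J10 J00 where "J11 = \<alpha>1 1 - \<beta>1 1" and "J01 = \<beta>0 1 - \<alpha>1 0"
    and "J10 = \<beta>1 0 - \<alpha>0 1" and "J00 = \<alpha>0 0 - \<beta>0 0"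
  have G: "(LINT z|lborel. h2 z * \<psi>x z) - (LINT z|lborel. h1 z * \<psi>y z) =
     R \<psi> + J11 * \<psi> (1, 1) + J01 * \<psi> (0, 1) + J10 * \<psi> (1, 0) + J00 * \<psi> (0, 0)"
    if x: "\<And>x y. ((\<lambda>x. \<psi> (x, y)) has_real_derivative \<psi>x (x, y)) (at x)"
    and y: "\<And>x y. ((\<lambda>y. \<psi> (x, y)) has_real_derivative \<psi>y (x, y)) (at y)"
    and cx: "continuous_on UNIV \<psi>x" and cy: "continuous_on UNIV \<psi>y" and c\<psi>: "continuous_on UNIV \<psi>" for \<psi> \<psi>x \<psi>y
  proof -
    have s: "continuous_on UNIV (\<lambda>t. f (t, a))" "continuous_on UNIV (\<lambda>t. f (a, t))"
      if "continuous_on UNIV f" for f :: "real \<times> real \<Rightarrow> real" and a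
      by (auto intro!: continuous_on_compose2[OF that] continuous_intros)
    have "I01 (\<lambda>x. \<alpha>1 x * \<psi>x (x, 1) - \<alpha>0 x * \<psi>x (x, 0)) = I01 (\<lambda>x. \<alpha>1 x * \<psi>x (x, 1)) - I01 (\<lambda>x. \<alpha>0 x * \<psi>x (x, 0))"
      by (intro I01_diff continuous_on_mult c s cx)
    moreover have "I01 (\<lambda>y. \<beta>1 y * \<psi>y (1, y) - \<beta>0 y * \<psi>y (0, y)) = I01 (\<lambda>y. \<beta>1 y * \<psi>y (1, y)) - I01 (\<lambda>y. \<beta>0 y * \<psi>y (0, y))"
      by (intro I01_diff continuous_on_mult c s cy)
    moreover have "I01 (\<lambda>x. \<alpha>1 x * \<psi>x (x, 1)) = \<alpha>1 1 * \<psi> (1, 1) - \<alpha>1 0 * \<psi> (0, 1) - I01 (\<lambda>x. \<alpha>1' x * \<psi> (x, 1))"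
      by (rule I01_parts[OF d(2) c'(2) x s(1)[OF cx]])
    moreover have "I01 (\<lambda>x. \<alpha>0 x * \<psi>x (x, 0)) = \<alpha>0 1 * \<psi> (1, 0) - \<alpha>0 0 * \<psi> (0, 0) - I01 (\<lambda>x. \<alpha>0' x * \<psi> (x, 0))"
      by (rule I01_parts[OF d(1) c'(1) x s(1)[OF cx]])
    moreover have "I01 (\<lambda>y. \<beta>1 y * \<psi>y (1, y)) = \<beta>1 1 * \<psi> (1, 1) - \<beta>1 0 * \<psi> (1, 0) - I01 (\<lambda>y. \<beta>1' y * \<psi> (1, y))"
      by (rule I01_parts[OF d(4) c'(4) y s(2)[OF cy]])
    moreover have "I01 (\<lambda>y. \<beta>0 y * \<psi>y (0, y)) = \<beta>0 1 * \<psi> (0, 1) - \<beta>0 0 * \<psi> (0, 0) - I01 (\<lambda>y. \<beta>0' y * \<psi> (0, y))"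
      by (rule I01_parts[OF d(3) c'(3) y s(2)[OF cy]])
    ultimately show ?thesis
      using green_row_raw[OF t2 t1 i z c x y cx cy c\<psi>]
      by (simp add: R_def J11_def J01_def J10_def J00_def algebra_simps)
  qed
  have J: "J11 * ((a + b) * (e + f)) + J01 * (a * (e + f)) + J10 * ((a + b) * e) + J00 * (a * e) = 0"
    if ab: "(a, b) = (0, 1) \<or> (a, b) = (1, -1 :: real)" and ef: "(e, f) = (0, 1) \<or> (e, f) = (1, -1 :: real)" for a b e f
  proof -
    define \<psi> where "\<psi> n z = (a + b * fst z)^n * (e + f * snd z)^n" for n and z :: "real \<times> real"
    have dp: "((\<lambda>t. (p + q * t)^n) has_real_derivative q * (real n * (p + q * t)^(n - 1))) (at t)" for p q t n
      by (auto intro!: derivative_eq_intros)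
    have lim: "(\<lambda>n. (p + q * t)^n) \<longlonglongrightarrow> 0" and le1: "\<bar>(p + q * t)^n\<bar> \<le> 1"
      if "(p, q) = (0, 1) \<or> (p, q) = (1, -1 :: real)" "t \<in> {0<..<1}" for p q t n
      using that by (auto intro!: LIMSEQ_power_zero power_le_one simp: power_abs[symmetric] abs_if simp del: power_abs)
    have le2: "\<bar>(p + q * t)^n\<bar> \<le> 1" if "(p, q) = (0, 1) \<or> (p, q) = (1, -1 :: real)" "t \<in> {0, 1}" for p q t n
      using that by (auto simp: power_0_left)
    have "(\<lambda>n. (LINT z|lborel. h2 z * (b * (real n * (a + b * fst z)^(n - 1)) * (e + f * snd z)^n))
        - (LINT z|lborel. h1 z * ((a + b * fst z)^n * (f * (real n * (e + f * snd z)^(n - 1)))))) \<longlonglongrightarrow> b * 0 - f * 0"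
    proof (intro tendsto_diff)
      have "(\<lambda>n. b * (LINT z|lborel. h2 z * (real n * (a + b * fst z)^(n - 1) * (e + f * snd z)^n))) \<longlonglongrightarrow> b * 0"
        by (intro tendsto_mult_left corner_gradient_null[OF i(3) sq(2) z(3) ab ef])
      then show "(\<lambda>n. LINT z|lborel. h2 z * (b * (real n * (a + b * fst z)^(n - 1)) * (e + f * snd z)^n)) \<longlonglongrightarrow> b * 0"
        by (subst (asm) integral_mult_right_zero[symmetric]) (simp add: mult_ac)
      have sw: "integrable lborel (\<lambda>z. h1 (prod.swap z))" "integrable lborel (\<lambda>z. (h1 (prod.swap z))\<^sup>2)"
        using plane_swap(2)[of h1] plane_swap(2)[of "\<lambda>z. (h1 z)\<^sup>2"] i(2) sq(1) by auto
      have sz: "h1 (prod.swap z) = 0" if "z \<notin> Q" for z using z(2)[of "prod.swap z"] that by (auto simp: Q_iff)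
      have [measurable]: "h1 \<in> borel_measurable borel" using i(2) by auto
      have "(\<lambda>n. f * (LINT z|lborel. h1 (prod.swap z) * (real n * (e + f * fst z)^(n - 1) * (a + b * snd z)^n))) \<longlonglongrightarrow> f * 0"
        by (intro tendsto_mult_left corner_gradient_null[OF sw sz ef ab])
      moreover have "(LINT z|lborel. h1 (prod.swap z) * (real n * (e + f * fst z)^(n - 1) * (a + b * snd z)^n))
        = (LINT z|lborel. h1 z * (real n * (e + f * snd z)^(n - 1) * (a + b * fst z)^n))" for n
        using plane_swap(1)[of "\<lambda>z. h1 z * (real n * (e + f * snd z)^(n - 1) * (a + b * fst z)^n)"] by simp
      ultimately show "(\<lambda>n. LINT z|lborel. h1 z * ((a + b * fst z)^n * (f * (real n * (e + f * snd z)^(n - 1))))) \<longlonglongrightarrow> f * 0"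
        by (simp only:) (subst (asm) integral_mult_right_zero[symmetric], simp add: mult_ac)
    qed
    moreover have "(LINT z|lborel. h2 z * (b * (real n * (a + b * fst z)^(n - 1)) * (e + f * snd z)^n))
        - (LINT z|lborel. h1 z * ((a + b * fst z)^n * (f * (real n * (e + f * snd z)^(n - 1)))))
      = R (\<psi> n) + J11 * \<psi> n (1, 1) + J01 * \<psi> n (0, 1) + J10 * \<psi> n (1, 0) + J00 * \<psi> n (0, 0)" for n
    proof (rule G)
      show "((\<lambda>x. \<psi> n (x, y)) has_real_derivative b * (real n * (a + b * fst (x, y))^(n - 1)) * (e + f * snd (x, y))^n) (at x)" for x y
        unfolding \<psi>_def using DERIV_cmult_right[OF dp] by simp
      show "((\<lambda>y. \<psi> n (x, y)) has_real_derivative (a + b * fst (x, y))^n * (f * (real n * (e + f * snd (x, y))^(n - 1)))) (at y)" for x y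
        unfolding \<psi>_def using DERIV_cmult[OF dp] by simp
    qed (auto simp: \<psi>_def intro!: continuous_intros)
    moreover have "(\<lambda>n. R (\<psi> n)) \<longlonglongrightarrow> 0 - 0 + 0 - 0"
      unfolding R_def
    proof (intro tendsto_diff tendsto_add)
      have X: "(\<lambda>n. I01 (\<lambda>t. g t * \<psi> n (t, s))) \<longlonglongrightarrow> 0" if "continuous_on UNIV g" "s \<in> {0, 1}" for g s
        by (rule I01_null[OF that(1)])
          (auto simp: \<psi>_def abs_mult intro!: mult_le_one le1[OF ab] le2[OF ef that(2)] continuous_intros
            Lim_null_comparison[OF always_eventually tendsto_rabs_zero[OF lim[OF ab]]] mult_left_le)
      have Y: "(\<lambda>n. I01 (\<lambda>t. g t * \<psi> n (s, t))) \<longlonglongrightarrow> 0" if "continuous_on UNIV g" "s \<in> {0, 1}" for g s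
        by (rule I01_null[OF that(1)])
          (auto simp: \<psi>_def abs_mult intro!: mult_le_one le1[OF ef] le2[OF ab that(2)] continuous_intros
            Lim_null_comparison[OF always_eventually tendsto_rabs_zero[OF lim[OF ef]]] mult_left_le_one_le)
      show "(\<lambda>n. I01 (\<lambda>x. \<alpha>0' x * \<psi> n (x, 0))) \<longlonglongrightarrow> 0" "(\<lambda>n. I01 (\<lambda>x. \<alpha>1' x * \<psi> n (x, 1))) \<longlonglongrightarrow> 0"
        by (rule X; use c' in simp)+
      show "(\<lambda>n. I01 (\<lambda>y. \<beta>1' y * \<psi> n (1, y))) \<longlonglongrightarrow> 0" "(\<lambda>n. I01 (\<lambda>y. \<beta>0' y * \<psi> n (0, y))) \<longlonglongrightarrow> 0"
        by (rule Y; use c' in simp)+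
    qed
    ultimately have "(\<lambda>n. J11 * \<psi> n (1, 1) + J01 * \<psi> n (0, 1) + J10 * \<psi> n (1, 0) + J00 * \<psi> n (0, 0)) \<longlonglongrightarrow> 0"
      using tendsto_diff[of "\<lambda>n. R (\<psi> n) + J11 * \<psi> n (1, 1) + J01 * \<psi> n (0, 1) + J10 * \<psi> n (1, 0) + J00 * \<psi> n (0, 0)" 0 sequentially "\<lambda>n. R (\<psi> n)" 0]
      by (simp add: algebra_simps)
    moreover have "\<forall>\<^sub>F n in sequentially. J11 * \<psi> n (1, 1) + J01 * \<psi> n (0, 1) + J10 * \<psi> n (1, 0) + J00 * \<psi> n (0, 0) =
      J11 * ((a + b) * (e + f)) + J01 * (a * (e + f)) + J10 * ((a + b) * e) + J00 * (a * e)"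
      by (rule eventually_sequentiallyI[of 1]) (use ab ef in \<open>auto simp: \<psi>_def power_0_left\<close>)
    ultimately have "(\<lambda>n::nat. J11 * ((a + b) * (e + f)) + J01 * (a * (e + f)) + J10 * ((a + b) * e) + J00 * (a * e)) \<longlonglongrightarrow> 0"
      by (rule Lim_transform_eventually)
    then show ?thesis by (simp add: LIMSEQ_const_iff)
  qed
  have "J11 = 0" "J01 = 0" "J10 = 0" "J00 = 0"
    using J[of 0 1 0 1] J[of 1 "-1" 0 1] J[of 0 1 1 "-1"] J[of 1 "-1" 1 "-1"] by auto
  then show ?thesis using G[OF x y cx cy c\<psi>] by (simp add: R_def)
qed

section \<open>Weak derivatives of classes of functions\<close>

lemma measurable_lebesgue_on_AE:
  fixes f g :: "'a::euclidean_space \<Rightarrow> 'b::euclidean_space"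
  assumes f: "f \<in> borel_measurable (lebesgue_on S)" and S: "S \<in> sets lebesgue"
    and ae: "AE x in lebesgue_on S. f x = g x"
  shows "g \<in> borel_measurable (lebesgue_on S)"
proof -
  have "(\<lambda>x. if x \<in> S then f x else 0) \<in> borel_measurable lebesgue"
    using f S by (simp add: borel_measurable_if)
  moreover have "AE x in lebesgue. (if x \<in> S then f x else 0) = (if x \<in> S then g x else 0)"
    using ae S by (auto simp: AE_restrict_space_iff elim: eventually_mono)
  ultimately have "(\<lambda>x. if x \<in> S then g x else 0) \<in> borel_measurable lebesgue" by (rule borel_measurable_AE)
  then show ?thesis using S by (simp add: borel_measurable_if)
qed

lemma rep_on_K_AE: "AE p in lebesgue_on K. rep_fld (on_K f) p = f p"
  using rep_on_K[of f] by (simp add: ae_eq_K_def)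

lemma fld_eqI:
  assumes "AE p in lebesgue_on K. rep_fld u p = rep_fld v p"
  shows "u = v"
  using assms fld.abs_eq_iff[of "rep_fld u" "rep_fld v"] Quotient3_abs_rep[OF Quotient3_fld]
  by (metis ae_eq_K_def)

lemma on_K_eq_iff: "on_K f = on_K g \<longleftrightarrow> (AE p in lebesgue_on K. f p = g p)"
  by (simp add: fld.abs_eq_iff ae_eq_K_def)

lemma rep_fld_add: "AE p in lebesgue_on K. rep_fld (u + v) p = rep_fld u p + rep_fld v p"
proof -
  have "u + v = on_K (\<lambda>p. rep_fld u p + rep_fld v p)"
    using plus_fld.abs_eq[of "rep_fld u" "rep_fld v"] by (simp add: Quotient3_abs_rep[OF Quotient3_fld])
  then show ?thesis using rep_on_K_AE by metis
qed

lemma rep_fld_scaleR: "AE p in lebesgue_on K. rep_fld (c *\<^sub>R u) p = c *\<^sub>R rep_fld u p"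
proof -
  have "c *\<^sub>R u = on_K (\<lambda>p. c *\<^sub>R rep_fld u p)"
    using scaleR_fld.abs_eq[of c "rep_fld u"] by (simp add: Quotient3_abs_rep[OF Quotient3_fld])
  then show ?thesis using rep_on_K_AE by metis
qed

lemma plane_rep_cong_AE:
  assumes F: "plane_rep F f" and ae: "AE p in lebesgue_on K. F p = G p"
  shows "plane_rep G f"
proof -
  have "G \<in> borel_measurable (lebesgue_on K)"
    using F by (intro measurable_lebesgue_on_AE[OF _ K_lebesgue ae]) (simp add: plane_rep_def)
  moreover have "AE p in lebesgue_on K. G p = f (p $ 1, p $ 2)"
    using F ae unfolding plane_rep_def by (auto elim: eventually_elim2)
  ultimately show ?thesis using F by (simp add: plane_rep_def)
qed

lemma plane_rep_add: "plane_rep F f \<Longrightarrow> plane_rep G g \<Longrightarrow> plane_rep (\<lambda>p. F p + G p) (\<lambda>z. f z + g z)"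
  unfolding plane_rep_def by (auto elim: eventually_elim2)

lemma plane_rep_cmult: "plane_rep F f \<Longrightarrow> plane_rep (\<lambda>p. c * F p) (\<lambda>z. c * f z)"
  unfolding plane_rep_def by (auto elim: eventually_mono)

lemma plane_rep_AE_eq:
  assumes "plane_rep F f" "plane_rep G g" "AE z in lborel. f z = g z"
  shows "AE p in lebesgue_on K. F p = G p"
proof -
  have "AE p in lebesgue_on K. f (p $ 1, p $ 2) = g (p $ 1, p $ 2)"
    unfolding AE_K_iff using assms(3) by (auto elim: eventually_mono)
  moreover have "AE p in lebesgue_on K. F p = f (p $ 1, p $ 2)" "AE p in lebesgue_on K. G p = g (p $ 1, p $ 2)"
    using assms by (auto simp: plane_rep_def)
  ultimately show ?thesis by eventually_elim simp
qed

lemma closure_K_vec2: "vec2 z \<in> closure K \<longleftrightarrow> z \<in> {0..1} \<times> {0..1}"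
  by (cases z) (auto simp: closure_K)

lemma compact_closure_K: "compact (closure K)"
  unfolding K_eq_box by (simp add: compact_closure)

lemma plane_rep_continuous:
  assumes c: "continuous_on (closure K) f"
  shows "plane_rep f (\<lambda>z. indicator Q z * f (vec2 z))" "integrable lborel (\<lambda>z. (indicator Q z * f (vec2 z))\<^sup>2)"
proof -
  have cQ: "continuous_on Q (\<lambda>z. f (vec2 z))"
    by (rule continuous_on_compose2[OF c]) (auto intro!: continuous_intros simp: closure_K_vec2 Q_iff)
  have b [measurable]: "(\<lambda>z. indicator Q z * f (vec2 z)) \<in> borel_measurable borel"
    using borel_measurable_continuous_on_indicator[OF Q_measurable cQ] by simp
  have cK: "continuous_on K f" using c closure_subset continuous_on_subset by blast
  have "f \<in> borel_measurable (lebesgue_on K)"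
    using continuous_imp_measurable_on_sets_lebesgue[OF cK K_lebesgue] .
  then show "plane_rep f (\<lambda>z. indicator Q z * f (vec2 z))"
    using b by (auto simp: plane_rep_def AE_restrict_space_iff Q_iff K_def)
  have "compact (f ` closure K)" by (rule compact_continuous_image[OF c compact_closure_K])
  then obtain M where M: "\<And>p. p \<in> closure K \<Longrightarrow> \<bar>f p\<bar> \<le> M"
    by (metis compact_imp_bounded bounded_real imageI)
  have "integrable lborel (indicator Q :: real \<times> real \<Rightarrow> real)"
    by (rule integrable_real_indicator) (simp_all add: emeasure_Q)
  then have "integrable lborel (\<lambda>z. indicator Q z * M\<^sup>2 :: real)" by simp
  then show "integrable lborel (\<lambda>z. (indicator Q z * f (vec2 z))\<^sup>2)"
  proof (rule Bochner_Integration.integrable_bound)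
    show "AE z in lborel. norm ((indicator Q z * f (vec2 z))\<^sup>2) \<le> norm (indicator Q z * M\<^sup>2)"
    proof (rule AE_I2)
      fix z
      have "(f (vec2 z))\<^sup>2 \<le> M\<^sup>2" if "z \<in> Q"
        using M[of "vec2 z"] that power_mono[of "\<bar>f (vec2 z)\<bar>" M 2] by (auto simp: closure_K_vec2 Q_iff mem_Times_iff)
      then show "norm ((indicator Q z * f (vec2 z))\<^sup>2) \<le> norm (indicator Q z * M\<^sup>2)"
        by (auto simp: indicator_def power_mult_distrib)
    qed
  qed measurable
qed

lemma L2_rep_on_K: "continuous_on (closure K) f \<Longrightarrow> L2_rep (on_K f) (\<lambda>z. indicator Q z * f (vec2 z))"
  unfolding L2_rep_def using plane_rep_continuous[of f] rep_on_K_AE[of f]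
  by (auto intro!: plane_rep_cong_AE[of f] elim: eventually_mono)

lemma square_add_integrable:
  fixes f g :: "real \<times> real \<Rightarrow> real"
  assumes [measurable]: "f \<in> borel_measurable borel" "g \<in> borel_measurable borel"
    and "integrable lborel (\<lambda>z. (f z)\<^sup>2)" "integrable lborel (\<lambda>z. (g z)\<^sup>2)"
  shows "integrable lborel (\<lambda>z. (f z + g z)\<^sup>2)"
proof -
  have "integrable lborel (\<lambda>z. 2 * (f z)\<^sup>2 + 2 * (g z)\<^sup>2)" using assms by simp
  then show ?thesis
  proof (rule Bochner_Integration.integrable_bound)
    have "(x + y)\<^sup>2 \<le> 2 * x\<^sup>2 + 2 * y\<^sup>2" for x y :: real
      using zero_le_power2[of "x - y"] by (simp add: power2_eq_square algebra_simps)
    then show "AE z in lborel. norm ((f z + g z)\<^sup>2) \<le> norm (2 * (f z)\<^sup>2 + 2 * (g z)\<^sup>2)" by (intro AE_I2) simp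
  qed measurable
qed

lemma L2_rep_add:
  assumes "L2_rep u f" "L2_rep v g" shows "L2_rep (u + v) (\<lambda>z. f z + g z)"
  unfolding L2_rep_def
proof
  show "plane_rep (rep_fld (u + v)) (\<lambda>z. f z + g z)"
    using rep_fld_add[of u v] assms
    by (intro plane_rep_cong_AE[OF plane_rep_add]) (auto simp: L2_rep_def elim: eventually_mono)
  show "integrable lborel (\<lambda>z. (f z + g z)\<^sup>2)"
    using assms by (intro square_add_integrable) (auto simp: L2_rep_def plane_rep_def)
qed

lemma L2_rep_scaleR:
  assumes "L2_rep u f" shows "L2_rep (c *\<^sub>R u) (\<lambda>z. c * f z)"
  unfolding L2_rep_def
proof
  show "plane_rep (rep_fld (c *\<^sub>R u)) (\<lambda>z. c * f z)"
    using rep_fld_scaleR[of c u] assms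
    by (intro plane_rep_cong_AE[OF plane_rep_cmult]) (auto simp: L2_rep_def elim: eventually_mono)
  show "integrable lborel (\<lambda>z. (c * f z)\<^sup>2)"
    using assms by (simp add: L2_rep_def power_mult_distrib)
qed

lemma L2_rep_eqI: "L2_rep u f \<Longrightarrow> L2_rep v g \<Longrightarrow> (AE z in lborel. f z = g z) \<Longrightarrow> u = v"
  unfolding L2_rep_def using plane_rep_AE_eq by (blast intro: fld_eqI)

lemma C1I:
  assumes d: "\<And>p. (f has_derivative (\<lambda>h. g1 p * h $ 1 + g2 p * h $ 2)) (at p)"
    and c: "continuous_on UNIV g1" "continuous_on UNIV g2"
  shows "f \<in> C1" "pd 1 f = g1" "pd 2 f = g2"
proof -
  have fd: "frechet_derivative f (at p) = (\<lambda>h. g1 p * h $ 1 + g2 p * h $ 2)" for p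
    using frechet_derivative_at[OF d] by simp
  show p: "pd 1 f = g1" "pd 2 f = g2" by (simp_all add: fun_eq_iff pd_def fd axis_def)
  show "f \<in> C1" using d p c unfolding C1_def by (auto simp: differentiable_def forall_2)
qed

lemma C1_partial:
  assumes "f \<in> C1"
  shows "((\<lambda>x. f (vec2 (x, y))) has_real_derivative pd 1 f (vec2 (x, y))) (at x)"
    and "((\<lambda>y. f (vec2 (x, y))) has_real_derivative pd 2 f (vec2 (x, y))) (at y)"
    and "continuous_on UNIV (\<lambda>z. pd j f (vec2 z))" "continuous_on UNIV (\<lambda>z. f (vec2 z))"
    and "continuous_on UNIV (pd j f)" "continuous_on UNIV f"
proof -
  let ?D = "frechet_derivative f (at (vec2 (x, y)))"
  have D: "(f has_derivative ?D) (at (vec2 (x, y)))"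
    using assms by (auto simp: C1_def frechet_derivative_works)
  interpret D: linear ?D using D by (rule has_derivative_linear)
  have "((\<lambda>x. vec2 (x, y)) has_derivative (\<lambda>h. h *\<^sub>R axis 1 1)) (at x)"
    unfolding vec2_alt by (auto intro!: derivative_eq_intros)
  from has_derivative_compose[OF this D]
  show "((\<lambda>x. f (vec2 (x, y))) has_real_derivative pd 1 f (vec2 (x, y))) (at x)"
    by (simp add: has_field_derivative_def pd_def D.scale mult.commute[of _ "?D _"])
  have "((\<lambda>y. vec2 (x, y)) has_derivative (\<lambda>h. h *\<^sub>R axis 2 1)) (at y)"
    unfolding vec2_alt by (auto intro!: derivative_eq_intros)
  from has_derivative_compose[OF this D]
  show "((\<lambda>y. f (vec2 (x, y))) has_real_derivative pd 2 f (vec2 (x, y))) (at y)"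
    by (simp add: has_field_derivative_def pd_def D.scale mult.commute[of _ "?D _"])
  show c: "continuous_on UNIV (pd j f)" using assms by (simp add: C1_def)
  show d: "continuous_on UNIV f"
    using assms by (auto simp: C1_def intro!: differentiable_imp_continuous_on differentiable_at_imp_differentiable_on)
  show "continuous_on UNIV (\<lambda>z. pd j f (vec2 z))" "continuous_on UNIV (\<lambda>z. f (vec2 z))"
    by (intro continuous_on_compose2[OF c] continuous_on_compose2[OF d] continuous_on_vec2 continuous_on_id subset_UNIV)+
qed

lemma C1_tensor:
  assumes a: "\<And>t. (a has_real_derivative a' t) (at t)" "continuous_on UNIV a'"
    and b: "\<And>t. (b has_real_derivative b' t) (at t)" "continuous_on UNIV b'"
  shows "(\<lambda>p::real^2. a (p $ 1) * b (p $ 2)) \<in> C1"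
    "pd 1 (\<lambda>p. a (p $ 1) * b (p $ 2)) = (\<lambda>p. a' (p $ 1) * b (p $ 2))"
    "pd 2 (\<lambda>p. a (p $ 1) * b (p $ 2)) = (\<lambda>p. a (p $ 1) * b' (p $ 2))"
proof -
  have c: "continuous_on UNIV a" "continuous_on UNIV b"
    using a b by (auto intro!: DERIV_isCont continuous_at_imp_continuous_on)
  have 1: "((\<lambda>p::real^2. a (p $ 1)) has_derivative (\<lambda>h. a' (p $ 1) * h $ 1)) (at p)" for p
    using has_derivative_compose[OF bounded_linear.has_derivative[OF bounded_linear_vec_nth has_derivative_ident] a(1)[unfolded has_field_derivative_def], of 1 p UNIV] by simp
  have 2: "((\<lambda>p::real^2. b (p $ 2)) has_derivative (\<lambda>h. b' (p $ 2) * h $ 2)) (at p)" for p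
    using has_derivative_compose[OF bounded_linear.has_derivative[OF bounded_linear_vec_nth has_derivative_ident] b(1)[unfolded has_field_derivative_def], of 2 p UNIV] by simp
  have d: "((\<lambda>p::real^2. a (p $ 1) * b (p $ 2)) has_derivative (\<lambda>h. (a' (p $ 1) * b (p $ 2)) * h $ 1 + (a (p $ 1) * b' (p $ 2)) * h $ 2)) (at p)" for p
    using has_derivative_mult[OF 1 2, of p] by (simp add: algebra_simps)
  have cc: "continuous_on UNIV (\<lambda>p::real^2. a' (p $ 1) * b (p $ 2))" "continuous_on UNIV (\<lambda>p::real^2. a (p $ 1) * b' (p $ 2))"
    by (auto intro!: continuous_intros continuous_on_compose2[OF a(2)] continuous_on_compose2[OF b(2)]
        continuous_on_compose2[OF c(1)] continuous_on_compose2[OF c(2)])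
  show "(\<lambda>p::real^2. a (p $ 1) * b (p $ 2)) \<in> C1"
    "pd 1 (\<lambda>p. a (p $ 1) * b (p $ 2)) = (\<lambda>p. a' (p $ 1) * b (p $ 2))"
    "pd 2 (\<lambda>p. a (p $ 1) * b (p $ 2)) = (\<lambda>p. a (p $ 1) * b' (p $ 2))"
    using C1I[OF d cc] by auto
qed

lemma pd_test_fun_tensor:
  assumes "test_fun a a'" "test_fun b b'"
  shows "pd 1 (\<lambda>p. a (p $ 1) * b (p $ 2)) = (\<lambda>p. a' (p $ 1) * b (p $ 2))"
    "pd 2 (\<lambda>p. a (p $ 1) * b (p $ 2)) = (\<lambda>p. a (p $ 1) * b' (p $ 2))"
  using assms C1_tensor(2,3)[of a a' b b'] by (simp_all add: test_fun_def)

lemma C1c_tensor: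
  assumes "test_fun a a'" "test_fun b b'"
  shows "(\<lambda>p::real^2. a (p $ 1) * b (p $ 2)) \<in> C1c"
proof -
  obtain c d where cd: "0 < c" "d < 1" "\<And>t. t \<notin> {c..d} \<Longrightarrow> a t = 0" using assms by (auto simp: test_fun_def)
  obtain e f where ef: "0 < e" "f < 1" "\<And>t. t \<notin> {e..f} \<Longrightarrow> b t = 0" using assms by (auto simp: test_fun_def)
  have "(\<lambda>p::real^2. a (p $ 1) * b (p $ 2)) \<in> C1"
    using assms by (intro C1_tensor(1)) (auto simp: test_fun_def)
  moreover have "cbox (vec2 (c, e)) (vec2 (d, f)) \<subseteq> K"
    using cd ef by (auto simp: K_def mem_box_cart forall_2)
  moreover have "a (p $ 1) * b (p $ 2) = 0" if "p \<notin> cbox (vec2 (c, e)) (vec2 (d, f))" for p :: "real^2"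
    using that cd(3)[of "p $ 1"] ef(3)[of "p $ 2"] by (auto simp: mem_box_cart forall_2)
  ultimately show ?thesis unfolding C1c_def using compact_cbox by blast
qed

lemma C1c_C1: "\<psi> \<in> C1c \<Longrightarrow> \<psi> \<in> C1"
  by (simp add: C1c_def)

lemma L2_rep_integral_mult:
  assumes "L2_rep u f" "continuous_on UNIV \<psi>"
  shows "(LINT p|lebesgue_on K. rep_fld u p * \<psi> p) = (LINT z|lborel. f z * \<psi> (vec2 z))"
  using plane_rep_integral(1)[OF plane_rep_mult_continuous[OF _ assms(2)], of "rep_fld u" f] assms(1) by (simp add: L2_rep_def)

lemma has_wpd_iff:
  assumes "L2_rep u f" "L2_rep g h"
  shows "has_wpd j u g \<longleftrightarrow> (\<forall>\<psi>\<in>C1c. (LINT z|lborel. f z * pd j \<psi> (vec2 z)) = - (LINT z|lborel. h z * \<psi> (vec2 z)))"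
  unfolding has_wpd_def using L2_rep_L2[OF assms(1)] L2_rep_L2[OF assms(2)]
    L2_rep_integral_mult[OF assms(1) C1_partial(5)[OF C1c_C1]] L2_rep_integral_mult[OF assms(2) C1_partial(6)[OF C1c_C1]]
  by simp

lemma tstI:
  "0 < c \<Longrightarrow> c < d \<Longrightarrow> d < 1 \<Longrightarrow> (\<And>t. t \<notin> {c..d} \<Longrightarrow> a t = 0) \<Longrightarrow>
    (\<And>t. (a has_real_derivative a' t) (at t)) \<Longrightarrow> continuous_on UNIV a' \<Longrightarrow> test_fun a a'"
  unfolding test_fun_def by blast

lemma tensor_test_unique:
  assumes f: "integrable lborel f" "\<And>z. z \<notin> Q \<Longrightarrow> f z = 0" and g: "integrable lborel g" "\<And>z. z \<notin> Q \<Longrightarrow> g z = 0"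
    and eq: "\<And>a a' b b' a'' b''. test_fun a a' \<Longrightarrow> test_fun b b' \<Longrightarrow> test_fun a' a'' \<Longrightarrow> test_fun b' b'' \<Longrightarrow>
      (LINT z|lborel. f z * (a (fst z) * b (snd z))) = (LINT z|lborel. g z * (a (fst z) * b (snd z)))"
  shows "AE z in lborel. f z = g z"
proof -
  have "AE z in lborel. f z - g z = 0"
  proof (rule tensor_bump_AE_0)
    fix n :: nat and c d c' d' :: real
    assume b: "0 < c" "c < d" "d < 1" "0 < c'" "c' < d'" "d' < 1"
    have t: "\<exists>a' a''. test_fun (bump n c d) a' \<and> test_fun a' a''" if "0 < c" "c < d" "d < 1" for c d :: real
    proof -
      obtain b' b'' where b: "\<And>t. (bump n c d has_real_derivative b' t) (at t)"
        "\<And>t. (b' has_real_derivative b'' t) (at t)" "continuous_on UNIV b''" "\<And>t. t \<notin> {c..d} \<Longrightarrow> b' t = 0"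
        using bump_C2[of n c d] by metis
      have "continuous_on UNIV b'" using b(2) by (auto intro!: DERIV_isCont continuous_at_imp_continuous_on)
      then have "test_fun (bump n c d) b'" "test_fun b' b''"
        using b that by (auto simp: bump_outside intro!: tstI[of c d])
      then show ?thesis by blast
    qed
    obtain a' a'' b' b'' where ab: "test_fun (bump n c d) a'" "test_fun a' a''" "test_fun (bump n c' d') b'" "test_fun b' b''"
      using t[OF b(1-3)] t[OF b(4-6)] by blast
    have c: "continuous_on UNIV (\<lambda>z. bump n c d (fst z) * bump n c' d' (snd z))"
      by (auto intro!: continuous_intros continuous_on_compose2[OF continuous_bump])
    have "(LINT z|lborel. (f z - g z) * (bump n c d (fst z) * bump n c' d' (snd z))) =
      (LINT z|lborel. f z * (bump n c d (fst z) * bump n c' d' (snd z))) - (LINT z|lborel. g z * (bump n c d (fst z) * bump n c' d' (snd z)))"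
      using Bochner_Integration.integral_diff[OF integrable_Q_mult[OF f c] integrable_Q_mult[OF g c]]
      by (simp add: left_diff_distrib)
    also have "\<dots> = 0" using eq[OF ab(1,3,2,4)] by simp
    finally show "(LINT z|lborel. (f z - g z) * (bump n c d (fst z) * bump n c' d' (snd z))) = 0" .
  qed (use f g in auto)
  then show ?thesis by eventually_elim simp
qed

lemma L2_rep_props: "L2_rep u f \<Longrightarrow> integrable lborel f \<and> (\<forall>z. z \<notin> Q \<longrightarrow> f z = 0) \<and> f \<in> borel_measurable borel"
  using L2_rep_integrable[of u f] unfolding L2_rep_def plane_rep_def by blast

lemma has_wpd_unique:
  assumes "has_wpd j u g" "has_wpd j u g'"
  shows "g = g'"
proof -
  obtain f where f: "L2_rep u f" using assms L2_rep_exists by (auto simp: has_wpd_def)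
  obtain h where h: "L2_rep g h" using assms L2_rep_exists by (auto simp: has_wpd_def)
  obtain h' where h': "L2_rep g' h'" using assms L2_rep_exists by (auto simp: has_wpd_def)
  show ?thesis
  proof (rule L2_rep_eqI[OF h h' tensor_test_unique])
    fix a a' b b' a'' b'' assume "test_fun a a'" "test_fun b b'"
    from C1c_tensor[OF this] 
    show "(LINT z|lborel. h z * (a (fst z) * b (snd z))) = (LINT z|lborel. h' z * (a (fst z) * b (snd z)))"
      using assms[unfolded has_wpd_iff[OF f h] has_wpd_iff[OF f h']] by force
  qed (use L2_rep_props[OF h] L2_rep_props[OF h'] in auto)
qed

lemma wpd_eq: "has_wpd j u g \<Longrightarrow> wpd j u = g"
  unfolding wpd_def using has_wpd_unique by blast

lemma H1_wpd: "u \<in> H1 \<Longrightarrow> has_wpd j u (wpd j u)"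
proof -
  assume "u \<in> H1"
  then obtain g where g: "has_wpd j u g" unfolding H1_def by blast
  then show ?thesis using wpd_eq[OF g] by simp
qed

lemma has_wpd_add:
  assumes "has_wpd j u g" "has_wpd j v h"
  shows "has_wpd j (u + v) (g + h)"
proof -
  obtain fu where u: "L2_rep u fu" using assms L2_rep_exists by (auto simp: has_wpd_def)
  obtain fv where v: "L2_rep v fv" using assms L2_rep_exists by (auto simp: has_wpd_def)
  obtain fg where g: "L2_rep g fg" using assms L2_rep_exists by (auto simp: has_wpd_def)
  obtain fh where h: "L2_rep h fh" using assms L2_rep_exists by (auto simp: has_wpd_def)
  have I: "integrable lborel (\<lambda>z. f z * \<phi> (vec2 z))" if "L2_rep u f" "continuous_on UNIV \<phi>" for u f \<phi>
    using L2_rep_props[OF that(1)]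
    by (intro integrable_Q_mult continuous_on_compose2[OF that(2)] continuous_on_vec2 continuous_on_id) auto
  show ?thesis
    unfolding has_wpd_iff[OF L2_rep_add[OF u v] L2_rep_add[OF g h]]
  proof
    fix \<psi> assume \<psi>: "\<psi> \<in> C1c"
    note c = C1_partial(5,6)[OF C1c_C1[OF \<psi>]]
    show "(LINT z|lborel. (fu z + fv z) * pd j \<psi> (vec2 z)) = - (LINT z|lborel. (fg z + fh z) * \<psi> (vec2 z))"
      using assms[unfolded has_wpd_iff[OF u g] has_wpd_iff[OF v h]] \<psi>
      by (simp add: distrib_right I[OF u c(1)] I[OF v c(1)] I[OF g c(2)] I[OF h c(2)])
  qed
qed

lemma has_wpd_scaleR:
  assumes "has_wpd j u g"
  shows "has_wpd j (c *\<^sub>R u) (c *\<^sub>R g)"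
proof -
  obtain fu where u: "L2_rep u fu" using assms L2_rep_exists by (auto simp: has_wpd_def)
  obtain fg where g: "L2_rep g fg" using assms L2_rep_exists by (auto simp: has_wpd_def)
  show ?thesis
    unfolding has_wpd_iff[OF L2_rep_scaleR[OF u] L2_rep_scaleR[OF g]]
    using assms[unfolded has_wpd_iff[OF u g]] by (simp add: mult.assoc)
qed

lemma H1_add:
  assumes "u \<in> H1" "v \<in> H1"
  shows "u + v \<in> H1" "wpd j (u + v) = wpd j u + wpd j v"
proof -
  have a: "has_wpd i (u + v) (wpd i u + wpd i v)" for i by (intro has_wpd_add H1_wpd assms)
  show "u + v \<in> H1" using a unfolding H1_def by blast
  show "wpd j (u + v) = wpd j u + wpd j v" by (rule wpd_eq[OF a])
qed

lemma H1_scaleR: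
  assumes "u \<in> H1"
  shows "c *\<^sub>R u \<in> H1" "wpd j (c *\<^sub>R u) = c *\<^sub>R wpd j u"
proof -
  have a: "has_wpd i (c *\<^sub>R u) (c *\<^sub>R wpd i u)" for i by (intro has_wpd_scaleR H1_wpd assms)
  show "c *\<^sub>R u \<in> H1" using a unfolding H1_def by blast
  show "wpd j (c *\<^sub>R u) = c *\<^sub>R wpd j u" by (rule wpd_eq[OF a])
qed

lemma H2_add: "u \<in> H2 \<Longrightarrow> v \<in> H2 \<Longrightarrow> u + v \<in> H2"
  by (simp add: H2_def H1_add)

lemma H2_scaleR: "u \<in> H2 \<Longrightarrow> c *\<^sub>R u \<in> H2"
  by (simp add: H2_def H1_scaleR)

lemma weak_dy_if_has_wpd:
  assumes "has_wpd 2 u g" "L2_rep u f" "L2_rep g h"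
  shows "weak_dy f h"
  unfolding weak_dy_def
proof (intro conjI allI impI)
  fix a a' b b' assume ab: "test_fun a a'" "test_fun b b'"
  have "pd 2 (\<lambda>p. a (p $ 1) * b (p $ 2)) = (\<lambda>p. a (p $ 1) * b' (p $ 2))"
    using ab by (intro C1_tensor(3)) (auto simp: test_fun_def)
  then show "(LINT z|lborel. f z * (a (fst z) * b' (snd z))) = - (LINT z|lborel. h z * (a (fst z) * b (snd z)))"
    using assms(1)[unfolded has_wpd_iff[OF assms(2,3)]] C1c_tensor[OF ab] by force
qed (use L2_rep_props[OF assms(2)] L2_rep_props[OF assms(3)] in auto)

lemma weak_dx_if_has_wpd:
  assumes "has_wpd 1 u g" "L2_rep u f" "L2_rep g h"
  shows "weak_dx f h"
  unfolding weak_dy_def weak_dx_def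
proof (intro conjI allI impI)
  have [measurable]: "f \<in> borel_measurable borel" "h \<in> borel_measurable borel"
    using L2_rep_props[OF assms(2)] L2_rep_props[OF assms(3)] by auto
  show "integrable lborel (\<lambda>z. f (prod.swap z))" "integrable lborel (\<lambda>z. h (prod.swap z))"
    using L2_rep_props[OF assms(2)] L2_rep_props[OF assms(3)] by (simp_all add: plane_swap)
  show "f (prod.swap z) = 0" "h (prod.swap z) = 0" if "z \<notin> Q" for z
  proof -
    have "prod.swap z \<notin> Q" using that by (auto simp: Q_iff)
    then show "f (prod.swap z) = 0" "h (prod.swap z) = 0"
      using L2_rep_props[OF assms(2)] L2_rep_props[OF assms(3)] by blast+
  qed
  fix a a' b b' assume ab: "test_fun a a'" "test_fun b b'"
  have [measurable]: "a \<in> borel_measurable borel" "b \<in> borel_measurable borel" "b' \<in> borel_measurable borel"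
    using test_fun_continuous[OF ab(1)] test_fun_continuous[OF ab(2)] ab(2)[unfolded test_fun_def]
    by (blast intro: borel_measurable_continuous_onI)+
  have "pd 1 (\<lambda>p. b (p $ 1) * a (p $ 2)) = (\<lambda>p. b' (p $ 1) * a (p $ 2))"
    using ab by (intro C1_tensor(2)) (auto simp: test_fun_def)
  then have "(LINT z|lborel. f z * (b' (fst z) * a (snd z))) = - (LINT z|lborel. h z * (b (fst z) * a (snd z)))"
    using assms(1)[unfolded has_wpd_iff[OF assms(2,3)]] C1c_tensor[OF ab(2,1)] by force
  then show "(LINT z|lborel. f (prod.swap z) * (a (fst z) * b' (snd z))) = - (LINT z|lborel. h (prod.swap z) * (a (fst z) * b (snd z)))"
    using plane_swap(1)[of "\<lambda>z. f z * (b' (fst z) * a (snd z))"] plane_swap(1)[of "\<lambda>z. h z * (b (fst z) * a (snd z))"]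
    by (simp add: mult_ac)
qed

lemma wpd_mixed:
  assumes "u \<in> H2"
  shows "wpd 1 (wpd 2 u) = wpd 2 (wpd 1 u)"
proof -
  have w: "has_wpd 1 u (wpd 1 u)" "has_wpd 2 u (wpd 2 u)" "has_wpd 1 (wpd 2 u) (wpd 1 (wpd 2 u))"
    "has_wpd 2 (wpd 1 u) (wpd 2 (wpd 1 u))" using assms by (auto simp: H2_def H1_wpd)
  obtain f where f: "L2_rep u f" using w L2_rep_exists by (auto simp: has_wpd_def)
  obtain f1 where f1: "L2_rep (wpd 1 u) f1" using w L2_rep_exists by (auto simp: has_wpd_def)
  obtain f2 where f2: "L2_rep (wpd 2 u) f2" using w L2_rep_exists by (auto simp: has_wpd_def)
  obtain f12 where f12: "L2_rep (wpd 1 (wpd 2 u)) f12" using w L2_rep_exists by (auto simp: has_wpd_def)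
  obtain f21 where f21: "L2_rep (wpd 2 (wpd 1 u)) f21" using w L2_rep_exists by (auto simp: has_wpd_def)
  show ?thesis
  proof (rule L2_rep_eqI[OF f12 f21 tensor_test_unique])
    fix a a' b b' a'' b'' assume t: "test_fun a a'" "test_fun b b'" "test_fun a' a''" "test_fun b' b''"
    note p = pd_test_fun_tensor(1)[OF t(1,2)] pd_test_fun_tensor(2)[OF t(1,2)] pd_test_fun_tensor(2)[OF t(3,2)]
      pd_test_fun_tensor(1)[OF t(1,4)]
    have "(LINT z|lborel. f2 z * (a' (fst z) * b (snd z))) = - (LINT z|lborel. f12 z * (a (fst z) * b (snd z)))"
      using w(3)[unfolded has_wpd_iff[OF f2 f12]] C1c_tensor[OF t(1,2)] p(1) by force
    moreover have "(LINT z|lborel. f z * (a' (fst z) * b' (snd z))) = - (LINT z|lborel. f2 z * (a' (fst z) * b (snd z)))"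
      using w(2)[unfolded has_wpd_iff[OF f f2]] C1c_tensor[OF t(3,2)] p(3) by force
    moreover have "(LINT z|lborel. f1 z * (a (fst z) * b' (snd z))) = - (LINT z|lborel. f21 z * (a (fst z) * b (snd z)))"
      using w(4)[unfolded has_wpd_iff[OF f1 f21]] C1c_tensor[OF t(1,2)] p(2) by force
    moreover have "(LINT z|lborel. f z * (a' (fst z) * b' (snd z))) = - (LINT z|lborel. f1 z * (a (fst z) * b' (snd z)))"
      using w(1)[unfolded has_wpd_iff[OF f f1]] C1c_tensor[OF t(1,4)] p(4) by force
    ultimately show "(LINT z|lborel. f12 z * (a (fst z) * b (snd z))) = (LINT z|lborel. f21 z * (a (fst z) * b (snd z)))"
      by simp
  qed (use L2_rep_props[OF f12] L2_rep_props[OF f21] in auto)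
qed

definition L2_rep_mat :: "(real^2^2) fld \<Rightarrow> (2 \<Rightarrow> 2 \<Rightarrow> real \<times> real \<Rightarrow> real) \<Rightarrow> bool" where
  "L2_rep_mat \<tau> F \<longleftrightarrow> (\<forall>i j. plane_rep (\<lambda>p. rep_fld \<tau> p $ i $ j) (F i j) \<and> integrable lborel (\<lambda>z. (F i j z)\<^sup>2))"

definition L2_rep_vec :: "(real^2) fld \<Rightarrow> (2 \<Rightarrow> real \<times> real \<Rightarrow> real) \<Rightarrow> bool" where
  "L2_rep_vec v D \<longleftrightarrow> (\<forall>i. plane_rep (\<lambda>p. rep_fld v p $ i) (D i) \<and> integrable lborel (\<lambda>z. (D i z)\<^sup>2))"

lemma measurable_vec_componentwise:
  fixes f :: "'a \<Rightarrow> 'b::euclidean_space ^ 'n"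
  assumes "\<And>i. (\<lambda>x. f x $ i) \<in> borel_measurable M"
  shows "f \<in> borel_measurable M"
  unfolding borel_measurable_euclidean_space[of f]
proof
  fix b :: "'b ^ 'n" assume "b \<in> Basis"
  then obtain i u where b: "b = axis i u" "u \<in> Basis" by (auto simp: Basis_vec_def)
  have [measurable]: "(\<lambda>x. f x $ i) \<in> borel_measurable M" by (rule assms)
  show "(\<lambda>x. f x \<bullet> b) \<in> borel_measurable M" unfolding b inner_axis by measurable
qed

lemma measurable_vec_nth:
  fixes f :: "'a \<Rightarrow> 'b::euclidean_space ^ 'n"
  assumes "f \<in> borel_measurable M"
  shows "(\<lambda>x. f x $ i) \<in> borel_measurable M"
proof -
  have "(\<lambda>v::'b ^ 'n. v $ i) \<in> borel_measurable borel" by (intro borel_measurable_continuous_onI continuous_intros)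
  from measurable_compose[OF assms this] show ?thesis .
qed

lemma norm_vec2_square: "(norm (v :: 'b::real_inner ^ 2))\<^sup>2 = (norm (v $ 1))\<^sup>2 + (norm (v $ 2))\<^sup>2"
  by (simp add: power2_norm_eq_inner inner_vec_def sum_2)

lemma plane_rep_square_integrable: "plane_rep F f \<Longrightarrow> integrable lborel (\<lambda>z. (f z)\<^sup>2) \<Longrightarrow> integrable (lebesgue_on K) (\<lambda>p. (F p)\<^sup>2)"
  using plane_rep_integral(2)[OF plane_rep_square, of F f] by simp

lemma L2_rep_vec_L2: 
  assumes "L2_rep_vec v D" shows "v \<in> L2"
proof -
  have "rep_fld v \<in> borel_measurable (lebesgue_on K)"
    using assms by (intro measurable_vec_componentwise) (auto simp: L2_rep_vec_def plane_rep_def)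
  moreover have "integrable (lebesgue_on K) (\<lambda>p. (rep_fld v p $ i)\<^sup>2)" for i
    using assms by (intro plane_rep_square_integrable[of _ "D i"]) (auto simp: L2_rep_vec_def)
  ultimately show ?thesis by (simp add: L2_def norm_vec2_square)
qed

lemma L2_rep_mat_L2:
  assumes "L2_rep_mat \<tau> F" shows "\<tau> \<in> L2"
proof -
  have "rep_fld \<tau> \<in> borel_measurable (lebesgue_on K)"
    using assms by (intro measurable_vec_componentwise) (auto simp: L2_rep_mat_def plane_rep_def)
  moreover have "integrable (lebesgue_on K) (\<lambda>p. (rep_fld \<tau> p $ i $ j)\<^sup>2)" for i j
    using assms by (intro plane_rep_square_integrable[of _ "F i j"]) (auto simp: L2_rep_mat_def)
  ultimately show ?thesis by (simp add: L2_def norm_vec2_square)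
qed

lemma L2_rep_vec_exists:
  assumes "v \<in> L2" obtains D where "L2_rep_vec v D"
proof -
  have m: "rep_fld v \<in> borel_measurable (lebesgue_on K)" and i: "integrable (lebesgue_on K) (\<lambda>p. (norm (rep_fld v p))\<^sup>2)"
    using assms by (auto simp: L2_def)
  have "\<exists>d. plane_rep (\<lambda>p. rep_fld v p $ i) d \<and> integrable lborel (\<lambda>z. (d z)\<^sup>2)" for i
  proof -
    have mi [measurable]: "(\<lambda>p. rep_fld v p $ i) \<in> borel_measurable (lebesgue_on K)" by (rule measurable_vec_nth[OF m])
    obtain d where d: "plane_rep (\<lambda>p. rep_fld v p $ i) d" using plane_rep_exists[OF mi] by blast
    have "integrable (lebesgue_on K) (\<lambda>p. (rep_fld v p $ i)\<^sup>2)"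
    proof (rule Bochner_Integration.integrable_bound[OF i])
      show "AE p in lebesgue_on K. norm ((rep_fld v p $ i)\<^sup>2) \<le> norm ((norm (rep_fld v p))\<^sup>2)"
        using exhaust_2[of i] by (intro AE_I2) (auto simp: norm_vec2_square)
    qed measurable
    then show ?thesis using d plane_rep_integral(2)[OF plane_rep_square[OF d]] by blast
  qed
  then obtain D where "\<And>i. plane_rep (\<lambda>p. rep_fld v p $ i) (D i) \<and> integrable lborel (\<lambda>z. (D i z)\<^sup>2)" by metis
  then have "L2_rep_vec v D" by (simp add: L2_rep_vec_def)
  then show ?thesis ..
qed

lemma L2_rep_vec_props: "L2_rep_vec v D \<Longrightarrow> integrable lborel (D i) \<and> (\<forall>z. z \<notin> Q \<longrightarrow> D i z = 0) \<and> D i \<in> borel_measurable borel"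
  unfolding L2_rep_vec_def plane_rep_def by (blast intro: integrable_if_square_integrable)

lemma L2_rep_mat_props: "L2_rep_mat \<tau> F \<Longrightarrow> integrable lborel (F i j) \<and> (\<forall>z. z \<notin> Q \<longrightarrow> F i j z = 0) \<and> F i j \<in> borel_measurable borel"
  unfolding L2_rep_mat_def plane_rep_def by (blast intro: integrable_if_square_integrable)

lemma L2_rep_vec_eqI:
  assumes "L2_rep_vec u D" "L2_rep_vec v E" "\<And>i. AE z in lborel. D i z = E i z"
  shows "u = v"
proof (rule fld_eqI)
  have "AE p in lebesgue_on K. rep_fld u p $ i = rep_fld v p $ i" for i
    using assms by (intro plane_rep_AE_eq[of _ "D i" _ "E i"]) (auto simp: L2_rep_vec_def)
  from this[of 1] this[of 2] show "AE p in lebesgue_on K. rep_fld u p = rep_fld v p"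
    by eventually_elim (simp add: vec_eq_iff forall_2)
qed

lemma L2_rep_mat_eqI:
  assumes "L2_rep_mat u D" "L2_rep_mat v E" "\<And>i j. AE z in lborel. D i j z = E i j z"
  shows "u = v"
proof (rule fld_eqI)
  have "AE p in lebesgue_on K. rep_fld u p $ i $ j = rep_fld v p $ i $ j" for i j
    using assms by (intro plane_rep_AE_eq[of _ "D i j" _ "E i j"]) (auto simp: L2_rep_mat_def)
  from this[of 1 1] this[of 1 2] this[of 2 1] this[of 2 2] show "AE p in lebesgue_on K. rep_fld u p = rep_fld v p"
    by eventually_elim (simp add: vec_eq_iff forall_2)
qed

lemma L2_rep_mat_add:
  assumes "L2_rep_mat u D" "L2_rep_mat v E" shows "L2_rep_mat (u + v) (\<lambda>i j z. D i j z + E i j z)"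
  unfolding L2_rep_mat_def
proof (intro allI conjI)
  fix i j
  show "plane_rep (\<lambda>p. rep_fld (u + v) p $ i $ j) (\<lambda>z. D i j z + E i j z)"
    using rep_fld_add[of u v] assms unfolding L2_rep_mat_def
    by (intro plane_rep_cong_AE[OF plane_rep_add[of "\<lambda>p. rep_fld u p $ i $ j" _ "\<lambda>p. rep_fld v p $ i $ j"]]) (auto elim: eventually_mono)
  show "integrable lborel (\<lambda>z. (D i j z + E i j z)\<^sup>2)"
    using assms by (intro square_add_integrable) (auto simp: L2_rep_mat_def plane_rep_def)
qed

lemma L2_rep_mat_scaleR:
  assumes "L2_rep_mat u D" shows "L2_rep_mat (c *\<^sub>R u) (\<lambda>i j z. c * D i j z)"
  unfolding L2_rep_mat_def
proof (intro allI conjI)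
  fix i j
  show "plane_rep (\<lambda>p. rep_fld (c *\<^sub>R u) p $ i $ j) (\<lambda>z. c * D i j z)"
    using rep_fld_scaleR[of c u] assms unfolding L2_rep_mat_def
    by (intro plane_rep_cong_AE[OF plane_rep_cmult[of "\<lambda>p. rep_fld u p $ i $ j"]]) (auto elim: eventually_mono)
  show "integrable lborel (\<lambda>z. (c * D i j z)\<^sup>2)"
    using assms by (auto simp: L2_rep_mat_def power_mult_distrib)
qed

lemma L2_rep_vec_on_K:
  assumes "\<And>i. continuous_on (closure K) (\<lambda>p. v p $ i)"
  shows "L2_rep_vec (on_K v) (\<lambda>i z. indicator Q z * (v (vec2 z) $ i))"
  unfolding L2_rep_vec_def
proof (intro allI conjI)
  fix i
  show "plane_rep (\<lambda>p. rep_fld (on_K v) p $ i) (\<lambda>z. indicator Q z * (v (vec2 z) $ i))"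
    using rep_on_K_AE[of v]
    by (intro plane_rep_cong_AE[OF plane_rep_continuous(1)[OF assms[of i]]]) (auto elim: eventually_mono)
qed (rule plane_rep_continuous(2)[OF assms])

lemma L2_rep_mat_on_K:
  assumes "\<And>i j. continuous_on (closure K) (\<lambda>p. v p $ i $ j)"
  shows "L2_rep_mat (on_K v) (\<lambda>i j z. indicator Q z * (v (vec2 z) $ i $ j))"
  unfolding L2_rep_mat_def
proof (intro allI conjI)
  fix i j
  show "plane_rep (\<lambda>p. rep_fld (on_K v) p $ i $ j) (\<lambda>z. indicator Q z * (v (vec2 z) $ i $ j))"
    using rep_on_K_AE[of v]
    by (intro plane_rep_cong_AE[OF plane_rep_continuous(1)[OF assms[of i j]]]) (auto elim: eventually_mono)
qed (rule plane_rep_continuous(2)[OF assms])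

lemma L2_rep_mat_row:
  assumes "L2_rep_mat \<tau> F" "\<psi> \<in> C1"
  shows "plane_rep (\<lambda>p. (rep_fld \<tau> p $ i) \<bullet> grad \<psi> p) (\<lambda>z. F i 1 z * pd 1 \<psi> (vec2 z) + F i 2 z * pd 2 \<psi> (vec2 z))"
proof -
  have "plane_rep (\<lambda>p. rep_fld \<tau> p $ i $ 1 * pd 1 \<psi> p + rep_fld \<tau> p $ i $ 2 * pd 2 \<psi> p)
     (\<lambda>z. F i 1 z * pd 1 \<psi> (vec2 z) + F i 2 z * pd 2 \<psi> (vec2 z))"
    using assms(1) C1_partial(5)[OF assms(2)] by (intro plane_rep_add plane_rep_mult_continuous) (auto simp: L2_rep_mat_def)
  then show ?thesis by (simp add: inner_vec_def sum_2 grad_def)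
qed

lemma has_wdiv_iff:
  assumes \<tau>: "L2_rep_mat \<tau> F" and d: "L2_rep_vec d D"
  shows "has_wdiv \<tau> d \<longleftrightarrow> (\<forall>i. \<forall>\<psi>\<in>C1c. (LINT z|lborel. F i 1 z * pd 1 \<psi> (vec2 z) + F i 2 z * pd 2 \<psi> (vec2 z))
    = - (LINT z|lborel. D i z * \<psi> (vec2 z)))"
proof -
  have "(LINT p|lebesgue_on K. (rep_fld \<tau> p $ i) \<bullet> grad \<psi> p) = (LINT z|lborel. F i 1 z * pd 1 \<psi> (vec2 z) + F i 2 z * pd 2 \<psi> (vec2 z))"
    if "\<psi> \<in> C1c" for i \<psi> by (rule plane_rep_integral(1)[OF L2_rep_mat_row[OF \<tau> C1c_C1[OF that]]])
  moreover have "(LINT p|lebesgue_on K. rep_fld d p $ i * \<psi> p) = (LINT z|lborel. D i z * \<psi> (vec2 z))"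
    if "\<psi> \<in> C1c" for i \<psi>
    using d C1_partial(6)[OF C1c_C1[OF that]]
    by (intro plane_rep_integral(1) plane_rep_mult_continuous) (auto simp: L2_rep_vec_def)
  ultimately show ?thesis using L2_rep_mat_L2[OF \<tau>] L2_rep_vec_L2[OF d] by (simp add: has_wdiv_def)
qed

lemma has_wdiv_unique:
  assumes "has_wdiv \<tau> d" "has_wdiv \<tau> e"
  shows "d = e"
proof -
  obtain D where D: "L2_rep_vec d D" using assms L2_rep_vec_exists by (auto simp: has_wdiv_def)
  obtain E where E: "L2_rep_vec e E" using assms L2_rep_vec_exists by (auto simp: has_wdiv_def)
  show ?thesis
  proof (rule L2_rep_vec_eqI[OF D E tensor_test_unique])
    fix i a a' b b' a'' b'' assume t: "test_fun a a'" "test_fun b b'"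
    let ?\<psi> = "\<lambda>p::real^2. a (p $ 1) * b (p $ 2)"
    note \<psi> = C1c_tensor[OF t]
    have "(LINT p|lebesgue_on K. rep_fld d p $ i * ?\<psi> p) = (LINT z|lborel. D i z * ?\<psi> (vec2 z))"
      using D C1_partial(6)[OF C1c_C1[OF \<psi>]]
      by (intro plane_rep_integral(1) plane_rep_mult_continuous) (auto simp: L2_rep_vec_def)
    moreover have "(LINT p|lebesgue_on K. rep_fld e p $ i * ?\<psi> p) = (LINT z|lborel. E i z * ?\<psi> (vec2 z))"
      using E C1_partial(6)[OF C1c_C1[OF \<psi>]]
      by (intro plane_rep_integral(1) plane_rep_mult_continuous) (auto simp: L2_rep_vec_def)
    moreover have "(LINT p|lebesgue_on K. rep_fld d p $ i * ?\<psi> p) = (LINT p|lebesgue_on K. rep_fld e p $ i * ?\<psi> p)"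
    proof -
      have "(LINT p|lebesgue_on K. (rep_fld \<tau> p $ i) \<bullet> grad ?\<psi> p) = - (LINT p|lebesgue_on K. rep_fld d p $ i * ?\<psi> p)"
        using assms(1) \<psi> unfolding has_wdiv_def by blast
      moreover have "(LINT p|lebesgue_on K. (rep_fld \<tau> p $ i) \<bullet> grad ?\<psi> p) = - (LINT p|lebesgue_on K. rep_fld e p $ i * ?\<psi> p)"
        using assms(2) \<psi> unfolding has_wdiv_def by blast
      ultimately show ?thesis by linarith
    qed
    ultimately show "(LINT z|lborel. D i z * (a (fst z) * b (snd z))) = (LINT z|lborel. E i z * (a (fst z) * b (snd z)))"
      by simp
  qed (use L2_rep_vec_props[OF D] L2_rep_vec_props[OF E] in auto)
qed

lemma wdiv_eq: "has_wdiv \<tau> d \<Longrightarrow> wdiv \<tau> = d"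
  unfolding wdiv_def using has_wdiv_unique by blast

section \<open>Normal traces\<close>

text \<open>The entries \<open>P i c\<close> are parametrised by the coordinate that varies along the i-th edge,
  not by its arc length.\<close>

definition bd_poly_fun :: "(4 \<Rightarrow> 2 \<Rightarrow> real poly) \<Rightarrow> real^2 \<Rightarrow> real^2" where
  "bd_poly_fun P p = (\<chi> c. if p $ 1 = 0 then poly (P 1 c) (p $ 2) else if p $ 2 = 0 then poly (P 2 c) (p $ 1)
     else if p $ 1 = 1 then poly (P 3 c) (p $ 2) else poly (P 4 c) (p $ 1))"

definition bd_poly :: "(4 \<Rightarrow> 2 \<Rightarrow> real poly) \<Rightarrow> (real^2) bdfld" where
  "bd_poly P = on_bd (bd_poly_fun P)"

definition edge_coords :: "4 \<Rightarrow> real \<Rightarrow> real \<times> real" where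
  "edge_coords j s = (if j = 1 then (0, s) else if j = 2 then (s, 0) else if j = 3 then (1, s) else (s, 1))"

definition edge_param :: "4 \<Rightarrow> real \<Rightarrow> real" where
  "edge_param j t = (if j = 1 \<or> j = 4 then 1 - t else t)"

lemma edge_eq: "edge j t = vec2 (edge_coords j (edge_param j t))"
  using exhaust_4[of j]
  by (elim disjE) (simp_all add: edge_def vertex_def edge_coords_def edge_param_def vec_eq_iff forall_2)

lemma bd_poly_fun_edge: "0 < t \<Longrightarrow> t < 1 \<Longrightarrow> bd_poly_fun P (edge j t) $ c = poly (P j c) (edge_param j t)"
  using exhaust_4[of j] by (elim disjE) (simp_all add: edge_eq bd_poly_fun_def edge_coords_def edge_param_def)

lemma rep_on_bd: "ae_eq_bd (rep_bdfld (on_bd f)) f"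
  by (simp add: bdfld.abs_eq_iff[symmetric] Quotient3_abs_rep[OF Quotient3_bdfld])

lemma on_bd_eq_iff: "on_bd f = on_bd g \<longleftrightarrow> ae_eq_bd f g"
  by (rule bdfld.abs_eq_iff)

lemma bdfld_eqI: "ae_eq_bd (rep_bdfld u) (rep_bdfld v) \<Longrightarrow> u = v"
  using on_bd_eq_iff[of "rep_bdfld u" "rep_bdfld v"] Quotient3_abs_rep[OF Quotient3_bdfld] by metis

lemma AE_01_iff: "(AE t in lebesgue_on {0..1::real}. P t) \<longleftrightarrow> (AE t in lborel. t \<in> {0<..<1} \<longrightarrow> P t)"
proof -
  have "(AE t in lebesgue_on {0..1::real}. P t) \<longleftrightarrow> (AE t in lborel. t \<in> {0..1} \<longrightarrow> P t)"
    by (simp add: AE_restrict_space_iff AE_completion_iff)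
  also have "\<dots> \<longleftrightarrow> (AE t in lborel. t \<in> {0<..<1} \<longrightarrow> P t)"
  proof
    assume "AE t in lborel. t \<in> {0<..<1} \<longrightarrow> P t"
    then show "AE t in lborel. t \<in> {0..1} \<longrightarrow> P t"
      using AE_lborel_singleton[of 0] AE_lborel_singleton[of 1] by eventually_elim auto
  qed (auto elim: eventually_mono)
  finally show ?thesis .
qed

lemma integral_01_continuous:
  fixes f g :: "real \<Rightarrow> real"
  assumes g: "continuous_on UNIV g" and ae: "AE t in lebesgue_on {0..1}. g t = f t"
  shows "(LINT t|lebesgue_on {0..1}. f t) = I01 g" "f \<in> borel_measurable (lebesgue_on {0..1})"
    "integrable (lebesgue_on {0..1}) f"
proof -
  have gb [measurable]: "g \<in> borel_measurable borel" using g by (rule borel_measurable_continuous_onI)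
  then have gm: "g \<in> borel_measurable (lebesgue_on {0..1})"
    by (intro measurable_restrict_space1 measurable_completion) simp
  show f: "f \<in> borel_measurable (lebesgue_on {0..1})"
    using measurable_lebesgue_on_AE[OF gm _ ae] by simp
  have ae2: "AE t in lborel. indicator {0..1} t * g t = indicator {0<..<1} t * g t"
    using AE_lborel_singleton[of 0] AE_lborel_singleton[of 1] by eventually_elim (auto simp: indicator_def)
  have "(LINT t|lebesgue_on {0..1}. f t) = (LINT t|lebesgue_on {0..1}. g t)"
    using ae by (intro integral_cong_AE f gm) (auto elim: eventually_mono)
  also have "\<dots> = (LINT t|lebesgue. indicator {0..1} t * g t)"
    by (subst integral_restrict_space) auto
  also have "\<dots> = (LINT t|lborel. indicator {0..1} t * g t)" by (rule integral_completion) simp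
  also have "\<dots> = I01 g" unfolding I01_def by (rule integral_cong_AE[OF _ _ ae2]) auto
  finally show "(LINT t|lebesgue_on {0..1}. f t) = I01 g" .
  have "integrable lborel (\<lambda>t. indicator {0..1} t * g t)"
    using integrable_01[OF g] by (subst integrable_cong_AE[OF _ _ ae2]) auto
  then have "integrable lebesgue (\<lambda>t. indicator {0..1} t * g t)"
    by (subst integrable_completion) auto
  then have "integrable (lebesgue_on {0..1}) g"
    by (subst integrable_restrict_space) auto
  then show "integrable (lebesgue_on {0..1}) f"
    by (subst integrable_cong_AE[OF f gm]) (use ae in \<open>auto elim: eventually_mono\<close>)
qed

lemma bd_poly_edge_AE: "AE t in lebesgue_on {0..1}. poly (P j c) (edge_param j t) = rep_bdfld (bd_poly P) (edge j t) $ c"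
proof -
  have "AE t in lebesgue_on {0..1}. rep_bdfld (bd_poly P) (edge j t) = bd_poly_fun P (edge j t)"
    using rep_on_bd[of "bd_poly_fun P"] by (simp add: ae_eq_bd_def bd_poly_def)
  then show ?thesis unfolding AE_01_iff by eventually_elim (auto simp: bd_poly_fun_edge)
qed

lemma continuous_edge_param: "continuous_on S (edge_param j)"
  unfolding edge_param_def by (cases "j = 1 \<or> j = 4") (auto intro!: continuous_intros)

lemma bd_poly_L2: "bd_poly P \<in> L2_bd"
proof -
  have c: "continuous_on UNIV (\<lambda>t. poly (P j c) (edge_param j t))" for j c
    by (intro continuous_on_poly continuous_edge_param)
  have m: "(\<lambda>t. rep_bdfld (bd_poly P) (edge j t)) \<in> borel_measurable (lebesgue_on {0..1})" for j
    by (intro measurable_vec_componentwise integral_01_continuous(2)[OF c bd_poly_edge_AE])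
  have "integrable (lebesgue_on {0..1}) (\<lambda>t. (rep_bdfld (bd_poly P) (edge j t) $ c)\<^sup>2)" for j c
  proof (rule integral_01_continuous(3))
    show "continuous_on UNIV (\<lambda>t. (poly (P j c) (edge_param j t))\<^sup>2)" by (intro continuous_intros c)
    show "AE t in lebesgue_on {0..1}. (poly (P j c) (edge_param j t))\<^sup>2 = (rep_bdfld (bd_poly P) (edge j t) $ c)\<^sup>2"
      using bd_poly_edge_AE[of P j c] by eventually_elim simp
  qed
  then show ?thesis using m by (simp add: L2_bd_def norm_vec2_square)
qed

lemma I01_edge_param: "I01 (\<lambda>t. g (edge_param j t)) = I01 g"
  unfolding edge_param_def using I01_reflect[of g] by (cases "j = 1 \<or> j = 4") auto

lemma bd_poly_edge_integral:
  assumes \<psi>: "continuous_on UNIV \<psi>"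
  shows "(LINT t|lebesgue_on {0..1}. rep_bdfld (bd_poly P) (edge j t) $ i * \<psi> (edge j t)) =
    I01 (\<lambda>s. poly (P j i) s * \<psi> (vec2 (edge_coords j s)))"
proof -
  have ce: "continuous_on UNIV (edge_coords j)"
    using exhaust_4[of j] by (elim disjE) (auto simp: edge_coords_def intro!: continuous_intros)
  have c: "continuous_on UNIV (\<lambda>s. poly (P j i) s * \<psi> (vec2 (edge_coords j s)))"
    by (intro continuous_on_mult continuous_on_compose2[OF \<psi>] continuous_on_vec2 ce continuous_on_poly continuous_on_id subset_UNIV)
  have "(LINT t|lebesgue_on {0..1}. rep_bdfld (bd_poly P) (edge j t) $ i * \<psi> (edge j t)) =
     I01 (\<lambda>t. poly (P j i) (edge_param j t) * \<psi> (vec2 (edge_coords j (edge_param j t))))"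
  proof (rule integral_01_continuous(1))
    show "continuous_on UNIV (\<lambda>t. poly (P j i) (edge_param j t) * \<psi> (vec2 (edge_coords j (edge_param j t))))"
      by (rule continuous_on_compose2[OF c continuous_edge_param]) auto
    show "AE t in lebesgue_on {0..1}. poly (P j i) (edge_param j t) * \<psi> (vec2 (edge_coords j (edge_param j t))) = rep_bdfld (bd_poly P) (edge j t) $ i * \<psi> (edge j t)"
      using bd_poly_edge_AE[of P j i] by eventually_elim (simp add: edge_eq)
  qed
  then show ?thesis using I01_edge_param[of "\<lambda>s. poly (P j i) s * \<psi> (vec2 (edge_coords j s))" j] by simp
qed

lemma has_ntrace_bdpI:
  assumes \<tau>: "L2_rep_mat \<tau> F" and d: "L2_rep_vec d D" and wd: "has_wdiv \<tau> d"
    and eq: "\<And>i \<psi>. \<psi> \<in> C1 \<Longrightarrow> (LINT z|lborel. F i 1 z * pd 1 \<psi> (vec2 z) + F i 2 z * pd 2 \<psi> (vec2 z)) + (LINT z|lborel. D i z * \<psi> (vec2 z))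
      = I01 (\<lambda>s. poly (P 1 i) s * \<psi> (vec2 (0, s))) + I01 (\<lambda>s. poly (P 2 i) s * \<psi> (vec2 (s, 0)))
      + I01 (\<lambda>s. poly (P 3 i) s * \<psi> (vec2 (1, s))) + I01 (\<lambda>s. poly (P 4 i) s * \<psi> (vec2 (s, 1)))"
  shows "has_ntrace \<tau> (bd_poly P)"
proof -
  have "(LINT p|lebesgue_on K. (rep_fld \<tau> p $ i) \<bullet> grad \<psi> p + rep_fld d p $ i * \<psi> p) =
     (\<Sum>j\<in>UNIV. LINT t|lebesgue_on {0..1}. rep_bdfld (bd_poly P) (edge j t) $ i * \<psi> (edge j t))"
    if \<psi>: "\<psi> \<in> C1" for i \<psi>
  proof -
    have c1: "plane_rep (\<lambda>p. (rep_fld \<tau> p $ i) \<bullet> grad \<psi> p) (\<lambda>z. F i 1 z * pd 1 \<psi> (vec2 z) + F i 2 z * pd 2 \<psi> (vec2 z))"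
      by (rule L2_rep_mat_row[OF \<tau> \<psi>])
    have c2: "plane_rep (\<lambda>p. rep_fld d p $ i * \<psi> p) (\<lambda>z. D i z * \<psi> (vec2 z))"
      using d C1_partial(6)[OF \<psi>] by (intro plane_rep_mult_continuous) (auto simp: L2_rep_vec_def)
    have I: "integrable lborel (\<lambda>z. F i j z * pd j \<psi> (vec2 z))" "integrable lborel (\<lambda>z. D i z * \<psi> (vec2 z))" for j
      using L2_rep_mat_props[OF \<tau>] L2_rep_vec_props[OF d] C1_partial(3,4)[OF \<psi>] by (auto intro!: integrable_Q_mult)
    have "(LINT p|lebesgue_on K. (rep_fld \<tau> p $ i) \<bullet> grad \<psi> p + rep_fld d p $ i * \<psi> p) =
      (LINT z|lborel. F i 1 z * pd 1 \<psi> (vec2 z) + F i 2 z * pd 2 \<psi> (vec2 z)) + (LINT z|lborel. D i z * \<psi> (vec2 z))"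
      using plane_rep_integral(1)[OF plane_rep_add[OF c1 c2]] I by simp
    also have "\<dots> = (\<Sum>j\<in>UNIV. LINT t|lebesgue_on {0..1}. rep_bdfld (bd_poly P) (edge j t) $ i * \<psi> (edge j t))"
      unfolding eq[OF \<psi>] bd_poly_edge_integral[OF C1_partial(6)[OF \<psi>]] sum_4 by (simp add: edge_coords_def)
    finally show ?thesis .
  qed
  with wd bd_poly_L2[of P] show ?thesis unfolding has_ntrace_def by blast
qed

lemma bump_AE_0_interval:
  fixes f :: "real \<Rightarrow> real"
  assumes f: "integrable (lebesgue_on {0..1}) f"
    and 0: "\<And>n c d. 0 < c \<Longrightarrow> c < d \<Longrightarrow> d < 1 \<Longrightarrow> (LINT t|lebesgue_on {0..1}. f t * bump n c d t) = 0"
  shows "AE t in lebesgue_on {0..1}. f t = 0"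
proof -
  have "integrable lebesgue (\<lambda>t. indicator {0..1} t *\<^sub>R f t)"
    using f by (subst (asm) integrable_restrict_space) auto
  then have m: "(\<lambda>t. indicator {0..1} t * f t) \<in> borel_measurable lebesgue" by auto
  obtain g where gb: "g \<in> borel_measurable lborel" and gae: "AE t in lborel. indicator {0..1} t * f t = g t"
    using completion_ex_borel_measurable_real[OF m] by auto
  have [measurable]: "g \<in> borel_measurable borel" using gb by simp
  have bm [measurable]: "bump n c d \<in> borel_measurable borel" for n c d
    using continuous_bump by (rule borel_measurable_continuous_onI)
  have ig: "integrable lborel g"
  proof -
    have "integrable lebesgue (\<lambda>t. indicator {0..1} t * f t)" using f by (subst (asm) integrable_restrict_space) auto
    then have "integrable lebesgue g"
      by (subst (asm) integrable_cong_AE[of _ _ g]) (use gae m in \<open>auto simp: AE_completion intro: measurable_completion\<close>)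
    then show ?thesis by (simp add: integrable_completion)
  qed
  define F where "F z = (indicator {0<..<1} (fst z) * g (fst z)) * indicator {0<..<1} (snd z)" for z :: "real \<times> real"
  have ig0: "integrable lborel (\<lambda>t. indicator {0<..<1} t * g t)"
    by (rule Bochner_Integration.integrable_bound[OF ig]) (auto simp: indicator_def)
  have i1: "integrable lborel (indicator {0<..<1} :: real \<Rightarrow> real)" by (rule integrable_real_indicator) auto
  have "AE z in lborel. F z = 0"
  proof (rule tensor_bump_AE_0)
    show "integrable lborel F" unfolding F_def by (rule integrable_tensor[OF ig0 i1])
    show "F z = 0" if "z \<notin> Q" for z using that by (auto simp: F_def Q_iff indicator_def)
    fix n :: nat and c d c' d' :: real
    assume b: "0 < c" "c < d" "d < 1" "0 < c'" "c' < d'" "d' < 1"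
    have B_der: "\<bar>bump n c d t\<bar> \<le> 1" for t using bump_bounds[of c d n t] b by auto
    have igb: "integrable lborel (\<lambda>t. g t * bump n c d t)"
      by (rule Bochner_Integration.integrable_bound[OF ig]) (auto simp: abs_mult intro!: mult_left_le B_der)
    have ib: "integrable lborel (bump n c' d')"
      by (rule integrable_compact_support_01[OF continuous_bump]) (use b in \<open>auto simp: bump_outside\<close>)
    have "(LINT t|lebesgue_on {0..1}. f t * bump n c d t) = (LINT t|lebesgue. (indicator {0..1} t * f t) * bump n c d t)"
      by (subst integral_restrict_space) (auto simp: mult_ac)
    also have "\<dots> = (LINT t|lebesgue. g t * bump n c d t)"
    proof (rule integral_cong_AE)
      show "AE t in lebesgue. indicator {0..1} t * f t * bump n c d t = g t * bump n c d t"
        using AE_completion[OF gae] by eventually_elim simp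
      have "bump n c d \<in> borel_measurable lebesgue" by (intro measurable_completion) simp
      then show "(\<lambda>t. indicator {0..1} t * f t * bump n c d t) \<in> borel_measurable lebesgue"
        using borel_measurable_times[OF m] by blast
    qed (intro measurable_completion, simp)
    also have "\<dots> = (LINT t|lborel. g t * bump n c d t)" by (rule integral_completion) simp
    finally have g0: "(LINT t|lborel. g t * bump n c d t) = 0" using 0[of c d n] b by simp
    have eq: "F z * (bump n c d (fst z) * bump n c' d' (snd z)) = (g (fst z) * bump n c d (fst z)) * bump n c' d' (snd z)" for z
      using b by (cases "c < fst z \<and> fst z < d"; cases "c' < snd z \<and> snd z < d'") (auto simp: F_def indicator_def bump_outside)
    show "(LINT z|lborel. F z * (bump n c d (fst z) * bump n c' d' (snd z))) = 0"
      unfolding eq using integral_tensor[OF igb ib] g0 by simp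
  qed
  then have "AE x in lborel. AE y in lborel. F (x, y) = 0" by (rule plane_AE)
  then have "AE x in lborel. x \<in> {0<..<1} \<longrightarrow> g x = 0"
  proof eventually_elim
    case (elim x)
    show ?case
    proof
      assume x: "x \<in> {0<..<1}"
      show "g x = 0"
      proof (rule ccontr)
        assume "g x \<noteq> 0"
        with elim x have "AE y in lborel. y \<notin> {0<..<1::real}" by (auto simp: F_def indicator_def elim: eventually_mono)
        then have "emeasure lborel {0<..<1::real} = 0" by (subst (asm) AE_iff_measurable[of "{0<..<1}"]) auto
        then show False by simp
      qed
    qed
  qed
  then show ?thesis unfolding AE_01_iff using gae by eventually_elim (auto simp: indicator_def)
qed

definition edge_test :: "4 \<Rightarrow> nat \<Rightarrow> real \<Rightarrow> real \<Rightarrow> real^2 \<Rightarrow> real" where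
  "edge_test j n c d p = (if j = 1 then (1 - p $ 1) * bump n c d (1 - p $ 2)
     else if j = 2 then bump n c d (p $ 1) * (1 - p $ 2)
     else if j = 3 then (p $ 1) * bump n c d (p $ 2) else bump n c d (1 - p $ 1) * p $ 2)"

lemma edge_test_C1: "edge_test j n c d \<in> C1"
proof -
  obtain b' b'' where b: "\<And>t. (bump n c d has_real_derivative b' t) (at t)" "\<And>t. (b' has_real_derivative b'' t) (at t)"
    using bump_C2 by metis
  have cb: "continuous_on UNIV b'" using b(2) by (auto intro!: DERIV_isCont continuous_at_imp_continuous_on)
  have r: "((\<lambda>t. bump n c d (1 - t)) has_real_derivative - b' (1 - t)) (at t)" for t
  proof -
    have "((\<lambda>t. 1 - t) has_real_derivative -1) (at t)" by (auto intro!: derivative_eq_intros)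
    from DERIV_chain2[OF b(1) this] show ?thesis by simp
  qed
  have cr: "continuous_on UNIV (\<lambda>t. - b' (1 - t))"
    by (intro continuous_intros continuous_on_compose2[OF cb]) auto
  have l: "((\<lambda>t. 1 - t) has_real_derivative -1) (at t)" "((\<lambda>t. t) has_real_derivative 1) (at t)" for t :: real
    by (auto intro!: derivative_eq_intros)
  have eq: "edge_test 1 n c d = (\<lambda>p. (1 - p $ 1) * bump n c d (1 - p $ 2))" "edge_test 2 n c d = (\<lambda>p. bump n c d (p $ 1) * (1 - p $ 2))"
    "edge_test 3 n c d = (\<lambda>p. (p $ 1) * bump n c d (p $ 2))" "edge_test 4 n c d = (\<lambda>p. bump n c d (1 - p $ 1) * p $ 2)"
    by (simp_all add: edge_test_def fun_eq_iff)
  have "edge_test 1 n c d \<in> C1" "edge_test 2 n c d \<in> C1" "edge_test 3 n c d \<in> C1" "edge_test 4 n c d \<in> C1"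
    unfolding eq by (rule C1_tensor(1)[OF l(1) _ r cr] C1_tensor(1)[OF b(1) cb l(1)] C1_tensor(1)[OF l(2) _ b(1) cb]
      C1_tensor(1)[OF r cr l(2)]; simp)+
  then show ?thesis using exhaust_4[of j] by auto
qed

lemma edge_test_edge:
  assumes "0 < c" "d < 1" "t \<in> {0..1}"
  shows "edge_test j n c d (edge i t) = (if i = j then bump n c d t else 0)"
proof -
  have "bump n c d 0 = 0" "bump n c d 1 = 0" using assms by (auto simp: bump_outside)
  then show ?thesis using exhaust_4[of i] exhaust_4[of j]
    by (elim disjE) (simp_all add: edge_test_def edge_eq edge_coords_def edge_param_def)
qed

lemma has_ntrace_unique:
  assumes "has_ntrace \<tau> m" "has_ntrace \<tau> m'"
  shows "m = m'"
proof (rule bdfld_eqI)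
  let ?r = "rep_bdfld m" and ?r' = "rep_bdfld m'"
  obtain d d' where d: "has_wdiv \<tau> d" "has_wdiv \<tau> d'"
    and id: "\<And>i \<psi>. \<psi> \<in> C1 \<Longrightarrow> (LINT p|lebesgue_on K. (rep_fld \<tau> p $ i) \<bullet> grad \<psi> p + (rep_fld d p $ i) * \<psi> p)
        = (\<Sum>j\<in>UNIV. LINT t|lebesgue_on {0..1}. (?r (edge j t) $ i) * \<psi> (edge j t))"
    and id': "\<And>i \<psi>. \<psi> \<in> C1 \<Longrightarrow> (LINT p|lebesgue_on K. (rep_fld \<tau> p $ i) \<bullet> grad \<psi> p + (rep_fld d' p $ i) * \<psi> p)
        = (\<Sum>j\<in>UNIV. LINT t|lebesgue_on {0..1}. (?r' (edge j t) $ i) * \<psi> (edge j t))"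
    using assms unfolding has_ntrace_def by blast
  have dd: "d' = d" using has_wdiv_unique d by blast
  have int: "integrable (lebesgue_on {0..1}) (\<lambda>t. rep_bdfld m (edge j t) $ i)" if "m \<in> L2_bd" for m :: "(real^2) bdfld" and i j
  proof -
    have m: "(\<lambda>t. rep_bdfld m (edge j t)) \<in> borel_measurable (lebesgue_on {0..1})"
      and sq: "integrable (lebesgue_on {0..1}) (\<lambda>t. (norm (rep_bdfld m (edge j t)))\<^sup>2)" using that by (auto simp: L2_bd_def)
    have "integrable (lebesgue_on {0..1}) (\<lambda>t. 1 + (norm (rep_bdfld m (edge j t)))\<^sup>2)"
      using sq integrable_restrict_space[of "{0..1::real}" lebesgue "\<lambda>_. 1::real"]
      by (intro Bochner_Integration.integrable_add finite_measure.integrable_const finite_measureI) (auto simp: emeasure_restrict_space)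
    then show ?thesis
    proof (rule Bochner_Integration.integrable_bound)
      show "AE t in lebesgue_on {0..1}. norm (rep_bdfld m (edge j t) $ i) \<le> norm (1 + (norm (rep_bdfld m (edge j t)))\<^sup>2)"
      proof (rule AE_I2)
        fix t
        have "norm (rep_bdfld m (edge j t) $ i) \<le> norm (rep_bdfld m (edge j t))" using component_le_norm_cart[of "rep_bdfld m (edge j t)" i] by simp
        also have "x \<le> 1 + x\<^sup>2" for x :: real
          using zero_le_power2[of "x - 1/2"] by (simp add: power2_eq_square algebra_simps)
        finally show "norm (rep_bdfld m (edge j t) $ i) \<le> norm (1 + (norm (rep_bdfld m (edge j t)))\<^sup>2)" by simp
      qed
    qed (rule measurable_vec_nth[OF m])
  qed
  have L: "m \<in> L2_bd" "m' \<in> L2_bd" using assms by (auto simp: has_ntrace_def)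
  have ae: "AE t in lebesgue_on {0..1}. ?r (edge j t) $ i - ?r' (edge j t) $ i = 0" for i j
  proof (rule bump_AE_0_interval)
    show "integrable (lebesgue_on {0..1}) (\<lambda>t. ?r (edge j t) $ i - ?r' (edge j t) $ i)"
      using int[OF L(1)] int[OF L(2)] by simp
    fix n :: nat and c d :: real assume b: "0 < c" "c < d" "d < 1"
    have test: "(\<Sum>k\<in>UNIV. LINT t|lebesgue_on {0..1}. (rep_bdfld m (edge k t) $ i) * edge_test j n c d (edge k t)) =
      (LINT t|lebesgue_on {0..1}. rep_bdfld m (edge j t) $ i * bump n c d t)" for m :: "(real^2) bdfld"
    proof -
      have "(LINT t|lebesgue_on {0..1}. (rep_bdfld m (edge k t) $ i) * edge_test j n c d (edge k t)) =
        (LINT t|lebesgue_on {0..1}. (if k = j then rep_bdfld m (edge j t) $ i * bump n c d t else 0))" for k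
        using b by (intro Bochner_Integration.integral_cong) (auto simp: edge_test_edge)
      then have "(\<Sum>k\<in>UNIV. LINT t|lebesgue_on {0..1}. (rep_bdfld m (edge k t) $ i) * edge_test j n c d (edge k t)) =
        (\<Sum>k\<in>UNIV. if k = j then LINT t|lebesgue_on {0..1}. rep_bdfld m (edge j t) $ i * bump n c d t else 0)"
        by (intro sum.cong) auto
      then show ?thesis by simp
    qed
    have B_der: "\<bar>bump n c d t\<bar> \<le> 1" for t using bump_bounds[of c d n t] b by auto
    have bm: "bump n c d \<in> borel_measurable (lebesgue_on {0..1})"
      by (intro measurable_restrict_space1 measurable_completion) (simp add: borel_measurable_continuous_onI continuous_bump)
    have ib: "integrable (lebesgue_on {0..1}) (\<lambda>t. rep_bdfld m (edge j t) $ i * bump n c d t)" if "m \<in> L2_bd" for m :: "(real^2) bdfld"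
      by (rule Bochner_Integration.integrable_bound[OF int[OF that, of j i]])
        (use int[OF that, of j i] bm in \<open>auto simp: abs_mult intro!: mult_left_le B_der\<close>)
    have "(LINT t|lebesgue_on {0..1}. ?r (edge j t) $ i * bump n c d t) = (LINT t|lebesgue_on {0..1}. ?r' (edge j t) $ i * bump n c d t)"
      using id[OF edge_test_C1[of j n c d], of i] id'[OF edge_test_C1[of j n c d], of i] dd test[of m] test[of m'] by simp
    then show "(LINT t|lebesgue_on {0..1}. (?r (edge j t) $ i - ?r' (edge j t) $ i) * bump n c d t) = 0"
      using ib[OF L(1)] ib[OF L(2)] by (simp add: left_diff_distrib)
  qed
  have "AE t in lebesgue_on {0..1}. ?r (edge j t) = ?r' (edge j t)" for j
    using ae[where i=1 and j=j] ae[where i=2 and j=j] by eventually_elim (simp add: vec_eq_iff forall_2)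
  then show "ae_eq_bd ?r ?r'" by (simp add: ae_eq_bd_def)
qed

lemma ntrace_eq: "has_ntrace \<tau> m \<Longrightarrow> ntrace \<tau> = m"
  unfolding ntrace_def using has_ntrace_unique by blast

lemma C1c_boundary:
  assumes "\<psi> \<in> C1c"
  shows "\<psi> (vec2 (0, s)) = 0" "\<psi> (vec2 (1, s)) = 0" "\<psi> (vec2 (s, 0)) = 0" "\<psi> (vec2 (s, 1)) = 0"
proof -
  have "\<psi> (vec2 z) = 0" if "z \<notin> Q" for z
    using assms that vec2_in_K[of z] unfolding C1c_def by blast
  then show "\<psi> (vec2 (0, s)) = 0" "\<psi> (vec2 (1, s)) = 0" "\<psi> (vec2 (s, 0)) = 0" "\<psi> (vec2 (s, 1)) = 0"
    by (auto simp: Q_iff)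
qed

lemma wdiv_ntraceI:
  assumes \<tau>: "L2_rep_mat \<tau> F" and d: "L2_rep_vec d D"
    and eq: "\<And>i \<psi>. \<psi> \<in> C1 \<Longrightarrow> (LINT z|lborel. F i 1 z * pd 1 \<psi> (vec2 z) + F i 2 z * pd 2 \<psi> (vec2 z)) + (LINT z|lborel. D i z * \<psi> (vec2 z))
      = I01 (\<lambda>s. poly (P 1 i) s * \<psi> (vec2 (0, s))) + I01 (\<lambda>s. poly (P 2 i) s * \<psi> (vec2 (s, 0)))
      + I01 (\<lambda>s. poly (P 3 i) s * \<psi> (vec2 (1, s))) + I01 (\<lambda>s. poly (P 4 i) s * \<psi> (vec2 (s, 1)))"
  shows "wdiv \<tau> = d" "ntrace \<tau> = bd_poly P"
proof -
  have wd: "has_wdiv \<tau> d"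
    unfolding has_wdiv_iff[OF \<tau> d]
  proof (intro allI ballI)
    fix i \<psi> assume \<psi>: "\<psi> \<in> C1c"
    have "I01 (\<lambda>s. 0) = 0" by (simp add: I01_def)
    then show "(LINT z|lborel. F i 1 z * pd 1 \<psi> (vec2 z) + F i 2 z * pd 2 \<psi> (vec2 z)) = - (LINT z|lborel. D i z * \<psi> (vec2 z))"
      using eq[OF C1c_C1[OF \<psi>], of i] by (simp add: C1c_boundary[OF \<psi>])
  qed
  then show "wdiv \<tau> = d" by (rule wdiv_eq)
  show "ntrace \<tau> = bd_poly P" by (rule ntrace_eq[OF has_ntrace_bdpI[OF \<tau> d wd eq]])
qed

lemma divergence_y:
  assumes F: "\<And>x y. ((\<lambda>y. F (x, y)) has_real_derivative f (x, y)) (at y)" and f: "continuous_on UNIV f"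
  shows "(LINT z|lborel. indicator Q z * f z) = I01 (\<lambda>x. F (x, 1) - F (x, 0))"
proof -
  have i: "integrable lborel (\<lambda>z. indicator Q z * f z)"
    by (rule integrable_Q_mult[OF _ _ f]) (auto intro!: integrable_real_indicator simp: emeasure_Q)
  have "(LINT z|lborel. indicator Q z * f z) = (LINT x|lborel. LINT y|lborel. indicator Q (x, y) * f (x, y))"
    using plane_fubini(3)[OF i] by simp
  also have "\<dots> = (LINT x|lborel. indicator {0<..<1} x * (F (x, 1) - F (x, 0)))"
  proof (rule Bochner_Integration.integral_cong[OF refl])
    fix x
    have "continuous_on UNIV (\<lambda>y. f (x, y))" by (intro continuous_on_compose2[OF f] continuous_intros) auto
    from I01_FTC[OF F this] have "I01 (\<lambda>y. f (x, y)) = F (x, 1) - F (x, 0)" .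
    moreover have "(LINT y|lborel. indicator Q (x, y) * f (x, y)) = (LINT y|lborel. indicator {0<..<1} x * (indicator {0<..<1} y * f (x, y)))"
      by (rule Bochner_Integration.integral_cong) (auto simp: Q_def indicator_def)
    ultimately show "(LINT y|lborel. indicator Q (x, y) * f (x, y)) = indicator {0<..<1} x * (F (x, 1) - F (x, 0))"
      by (simp add: I01_def)
  qed
  finally show ?thesis by (simp add: I01_def)
qed

lemma divergence_x:
  assumes F: "\<And>x y. ((\<lambda>x. F (x, y)) has_real_derivative f (x, y)) (at x)" and f: "continuous_on UNIV f"
  shows "(LINT z|lborel. indicator Q z * f z) = I01 (\<lambda>y. F (1, y) - F (0, y))"
proof -
  have [measurable]: "f \<in> borel_measurable borel" using f by (rule borel_measurable_continuous_onI)
  have c: "continuous_on UNIV (\<lambda>z. f (prod.swap z))"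
    by (intro continuous_on_compose2[OF f] continuous_on_swap) auto
  have ind: "indicator Q (prod.swap z) = (indicator Q z :: real)" for z by (auto simp: indicator_def Q_iff)
  have "(LINT z|lborel. indicator Q z * f (prod.swap z)) = I01 (\<lambda>y. F (1, y) - F (0, y))"
    using divergence_y[of "\<lambda>z. F (prod.swap z)" "\<lambda>z. f (prod.swap z)"] F c by simp
  then show ?thesis using plane_swap(1)[of "\<lambda>z. indicator Q z * f z"] by (simp add: ind)
qed

lemma smooth_wdiv_ntrace:
  fixes \<tau> :: "real^2 \<Rightarrow> real^2^2"
  assumes C1: "\<And>i j. (\<lambda>p. \<tau> p $ i $ j) \<in> C1"
    and P: "\<And>i s. poly (P 1 i) s = - (\<tau> (vec2 (0, s)) $ i $ 1)" "\<And>i s. poly (P 2 i) s = - (\<tau> (vec2 (s, 0)) $ i $ 2)"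
      "\<And>i s. poly (P 3 i) s = \<tau> (vec2 (1, s)) $ i $ 1" "\<And>i s. poly (P 4 i) s = \<tau> (vec2 (s, 1)) $ i $ 2"
  shows "wdiv (on_K \<tau>) = on_K (\<lambda>p. \<chi> i. pd 1 (\<lambda>p. \<tau> p $ i $ 1) p + pd 2 (\<lambda>p. \<tau> p $ i $ 2) p)"
    "ntrace (on_K \<tau>) = bd_poly P"
proof -
  let ?d = "\<lambda>p. \<chi> i. pd 1 (\<lambda>p. \<tau> p $ i $ 1) p + pd 2 (\<lambda>p. \<tau> p $ i $ 2) p"
  note c = C1_partial(3-6)[OF C1]
  have \<tau>: "L2_rep_mat (on_K \<tau>) (\<lambda>i j z. indicator Q z * (\<tau> (vec2 z) $ i $ j))"
    using c(4) by (intro L2_rep_mat_on_K) (auto intro: continuous_on_subset)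
  have d: "L2_rep_vec (on_K ?d) (\<lambda>i z. indicator Q z * (?d (vec2 z) $ i))"
    using c(3) by (intro L2_rep_vec_on_K) (auto intro!: continuous_intros intro: continuous_on_subset)
  have I: "integrable lborel (\<lambda>z. indicator Q z * \<phi> z)" if "continuous_on UNIV \<phi>" for \<phi> :: "real \<times> real \<Rightarrow> real"
    by (rule integrable_Q_mult[OF _ _ that]) (auto intro!: integrable_real_indicator simp: emeasure_Q)
  have eq: "(LINT z|lborel. indicator Q z * (\<tau> (vec2 z) $ i $ 1) * pd 1 \<psi> (vec2 z) + indicator Q z * (\<tau> (vec2 z) $ i $ 2) * pd 2 \<psi> (vec2 z))
       + (LINT z|lborel. indicator Q z * (?d (vec2 z) $ i) * \<psi> (vec2 z))
      = I01 (\<lambda>s. poly (P 1 i) s * \<psi> (vec2 (0, s))) + I01 (\<lambda>s. poly (P 2 i) s * \<psi> (vec2 (s, 0)))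
      + I01 (\<lambda>s. poly (P 3 i) s * \<psi> (vec2 (1, s))) + I01 (\<lambda>s. poly (P 4 i) s * \<psi> (vec2 (s, 1)))"
    if \<psi>: "\<psi> \<in> C1" for i \<psi>
  proof -
    note c\<psi> = C1_partial(3-6)[OF \<psi>]
    let ?t = "\<lambda>j z. \<tau> (vec2 z) $ i $ j" and ?t' = "\<lambda>j z. pd j (\<lambda>p. \<tau> p $ i $ j) (vec2 z)"
      and ?p = "\<lambda>z. \<psi> (vec2 z)" and ?p' = "\<lambda>j z. pd j \<psi> (vec2 z)"
    have cc: "continuous_on UNIV (\<lambda>z. ?t j z * ?p' j z + ?t' j z * ?p z)" for j
      by (intro continuous_intros c(1,2) c\<psi>(1,2))
    have "(LINT z|lborel. indicator Q z * (?t 1 z * ?p' 1 z + ?t' 1 z * ?p z)) = I01 (\<lambda>y. ?t 1 (1, y) * ?p (1, y) - ?t 1 (0, y) * ?p (0, y))"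
      using DERIV_mult[OF C1_partial(1)[OF C1] C1_partial(1)[OF \<psi>]] 
      by (intro divergence_x cc) (simp add: algebra_simps)
    moreover have "(LINT z|lborel. indicator Q z * (?t 2 z * ?p' 2 z + ?t' 2 z * ?p z)) = I01 (\<lambda>x. ?t 2 (x, 1) * ?p (x, 1) - ?t 2 (x, 0) * ?p (x, 0))"
      using DERIV_mult[OF C1_partial(2)[OF C1] C1_partial(2)[OF \<psi>]] 
      by (intro divergence_y cc) (simp add: algebra_simps)
    moreover have "I01 (\<lambda>y. ?t 1 (1, y) * ?p (1, y) - ?t 1 (0, y) * ?p (0, y)) = I01 (\<lambda>s. poly (P 3 i) s * ?p (1, s)) + I01 (\<lambda>s. poly (P 1 i) s * ?p (0, s))"
    proof -
      have s: "continuous_on UNIV (\<lambda>y. ?t 1 (a, y) * ?p (a, y))" for a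
        by (intro continuous_intros continuous_on_compose2[OF c(2)] continuous_on_compose2[OF c\<psi>(2)]) auto
      show ?thesis by (subst I01_diff[OF s s]) (simp add: P I01_minus)
    qed
    moreover have "I01 (\<lambda>x. ?t 2 (x, 1) * ?p (x, 1) - ?t 2 (x, 0) * ?p (x, 0)) = I01 (\<lambda>s. poly (P 4 i) s * ?p (s, 1)) + I01 (\<lambda>s. poly (P 2 i) s * ?p (s, 0))"
    proof -
      have s: "continuous_on UNIV (\<lambda>x. ?t 2 (x, a) * ?p (x, a))" for a
        by (intro continuous_intros continuous_on_compose2[OF c(2)] continuous_on_compose2[OF c\<psi>(2)]) auto
      show ?thesis by (subst I01_diff[OF s s]) (simp add: P I01_minus)
    qed
    moreover have "(LINT z|lborel. indicator Q z * ?t 1 z * ?p' 1 z + indicator Q z * ?t 2 z * ?p' 2 z) + (LINT z|lborel. indicator Q z * (?d (vec2 z) $ i) * ?p z)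
      = (LINT z|lborel. indicator Q z * (?t 1 z * ?p' 1 z + ?t' 1 z * ?p z)) + (LINT z|lborel. indicator Q z * (?t 2 z * ?p' 2 z + ?t' 2 z * ?p z))"
    proof -
      have i1: "integrable lborel (\<lambda>z. indicator Q z * ?t 1 z * ?p' 1 z + indicator Q z * ?t 2 z * ?p' 2 z)"
        using I[OF continuous_on_add[OF continuous_on_mult[OF c(2)[of i 1] c\<psi>(1)[of 1]] continuous_on_mult[OF c(2)[of i 2] c\<psi>(1)[of 2]]]]
        by (simp add: algebra_simps)
      have i2: "integrable lborel (\<lambda>z. indicator Q z * (?d (vec2 z) $ i) * ?p z)"
        using I[OF continuous_on_mult[OF continuous_on_add[OF c(1)[of 1 i 1] c(1)[of 2 i 2]] c\<psi>(2)]]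
        by (simp add: algebra_simps)
      show ?thesis
        unfolding Bochner_Integration.integral_add[OF i1 i2, symmetric] Bochner_Integration.integral_add[OF I[OF cc] I[OF cc], symmetric]
        by (rule Bochner_Integration.integral_cong) (simp_all add: algebra_simps)
    qed
    ultimately show ?thesis by simp
  qed
  show "wdiv (on_K \<tau>) = on_K ?d" "ntrace (on_K \<tau>) = bd_poly P"
    using wdiv_ntraceI[OF \<tau> d eq] by auto
qed

lemma airy_L2_rep_mat:
  assumes "L2_rep (wpd 2 (wpd 2 u)) h22" "L2_rep (wpd 1 (wpd 2 u)) h12" "L2_rep (wpd 1 (wpd 1 u)) h11"
  shows "L2_rep_mat (airy u) (\<lambda>i j z. if i = 1 then (if j = 1 then h22 z else - h12 z) else (if j = 1 then - h12 z else h11 z))"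
proof -
  have ae: "AE p in lebesgue_on K. rep_fld (airy u) p = vector
     [vector [rep_fld (wpd 2 (wpd 2 u)) p, - rep_fld (wpd 1 (wpd 2 u)) p],
      vector [- rep_fld (wpd 1 (wpd 2 u)) p, rep_fld (wpd 1 (wpd 1 u)) p]]"
    unfolding airy_def by (rule rep_on_K_AE)
  have neg: "plane_rep (\<lambda>p. - F p) (\<lambda>z. - f z)" if "plane_rep F f" for F f using plane_rep_cmult[OF that, of "-1"] by simp
  have cr: "plane_rep (rep_fld (wpd 2 (wpd 2 u))) h22" "plane_rep (rep_fld (wpd 1 (wpd 2 u))) h12" "plane_rep (rep_fld (wpd 1 (wpd 1 u))) h11"
    using assms by (simp_all add: L2_rep_def)
  have c11: "plane_rep (\<lambda>p. rep_fld (airy u) p $ 1 $ 1) h22"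
  proof (rule plane_rep_cong_AE[OF cr(1)])
    show "AE p in lebesgue_on K. rep_fld (wpd 2 (wpd 2 u)) p = rep_fld (airy u) p $ 1 $ 1"
      using ae by eventually_elim simp
  qed
  have c12: "plane_rep (\<lambda>p. rep_fld (airy u) p $ 1 $ 2) (\<lambda>z. - h12 z)"
  proof (rule plane_rep_cong_AE[OF neg[OF cr(2)]])
    show "AE p in lebesgue_on K. - rep_fld (wpd 1 (wpd 2 u)) p = rep_fld (airy u) p $ 1 $ 2"
      using ae by eventually_elim simp
  qed
  have c21: "plane_rep (\<lambda>p. rep_fld (airy u) p $ 2 $ 1) (\<lambda>z. - h12 z)"
  proof (rule plane_rep_cong_AE[OF neg[OF cr(2)]])
    show "AE p in lebesgue_on K. - rep_fld (wpd 1 (wpd 2 u)) p = rep_fld (airy u) p $ 2 $ 1"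
      using ae by eventually_elim simp
  qed
  have c22: "plane_rep (\<lambda>p. rep_fld (airy u) p $ 2 $ 2) h11"
  proof (rule plane_rep_cong_AE[OF cr(3)])
    show "AE p in lebesgue_on K. rep_fld (wpd 1 (wpd 1 u)) p = rep_fld (airy u) p $ 2 $ 2"
      using ae by eventually_elim simp
  qed
  show ?thesis using c11 c12 c21 c22 assms by (simp add: L2_rep_mat_def forall_2 L2_rep_def)
qed

lemma H2_second:
  assumes "u \<in> H2"
  shows "\<exists>h. L2_rep (wpd i (wpd j u)) h"
proof -
  have "wpd j u \<in> H1" using assms by (simp add: H2_def)
  from H1_wpd[OF this, of i] have "wpd i (wpd j u) \<in> L2" by (simp add: has_wpd_def)
  then show ?thesis using L2_rep_exists by blast
qed

lemma airy_add:
  assumes "u \<in> H2" "v \<in> H2"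
  shows "airy (u + v) = airy u + airy v"
proof -
  obtain f22 f12 f11 where f: "L2_rep (wpd 2 (wpd 2 u)) f22" "L2_rep (wpd 1 (wpd 2 u)) f12" "L2_rep (wpd 1 (wpd 1 u)) f11"
    using H2_second[OF assms(1), of 2 2] H2_second[OF assms(1), of 1 2] H2_second[OF assms(1), of 1 1] by blast
  obtain g22 g12 g11 where g: "L2_rep (wpd 2 (wpd 2 v)) g22" "L2_rep (wpd 1 (wpd 2 v)) g12" "L2_rep (wpd 1 (wpd 1 v)) g11"
    using H2_second[OF assms(2), of 2 2] H2_second[OF assms(2), of 1 2] H2_second[OF assms(2), of 1 1] by blast
  have w: "wpd i (wpd j (u + v)) = wpd i (wpd j u) + wpd i (wpd j v)" for i j
    using assms by (simp add: H2_def H1_add)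
  show ?thesis
  proof (rule L2_rep_mat_eqI)
    show "L2_rep_mat (airy (u + v)) (\<lambda>i j z. if i = 1 then (if j = 1 then f22 z + g22 z else - (f12 z + g12 z))
        else (if j = 1 then - (f12 z + g12 z) else f11 z + g11 z))"
      by (rule airy_L2_rep_mat; unfold w; intro L2_rep_add f g)
    show "L2_rep_mat (airy u + airy v) (\<lambda>i j z. (if i = 1 then (if j = 1 then f22 z else - f12 z) else (if j = 1 then - f12 z else f11 z)) +
        (if i = 1 then (if j = 1 then g22 z else - g12 z) else (if j = 1 then - g12 z else g11 z)))"
      by (intro L2_rep_mat_add airy_L2_rep_mat f g)
  qed simp
qed

lemma airy_scaleR:
  assumes "u \<in> H2"
  shows "airy (c *\<^sub>R u) = c *\<^sub>R airy u"
proof -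
  obtain f22 f12 f11 where f: "L2_rep (wpd 2 (wpd 2 u)) f22" "L2_rep (wpd 1 (wpd 2 u)) f12" "L2_rep (wpd 1 (wpd 1 u)) f11"
    using H2_second[OF assms, of 2 2] H2_second[OF assms, of 1 2] H2_second[OF assms, of 1 1] by blast
  have w: "wpd i (wpd j (c *\<^sub>R u)) = c *\<^sub>R wpd i (wpd j u)" for i j
    using assms by (simp add: H2_def H1_scaleR)
  show ?thesis
  proof (rule L2_rep_mat_eqI)
    show "L2_rep_mat (airy (c *\<^sub>R u)) (\<lambda>i j z. if i = 1 then (if j = 1 then c * f22 z else - (c * f12 z))
        else (if j = 1 then - (c * f12 z) else c * f11 z))"
      by (rule airy_L2_rep_mat; unfold w; intro L2_rep_scaleR f)
    show "L2_rep_mat (c *\<^sub>R airy u) (\<lambda>i j z. c * (if i = 1 then (if j = 1 then f22 z else - f12 z) else (if j = 1 then - f12 z else f11 z)))"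
      by (intro L2_rep_mat_scaleR airy_L2_rep_mat f)
  qed simp
qed

lemma zero_in_H2: "0 \<in> H2"
proof -
  have "L2_rep (0 :: real fld) (\<lambda>z. indicator Q z * 0)"
    using L2_rep_on_K[of "\<lambda>_. 0"] by (simp add: zero_fld_def)
  then have z: "L2_rep (0 :: real fld) (\<lambda>z. 0)" by simp
  have w: "has_wpd j 0 0" for j unfolding has_wpd_iff[OF z z] by simp
  then have "0 \<in> H1" unfolding H1_def by blast
  then show ?thesis using wpd_eq[OF w] by (simp add: H2_def)
qed

section \<open>The normal trace of an Airy field\<close>

text \<open>\<open>a j\<close> and \<open>b j\<close> are the value of \<open>\<phi>\<close> and its derivative in the coordinate normal to the j-th edge
  (not in the outward direction), as functions of the other coordinate.\<close>

definition edge_jet :: "(real^2 \<Rightarrow> real) \<Rightarrow> (4 \<Rightarrow> real poly) \<Rightarrow> (4 \<Rightarrow> real poly) \<Rightarrow> bool" where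
  "edge_jet \<phi> a b \<longleftrightarrow> (\<forall>j. \<forall>s\<in>{0..1}. \<phi> (vec2 (edge_coords j s)) = poly (a j) s) \<and>
     (AE s in lborel. s \<in> {0<..<1} \<longrightarrow>
        ((\<lambda>x. \<phi> (vec2 (x, s))) has_real_derivative poly (b 1) s) (at_right 0) \<and>
        ((\<lambda>y. \<phi> (vec2 (s, y))) has_real_derivative poly (b 2) s) (at_right 0) \<and>
        ((\<lambda>x. \<phi> (vec2 (x, s))) has_real_derivative poly (b 3) s) (at_left 1) \<and>
        ((\<lambda>y. \<phi> (vec2 (s, y))) has_real_derivative poly (b 4) s) (at_left 1))"

definition airy_trace :: "(4 \<Rightarrow> real poly) \<Rightarrow> (4 \<Rightarrow> real poly) \<Rightarrow> 4 \<Rightarrow> 2 \<Rightarrow> real poly" where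
  "airy_trace a b i c =
    (if i = 1 then (if c = 1 then - pderiv (pderiv (a 1)) else pderiv (b 1))
     else if i = 2 then (if c = 1 then pderiv (b 2) else - pderiv (pderiv (a 2)))
     else if i = 3 then (if c = 1 then pderiv (pderiv (a 3)) else - pderiv (b 3))
     else (if c = 1 then - pderiv (b 4) else pderiv (pderiv (a 4))))"

lemma indicator_swap: "indicator Q (prod.swap z) = (indicator Q z :: real)"
  by (auto simp: indicator_def Q_iff)

theorem airy_wdiv_ntrace:
  assumes H2: "on_K \<phi> \<in> H2" and cont: "continuous_on (closure K) \<phi>" and jet: "edge_jet \<phi> a b"
  shows "wdiv (airy (on_K \<phi>)) = 0" "ntrace (airy (on_K \<phi>)) = bd_poly (airy_trace a b)"
proof -
  let ?u = "on_K \<phi>"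
  let ?f = "\<lambda>z. \<phi> (vec2 z)"
  have w: "has_wpd 1 ?u (wpd 1 ?u)" "has_wpd 2 ?u (wpd 2 ?u)" "has_wpd 1 (wpd 2 ?u) (wpd 1 (wpd 2 ?u))"
    "has_wpd 2 (wpd 2 ?u) (wpd 2 (wpd 2 ?u))" "has_wpd 2 (wpd 1 ?u) (wpd 1 (wpd 2 ?u))" "has_wpd 1 (wpd 1 ?u) (wpd 1 (wpd 1 ?u))"
  proof -
    have H: "?u \<in> H1" "wpd i ?u \<in> H1" for i using H2 by (auto simp: H2_def)
    show "has_wpd 1 ?u (wpd 1 ?u)" "has_wpd 2 ?u (wpd 2 ?u)" "has_wpd 1 (wpd 2 ?u) (wpd 1 (wpd 2 ?u))"
      "has_wpd 2 (wpd 2 ?u) (wpd 2 (wpd 2 ?u))" "has_wpd 1 (wpd 1 ?u) (wpd 1 (wpd 1 ?u))"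
      by (rule H1_wpd[OF H(1)] H1_wpd[OF H(2)])+
    show "has_wpd 2 (wpd 1 ?u) (wpd 1 (wpd 2 ?u))"
      unfolding wpd_mixed[OF H2] by (rule H1_wpd[OF H(2)])
  qed
  have f: "L2_rep ?u (\<lambda>z. indicator Q z * ?f z)" by (rule L2_rep_on_K[OF cont])
  obtain w1 where w1: "L2_rep (wpd 1 ?u) w1" using w L2_rep_exists by (auto simp: has_wpd_def)
  obtain w2 where w2: "L2_rep (wpd 2 ?u) w2" using w L2_rep_exists by (auto simp: has_wpd_def)
  obtain h11 where h11: "L2_rep (wpd 1 (wpd 1 ?u)) h11" using w L2_rep_exists by (auto simp: has_wpd_def)
  obtain h12 where h12: "L2_rep (wpd 1 (wpd 2 ?u)) h12" using w L2_rep_exists by (auto simp: has_wpd_def)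
  obtain h22 where h22: "L2_rep (wpd 2 (wpd 2 ?u)) h22" using w L2_rep_exists by (auto simp: has_wpd_def)
  have cf: "continuous_on ({0..1} \<times> {0..1}) ?f"
    by (rule continuous_on_compose2[OF cont]) (auto intro!: continuous_intros simp: closure_K)
  have cfs: "continuous_on ({0..1} \<times> {0..1}) (\<lambda>z. ?f (prod.swap z))"
    by (rule continuous_on_compose2[OF cf continuous_on_swap]) auto
  have pd: "(poly p has_real_derivative poly (pderiv p) t) (at t)" for p :: "real poly" and t by (rule poly_DERIV)
  have pc: "continuous_on UNIV (poly p)" for p :: "real poly" by (rule continuous_on_poly) (rule continuous_on_id)
  have val: "?f (0, s) = poly (a 1) s" "?f (s, 0) = poly (a 2) s" "?f (1, s) = poly (a 3) s" "?f (s, 1) = poly (a 4) s" if "s \<in> {0..1}" for s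
    using jet that unfolding edge_jet_def edge_coords_def by (auto simp: forall_4)
  have nd: "AE s in lborel. s \<in> {0<..<1} \<longrightarrow> ((\<lambda>x. ?f (x, s)) has_real_derivative poly (b 1) s) (at_right 0)"
    "AE s in lborel. s \<in> {0<..<1} \<longrightarrow> ((\<lambda>y. ?f (s, y)) has_real_derivative poly (b 2) s) (at_right 0)"
    "AE s in lborel. s \<in> {0<..<1} \<longrightarrow> ((\<lambda>x. ?f (x, s)) has_real_derivative poly (b 3) s) (at_left 1)"
    "AE s in lborel. s \<in> {0<..<1} \<longrightarrow> ((\<lambda>y. ?f (s, y)) has_real_derivative poly (b 4) s) (at_left 1)"
    using jet unfolding edge_jet_def by (auto elim: eventually_mono)
  have row1n: "trace_y w2 h22 (poly (b 2)) (poly (b 4))"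
    by (rule trace_y_normal[OF cf weak_dy_if_has_wpd[OF w(2) f w2] weak_dy_if_has_wpd[OF w(4) w2 h22] nd(2,4) pc pc])
  have row1t: "trace_y (\<lambda>z. w2 (prod.swap z)) (\<lambda>z. h12 (prod.swap z)) (poly (pderiv (a 1))) (poly (pderiv (a 3)))"
    by (rule trace_y_tangential[OF cf weak_dy_if_has_wpd[OF w(2) f w2] weak_dx_if_has_wpd[OF w(3) w2 h12] val(1,3) pd pc pd pc])
  have fs: "weak_dy (\<lambda>z. indicator Q z * ?f (prod.swap z)) (\<lambda>z. w1 (prod.swap z))"
    using weak_dx_if_has_wpd[OF w(1) f w1] by (simp add: weak_dx_def indicator_swap)
  have row2n: "trace_y (\<lambda>z. w1 (prod.swap z)) (\<lambda>z. h11 (prod.swap z)) (poly (b 1)) (poly (b 3))"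
    by (rule trace_y_normal[OF cfs fs weak_dx_if_has_wpd[OF w(6) w1 h11, unfolded weak_dx_def] _ _ pc pc]) (use nd(1,3) in simp_all)
  have row2t: "trace_y (\<lambda>z. w1 (prod.swap (prod.swap z))) (\<lambda>z. h12 (prod.swap (prod.swap z))) (poly (pderiv (a 2))) (poly (pderiv (a 4)))"
    by (rule trace_y_tangential[OF cfs fs _ _ _ pd pc pd pc]) (use val weak_dy_if_has_wpd[OF w(5) w1 h12] in \<open>simp_all add: weak_dx_def\<close>)
  note props = L2_rep_props[OF w1] L2_rep_props[OF w2] L2_rep_props[OF h11] L2_rep_props[OF h12] L2_rep_props[OF h22]
  have [measurable]: "w1 \<in> borel_measurable borel" "h11 \<in> borel_measurable borel" "h12 \<in> borel_measurable borel"
    using props by auto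
  have sq: "integrable lborel (\<lambda>z. (h11 z)\<^sup>2)" "integrable lborel (\<lambda>z. (h12 z)\<^sup>2)" "integrable lborel (\<lambda>z. (h22 z)\<^sup>2)"
    using h11 h12 h22 by (auto simp: L2_rep_def)
  have sQ: "prod.swap z \<notin> Q" if "z \<notin> Q" for z using that by (auto simp: Q_iff)
  let ?F = "\<lambda>i j z. if i = (1::2) then (if j = (1::2) then h22 z else - h12 z) else (if j = 1 then - h12 z else h11 z)"
  have eq: "(LINT z|lborel. ?F i 1 z * pd 1 \<psi> (vec2 z) + ?F i 2 z * pd 2 \<psi> (vec2 z)) + (LINT z|lborel. (indicator Q z * (0 :: real^2) $ i) * \<psi> (vec2 z))
      = I01 (\<lambda>s. poly (airy_trace a b 1 i) s * \<psi> (vec2 (0, s))) + I01 (\<lambda>s. poly (airy_trace a b 2 i) s * \<psi> (vec2 (s, 0)))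
      + I01 (\<lambda>s. poly (airy_trace a b 3 i) s * \<psi> (vec2 (1, s))) + I01 (\<lambda>s. poly (airy_trace a b 4 i) s * \<psi> (vec2 (s, 1)))"
    if \<psi>: "\<psi> \<in> C1" for i \<psi>
  proof -
    note p = C1_partial(1,2)[OF \<psi>] and c = C1_partial(3,4)[OF \<psi>]
    have I: "integrable lborel (\<lambda>z. h z * pd j \<psi> (vec2 z))" if "L2_rep v h" for v h j
      using L2_rep_props[OF that] by (intro integrable_Q_mult c) auto
    show ?thesis
    proof (cases "i = 1")
      case True
      have "(LINT z|lborel. h22 z * pd 1 \<psi> (vec2 z)) - (LINT z|lborel. h12 z * pd 2 \<psi> (vec2 z)) =
        I01 (\<lambda>x. poly (pderiv (b 2)) x * \<psi> (vec2 (x, 0))) - I01 (\<lambda>x. poly (pderiv (b 4)) x * \<psi> (vec2 (x, 1)))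
        + I01 (\<lambda>y. poly (pderiv (pderiv (a 3))) y * \<psi> (vec2 (1, y))) - I01 (\<lambda>y. poly (pderiv (pderiv (a 1))) y * \<psi> (vec2 (0, y)))"
        by (rule green_row[OF row1n row1t _ _ _ sq(2,3) _ _ _ pd pd pd pd pc pc pc pc p c(1) c(1) c(2)]) (use props in auto)
      then show ?thesis using True I[OF h22, of 1] I[OF h12, of 2] by (simp add: airy_trace_def I01_minus)
    next
      case False
      then have i: "i = 2" using exhaust_2[of i] by auto
      have cs: "continuous_on UNIV (\<lambda>z. \<phi> (prod.swap z))" if "continuous_on UNIV \<phi>" for \<phi> :: "real \<times> real \<Rightarrow> real"
        by (intro continuous_on_compose2[OF that] continuous_on_swap) auto
      have S: "integrable lborel (\<lambda>z. w1 (prod.swap z))" "integrable lborel (\<lambda>z. h12 (prod.swap z))" "integrable lborel (\<lambda>z. h11 (prod.swap z))"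
        "integrable lborel (\<lambda>z. (h12 (prod.swap z))\<^sup>2)" "integrable lborel (\<lambda>z. (h11 (prod.swap z))\<^sup>2)"
        using props sq plane_swap(2)[of w1] plane_swap(2)[of h12] plane_swap(2)[of h11]
          plane_swap(2)[of "\<lambda>z. (h12 z)\<^sup>2"] plane_swap(2)[of "\<lambda>z. (h11 z)\<^sup>2"] by auto
      have Z: "w1 (prod.swap z) = 0" "h12 (prod.swap z) = 0" "h11 (prod.swap z) = 0" if "z \<notin> Q" for z
        using props sQ[OF that] by blast+
      have "(LINT z|lborel. h11 (prod.swap z) * pd 2 \<psi> (vec2 (prod.swap z))) - (LINT z|lborel. h12 (prod.swap z) * pd 1 \<psi> (vec2 (prod.swap z))) =
        I01 (\<lambda>x. poly (pderiv (b 1)) x * \<psi> (vec2 (prod.swap (x, 0)))) - I01 (\<lambda>x. poly (pderiv (b 3)) x * \<psi> (vec2 (prod.swap (x, 1))))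
        + I01 (\<lambda>y. poly (pderiv (pderiv (a 4))) y * \<psi> (vec2 (prod.swap (1, y)))) - I01 (\<lambda>y. poly (pderiv (pderiv (a 2))) y * \<psi> (vec2 (prod.swap (0, y))))"
        by (rule green_row[OF row2n row2t S Z pd pd pd pd pc pc pc pc _ _ cs[OF c(1)] cs[OF c(1)] cs[OF c(2)]]) (use p in simp_all)
      moreover have "(LINT z|lborel. h11 (prod.swap z) * pd 2 \<psi> (vec2 (prod.swap z))) = (LINT z|lborel. h11 z * pd 2 \<psi> (vec2 z))"
        using plane_swap(1)[of "\<lambda>z. h11 z * pd 2 \<psi> (vec2 z)"] I[OF h11, of 2] by auto
      moreover have "(LINT z|lborel. h12 (prod.swap z) * pd 1 \<psi> (vec2 (prod.swap z))) = (LINT z|lborel. h12 z * pd 1 \<psi> (vec2 z))"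
        using plane_swap(1)[of "\<lambda>z. h12 z * pd 1 \<psi> (vec2 z)"] I[OF h12, of 1] by auto
      ultimately show ?thesis using i I[OF h11, of 2] I[OF h12, of 1] by (simp add: airy_trace_def I01_minus)
    qed
  qed
  have d: "L2_rep_vec 0 (\<lambda>i z. indicator Q z * (0 :: real^2) $ i)"
    using L2_rep_vec_on_K[of "\<lambda>_. 0"] by (simp add: zero_fld_def)
  show "wdiv (airy ?u) = 0" "ntrace (airy ?u) = bd_poly (airy_trace a b)"
    using wdiv_ntraceI[OF airy_L2_rep_mat[OF h22 h12 h11] d eq] by auto
qed

lemma AE_reflect:
  assumes "AE t in lborel. P (t::real)"
  shows "AE t in lborel. P (1 - t)"
proof -
  have "AE t in distr lborel borel ((+) 1). P t" using assms unfolding lborel_distr_plus .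
  then have "AE t in lborel. P (1 + t)" by (rule AE_distrD[rotated]) simp
  then have "AE t in distr lborel borel uminus. P (1 + t)" unfolding lborel_distr_uminus .
  then have "AE t in lborel. P (1 + - t)" by (rule AE_distrD[rotated]) simp
  then show ?thesis by simp
qed

lemma AE_edge_param:
  assumes "AE t in lebesgue_on {0..1}. P (edge_param j t)"
  shows "AE s in lborel. s \<in> {0<..<1} \<longrightarrow> P s"
proof (cases "j = 1 \<or> j = 4")
  case True
  have "AE t in lborel. 1 - t \<in> {0<..<1} \<longrightarrow> P (edge_param j (1 - t))"
    using AE_reflect[OF assms[unfolded AE_01_iff]] .
  then show ?thesis by eventually_elim (use True in \<open>auto simp: edge_param_def\<close>)
next
  case False
  then show ?thesis using assms[unfolded AE_01_iff] by (simp add: edge_param_def)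
qed

definition outward_sign :: "4 \<Rightarrow> real" where "outward_sign j = (if j = 1 \<or> j = 2 then - 1 else 1)"

lemma edge_jetI:
  assumes val: "\<And>j s. s \<in> {0..1} \<Longrightarrow> \<phi> (vec2 (edge_coords j s)) = poly (a j) s"
    and nd: "\<And>j. has_nderiv j \<phi> (g j)"
    and g: "\<And>j s. s \<in> {0<..<1} \<Longrightarrow> g j (vec2 (edge_coords j s)) = outward_sign j * poly (b j) s"
  shows "edge_jet \<phi> a b"
proof -
  have nd': "AE s in lborel. s \<in> {0<..<1} \<longrightarrow>
      ((\<lambda>r. \<phi> (vec2 (edge_coords j s) + r *\<^sub>R nrm j)) has_real_derivative outward_sign j * poly (b j) s) (at_left 0)" for j
  proof -
    have "AE t in lebesgue_on {0..1}. ((\<lambda>r. \<phi> (vec2 (edge_coords j (edge_param j t)) + r *\<^sub>R nrm j)) has_real_derivative g j (vec2 (edge_coords j (edge_param j t)))) (at_left 0)"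
      using nd[of j] by (simp add: has_nderiv_def edge_eq)
    from AE_edge_param[OF this] show ?thesis by eventually_elim (simp add: g)
  qed
  have lft: "((\<lambda>x. h (- x)) has_real_derivative - D) (at_right 0)" if "(h has_real_derivative D) (at_left 0)" for h D
  proof -
    have "(h has_real_derivative D) (at (- 0) within uminus ` {0<..})" using that by simp
    moreover have "(uminus has_real_derivative -1) (at_right (0::real))" by (auto intro!: derivative_eq_intros)
    ultimately show ?thesis using DERIV_image_chain[of h D uminus 0 "{0<..}" "-1"] by (simp add: comp_def)
  qed
  have rgt: "((\<lambda>x. h (x - 1)) has_real_derivative D) (at_left 1)" if "(h has_real_derivative D) (at_left 0)" for h and D :: real
  proof -
    have "(\<lambda>x. x - 1) ` {..<1::real} = {..<0}" by (auto simp: image_iff intro!: bexI[of _ "_ + 1"])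
    then have "(h has_real_derivative D) (at (1 - 1) within (\<lambda>x. x - 1) ` {..<1})" using that by simp
    moreover have "((\<lambda>x. x - 1) has_real_derivative 1) (at_left (1::real))" by (auto intro!: derivative_eq_intros)
    ultimately show ?thesis using DERIV_image_chain[of h D "\<lambda>x. x - 1" 1 "{..<1}" 1] by (simp add: comp_def)
  qed
  have v: "vec2 (edge_coords 1 s) + (- x) *\<^sub>R nrm 1 = vec2 (x, s)" "vec2 (edge_coords 2 s) + (- x) *\<^sub>R nrm 2 = vec2 (s, x)"
    "vec2 (edge_coords 3 s) + (x - 1) *\<^sub>R nrm 3 = vec2 (x, s)" "vec2 (edge_coords 4 s) + (x - 1) *\<^sub>R nrm 4 = vec2 (s, x)" for x s
    by (simp_all add: edge_coords_def nrm_def vec_eq_iff forall_2)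
  show ?thesis
    unfolding edge_jet_def
  proof (intro conjI allI ballI val)
    show "AE s in lborel. s \<in> {0<..<1} \<longrightarrow>
        ((\<lambda>x. \<phi> (vec2 (x, s))) has_real_derivative poly (b 1) s) (at_right 0) \<and>
        ((\<lambda>y. \<phi> (vec2 (s, y))) has_real_derivative poly (b 2) s) (at_right 0) \<and>
        ((\<lambda>x. \<phi> (vec2 (x, s))) has_real_derivative poly (b 3) s) (at_left 1) \<and>
        ((\<lambda>y. \<phi> (vec2 (s, y))) has_real_derivative poly (b 4) s) (at_left 1)"
      using nd'[of 1] nd'[of 2] nd'[of 3] nd'[of 4]
    proof eventually_elim
      case (elim s)
      show ?case
      proof
        assume s: "s \<in> {0<..<1}"
        show "((\<lambda>x. \<phi> (vec2 (x, s))) has_real_derivative poly (b 1) s) (at_right 0) \<and>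
          ((\<lambda>y. \<phi> (vec2 (s, y))) has_real_derivative poly (b 2) s) (at_right 0) \<and>
          ((\<lambda>x. \<phi> (vec2 (x, s))) has_real_derivative poly (b 3) s) (at_left 1) \<and>
          ((\<lambda>y. \<phi> (vec2 (s, y))) has_real_derivative poly (b 4) s) (at_left 1)"
          using lft[OF elim(1)[rule_format, OF s]] lft[OF elim(2)[rule_format, OF s]]
            rgt[OF elim(3)[rule_format, OF s]] rgt[OF elim(4)[rule_format, OF s]]
          unfolding v by (simp add: outward_sign_def)
      qed
    qed
  qed
qed

section \<open>Polynomial fields\<close>

lemma dim_param:
  fixes T :: "('i \<Rightarrow> real) \<Rightarrow> 'v::real_vector"
  assumes B: "finite B" and add: "\<And>c d. T (\<lambda>i. c i + d i) = T c + T d"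
    and scale: "\<And>r c. T (\<lambda>i. r * c i) = r *\<^sub>R T c"
    and inj: "\<And>c. \<forall>i. i \<notin> B \<longrightarrow> c i = 0 \<Longrightarrow> T c = 0 \<Longrightarrow> \<forall>i. c i = 0"
  shows "dim {T c |c. \<forall>i. i \<notin> B \<longrightarrow> c i = 0} = card B"
proof -
  define e where "e i = T (\<lambda>j. if j = i then 1 else 0)" for i
  have T0: "T (\<lambda>_. 0) = 0" using scale[of 0 "\<lambda>_. 0"] by simp
  have fin: "T (\<lambda>j. \<Sum>i\<in>A. d i * (if j = i then 1 else 0)) = (\<Sum>i\<in>A. d i *\<^sub>R e i)" if "finite A" for A d
    using that
  proof induction
    case (insert i A)
    have "T (\<lambda>j. \<Sum>i\<in>insert i A. d i * (if j = i then 1 else 0)) =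
      T (\<lambda>j. d i * (if j = i then 1 else 0) + (\<Sum>i\<in>A. d i * (if j = i then 1 else 0)))"
      using insert by simp
    also have "\<dots> = d i *\<^sub>R e i + (\<Sum>i\<in>A. d i *\<^sub>R e i)" by (simp only: add scale insert e_def)
    finally show ?case using insert by simp
  qed (simp add: T0)
  have rep: "T c = (\<Sum>i\<in>B. c i *\<^sub>R e i)" if "\<forall>i. i \<notin> B \<longrightarrow> c i = 0" for c
  proof -
    have "c j = (\<Sum>i\<in>B. c i * (if j = i then 1 else 0))" for j
      using that B by (cases "j \<in> B") (auto simp: if_distrib cong: if_cong)
    then have "c = (\<lambda>j. \<Sum>i\<in>B. c i * (if j = i then 1 else 0))" by (rule ext)
    with fin[OF B, of c] show ?thesis by simp
  qed
  have zero: "\<forall>i\<in>B. d i = 0" if "(\<Sum>i\<in>B. d i *\<^sub>R e i) = 0" for d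
  proof -
    define c where "c i = (if i \<in> B then d i else 0)" for i
    have "(\<Sum>i\<in>B. c i *\<^sub>R e i) = 0" using that unfolding c_def by (simp cong: sum.cong)
    moreover have c0: "\<forall>i. i \<notin> B \<longrightarrow> c i = 0" by (simp add: c_def)
    ultimately have "T c = 0" using rep[OF c0] by simp
    from inj[OF c0 this] show ?thesis by (auto simp: c_def split: if_splits)
  qed
  have inj_e: "inj_on e B"
  proof (rule inj_onI, rule ccontr)
    fix i j assume ij: "i \<in> B" "j \<in> B" "e i = e j" "i \<noteq> j"
    define d where "d l = (if l = i then 1 else 0) - (if l = j then 1 else (0::real))" for l
    have "(\<Sum>l\<in>B. d l *\<^sub>R e l) = (\<Sum>l\<in>B. (if l = i then e l else 0)) - (\<Sum>l\<in>B. (if l = j then e l else 0))"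
      unfolding sum_subtractf[symmetric] by (intro sum.cong) (auto simp: d_def)
    also have "\<dots> = 0" using B ij by simp
    finally have "d i = 0" using zero ij by blast
    then show False using ij by (simp add: d_def)
  qed
  have indep: "independent (e ` B)"
  proof (rule independent_if_scalars_zero)
    fix f x assume f: "(\<Sum>x\<in>e ` B. f x *\<^sub>R x) = 0" and x: "x \<in> e ` B"
    from f have "(\<Sum>i\<in>B. f (e i) *\<^sub>R e i) = 0" by (simp add: sum.reindex[OF inj_e])
    then show "f x = 0" using zero[of "\<lambda>i. f (e i)"] x by blast
  qed (use B in simp)
  have "{T c |c. \<forall>i. i \<notin> B \<longrightarrow> c i = 0} = span (e ` B)"
  proof (intro equalityI subsetI)
    fix v assume "v \<in> {T c |c. \<forall>i. i \<notin> B \<longrightarrow> c i = 0}"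
    then obtain c where c: "v = T c" "\<forall>i. i \<notin> B \<longrightarrow> c i = 0" by blast
    show "v \<in> span (e ` B)" unfolding c(1) rep[OF c(2)] by (intro span_sum span_scale span_base imageI)
  next
    fix v assume "v \<in> span (e ` B)"
    then obtain u where u: "v = (\<Sum>x\<in>e ` B. u x *\<^sub>R x)" using B by (auto simp: span_finite)
    define c where "c i = (if i \<in> B then u (e i) else 0)" for i
    have "v = (\<Sum>i\<in>B. c i *\<^sub>R e i)" unfolding u c_def by (simp add: sum.reindex[OF inj_e] cong: sum.cong)
    then have "v = T c" using rep[of c] by (simp add: c_def)
    then show "v \<in> {T c |c. \<forall>i. i \<notin> B \<longrightarrow> c i = 0}" by (auto simp: c_def)
  qed
  then show ?thesis using dim_span_eq_card_independent[OF indep] card_image[OF inj_e] by simp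
qed

definition supp :: "nat \<Rightarrow> (nat \<Rightarrow> nat \<Rightarrow> real) \<Rightarrow> bool" where
  "supp k c \<longleftrightarrow> (\<forall>i j. k < i \<or> k < j \<longrightarrow> c i j = 0)"

definition bipoly :: "nat \<Rightarrow> (nat \<Rightarrow> nat \<Rightarrow> real) \<Rightarrow> real^2 \<Rightarrow> real" where
  "bipoly k c p = (\<Sum>i\<le>k. \<Sum>j\<le>k. c i j * (p$1)^i * (p$2)^j)"

definition dX :: "(nat \<Rightarrow> nat \<Rightarrow> real) \<Rightarrow> nat \<Rightarrow> nat \<Rightarrow> real" where "dX c i j = real (Suc i) * c (Suc i) j"
definition dY :: "(nat \<Rightarrow> nat \<Rightarrow> real) \<Rightarrow> nat \<Rightarrow> nat \<Rightarrow> real" where "dY c i j = real (Suc j) * c i (Suc j)"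

definition upoly :: "nat \<Rightarrow> (nat \<Rightarrow> real) \<Rightarrow> real poly" where
  "upoly k a = (\<Sum>i\<le>k. monom (a i) i)"

lemma coeff_upoly: "coeff (upoly k a) n = (if n \<le> k then a n else 0)"
  by (simp add: upoly_def coeff_sum)

lemma poly_upoly: "poly (upoly k a) x = (\<Sum>i\<le>k. a i * x^i)"
  by (simp add: upoly_def poly_sum poly_monom)

lemma degree_upoly: "degree (upoly k a) \<le> k"
  by (rule degree_le) (simp add: coeff_upoly)

lemma poly_eq_on_01:
  fixes p q :: "real poly"
  assumes "\<And>x. 0 < x \<Longrightarrow> x < 1 \<Longrightarrow> poly p x = poly q x"
  shows "p = q"
proof (rule ccontr)
  assume "p \<noteq> q"
  then have "finite {x. poly (p - q) x = 0}" by (intro poly_roots_finite) simp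
  moreover have "{0<..<1} \<subseteq> {x. poly (p - q) x = 0}" using assms by auto
  ultimately have "finite {0<..<1::real}" by (rule rev_finite_subset)
  then show False using infinite_Ioo[of 0 "1::real"] by simp
qed

lemma sum_power_eq_0:
  assumes "\<And>x. 0 < x \<Longrightarrow> x < 1 \<Longrightarrow> (\<Sum>i\<le>k. a i * x^i) = (0::real)" "i \<le> k"
  shows "a i = 0"
proof -
  have "upoly k a = 0" by (rule poly_eq_on_01) (simp add: poly_upoly assms(1))
  then show ?thesis using coeff_upoly[of k a i] assms(2) by simp
qed

lemma bipoly_eq_0:
  assumes "supp k c" "\<And>z. z \<in> Q \<Longrightarrow> bipoly k c (vec2 z) = 0"
  shows "c = (\<lambda>i j. 0)"
proof -
  have "c i j = 0" if "i \<le> k" "j \<le> k" for i j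
  proof (rule sum_power_eq_0[OF _ that(2), where a="c i"])
    fix y :: real assume y: "0 < y" "y < 1"
    show "(\<Sum>j\<le>k. c i j * y^j) = 0"
    proof (rule sum_power_eq_0[OF _ that(1), where a="\<lambda>i. \<Sum>j\<le>k. c i j * y^j"])
      fix x :: real assume x: "0 < x" "x < 1"
      have "(\<Sum>i\<le>k. (\<Sum>j\<le>k. c i j * y^j) * x^i) = bipoly k c (vec2 (x, y))"
        by (simp add: bipoly_def sum_distrib_right sum_distrib_left mult_ac)
      then show "(\<Sum>i\<le>k. (\<Sum>j\<le>k. c i j * y^j) * x^i) = 0" using assms(2)[of "(x, y)"] x y by (simp add: Q_iff)
    qed
  qed
  then show ?thesis using assms(1) by (auto simp: supp_def fun_eq_iff) (metis not_le)
qed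

lemma bipoly_add: "bipoly k (\<lambda>i j. c i j + d i j) p = bipoly k c p + bipoly k d p"
  by (simp add: bipoly_def distrib_right sum.distrib)

lemma bipoly_cmult: "bipoly k (\<lambda>i j. r * c i j) p = r * bipoly k c p"
  by (simp add: bipoly_def sum_distrib_left mult.assoc)

lemma bipoly_C1:
  assumes "supp k c"
  shows "bipoly k c \<in> C1" "pd 1 (bipoly k c) = bipoly k (dX c)" "pd 2 (bipoly k c) = bipoly k (dY c)"
proof -
  have m1: "((\<lambda>p::real^2. p $ j) has_derivative (\<lambda>h. h $ j)) (at p)" for j p
    by (rule bounded_linear.has_derivative[OF bounded_linear_vec_nth has_derivative_ident])
  have m: "((\<lambda>p::real^2. c i j * (p$1)^i * (p$2)^j) has_derivative
     (\<lambda>h. (real i * c i j * (p$1)^(i - 1) * (p$2)^j) * h $ 1 + (real j * c i j * (p$1)^i * (p$2)^(j - 1)) * h $ 2)) (at p)" for i j p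
    by (rule has_derivative_eq_rhs, (rule derivative_intros m1)+) (simp add: fun_eq_iff algebra_simps)
  have d: "(bipoly k c has_derivative (\<lambda>h. (\<Sum>i\<le>k. \<Sum>j\<le>k. real i * c i j * (p$1)^(i - 1) * (p$2)^j) * h $ 1
     + (\<Sum>i\<le>k. \<Sum>j\<le>k. real j * c i j * (p$1)^i * (p$2)^(j - 1)) * h $ 2)) (at p)" for p
    unfolding bipoly_def[abs_def]
    by (rule has_derivative_eq_rhs, (rule has_derivative_sum m)+)
      (simp add: fun_eq_iff sum_distrib_right sum.distrib)
  have shift: "(\<Sum>i\<le>k. real i * a i * x^(i - 1)) = (\<Sum>i\<le>k. real (Suc i) * a (Suc i) * x^i)"
    if "a (Suc k) = 0" for a :: "nat \<Rightarrow> real" and x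
  proof -
    have "(\<Sum>i\<le>k. real i * a i * x^(i - 1)) = (\<Sum>i\<le>Suc k. real i * a i * x^(i - 1))" using that by simp
    also have "\<dots> = (\<Sum>i\<le>k. real (Suc i) * a (Suc i) * x^i)" by (subst sum.atMost_Suc_shift) simp
    finally show ?thesis .
  qed
  have X: "(\<Sum>i\<le>k. \<Sum>j\<le>k. real i * c i j * (p$1)^(i - 1) * (p$2)^j) = bipoly k (dX c) p" for p
  proof -
    have "(\<Sum>i\<le>k. \<Sum>j\<le>k. real i * c i j * (p$1)^(i - 1) * (p$2)^j) = (\<Sum>j\<le>k. (\<Sum>i\<le>k. real i * c i j * (p$1)^(i - 1)) * (p$2)^j)"
      by (subst sum.swap) (simp add: sum_distrib_right)
    also have "\<dots> = (\<Sum>j\<le>k. (\<Sum>i\<le>k. real (Suc i) * c (Suc i) j * (p$1)^i) * (p$2)^j)"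
      using assms by (intro sum.cong refl arg_cong2[where f="(*)"] shift) (simp add: supp_def)
    also have "\<dots> = bipoly k (dX c) p"
      unfolding bipoly_def dX_def by (subst sum.swap) (simp add: sum_distrib_right)
    finally show ?thesis .
  qed
  have Y: "(\<Sum>i\<le>k. \<Sum>j\<le>k. real j * c i j * (p$1)^i * (p$2)^(j - 1)) = bipoly k (dY c) p" for p
  proof -
    have "(\<Sum>i\<le>k. \<Sum>j\<le>k. real j * c i j * (p$1)^i * (p$2)^(j - 1)) = (\<Sum>i\<le>k. (p$1)^i * (\<Sum>j\<le>k. real j * c i j * (p$2)^(j - 1)))"
      by (simp add: sum_distrib_left mult_ac)
    also have "\<dots> = (\<Sum>i\<le>k. (p$1)^i * (\<Sum>j\<le>k. real (Suc j) * c i (Suc j) * (p$2)^j))"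
      using assms by (intro sum.cong refl arg_cong2[where f="(*)"] shift) (simp add: supp_def)
    also have "\<dots> = bipoly k (dY c) p"
      unfolding bipoly_def dY_def by (simp add: sum_distrib_left mult_ac)
    finally show ?thesis .
  qed
  have cpf: "continuous_on UNIV (bipoly k c)" for c unfolding bipoly_def[abs_def] by (intro continuous_intros)
  show "bipoly k c \<in> C1" "pd 1 (bipoly k c) = bipoly k (dX c)" "pd 2 (bipoly k c) = bipoly k (dY c)"
    using C1I[OF d[unfolded X Y] cpf cpf] by auto
qed

lemma supp_dX: "supp k c \<Longrightarrow> supp k (dX c)"
  by (simp add: supp_def dX_def)

lemma supp_dY: "supp k c \<Longrightarrow> supp k (dY c)"
  by (simp add: supp_def dY_def)

lemma supp_add: "supp k c \<Longrightarrow> supp k d \<Longrightarrow> supp k (\<lambda>i j. c i j + d i j)"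
  by (simp add: supp_def)

lemma Qpoly_eq: "Qpoly k = {bipoly k c |c. supp k c}"
proof (intro equalityI subsetI)
  fix f assume "f \<in> Qpoly k"
  then obtain c where c: "f = bipoly k c" by (auto simp: Qpoly_def bipoly_def fun_eq_iff)
  define d where "d i j = (if i \<le> k \<and> j \<le> k then c i j else 0)" for i j
  have "f = bipoly k d" unfolding c by (simp add: fun_eq_iff bipoly_def d_def)
  moreover have "supp k d" by (simp add: supp_def d_def)
  ultimately show "f \<in> {bipoly k c |c. supp k c}" by blast
qed (auto simp: Qpoly_def bipoly_def)

lemma on_K_continuous_eqD:
  fixes f g :: "real^2 \<Rightarrow> 'b::real_normed_vector"
  assumes "on_K f = on_K g" "continuous_on (closure K) f" "continuous_on (closure K) g" "p \<in> closure K"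
  shows "f p = g p"
proof (rule AE_eq_continuous_closure[OF open_K assms(2,3) _ assms(4)])
  show "AE p in lborel. p \<in> K \<longrightarrow> f p = g p"
    using assms(1) by (simp add: on_K_eq_iff AE_restrict_space_iff AE_completion_iff)
qed

lemma continuous_bipoly: "continuous_on S (bipoly k c)"
  unfolding bipoly_def[abs_def] by (intro continuous_intros)

lemma continuous_vector2:
  assumes "continuous_on S f" "continuous_on S g"
  shows "continuous_on S (\<lambda>p. vector [f p, g p] :: real^2)"
  using continuous_on_vec2[OF continuous_on_Pair[OF assms]] by (simp add: vec2_def)

definition vec_bipoly :: "nat \<Rightarrow> (nat \<Rightarrow> nat \<Rightarrow> real) \<Rightarrow> (nat \<Rightarrow> nat \<Rightarrow> real) \<Rightarrow> (real^2) fld" where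
  "vec_bipoly k c d = on_K (\<lambda>p. vector [bipoly k c p, bipoly k d p])"

lemma vec_bipoly_eq_0:
  assumes "vec_bipoly k c d = 0" "supp k c" "supp k d"
  shows "c = (\<lambda>i j. 0)" "d = (\<lambda>i j. 0)"
proof -
  have "on_K (\<lambda>p. vector [bipoly k c p, bipoly k d p] :: real^2) = on_K (\<lambda>p. 0)"
    using assms(1) by (simp add: vec_bipoly_def zero_fld_def)
  then have "(vector [bipoly k c p, bipoly k d p] :: real^2) = 0" if "p \<in> closure K" for p
    by (rule on_K_continuous_eqD[OF _ _ continuous_on_const that]) (intro continuous_vector2 continuous_bipoly)
  moreover have "vec2 z \<in> closure K" if "z \<in> Q" for z using that closure_subset vec2_in_K by blast
  ultimately have "bipoly k c (vec2 z) = 0" "bipoly k d (vec2 z) = 0" if "z \<in> Q" for z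
    using that by (metis vector_2 zero_index)+
  then show "c = (\<lambda>i j. 0)" "d = (\<lambda>i j. 0)" using bipoly_eq_0 assms by blast+
qed

lemma vec_bipoly_add: "vec_bipoly k (\<lambda>i j. c i j + c' i j) (\<lambda>i j. d i j + d' i j) = vec_bipoly k c d + vec_bipoly k c' d'"
  unfolding vec_bipoly_def plus_fld.abs_eq by (simp add: bipoly_add vec_eq_iff forall_2 on_K_eq_iff)

lemma vec_bipoly_scaleR: "vec_bipoly k (\<lambda>i j. r * c i j) (\<lambda>i j. r * d i j) = r *\<^sub>R vec_bipoly k c d"
  unfolding vec_bipoly_def scaleR_fld.abs_eq by (simp add: bipoly_cmult vec_eq_iff forall_2 on_K_eq_iff)

lemma V_g_eq: "V_g k = {vec_bipoly k c d |c d. supp k c \<and> supp k d}"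
proof (intro equalityI subsetI)
  fix u assume "u \<in> V_g k"
  then obtain v where v: "u = on_K v" "\<forall>i. (\<lambda>p. v p $ i) \<in> Qpoly k" by (auto simp: V_g_def)
  obtain c d where "(\<lambda>p. v p $ 1) = bipoly k c" "supp k c" "(\<lambda>p. v p $ 2) = bipoly k d" "supp k d"
    using v(2)[rule_format, of 1] v(2)[rule_format, of 2] by (auto simp: Qpoly_eq)
  moreover from this have "v = (\<lambda>p. vector [bipoly k c p, bipoly k d p])"
    by (auto simp: fun_eq_iff vec_eq_iff forall_2 dest: fun_cong)
  ultimately show "u \<in> {vec_bipoly k c d |c d. supp k c \<and> supp k d}" using v(1) by (auto simp: vec_bipoly_def)
next
  fix u assume "u \<in> {vec_bipoly k c d |c d. supp k c \<and> supp k d}"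
  then obtain c d where u: "u = vec_bipoly k c d" "supp k c" "supp k d" by blast
  have eq: "(\<lambda>p. (vector [bipoly k c p, bipoly k d p] :: real^2) $ 1) = bipoly k c" "(\<lambda>p. (vector [bipoly k c p, bipoly k d p] :: real^2) $ 2) = bipoly k d"
    by simp_all
  have "\<forall>i. (\<lambda>p. (vector [bipoly k c p, bipoly k d p] :: real^2) $ i) \<in> Qpoly k"
    unfolding forall_2 eq using u by (auto simp: Qpoly_eq)
  then show "u \<in> V_g k" unfolding V_g_def u(1) vec_bipoly_def by blast
qed

definition sym_bipoly :: "nat \<Rightarrow> (nat \<Rightarrow> nat \<Rightarrow> real) \<Rightarrow> (nat \<Rightarrow> nat \<Rightarrow> real) \<Rightarrow> (nat \<Rightarrow> nat \<Rightarrow> real) \<Rightarrow> (real^2^2) fld" where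
  "sym_bipoly k c d e = on_K (\<lambda>p. vector [vector [bipoly k c p, bipoly k d p], vector [bipoly k d p, bipoly k e p]])"

lemma Sigma_g_eq: "Sigma_g k = {sym_bipoly k c d e |c d e. supp k c \<and> supp k d \<and> supp k e}"
proof (intro equalityI subsetI)
  fix u assume "u \<in> Sigma_g k"
  then obtain \<tau> where \<tau>: "u = on_K \<tau>" "\<forall>i j. (\<lambda>p. \<tau> p $ i $ j) \<in> Qpoly k" "\<forall>p. transpose (\<tau> p) = \<tau> p"
    by (auto simp: Sigma_g_def)
  obtain c d e where s: "supp k c" "supp k d" "supp k e"
    and e: "(\<lambda>p. \<tau> p $ 1 $ 1) = bipoly k c" "(\<lambda>p. \<tau> p $ 1 $ 2) = bipoly k d" "(\<lambda>p. \<tau> p $ 2 $ 2) = bipoly k e"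
    using \<tau>(2)[rule_format, of 1 1] \<tau>(2)[rule_format, of 1 2] \<tau>(2)[rule_format, of 2 2] by (auto simp: Qpoly_eq)
  have "\<tau> p $ 2 $ 1 = \<tau> p $ 1 $ 2" for p
  proof -
    have "\<tau> p $ 2 $ 1 = transpose (\<tau> p) $ 1 $ 2" by (simp add: transpose_def)
    also have "\<dots> = \<tau> p $ 1 $ 2" by (simp only: \<tau>(3)[rule_format])
    finally show ?thesis .
  qed
  then have "\<tau> = (\<lambda>p. vector [vector [bipoly k c p, bipoly k d p], vector [bipoly k d p, bipoly k e p]])"
    using e by (auto simp: fun_eq_iff vec_eq_iff forall_2)
  then show "u \<in> {sym_bipoly k c d e |c d e. supp k c \<and> supp k d \<and> supp k e}" using \<tau>(1) s by (auto simp: sym_bipoly_def)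
next
  fix u assume "u \<in> {sym_bipoly k c d e |c d e. supp k c \<and> supp k d \<and> supp k e}"
  then obtain c d e where u: "u = sym_bipoly k c d e" "supp k c" "supp k d" "supp k e" by blast
  have "bipoly k c \<in> Qpoly k" "bipoly k d \<in> Qpoly k" "bipoly k e \<in> Qpoly k" using u by (auto simp: Qpoly_eq)
  then show "u \<in> Sigma_g k" unfolding Sigma_g_def u sym_bipoly_def
    by (intro CollectI exI conjI refl) (auto simp: forall_2 transpose_def vec_eq_iff)
qed

definition sym_bipoly_trace :: "nat \<Rightarrow> (nat \<Rightarrow> nat \<Rightarrow> real) \<Rightarrow> (nat \<Rightarrow> nat \<Rightarrow> real) \<Rightarrow> (nat \<Rightarrow> nat \<Rightarrow> real) \<Rightarrow> 4 \<Rightarrow> 2 \<Rightarrow> real poly" where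
  "sym_bipoly_trace k c d e i l =
    (if i = 1 then (if l = 1 then - upoly k (c 0) else - upoly k (d 0))
     else if i = 2 then (if l = 1 then - upoly k (\<lambda>i. d i 0) else - upoly k (\<lambda>i. e i 0))
     else if i = 3 then (if l = 1 then upoly k (\<lambda>j. \<Sum>i\<le>k. c i j) else upoly k (\<lambda>j. \<Sum>i\<le>k. d i j))
     else (if l = 1 then upoly k (\<lambda>i. \<Sum>j\<le>k. d i j) else upoly k (\<lambda>i. \<Sum>j\<le>k. e i j)))"

lemma bipoly_edge:
  "bipoly k c (vec2 (0, s)) = poly (upoly k (c 0)) s" "bipoly k c (vec2 (s, 0)) = poly (upoly k (\<lambda>i. c i 0)) s"
  "bipoly k c (vec2 (1, s)) = poly (upoly k (\<lambda>j. \<Sum>i\<le>k. c i j)) s"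
  "bipoly k c (vec2 (s, 1)) = poly (upoly k (\<lambda>i. \<Sum>j\<le>k. c i j)) s"
proof -
  have z: "(\<Sum>i\<le>k. f i * 0^i) = f 0" for f :: "nat \<Rightarrow> real"
    by (simp add: power_0_left if_distrib cong: if_cong)
  have "bipoly k c (vec2 (0, s)) = (\<Sum>i\<le>k. (\<Sum>j\<le>k. c i j * s^j) * 0^i)"
    by (simp add: bipoly_def sum_distrib_right sum_distrib_left mult_ac)
  then show "bipoly k c (vec2 (0, s)) = poly (upoly k (c 0)) s" by (simp add: z poly_upoly)
  have "bipoly k c (vec2 (s, 0)) = (\<Sum>i\<le>k. (\<Sum>j\<le>k. c i j * 0^j) * s^i)"
    by (simp add: bipoly_def sum_distrib_right sum_distrib_left mult_ac)
  then show "bipoly k c (vec2 (s, 0)) = poly (upoly k (\<lambda>i. c i 0)) s" by (simp add: z poly_upoly)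
  show "bipoly k c (vec2 (1, s)) = poly (upoly k (\<lambda>j. \<Sum>i\<le>k. c i j)) s"
    unfolding bipoly_def by (subst sum.swap) (simp add: poly_upoly sum_distrib_right)
  show "bipoly k c (vec2 (s, 1)) = poly (upoly k (\<lambda>i. \<Sum>j\<le>k. c i j)) s"
    by (simp add: bipoly_def poly_upoly sum_distrib_right)
qed

lemma sym_bipoly_wdiv_ntrace:
  assumes "supp k c" "supp k d" "supp k e"
  shows "wdiv (sym_bipoly k c d e) = vec_bipoly k (\<lambda>i j. dX c i j + dY d i j) (\<lambda>i j. dX d i j + dY e i j)"
    "ntrace (sym_bipoly k c d e) = bd_poly (sym_bipoly_trace k c d e)"
proof -
  let ?t = "\<lambda>p. vector [vector [bipoly k c p, bipoly k d p], vector [bipoly k d p, bipoly k e p]] :: real^2^2"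
  have 1: "(\<lambda>p. ?t p $ i $ j) \<in> C1" for i j
  proof -
    have eq: "(\<lambda>p. ?t p $ 1 $ 1) = bipoly k c" "(\<lambda>p. ?t p $ 1 $ 2) = bipoly k d" "(\<lambda>p. ?t p $ 2 $ 1) = bipoly k d" "(\<lambda>p. ?t p $ 2 $ 2) = bipoly k e"
      by simp_all
    have "(\<lambda>p. ?t p $ 1 $ 1) \<in> C1" "(\<lambda>p. ?t p $ 1 $ 2) \<in> C1" "(\<lambda>p. ?t p $ 2 $ 1) \<in> C1" "(\<lambda>p. ?t p $ 2 $ 2) \<in> C1"
      unfolding eq using bipoly_C1(1) assms by blast+
    then show ?thesis using exhaust_2[of i] exhaust_2[of j] by auto
  qed
  have "(\<chi> i. pd 1 (\<lambda>p. ?t p $ i $ 1) p + pd 2 (\<lambda>p. ?t p $ i $ 2) p) =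
      (vector [bipoly k (\<lambda>i j. dX c i j + dY d i j) p, bipoly k (\<lambda>i j. dX d i j + dY e i j) p] :: real^2)" for p
    using bipoly_C1(2,3)[OF assms(1)] bipoly_C1(2,3)[OF assms(2)] bipoly_C1(2,3)[OF assms(3)]
    by (simp add: vec_eq_iff forall_2 bipoly_add)
  moreover have P: "\<And>i s. poly (sym_bipoly_trace k c d e 1 i) s = - (?t (vec2 (0, s)) $ i $ 1)" "\<And>i s. poly (sym_bipoly_trace k c d e 2 i) s = - (?t (vec2 (s, 0)) $ i $ 2)"
      "\<And>i s. poly (sym_bipoly_trace k c d e 3 i) s = ?t (vec2 (1, s)) $ i $ 1" "\<And>i s. poly (sym_bipoly_trace k c d e 4 i) s = ?t (vec2 (s, 1)) $ i $ 2"
    subgoal for i s using exhaust_2[of i] by (auto simp: sym_bipoly_trace_def bipoly_edge)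
    subgoal for i s using exhaust_2[of i] by (auto simp: sym_bipoly_trace_def bipoly_edge)
    subgoal for i s using exhaust_2[of i] by (auto simp: sym_bipoly_trace_def bipoly_edge)
    subgoal for i s using exhaust_2[of i] by (auto simp: sym_bipoly_trace_def bipoly_edge)
    done
  ultimately show "wdiv (sym_bipoly k c d e) = vec_bipoly k (\<lambda>i j. dX c i j + dY d i j) (\<lambda>i j. dX d i j + dY e i j)"
    "ntrace (sym_bipoly k c d e) = bd_poly (sym_bipoly_trace k c d e)"
    using smooth_wdiv_ntrace[of ?t "sym_bipoly_trace k c d e", OF 1 P] unfolding sym_bipoly_def vec_bipoly_def by simp_all
qed

lemma bd_poly_add: "bd_poly (\<lambda>i c. P i c + R i c) = bd_poly P + bd_poly R"
proof -
  have "bd_poly_fun (\<lambda>i c. P i c + R i c) = (\<lambda>p. bd_poly_fun P p + bd_poly_fun R p)"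
    by (simp add: fun_eq_iff bd_poly_fun_def vec_eq_iff)
  then show ?thesis by (simp add: bd_poly_def plus_bdfld.abs_eq)
qed

lemma bd_poly_scaleR: "bd_poly (\<lambda>i c. smult r (P i c)) = r *\<^sub>R bd_poly P"
proof -
  have "bd_poly_fun (\<lambda>i c. smult r (P i c)) = (\<lambda>p. r *\<^sub>R bd_poly_fun P p)"
    by (simp add: fun_eq_iff bd_poly_fun_def vec_eq_iff)
  then show ?thesis by (simp add: bd_poly_def scaleR_bdfld.abs_eq)
qed

lemma bd_poly_0: "bd_poly (\<lambda>i c. 0) = 0"
  using bd_poly_scaleR[of 0 "\<lambda>i c. 0"] by simp

lemma bd_poly_inj:
  assumes "bd_poly P = bd_poly R"
  shows "P = R"
proof (intro ext poly_eq_on_01)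
  fix j c and x :: real assume x: "0 < x" "x < 1"
  have "AE t in lebesgue_on {0..1}. bd_poly_fun P (edge j t) = bd_poly_fun R (edge j t)"
    using assms by (simp add: bd_poly_def on_bd_eq_iff ae_eq_bd_def)
  then have "AE t in lborel. t \<in> {0<..<1} \<longrightarrow> poly (P j c) (edge_param j t) = poly (R j c) (edge_param j t)"
    unfolding AE_01_iff by eventually_elim (metis bd_poly_fun_edge greaterThanLessThan_iff)
  then have "poly (P j c) (edge_param j t) = poly (R j c) (edge_param j t)" if "t \<in> {0..1}" for t
    by (intro AE_eq_01[OF _ _ _ that]) (auto intro!: continuous_on_poly continuous_edge_param)
  from this[of "edge_param j x"] show "poly (P j c) x = poly (R j c) x"
    using x by (cases "j = 1 \<or> j = 4") (auto simp: edge_param_def)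
qed

lemma Mspace_eq: "Mspace k = {bd_poly P |P. \<forall>i c. degree (P i c) \<le> k}"
proof -
  have edge_param_poly: "\<exists>r. degree r \<le> k \<and> (\<forall>t. poly r t = poly q (edge_param j t))" if "degree q \<le> k" for q :: "real poly" and j
  proof (cases "j = 1 \<or> j = 4")
    case True
    have "degree (pcompose q [:1, -1:]) \<le> k" using degree_pcompose_le[of q "[:1, -1:]"] that by simp
    then show ?thesis using True by (intro exI[of _ "pcompose q [:1, -1:]"]) (simp add: poly_pcompose edge_param_def)
  qed (use that in \<open>auto simp: edge_param_def\<close>)
  have inv: "edge_param j (edge_param j t) = t" for j t by (simp add: edge_param_def)
  have epar01: "0 < t \<Longrightarrow> t < 1 \<Longrightarrow> 0 < edge_param j t \<and> edge_param j t < 1" for j t by (auto simp: edge_param_def)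
  show ?thesis
  proof (intro equalityI subsetI)
    fix m assume "m \<in> Mspace k"
    then obtain \<mu> where \<mu>: "m = on_bd \<mu>" "\<And>i c. (\<lambda>p. \<mu> p $ c) \<in> Ppoly_edge k i" by (auto simp: Mspace_def)
    have "\<forall>i c. \<exists>r. degree r \<le> k \<and> (\<forall>t\<in>{0<..<1}. \<mu> (edge i t) $ c = poly r (edge_param i t))"
    proof (intro allI)
      fix i c
      obtain q where q: "degree q \<le> k" "\<And>t. t \<in> {0<..<1} \<Longrightarrow> \<mu> (edge i t) $ c = poly q t"
        using \<mu>(2)[of c i] by (auto simp: Ppoly_edge_def)
      obtain r where "degree r \<le> k" "\<And>t. poly r t = poly q (edge_param i t)" using edge_param_poly[OF q(1)] by blast
      then show "\<exists>r. degree r \<le> k \<and> (\<forall>t\<in>{0<..<1}. \<mu> (edge i t) $ c = poly r (edge_param i t))"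
        using q(2) inv by (intro exI[of _ r]) auto
    qed
    then obtain P where P: "\<And>i c. degree (P i c) \<le> k" "\<And>i c t. t \<in> {0<..<1} \<Longrightarrow> \<mu> (edge i t) $ c = poly (P i c) (edge_param i t)"
      by metis
    have "m = bd_poly P"
      unfolding \<mu>(1) bd_poly_def on_bd_eq_iff ae_eq_bd_def AE_01_iff
      by (intro allI AE_I2) (auto simp: vec_eq_iff P(2) bd_poly_fun_edge)
    then show "m \<in> {bd_poly P |P. \<forall>i c. degree (P i c) \<le> k}" using P(1) by blast
  next
    fix m assume "m \<in> {bd_poly P |P. \<forall>i c. degree (P i c) \<le> k}"
    then obtain P where P: "m = bd_poly P" "\<And>i c. degree (P i c) \<le> k" by blast
    have "(\<lambda>p. bd_poly_fun P p $ c) \<in> Ppoly_edge k i" for i c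
      using edge_param_poly[OF P(2)[of i c], of i] by (auto simp: Ppoly_edge_def bd_poly_fun_edge)
    then show "m \<in> Mspace k" unfolding Mspace_def P(1) bd_poly_def by blast
  qed
qed

lemma dim_Mspace: "dim (Mspace k) = 8 * (k + 1)"
proof -
  define T where "T c = bd_poly (\<lambda>i l. upoly k (\<lambda>n. c (i, l, n)))" for c :: "4 \<times> 2 \<times> nat \<Rightarrow> real"
  let ?B = "(UNIV :: 4 set) \<times> (UNIV :: 2 set) \<times> {..k}"
  have "Mspace k = {T c |c. \<forall>i. i \<notin> ?B \<longrightarrow> c i = 0}"
  proof (intro equalityI subsetI)
    fix m assume "m \<in> Mspace k"
    then obtain P where P: "m = bd_poly P" "\<And>i c. degree (P i c) \<le> k" by (auto simp: Mspace_eq)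
    define c where "c = (\<lambda>(i, l, n). coeff (P i l) n)"
    have "P i l = upoly k (\<lambda>n. c (i, l, n))" for i l
      using P(2)[of i l] by (intro poly_eqI) (auto simp: coeff_upoly c_def coeff_eq_0)
    then have "P = (\<lambda>i l. upoly k (\<lambda>n. c (i, l, n)))" by (intro ext)
    then have "m = T c" by (simp only: P(1) T_def)
    moreover have "c i = 0" if "i \<notin> ?B" for i
    proof -
      obtain a b n where i: "i = (a, b, n)" by (cases i)
      then have "degree (P a b) < n" using that P(2)[of a b] by simp
      then show ?thesis by (simp add: c_def i coeff_eq_0)
    qed
    ultimately show "m \<in> {T c |c. \<forall>i. i \<notin> ?B \<longrightarrow> c i = 0}" by blast
  qed (auto simp: Mspace_eq T_def degree_upoly)
  moreover have "dim {T c |c. \<forall>i. i \<notin> ?B \<longrightarrow> c i = 0} = card ?B"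
  proof (rule dim_param)
    show "T (\<lambda>i. c i + d i) = T c + T d" for c d
    proof -
      have "upoly k (\<lambda>n. c (i, l, n) + d (i, l, n)) = upoly k (\<lambda>n. c (i, l, n)) + upoly k (\<lambda>n. d (i, l, n))" for i l
        by (rule poly_eqI) (simp add: coeff_upoly)
      then show ?thesis by (simp add: T_def bd_poly_add)
    qed
    show "T (\<lambda>i. r * c i) = r *\<^sub>R T c" for r c
    proof -
      have "upoly k (\<lambda>n. r * c (i, l, n)) = smult r (upoly k (\<lambda>n. c (i, l, n)))" for i l
        by (rule poly_eqI) (simp add: coeff_upoly)
      then show ?thesis by (simp add: T_def bd_poly_scaleR)
    qed
    show "\<forall>i. c i = 0" if c: "\<forall>i. i \<notin> ?B \<longrightarrow> c i = 0" and T: "T c = 0" for c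
    proof
      fix x :: "4 \<times> 2 \<times> nat"
      obtain i l n where x: "x = (i, l, n)" by (cases x)
      have "(\<lambda>i l. upoly k (\<lambda>n. c (i, l, n))) = (\<lambda>i l. 0)" by (rule bd_poly_inj) (use T in \<open>simp add: T_def bd_poly_0\<close>)
      then have "upoly k (\<lambda>n. c (i, l, n)) = 0" by metis
      then have "coeff (upoly k (\<lambda>n. c (i, l, n))) n = 0" by simp
      then show "c x = 0" using c x by (cases "n \<le> k") (auto simp: coeff_upoly)
    qed
  qed simp
  ultimately show ?thesis by simp
qed

section \<open>Airy potentials of divergence-free polynomial fields\<close>

definition bipoly_val :: "nat \<Rightarrow> (nat \<Rightarrow> nat \<Rightarrow> real) \<Rightarrow> 4 \<Rightarrow> real poly" where
  "bipoly_val N c j = (if j = 1 then upoly N (c 0) else if j = 2 then upoly N (\<lambda>i. c i 0)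
     else if j = 3 then upoly N (\<lambda>j. \<Sum>i\<le>N. c i j) else upoly N (\<lambda>i. \<Sum>j\<le>N. c i j))"

definition bipoly_der :: "nat \<Rightarrow> (nat \<Rightarrow> nat \<Rightarrow> real) \<Rightarrow> 4 \<Rightarrow> real poly" where
  "bipoly_der N c j = (if j = 1 then upoly N (c 1) else if j = 2 then upoly N (\<lambda>i. c i 1)
     else if j = 3 then upoly N (\<lambda>j. \<Sum>i\<le>N. real i * c i j) else upoly N (\<lambda>i. \<Sum>j\<le>N. real j * c i j))"

definition airy_bipoly_trace :: "nat \<Rightarrow> (nat \<Rightarrow> nat \<Rightarrow> real) \<Rightarrow> (real^2) bdfld" where
  "airy_bipoly_trace N c = bd_poly (airy_trace (bipoly_val N c) (bipoly_der N c))"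

lemma upoly_add: "upoly N (\<lambda>i. f i + g i) = upoly N f + upoly N g"
  by (rule poly_eqI) (simp add: coeff_upoly)

lemma upoly_cmult: "upoly N (\<lambda>i. r * f i) = smult r (upoly N f)"
  by (rule poly_eqI) (simp add: coeff_upoly)

lemma airy_trace_add: "airy_trace (\<lambda>j. a j + a' j) (\<lambda>j. b j + b' j) = (\<lambda>i c. airy_trace a b i c + airy_trace a' b' i c)"
  by (simp add: fun_eq_iff airy_trace_def pderiv_add)

lemma airy_trace_smult: "airy_trace (\<lambda>j. smult r (a j)) (\<lambda>j. smult r (b j)) = (\<lambda>i c. smult r (airy_trace a b i c))"
  by (simp add: fun_eq_iff airy_trace_def pderiv_smult)

lemma airy_bipoly_trace_add: "airy_bipoly_trace N (\<lambda>i j. c i j + d i j) = airy_bipoly_trace N c + airy_bipoly_trace N d"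
proof -
  have "bipoly_val N (\<lambda>i j. c i j + d i j) = (\<lambda>j. bipoly_val N c j + bipoly_val N d j)"
    "bipoly_der N (\<lambda>i j. c i j + d i j) = (\<lambda>j. bipoly_der N c j + bipoly_der N d j)"
    by (simp_all add: fun_eq_iff bipoly_val_def bipoly_der_def upoly_add[symmetric] sum.distrib distrib_left)
  then show ?thesis by (simp add: airy_bipoly_trace_def airy_trace_add bd_poly_add)
qed

lemma airy_bipoly_trace_cmult: "airy_bipoly_trace N (\<lambda>i j. r * c i j) = r *\<^sub>R airy_bipoly_trace N c"
proof -
  have "bipoly_val N (\<lambda>i j. r * c i j) = (\<lambda>j. smult r (bipoly_val N c j))" "bipoly_der N (\<lambda>i j. r * c i j) = (\<lambda>j. smult r (bipoly_der N c j))"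
    by (simp_all add: fun_eq_iff bipoly_val_def bipoly_der_def upoly_cmult[symmetric] sum_distrib_left mult.left_commute)
  then show ?thesis by (simp add: airy_bipoly_trace_def airy_trace_smult bd_poly_scaleR)
qed

lemma airy_bipoly_trace_sum:
  assumes "finite F"
  shows "airy_bipoly_trace N (\<lambda>i j. \<Sum>f\<in>F. r f * W f i j) = (\<Sum>f\<in>F. r f *\<^sub>R airy_bipoly_trace N (W f))"
  using assms
proof induction
  case empty
  then show ?case using airy_bipoly_trace_cmult[of N 0 "\<lambda>i j. 0"] by simp
next
  case (insert x F)
  then show ?case
    using airy_bipoly_trace_add[of N "\<lambda>i j. r x * W x i j" "\<lambda>i j. \<Sum>f\<in>F. r f * W f i j"] by (simp add: airy_bipoly_trace_cmult)
qed

definition potential_exps :: "nat \<Rightarrow> (nat \<times> nat) set" where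
  "potential_exps k = {(a, b). a \<le> k \<and> b \<le> k \<or> a = 0 \<and> b \<le> k + 2 \<or> a = 1 \<and> b \<le> k + 1 \<or>
     b = 0 \<and> a \<le> k + 2 \<or> b = 1 \<and> a \<le> k + 1}"

lemma coeff_pderiv_upoly: "coeff (pderiv (upoly N f)) n = (if n < N then real (Suc n) * f (Suc n) else 0)"
  by (simp add: coeff_pderiv coeff_upoly Suc_le_eq)

lemma coeff_pderiv2_upoly:
  "coeff (pderiv (pderiv (upoly N f))) n = (if Suc n < N then real (Suc n) * (real (Suc (Suc n)) * f (Suc (Suc n))) else 0)"
  by (simp add: coeff_pderiv[of "pderiv _"] coeff_pderiv_upoly)

definition airy_xx where "airy_xx c i j = real (Suc j) * (real (Suc (Suc j)) * c i (Suc (Suc j)))" for c :: "nat \<Rightarrow> nat \<Rightarrow> real"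
definition airy_xy where "airy_xy c i j = - (real (Suc i) * (real (Suc j) * c (Suc i) (Suc j)))" for c :: "nat \<Rightarrow> nat \<Rightarrow> real"
definition airy_yy where "airy_yy c i j = real (Suc i) * (real (Suc (Suc i)) * c (Suc (Suc i)) j)" for c :: "nat \<Rightarrow> nat \<Rightarrow> real"

lemma sum_extend2:
  fixes f :: "nat \<Rightarrow> real"
  assumes "f (Suc k) = 0" "f (Suc (Suc k)) = 0"
  shows "(\<Sum>i\<le>Suc (Suc k). f i) = (\<Sum>i\<le>k. f i)"
  using assms by simp

lemma sum_shift2:
  fixes f :: "nat \<Rightarrow> real"
  assumes "f (Suc (Suc k)) = 0"
  shows "(\<Sum>i\<le>Suc (Suc k). real i * f i) = (\<Sum>i\<le>k. real (Suc i) * f (Suc i))"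
proof -
  have "(\<Sum>i\<le>Suc (Suc k). real i * f i) = (\<Sum>i\<le>Suc k. real i * f i)" using assms by simp
  also have "\<dots> = (\<Sum>i\<le>k. real (Suc i) * f (Suc i))" by (subst sum.atMost_Suc_shift) simp
  finally show ?thesis .
qed

lemma potential_tensor:
  assumes k: "k \<ge> 1" and c: "\<And>a b. (a, b) \<notin> potential_exps k \<Longrightarrow> c a b = 0"
  shows "sym_bipoly k (airy_xx c) (airy_xy c) (airy_yy c) \<in> divfree (Sigma_g k)"
    "ntrace (sym_bipoly k (airy_xx c) (airy_xy c) (airy_yy c)) = airy_bipoly_trace (Suc (Suc k)) c"
proof -
  have s: "supp k (airy_xx c)" "supp k (airy_xy c)" "supp k (airy_yy c)"
    using k by (auto simp: supp_def airy_xx_def airy_xy_def airy_yy_def potential_exps_def intro!: c)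
  have "(\<lambda>i j. dX (airy_xx c) i j + dY (airy_xy c) i j) = (\<lambda>i j. 0)" "(\<lambda>i j. dX (airy_xy c) i j + dY (airy_yy c) i j) = (\<lambda>i j. 0)"
    by (simp_all add: fun_eq_iff dX_def dY_def airy_xx_def airy_xy_def airy_yy_def algebra_simps)
  then have "wdiv (sym_bipoly k (airy_xx c) (airy_xy c) (airy_yy c)) = vec_bipoly k (\<lambda>i j. 0) (\<lambda>i j. 0)"
    using sym_bipoly_wdiv_ntrace(1)[OF s] by simp
  also have "\<dots> = 0" using vec_bipoly_scaleR[of k 0 "\<lambda>i j. 0" "\<lambda>i j. 0"] by simp
  finally show "sym_bipoly k (airy_xx c) (airy_xy c) (airy_yy c) \<in> divfree (Sigma_g k)"
    using s by (auto simp: divfree_def Sigma_g_eq)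
  have z1: "c (Suc k) (Suc (Suc n)) = 0" "c (Suc (Suc k)) (Suc n) = 0" "c (Suc (Suc n)) (Suc k) = 0" "c (Suc n) (Suc (Suc k)) = 0"
    "c 1 (Suc (Suc k)) = 0" "c (Suc (Suc k)) 1 = 0" for n using k by (auto simp: potential_exps_def intro!: c)
  have z2: "(\<Sum>i\<le>Suc (Suc k). real i * c i (Suc (Suc k))) = 0" "(\<Sum>j\<le>Suc (Suc k). real j * c (Suc (Suc k)) j) = 0"
  proof -
    have a: "real i * c i (Suc (Suc k)) = 0" "real i * c (Suc (Suc k)) i = 0" for i
      using z1(4)[of "i - 1"] z1(2)[of "i - 1"] by (cases i; simp)+
    show "(\<Sum>i\<le>Suc (Suc k). real i * c i (Suc (Suc k))) = 0" "(\<Sum>j\<le>Suc (Suc k). real j * c (Suc (Suc k)) j) = 0"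
      by (simp_all only: a sum.neutral_const)
  qed
  let ?N = "Suc (Suc k)"
  have "sym_bipoly_trace k (airy_xx c) (airy_xy c) (airy_yy c) i l = airy_trace (bipoly_val ?N c) (bipoly_der ?N c) i l" for i l
  proof (rule poly_eqI)
    fix n
    have R1: "(\<Sum>i\<le>k. airy_xx c i n) = real (Suc n) * (real (Suc (Suc n)) * (\<Sum>i\<le>?N. c i (Suc (Suc n))))"
      by (subst sum_extend2) (simp_all add: z1 airy_xx_def sum_distrib_left)
    have R2: "(\<Sum>i\<le>k. airy_xy c i n) = - (real (Suc n) * (\<Sum>i\<le>?N. real i * c i (Suc n)))"
      by (subst sum_shift2[of "\<lambda>i. c i (Suc n)"]) (simp_all add: z1 airy_xy_def sum_distrib_left sum_negf mult.left_commute del: of_nat_Suc)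
    have T1: "(\<Sum>j\<le>k. airy_xy c n j) = - (real (Suc n) * (\<Sum>j\<le>?N. real j * c (Suc n) j))"
      by (subst sum_shift2[of "\<lambda>j. c (Suc n) j"]) (simp_all add: z1 airy_xy_def sum_distrib_left sum_negf mult.left_commute del: of_nat_Suc)
    have T2: "(\<Sum>j\<le>k. airy_yy c n j) = real (Suc n) * (real (Suc (Suc n)) * (\<Sum>j\<le>?N. c (Suc (Suc n)) j))"
      by (subst sum_extend2) (simp_all add: z1 airy_yy_def sum_distrib_left)
    consider "n \<le> k" | "n = Suc k" | "n > Suc k" by linarith
    then show "coeff (sym_bipoly_trace k (airy_xx c) (airy_xy c) (airy_yy c) i l) n = coeff (airy_trace (bipoly_val ?N c) (bipoly_der ?N c) i l) n"
    proof cases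
      case 1
      then show ?thesis
        unfolding sym_bipoly_trace_def airy_trace_def bipoly_val_def bipoly_der_def
        by (simp add: coeff_upoly coeff_pderiv_upoly coeff_pderiv2_upoly R1 R2 T1 T2 del: sum.atMost_Suc of_nat_Suc)
          (simp add: airy_xx_def airy_xy_def airy_yy_def)
    next
      case 2
      then show ?thesis
        unfolding sym_bipoly_trace_def airy_trace_def bipoly_val_def bipoly_der_def using z1 z2
        by (simp add: coeff_upoly coeff_pderiv_upoly coeff_pderiv2_upoly del: sum.atMost_Suc of_nat_Suc)
    next
      case 3
      then show ?thesis
        unfolding sym_bipoly_trace_def airy_trace_def bipoly_val_def bipoly_der_def
        by (simp add: coeff_upoly coeff_pderiv_upoly coeff_pderiv2_upoly del: sum.atMost_Suc of_nat_Suc)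
    qed
  qed
  then have "sym_bipoly_trace k (airy_xx c) (airy_xy c) (airy_yy c) = airy_trace (bipoly_val ?N c) (bipoly_der ?N c)" by (intro ext)
  then show "ntrace (sym_bipoly k (airy_xx c) (airy_xy c) (airy_yy c)) = airy_bipoly_trace ?N c"
    using sym_bipoly_wdiv_ntrace(2)[OF s] by (simp add: airy_bipoly_trace_def)
qed

lemma potential_exists:
  assumes k: "k \<ge> 1" and \<tau>: "\<tau> \<in> divfree (Sigma_g k)"
  obtains c where "\<And>a b. (a, b) \<notin> potential_exps k \<Longrightarrow> c a b = 0" "\<tau> = sym_bipoly k (airy_xx c) (airy_xy c) (airy_yy c)"
proof -
  obtain P R S where t: "\<tau> = sym_bipoly k P R S" and s: "supp k P" "supp k R" "supp k S" and d: "wdiv \<tau> = 0"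
    using \<tau> by (auto simp: divfree_def Sigma_g_eq)
  have "vec_bipoly k (\<lambda>i j. dX P i j + dY R i j) (\<lambda>i j. dX R i j + dY S i j) = 0"
    using d sym_bipoly_wdiv_ntrace(1)[OF s] t by simp
  moreover have "supp k (\<lambda>i j. dX P i j + dY R i j)" "supp k (\<lambda>i j. dX R i j + dY S i j)"
    using s by (simp_all add: supp_add supp_dX supp_dY)
  ultimately have z: "(\<lambda>i j. dX P i j + dY R i j) = (\<lambda>i j. 0)" "(\<lambda>i j. dX R i j + dY S i j) = (\<lambda>i j. 0)"
    by (rule vec_bipoly_eq_0)+
  have E1: "real (Suc i) * P (Suc i) j = - (real (Suc j) * R i (Suc j))" for i j
    using fun_cong[OF fun_cong[OF z(1)], of i j] by (simp add: dX_def dY_def del: of_nat_Suc)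
  have E2: "real (Suc i) * R (Suc i) j = - (real (Suc j) * S i (Suc j))" for i j
    using fun_cong[OF fun_cong[OF z(2)], of i j] by (simp add: dX_def dY_def del: of_nat_Suc)
  have s0: "P i j = 0" "R i j = 0" "S i j = 0" if "k < i \<or> k < j" for i j using s that by (auto simp: supp_def)
  define c where "c a b = (if b \<ge> 2 then P a (b - 2) / (real b * real (b - 1)) else
     if a \<ge> 2 then S (a - 2) b / (real a * real (a - 1)) else if a = 1 \<and> b = 1 then - R 0 0 else 0)" for a b
  show ?thesis
  proof
    have pP: "airy_xx c = P" by (simp add: fun_eq_iff airy_xx_def c_def)
    have pR: "airy_xy c = R"
    proof (intro ext)
      fix i j
      show "airy_xy c i j = R i j"
      proof (cases j)
        case (Suc m)
        then have "airy_xy c i j = - (real (Suc i) * P (Suc i) m) / real (Suc m)"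
          by (simp add: Suc airy_xy_def c_def field_simps del: of_nat_Suc)
        also have "\<dots> = R i j" unfolding E1 using Suc by simp
        finally show ?thesis .
      next
        case 0
        show ?thesis
        proof (cases i)
          case (Suc m)
          have "airy_xy c i j = - S m 1 / real (Suc m)"
            using 0 Suc by (simp add: airy_xy_def c_def field_simps del: of_nat_Suc)
          also have "\<dots> = R i j" using E2[of m 0] 0 Suc by (simp add: field_simps del: of_nat_Suc)
          finally show ?thesis .
        qed (simp add: 0 airy_xy_def c_def)
      qed
    qed
    have pS: "airy_yy c = S"
    proof (intro ext)
      fix i j
      show "airy_yy c i j = S i j"
      proof (cases "j \<ge> 2")
        case True
        then obtain m where m: "j = Suc (Suc m)" by (metis add_2_eq_Suc le_Suc_ex)
        have "airy_yy c i j = real (Suc i) * (real (Suc (Suc i)) * P (Suc (Suc i)) m) / (real (Suc (Suc m)) * real (Suc m))"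
          by (simp add: airy_yy_def c_def m)
        also have "\<dots> = - (real (Suc i) * R (Suc i) (Suc m)) / real (Suc (Suc m))"
          unfolding E1[of "Suc i" m] by (simp add: field_simps del: of_nat_Suc)
        also have "\<dots> = S i j" unfolding E2[of i "Suc m"] by (simp add: m del: of_nat_Suc)
        finally show ?thesis .
      next
        case False
        then show ?thesis by (simp add: airy_yy_def c_def)
      qed
    qed
    show "\<tau> = sym_bipoly k (airy_xx c) (airy_xy c) (airy_yy c)" by (simp add: t pP pR pS)
    fix a b assume ab: "(a, b) \<notin> potential_exps k"
    show "c a b = 0"
    proof (cases "b \<ge> 2")
      case True
      then obtain m where m: "b = Suc (Suc m)" by (metis add_2_eq_Suc le_Suc_ex)
      have "P a m = 0"
      proof (cases a)
        case 0
        then show ?thesis using ab m by (intro s0) (auto simp: potential_exps_def)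
      next
        case (Suc a')
        have 1: "P a m = 0" if "R a' (Suc m) = 0" using E1[of a' m] that Suc by (simp del: of_nat_Suc)
        show ?thesis
        proof (cases "k < a \<or> k \<le> m")
          case True
          then show ?thesis using 1 s0 by (cases "k < a") auto
        next
          case False
          with ab m Suc k have "Suc m = k" "a' \<ge> 1" by (auto simp: potential_exps_def)
          then obtain a'' where a'': "a' = Suc a''" by (cases a') auto
          have "S a'' (Suc (Suc m)) = 0" using \<open>Suc m = k\<close> by (intro s0) auto
          then have "R a' (Suc m) = 0" using E2[of a'' "Suc m"] a'' by (simp del: of_nat_Suc)
          with 1 show ?thesis .
        qed
      qed
      then show ?thesis by (simp add: c_def m)
    next
      case False
      show ?thesis
      proof (cases "a \<ge> 2")
        case True
        then obtain m where m: "a = Suc (Suc m)" by (metis add_2_eq_Suc le_Suc_ex)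
        have "S m b = 0"
        proof (cases "k < m")
          case False
          with ab m \<open>\<not> b \<ge> 2\<close> k have "b = 1" "m = k" by (auto simp: potential_exps_def)
          have "R (Suc m) 0 = 0" using \<open>m = k\<close> by (intro s0) auto
          then show ?thesis using E2[of m 0] \<open>b = 1\<close> by simp
        qed (auto intro: s0)
        then show ?thesis using \<open>\<not> b \<ge> 2\<close> by (simp add: c_def m)
      next
        case False
        with \<open>\<not> b \<ge> 2\<close> ab k show ?thesis by (auto simp: c_def potential_exps_def)
      qed
    qed
  qed
qed

lemma ntrace_divfree:
  assumes "k \<ge> 1"
  shows "ntrace ` divfree (Sigma_g k) = {airy_bipoly_trace (Suc (Suc k)) c |c. \<forall>a b. (a, b) \<notin> potential_exps k \<longrightarrow> c a b = 0}"
proof (intro equalityI subsetI)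
  fix m assume "m \<in> ntrace ` divfree (Sigma_g k)"
  then obtain \<tau> where \<tau>: "\<tau> \<in> divfree (Sigma_g k)" "m = ntrace \<tau>" by blast
  obtain c where "\<And>a b. (a, b) \<notin> potential_exps k \<Longrightarrow> c a b = 0" "\<tau> = sym_bipoly k (airy_xx c) (airy_xy c) (airy_yy c)"
    using potential_exists[OF assms \<tau>(1)] by blast
  then show "m \<in> {airy_bipoly_trace (Suc (Suc k)) c |c. \<forall>a b. (a, b) \<notin> potential_exps k \<longrightarrow> c a b = 0}"
    using potential_tensor(2)[OF assms, of c] \<tau>(2) by blast
next
  fix m assume "m \<in> {airy_bipoly_trace (Suc (Suc k)) c |c. \<forall>a b. (a, b) \<notin> potential_exps k \<longrightarrow> c a b = 0}"
  then obtain c where c: "m = airy_bipoly_trace (Suc (Suc k)) c" "\<And>a b. (a, b) \<notin> potential_exps k \<Longrightarrow> c a b = 0" by blast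
  then show "m \<in> ntrace ` divfree (Sigma_g k)" using potential_tensor[OF assms, of c] by (metis imageI)
qed

definition free_exps :: "nat \<Rightarrow> (nat \<times> nat) set" where
  "free_exps k = ({4..k} \<times> {4..k}) \<union> {(0, 0), (1, 0), (0, 1)}"

text \<open>\<open>hermite_cubic a\<close> lists the coefficients of \<open>x\<^sup>a\<close> minus its cubic Hermite interpolant at \<open>0\<close> and \<open>1\<close>, which is
  \<open>(3 - a) x\<^sup>2 + (a - 2) x\<^sup>3\<close> for \<open>a \<ge> 2\<close>.\<close>

definition hermite_cubic :: "nat \<Rightarrow> nat \<Rightarrow> real" where
  "hermite_cubic a i = (if i = a then 1 else 0) - (3 - real a) * (if i = 2 then 1 else 0) - (real a - 2) * (if i = 3 then 1 else 0)"

lemma hermite_cubic_sums: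
  assumes "4 \<le> a" "a \<le> N"
  shows "(\<Sum>i\<le>N. hermite_cubic a i) = 0" "(\<Sum>i\<le>N. real i * hermite_cubic a i) = 0" "hermite_cubic a 0 = 0" "hermite_cubic a 1 = 0"
proof -
  have s: "(\<Sum>i\<le>N. g i * (if i = l then 1 else 0)) = g l" if "l \<le> N" for l and g :: "nat \<Rightarrow> real"
    using that by (simp add: if_distrib cong: if_cong)
  have "(\<Sum>i\<le>N. g i * hermite_cubic a i) = g a - (3 - real a) * g 2 - (real a - 2) * g 3" for g
  proof -
    have "g i * hermite_cubic a i = g i * (if i = a then 1 else 0) - (3 - real a) * (g i * (if i = 2 then 1 else 0)) - (real a - 2) * (g i * (if i = 3 then 1 else 0))" for i
      by (simp add: hermite_cubic_def algebra_simps)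
    then show ?thesis using assms by (simp only: sum_subtractf sum_distrib_left[symmetric] s)
  qed
  from this[of "\<lambda>_. 1"] this[of real] show "(\<Sum>i\<le>N. hermite_cubic a i) = 0" "(\<Sum>i\<le>N. real i * hermite_cubic a i) = 0"
    by (simp_all add: algebra_simps)
  show "hermite_cubic a 0 = 0" "hermite_cubic a 1 = 0" using assms by (auto simp: hermite_cubic_def)
qed

definition kernel_coeffs :: "nat \<times> nat \<Rightarrow> nat \<Rightarrow> nat \<Rightarrow> real" where
  "kernel_coeffs f i j = (if fst f \<ge> 4 then hermite_cubic (fst f) i * hermite_cubic (snd f) j else if (i, j) = f then 1 else 0)"

lemma upoly_zero: "(\<And>i. f i = 0) \<Longrightarrow> upoly N f = 0"
  by (rule poly_eqI) (simp add: coeff_upoly)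

lemma airy_bipoly_trace_kernel_coeffs:
  assumes "f \<in> free_exps k" "N = Suc (Suc k)"
  shows "airy_bipoly_trace N (kernel_coeffs f) = 0"
proof -
  have "airy_trace (bipoly_val N (kernel_coeffs f)) (bipoly_der N (kernel_coeffs f)) i l = 0" for i l
  proof (cases "fst f \<ge> 4")
    case True
    then have f: "4 \<le> fst f" "fst f \<le> N" "4 \<le> snd f" "snd f \<le> N" using assms by (auto simp: free_exps_def)
    note h = hermite_cubic_sums[OF f(1,2)] hermite_cubic_sums[OF f(3,4)]
    have "bipoly_val N (kernel_coeffs f) j = 0" "bipoly_der N (kernel_coeffs f) j = 0" for j
    proof -
      have s: "(\<Sum>i\<le>N. hermite_cubic (fst f) i * y) = 0" "(\<Sum>i\<le>N. real i * (hermite_cubic (fst f) i * y)) = 0"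
        "(\<Sum>i\<le>N. y * hermite_cubic (snd f) i) = 0" "(\<Sum>i\<le>N. real i * (y * hermite_cubic (snd f) i)) = 0" for y
        by (simp_all only: mult.assoc[symmetric] sum_distrib_right[symmetric] h mult_zero_left)
          (simp_all only: mult.assoc mult.left_commute[of _ y] sum_distrib_left[symmetric] h mult_zero_right)
      show "bipoly_val N (kernel_coeffs f) j = 0" "bipoly_der N (kernel_coeffs f) j = 0"
        unfolding bipoly_val_def bipoly_der_def kernel_coeffs_def using True h s by (auto intro!: upoly_zero simp del: One_nat_def)
    qed
    then show ?thesis by (simp add: airy_trace_def)
  next
    case False
    then have f: "f = (0, 0) \<or> f = (1, 0) \<or> f = (0, 1)" using assms by (auto simp: free_exps_def)
    have W: "kernel_coeffs f i j = (if (i, j) = f then 1 else 0)" for i j using False by (simp add: kernel_coeffs_def)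
    have d: "(\<Sum>i\<le>N. if (i, j) = f then 1 else 0) = (if snd f = j then 1 else (0::real))"
      "(\<Sum>i\<le>N. real i * (if (i, j) = f then 1 else 0)) = (if snd f = j then real (fst f) else (0::real))"
      "(\<Sum>i\<le>N. if (j, i) = f then 1 else 0) = (if fst f = j then 1 else (0::real))"
      "(\<Sum>i\<le>N. real i * (if (j, i) = f then 1 else 0)) = (if fst f = j then real (snd f) else (0::real))" for j
      using f assms(2) by (auto simp: if_distrib cong: if_cong)
    show ?thesis
      by (rule poly_eqI) (use f in \<open>auto simp: airy_trace_def bipoly_val_def bipoly_der_def coeff_pderiv_upoly coeff_pderiv2_upoly W d\<close>)
  qed
  then have "airy_trace (bipoly_val N (kernel_coeffs f)) (bipoly_der N (kernel_coeffs f)) = (\<lambda>i l. 0)" by (intro ext)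
  then show ?thesis by (simp add: airy_bipoly_trace_def bd_poly_0)
qed

lemma finite_potential_exps: "finite (potential_exps k)"
  by (rule finite_subset[of _ "{..k + 2} \<times> {..k + 2}"]) (auto simp: potential_exps_def)

lemma finite_free_exps: "finite (free_exps k)"
  by (simp add: free_exps_def)

lemma airy_bipoly_trace_reduce:
  assumes k: "k \<ge> 1"
  shows "{airy_bipoly_trace (Suc (Suc k)) c |c. \<forall>a b. (a, b) \<notin> potential_exps k \<longrightarrow> c a b = 0} =
    {airy_bipoly_trace (Suc (Suc k)) c |c. \<forall>a b. (a, b) \<notin> potential_exps k - free_exps k \<longrightarrow> c a b = 0}"
proof (intro equalityI subsetI)
  fix m assume "m \<in> {airy_bipoly_trace (Suc (Suc k)) c |c. \<forall>a b. (a, b) \<notin> potential_exps k \<longrightarrow> c a b = 0}"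
  then obtain c where c: "m = airy_bipoly_trace (Suc (Suc k)) c" "\<And>a b. (a, b) \<notin> potential_exps k \<Longrightarrow> c a b = 0" by blast
  define d where "d i j = c i j + (-1) * (\<Sum>f\<in>free_exps k. c (fst f) (snd f) * kernel_coeffs f i j)" for i j
  have W1: "kernel_coeffs f i j = (if f = (i, j) then 1 else 0)" if "f \<in> free_exps k" "(i, j) \<in> free_exps k" for f i j
    using that by (cases f) (auto simp: free_exps_def kernel_coeffs_def hermite_cubic_def)
  have W0: "kernel_coeffs f i j = 0" if "f \<in> free_exps k" "(i, j) \<notin> potential_exps k" for f i j
  proof (cases "4 \<le> fst f")
    case True
    then have f: "4 \<le> snd f" "fst f \<le> k" "snd f \<le> k" using that(1) by (auto simp: free_exps_def)
    have "k < i \<or> k < j" using that(2) by (auto simp: potential_exps_def)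
    then have "hermite_cubic (fst f) i = 0 \<or> hermite_cubic (snd f) j = 0" using True f by (auto simp: hermite_cubic_def)
    then show ?thesis using True by (auto simp: kernel_coeffs_def)
  next
    case False
    then have "f = (0, 0) \<or> f = (1, 0) \<or> f = (0, 1)" using that(1) by (auto simp: free_exps_def)
    then have "f \<in> potential_exps k" using k by (auto simp: potential_exps_def)
    then show ?thesis using False that(2) by (auto simp: kernel_coeffs_def)
  qed
  have "airy_bipoly_trace (Suc (Suc k)) d = m + (-1) *\<^sub>R (\<Sum>f\<in>free_exps k. c (fst f) (snd f) *\<^sub>R airy_bipoly_trace (Suc (Suc k)) (kernel_coeffs f))"
    unfolding d_def airy_bipoly_trace_add airy_bipoly_trace_cmult airy_bipoly_trace_sum[OF finite_free_exps] c(1) ..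
  also have "\<dots> = m" by (simp add: airy_bipoly_trace_kernel_coeffs)
  finally have "m = airy_bipoly_trace (Suc (Suc k)) d" ..
  moreover have "d a b = 0" if "(a, b) \<notin> potential_exps k - free_exps k" for a b
  proof (cases "(a, b) \<in> free_exps k")
    case True
    have "(\<Sum>f\<in>free_exps k. c (fst f) (snd f) * kernel_coeffs f a b) = (\<Sum>f\<in>free_exps k. if f = (a, b) then c a b else 0)"
      by (intro sum.cong) (auto simp: W1[OF _ True])
    then show ?thesis using True by (simp add: d_def finite_free_exps)
  next
    case False
    then have "(a, b) \<notin> potential_exps k" using that by blast
    then show ?thesis by (simp add: d_def c(2) W0)
  qed
  ultimately show "m \<in> {airy_bipoly_trace (Suc (Suc k)) c |c. \<forall>a b. (a, b) \<notin> potential_exps k - free_exps k \<longrightarrow> c a b = 0}" by blast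
qed blast

lemma airy_bipoly_trace_eq_0D:
  assumes "airy_bipoly_trace N c = 0"
  shows "n \<ge> 2 \<Longrightarrow> n \<le> N \<Longrightarrow> c 0 n = 0" "n \<ge> 1 \<Longrightarrow> n \<le> N \<Longrightarrow> c 1 n = 0"
    "n \<ge> 2 \<Longrightarrow> n \<le> N \<Longrightarrow> c n 0 = 0" "n \<ge> 1 \<Longrightarrow> n \<le> N \<Longrightarrow> c n 1 = 0"
    "n \<ge> 2 \<Longrightarrow> n \<le> N \<Longrightarrow> (\<Sum>i\<le>N. c i n) = 0" "n \<ge> 1 \<Longrightarrow> n \<le> N \<Longrightarrow> (\<Sum>i\<le>N. real i * c i n) = 0"
    "n \<ge> 2 \<Longrightarrow> n \<le> N \<Longrightarrow> (\<Sum>i\<le>N. c n i) = 0" "n \<ge> 1 \<Longrightarrow> n \<le> N \<Longrightarrow> (\<Sum>i\<le>N. real i * c n i) = 0"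
proof -
  have "airy_trace (bipoly_val N c) (bipoly_der N c) = (\<lambda>i l. 0)"
    by (rule bd_poly_inj) (use assms in \<open>simp add: airy_bipoly_trace_def bd_poly_0\<close>)
  then have z: "coeff (airy_trace (bipoly_val N c) (bipoly_der N c) i l) m = 0" for i l m by simp
  have two: "f n = 0" if "\<And>m. Suc m < N \<Longrightarrow> f (Suc (Suc m)) = 0" "n \<ge> 2" "n \<le> N" for f :: "nat \<Rightarrow> real" and n
    using that(1)[of "n - 2"] that(2,3) by (simp add: numeral_2_eq_2 Suc_diff_Suc)
  have one: "f n = 0" if "\<And>m. m < N \<Longrightarrow> f (Suc m) = 0" "n \<ge> 1" "n \<le> N" for f :: "nat \<Rightarrow> real" and n
    using that(1)[of "n - 1"] that(2,3) by simp
  note cs = coeff_pderiv_upoly coeff_pderiv2_upoly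
  have Z: "Suc m < N \<Longrightarrow> c 0 (Suc (Suc m)) = 0" "m < N \<Longrightarrow> c 1 (Suc m) = 0" "Suc m < N \<Longrightarrow> c (Suc (Suc m)) 0 = 0" "m < N \<Longrightarrow> c (Suc m) 1 = 0"
    "Suc m < N \<Longrightarrow> (\<Sum>i\<le>N. c i (Suc (Suc m))) = 0" "m < N \<Longrightarrow> (\<Sum>i\<le>N. real i * c i (Suc m)) = 0"
    "Suc m < N \<Longrightarrow> (\<Sum>i\<le>N. c (Suc (Suc m)) i) = 0" "m < N \<Longrightarrow> (\<Sum>i\<le>N. real i * c (Suc m) i) = 0" for m
    using z[of 1 1 m] z[of 1 2 m] z[of 2 2 m] z[of 2 1 m] z[of 3 1 m] z[of 3 2 m] z[of 4 2 m] z[of 4 1 m]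
    by (simp_all add: airy_trace_def bipoly_val_def bipoly_der_def cs del: of_nat_Suc)
  show "n \<ge> 2 \<Longrightarrow> n \<le> N \<Longrightarrow> c 0 n = 0" by (rule two[where f="c 0", OF Z(1)])
  show "n \<ge> 1 \<Longrightarrow> n \<le> N \<Longrightarrow> c 1 n = 0" by (rule one[where f="c 1", OF Z(2)])
  show "n \<ge> 2 \<Longrightarrow> n \<le> N \<Longrightarrow> c n 0 = 0" by (rule two[where f="\<lambda>n. c n 0", OF Z(3)])
  show "n \<ge> 1 \<Longrightarrow> n \<le> N \<Longrightarrow> c n 1 = 0" by (rule one[where f="\<lambda>n. c n 1", OF Z(4)])
  show "n \<ge> 2 \<Longrightarrow> n \<le> N \<Longrightarrow> (\<Sum>i\<le>N. c i n) = 0" by (rule two[where f="\<lambda>n. \<Sum>i\<le>N. c i n", OF Z(5)])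
  show "n \<ge> 1 \<Longrightarrow> n \<le> N \<Longrightarrow> (\<Sum>i\<le>N. real i * c i n) = 0" by (rule one[where f="\<lambda>n. \<Sum>i\<le>N. real i * c i n", OF Z(6)])
  show "n \<ge> 2 \<Longrightarrow> n \<le> N \<Longrightarrow> (\<Sum>i\<le>N. c n i) = 0" by (rule two[where f="\<lambda>n. \<Sum>i\<le>N. c n i", OF Z(7)])
  show "n \<ge> 1 \<Longrightarrow> n \<le> N \<Longrightarrow> (\<Sum>i\<le>N. real i * c n i) = 0" by (rule one[where f="\<lambda>n. \<Sum>i\<le>N. real i * c n i", OF Z(8)])
qed

lemma two_term_zero:
  fixes f :: "nat \<Rightarrow> real"
  assumes "N \<ge> 3" "\<And>i. i \<noteq> 2 \<Longrightarrow> i \<noteq> 3 \<Longrightarrow> f i = 0" "(\<Sum>i\<le>N. f i) = 0" "(\<Sum>i\<le>N. real i * f i) = 0"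
  shows "f i = 0"
proof -
  have "(\<Sum>i\<le>N. g i) = g 2 + g 3" if "\<And>i. i \<noteq> 2 \<Longrightarrow> i \<noteq> 3 \<Longrightarrow> g i = 0" for g :: "nat \<Rightarrow> real"
  proof -
    have "(\<Sum>i\<le>N. g i) = (\<Sum>i\<in>{2, 3}. g i)" using assms(1) that by (intro sum.mono_neutral_right) auto
    then show ?thesis by simp
  qed
  from this[of f] this[of "\<lambda>i. real i * f i"] assms have "f 2 + f 3 = 0" "2 * f 2 + 3 * f 3 = 0" by simp_all
  then have "f 2 = 0" "f 3 = 0" by linarith+
  then show ?thesis using assms(2) by (cases "i = 2 \<or> i = 3") auto
qed

lemma airy_bipoly_trace_inj:
  assumes k: "k \<ge> 1" and c: "\<And>a b. (a, b) \<notin> potential_exps k - free_exps k \<Longrightarrow> c a b = 0" and T: "airy_bipoly_trace (Suc (Suc k)) c = 0"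
  shows "c i j = 0"
proof -
  let ?N = "Suc (Suc k)"
  note z = airy_bipoly_trace_eq_0D[OF T]
  have out: "c a b = 0" if "a > ?N \<or> b > ?N" for a b using that by (intro c) (auto simp: potential_exps_def)
  have low: "c a b = 0" if "a < 2 \<or> b < 2" for a b
  proof (cases "a \<le> ?N \<and> b \<le> ?N")
    case True
    have f: "c 0 0 = 0" "c 1 0 = 0" "c 0 1 = 0" by (auto intro!: c simp: free_exps_def)
    have "c 0 b = 0" using z(1)[of b] f True by (cases "b = 0 \<or> b = 1") auto
    moreover have "c 1 b = 0" using z(2)[of b] f True by (cases "b = 0") auto
    moreover have "c a 0 = 0" using z(3)[of a] f True by (cases "a = 0 \<or> a = 1") auto
    moreover have "c a 1 = 0" using z(4)[of a] f True by (cases "a = 0") auto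
    moreover have "a = 0 \<or> a = 1 \<or> b = 0 \<or> b = 1" using that by auto
    ultimately show ?thesis by auto
  qed (use out in auto)
  have N3: "?N \<ge> 3" using k by simp
  have hi: "c a b = 0" if "4 \<le> a" "4 \<le> b" for a b
    using that by (intro c) (auto simp: potential_exps_def free_exps_def)
  have b4: "c a b = 0" if "4 \<le> b" for a b
  proof (cases "b \<le> ?N")
    case True
    have "(\<Sum>i\<le>?N. c i b) = 0" "(\<Sum>i\<le>?N. real i * c i b) = 0" using z(5,6)[of b] that True by auto
    moreover have "c i b = 0" if "i \<noteq> 2" "i \<noteq> 3" for i
      using low[of i b] hi[of i b] \<open>4 \<le> b\<close> that by (cases "i < 2") auto
    ultimately show ?thesis using two_term_zero[OF N3, of "\<lambda>i. c i b"] by blast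
  qed (use out in auto)
  have a4: "c a b = 0" if "4 \<le> a" for a b
  proof (cases "a \<le> ?N")
    case True
    have "(\<Sum>i\<le>?N. c a i) = 0" "(\<Sum>i\<le>?N. real i * c a i) = 0" using z(7,8)[of a] that True by auto
    moreover have "c a i = 0" if "i \<noteq> 2" "i \<noteq> 3" for i
      using low[of a i] hi[of a i] \<open>4 \<le> a\<close> that by (cases "i < 2") auto
    ultimately show ?thesis using two_term_zero[OF N3, of "\<lambda>i. c a i"] by blast
  qed (use out in auto)
  show ?thesis
  proof (cases "2 \<le> j \<and> j \<le> 3")
    case True
    have "(\<Sum>i\<le>?N. c i j) = 0" "(\<Sum>i\<le>?N. real i * c i j) = 0" using z(5,6)[of j] True N3 by auto
    moreover have "c i j = 0" if "i \<noteq> 2" "i \<noteq> 3" for i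
      using low[of i j] a4[of i j] that by (cases "i < 2") auto
    ultimately show ?thesis using two_term_zero[OF N3, of "\<lambda>i. c i j"] by blast
  next
    case False
    then show ?thesis using low[of i j] b4[of j i] by (cases "j < 2") auto
  qed
qed

lemma card_potential_exps_diff:
  assumes "k \<ge> 1"
  shows "card (potential_exps k - free_exps k) = (k + 1)^2 + 3 - (k - 3)^2"
proof -
  let ?S = "{(0, k + 1), (0, k + 2), (1, k + 1), (k + 1, 0), (k + 2, 0), (k + 1, 1)} :: (nat \<times> nat) set"
  have "(a, b) \<in> potential_exps k \<longleftrightarrow> (a, b) \<in> {..k} \<times> {..k} \<union> ?S" for a b
  proof -
    have "(a \<le> k \<and> b \<le> k \<or> a = 0 \<and> b \<le> k + 2 \<or> a = 1 \<and> b \<le> k + 1 \<or> b = 0 \<and> a \<le> k + 2 \<or> b = 1 \<and> a \<le> k + 1) \<longleftrightarrow>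
      a \<le> k \<and> b \<le> k \<or> (a = 0 \<and> b = k + 1 \<or> a = 0 \<and> b = k + 2 \<or> a = 1 \<and> b = k + 1 \<or>
        a = k + 1 \<and> b = 0 \<or> a = k + 2 \<and> b = 0 \<or> a = k + 1 \<and> b = 1)"
      using assms by presburger
    then show ?thesis by (simp add: potential_exps_def) blast
  qed
  then have "potential_exps k = {..k} \<times> {..k} \<union> ?S" by (intro set_eqI) (metis surj_pair)
  moreover have "?S - free_exps k = ?S" using assms by (auto simp: free_exps_def)
  ultimately have eq: "potential_exps k - free_exps k = ({..k} \<times> {..k} - ({4..k} \<times> {4..k} \<union> {(0, 0), (1, 0), (0, 1)})) \<union> ?S"
    by (simp only: Un_Diff free_exps_def)
  have "card ({4..k} \<times> {4..k} \<union> {(0, 0), (1, 0), (0, 1::nat)}) = (k - 3)^2 + 3"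
    by (subst card_Un_disjoint) (auto simp: power2_eq_square)
  then have "card ({..k} \<times> {..k} - ({4..k} \<times> {4..k} \<union> {(0, 0), (1, 0), (0, 1)})) = (k + 1)^2 - ((k - 3)^2 + 3)"
    using assms by (subst card_Diff_subset) (auto simp: power2_eq_square)
  moreover have "card ?S = 6" using assms by simp
  ultimately have "card (potential_exps k - free_exps k) = (k + 1)^2 - ((k - 3)^2 + 3) + 6"
    unfolding eq by (subst card_Un_disjoint) auto
  moreover have "(k - 3)^2 + 3 \<le> (k + 1)^2"
  proof -
    have "(k - 3)^2 \<le> (k - 1)^2" by (rule power_mono) auto
    moreover have "(k - 1)^2 + 4 * k = (k + 1)^2" using assms by (cases k) (auto simp: power2_eq_square algebra_simps)
    ultimately show ?thesis using assms by linarith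
  qed
  ultimately show ?thesis by linarith
qed

lemma dim_ntrace_divfree:
  assumes k: "k \<ge> 1"
  shows "dim (ntrace ` divfree (Sigma_g k)) = (k + 1)^2 + 3 - (k - 3)^2"
proof -
  define T where "T c = airy_bipoly_trace (Suc (Suc k)) (\<lambda>i j. c (i, j))" for c :: "nat \<times> nat \<Rightarrow> real"
  have "ntrace ` divfree (Sigma_g k) = {T c |c. \<forall>i. i \<notin> potential_exps k - free_exps k \<longrightarrow> c i = 0}"
    unfolding ntrace_divfree[OF k] airy_bipoly_trace_reduce[OF k]
  proof (intro equalityI subsetI)
    fix m assume "m \<in> {airy_bipoly_trace (Suc (Suc k)) c |c. \<forall>a b. (a, b) \<notin> potential_exps k - free_exps k \<longrightarrow> c a b = 0}"
    then obtain c where c: "m = airy_bipoly_trace (Suc (Suc k)) c" "\<forall>a b. (a, b) \<notin> potential_exps k - free_exps k \<longrightarrow> c a b = 0" by blast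
    then have "m = T (\<lambda>(i, j). c i j)" "\<forall>i. i \<notin> potential_exps k - free_exps k \<longrightarrow> (\<lambda>(i, j). c i j) i = 0" by (auto simp: T_def)
    then show "m \<in> {T c |c. \<forall>i. i \<notin> potential_exps k - free_exps k \<longrightarrow> c i = 0}" by blast
  qed (auto simp: T_def)
  moreover have "dim {T c |c. \<forall>i. i \<notin> potential_exps k - free_exps k \<longrightarrow> c i = 0} = card (potential_exps k - free_exps k)"
  proof (rule dim_param)
    show "\<forall>i. c i = 0" if "\<forall>i. i \<notin> potential_exps k - free_exps k \<longrightarrow> c i = 0" "T c = 0" for c
      using airy_bipoly_trace_inj[OF k, of "\<lambda>i j. c (i, j)"] that by (auto simp: T_def)
  qed (auto simp: T_def airy_bipoly_trace_add airy_bipoly_trace_cmult finite_potential_exps)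
  ultimately show ?thesis using card_potential_exps_diff[OF k] by simp
qed

section \<open>The indices and the space \<open>fillV\<close>\<close>

lemma dim_V_g: "dim (V_g k) = 2 * (k + 1)^2"
proof -
  define T where "T c = vec_bipoly k (\<lambda>i j. c (i, j, False)) (\<lambda>i j. c (i, j, True))" for c :: "nat \<times> nat \<times> bool \<Rightarrow> real"
  let ?B = "{..k} \<times> {..k} \<times> (UNIV :: bool set)"
  have "V_g k = {T c |c. \<forall>i. i \<notin> ?B \<longrightarrow> c i = 0}"
  proof (intro equalityI subsetI)
    fix u assume "u \<in> V_g k"
    then obtain c d where u: "u = vec_bipoly k c d" "supp k c" "supp k d" by (auto simp: V_g_eq)
    then have "u = T (\<lambda>(i, j, b). if b then d i j else c i j)"
      "\<forall>i. i \<notin> ?B \<longrightarrow> (\<lambda>(i, j, b). if b then d i j else c i j) i = 0"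
      by (auto simp: T_def supp_def)
    then show "u \<in> {T c |c. \<forall>i. i \<notin> ?B \<longrightarrow> c i = 0}" by blast
  next
    fix u assume "u \<in> {T c |c. \<forall>i. i \<notin> ?B \<longrightarrow> c i = 0}"
    then obtain c where c: "u = T c" "\<forall>i. i \<notin> ?B \<longrightarrow> c i = 0" by blast
    have "supp k (\<lambda>i j. c (i, j, b))" for b using c(2) by (auto simp: supp_def)
    then show "u \<in> V_g k" unfolding V_g_eq c(1) T_def by blast
  qed
  moreover have "dim {T c |c. \<forall>i. i \<notin> ?B \<longrightarrow> c i = 0} = card ?B"
  proof (rule dim_param)
    show "\<forall>i. c i = 0" if c: "\<forall>i. i \<notin> ?B \<longrightarrow> c i = 0" and T: "T c = 0" for c
    proof -
      have "supp k (\<lambda>i j. c (i, j, b))" for b using c by (auto simp: supp_def)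
      from vec_bipoly_eq_0[OF T[unfolded T_def] this this]
      have "c (i, j, b) = 0" for i j b by (cases b) (metis (full_types))+
      then show ?thesis by auto
    qed
  qed (auto simp: T_def vec_bipoly_add vec_bipoly_scaleR)
  ultimately show ?thesis by (simp add: power2_eq_square)
qed

lemma vec_bipoly_inj:
  assumes "vec_bipoly k c d = vec_bipoly k c' d'" "supp k c" "supp k d" "supp k c'" "supp k d'"
  shows "c = c'" "d = d'"
proof -
  have "vec_bipoly k (\<lambda>i j. c i j + (-1) * c' i j) (\<lambda>i j. d i j + (-1) * d' i j) = 0"
    using assms(1) by (simp only: vec_bipoly_add vec_bipoly_scaleR) simp
  from vec_bipoly_eq_0[OF this] assms(2-5) have "(\<lambda>i j. c i j + (-1) * c' i j) = (\<lambda>i j. 0)" "(\<lambda>i j. d i j + (-1) * d' i j) = (\<lambda>i j. 0)"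
    by (simp_all add: supp_def)
  then show "c = c'" "d = d'" by (simp_all add: fun_eq_iff)
qed

lemma vec_bipoly_memI:
  "supp k v \<Longrightarrow> supp k w \<Longrightarrow> P v w \<Longrightarrow> vec_bipoly k v w \<in> {vec_bipoly k v w |v w. supp k v \<and> supp k w \<and> P v w}"
  by blast

lemma wdiv_Sigma_g:
  assumes k: "k \<ge> 1"
  shows "wdiv ` Sigma_g k = {vec_bipoly k v w |v w. supp k v \<and> supp k w \<and> v k k = 0 \<and> w k k = 0 \<and> v k (k - 1) = w (k - 1) k}"
proof (intro equalityI subsetI)
  fix u assume "u \<in> wdiv ` Sigma_g k"
  then obtain c d e where u: "u = wdiv (sym_bipoly k c d e)" and s: "supp k c" "supp k d" "supp k e" by (auto simp: Sigma_g_eq)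
  have z: "c (Suc k) j = 0" "d i (Suc k) = 0" "d (Suc k) j = 0" "e i (Suc k) = 0" for i j using s by (simp_all add: supp_def)
  have "dX c k k + dY d k k = 0" "dX d k k + dY e k k = 0" "dX c k (k - 1) + dY d k (k - 1) = dX d (k - 1) k + dY e (k - 1) k"
    using k by (simp_all add: dX_def dY_def z)
  then show "u \<in> {vec_bipoly k v w |v w. supp k v \<and> supp k w \<and> v k k = 0 \<and> w k k = 0 \<and> v k (k - 1) = w (k - 1) k}"
    unfolding u sym_bipoly_wdiv_ntrace(1)[OF s] using s
    by (intro vec_bipoly_memI[where P = "\<lambda>v w. v k k = 0 \<and> w k k = 0 \<and> v k (k - 1) = w (k - 1) k"] supp_add supp_dX supp_dY conjI) simp_all
next
  fix u assume "u \<in> {vec_bipoly k v w |v w. supp k v \<and> supp k w \<and> v k k = 0 \<and> w k k = 0 \<and> v k (k - 1) = w (k - 1) k}"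
  then obtain v w where u: "u = vec_bipoly k v w" and s: "supp k v" "supp k w" and c: "v k k = 0" "w k k = 0" "v k (k - 1) = w (k - 1) k" by blast
  define d where "d i j = (if i = k \<and> 1 \<le> j \<and> j \<le> k then v k (j - 1) / real j
    else if j = k \<and> 1 \<le> i \<and> i \<le> k then w (i - 1) k / real i else 0)" for i j
  define p where "p i j = (if 1 \<le> i \<and> i \<le> k \<and> j \<le> k then (v (i - 1) j - dY d (i - 1) j) / real i else 0)" for i j
  define r where "r i j = (if 1 \<le> j \<and> j \<le> k \<and> i \<le> k then (w i (j - 1) - dX d i (j - 1)) / real j else 0)" for i j
  have sd: "supp k d" "supp k p" "supp k r" by (auto simp: supp_def d_def p_def r_def)
  have dk: "dY d k j = v k j" if "j < k" for j using that by (simp add: dY_def d_def del: of_nat_Suc)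
  have dk': "dX d i k = w i k" if "i < k" for i
  proof (cases "Suc i = k")
    case True
    then have "dX d i k = real k * (v k (k - 1) / real k)" using k by (simp add: dX_def d_def)
    also have "\<dots> = w i k" using True c(3) k by auto
    finally show ?thesis .
  next
    case False
    then show ?thesis using that by (simp add: dX_def d_def del: of_nat_Suc)
  qed
  have "(\<lambda>i j. dX p i j + dY d i j) = v"
  proof (intro ext)
    fix i j
    consider "k < i \<or> k < j" | "i < k" "j \<le> k" | "i = k" "j < k" | "i = k" "j = k" by linarith
    then show "dX p i j + dY d i j = v i j"
    proof cases
      case 1
      then show ?thesis using supp_dX[OF sd(2)] supp_dY[OF sd(1)] s by (auto simp: supp_def)
    next
      case 2
      then show ?thesis by (simp add: dX_def p_def del: of_nat_Suc)
    next
      case 3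
      then show ?thesis by (simp add: dX_def p_def dk)
    next
      case 4
      then show ?thesis by (simp add: dX_def p_def dY_def d_def c)
    qed
  qed
  moreover have "(\<lambda>i j. dX d i j + dY r i j) = w"
  proof (intro ext)
    fix i j
    consider "k < i \<or> k < j" | "j < k" "i \<le> k" | "j = k" "i < k" | "i = k" "j = k" by linarith
    then show "dX d i j + dY r i j = w i j"
    proof cases
      case 1
      then show ?thesis using supp_dX[OF sd(1)] supp_dY[OF sd(3)] s by (auto simp: supp_def)
    next
      case 2
      then show ?thesis by (simp add: dY_def r_def del: of_nat_Suc)
    next
      case 3
      then show ?thesis by (simp add: dY_def r_def dk')
    next
      case 4
      then show ?thesis by (simp add: dY_def r_def dX_def d_def c)
    qed
  qed
  ultimately have "wdiv (sym_bipoly k p d r) = u" using sym_bipoly_wdiv_ntrace(1)[OF sd(2,1,3)] by (simp add: u)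
  then show "u \<in> wdiv ` Sigma_g k" using sd by (auto simp: Sigma_g_eq)
qed

lemma dim_wdiv_Sigma_g:
  assumes k: "k \<ge> 1"
  shows "dim (wdiv ` Sigma_g k) = 2 * (k + 1)^2 - 3"
proof -
  define W where "W c i j = (if i = k - 1 \<and> j = k then c (k, k - 1, False) else c (i, j, True))" for c :: "nat \<times> nat \<times> bool \<Rightarrow> real" and i j
  define T where "T c = vec_bipoly k (\<lambda>i j. c (i, j, False)) (W c)" for c
  let ?X = "{(k, k, False), (k, k, True), (k - 1, k, True)}"
  let ?B = "{..k} \<times> {..k} \<times> (UNIV :: bool set) - ?X"
  have sW: "supp k (\<lambda>i j. c (i, j, False))" "supp k (W c)" if "\<forall>i. i \<notin> ?B \<longrightarrow> c i = 0" for c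
    using that k by (auto simp: supp_def W_def)
  have "wdiv ` Sigma_g k = {T c |c. \<forall>i. i \<notin> ?B \<longrightarrow> c i = 0}"
    unfolding wdiv_Sigma_g[OF k]
  proof (intro equalityI subsetI)
    fix u assume "u \<in> {vec_bipoly k v w |v w. supp k v \<and> supp k w \<and> v k k = 0 \<and> w k k = 0 \<and> v k (k - 1) = w (k - 1) k}"
    then obtain v w where u: "u = vec_bipoly k v w" and s: "supp k v" "supp k w" and c: "v k k = 0" "w k k = 0" "v k (k - 1) = w (k - 1) k" by blast
    define cc where "cc = (\<lambda>(i, j, b). if b then (if i = k - 1 \<and> j = k then 0 else w i j) else v i j)"
    have "W cc = w" using c k by (auto simp: fun_eq_iff W_def cc_def)
    then have "u = T cc" by (simp add: T_def u cc_def)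
    moreover have "\<forall>i. i \<notin> ?B \<longrightarrow> cc i = 0"
    proof (intro allI impI)
      fix x :: "nat \<times> nat \<times> bool" assume x: "x \<notin> ?B"
      obtain i j b where xe: "x = (i, j, b)" by (cases x)
      show "cc x = 0"
      proof (cases "i \<le> k \<and> j \<le> k")
        case True
        then show ?thesis using x c by (auto simp: cc_def xe)
      next
        case False
        then have "v i j = 0" "w i j = 0" using s by (auto simp: supp_def)
        then show ?thesis by (simp add: cc_def xe)
      qed
    qed
    ultimately show "u \<in> {T c |c. \<forall>i. i \<notin> ?B \<longrightarrow> c i = 0}" by blast
  next
    fix u assume "u \<in> {T c |c. \<forall>i. i \<notin> ?B \<longrightarrow> c i = 0}"
    then obtain c where c: "u = T c" "\<forall>i. i \<notin> ?B \<longrightarrow> c i = 0" by blast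
    have "c (k, k, False) = 0" "W c k k = 0" "c (k, k - 1, False) = W c (k - 1) k"
      using c(2) k by (auto simp: W_def)
    then show "u \<in> {vec_bipoly k v w |v w. supp k v \<and> supp k w \<and> v k k = 0 \<and> w k k = 0 \<and> v k (k - 1) = w (k - 1) k}"
      unfolding c(1) T_def using sW[OF c(2)]
      by (intro vec_bipoly_memI[where P = "\<lambda>v w. v k k = 0 \<and> w k k = 0 \<and> v k (k - 1) = w (k - 1) k"] conjI)
  qed
  moreover have "dim {T c |c. \<forall>i. i \<notin> ?B \<longrightarrow> c i = 0} = card ?B"
  proof (rule dim_param)
    show "T (\<lambda>i. c i + d i) = T c + T d" for c d
    proof -
      have "W (\<lambda>i. c i + d i) = (\<lambda>i j. W c i j + W d i j)" by (simp add: fun_eq_iff W_def)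
      then show ?thesis by (simp add: T_def vec_bipoly_add)
    qed
    show "T (\<lambda>i. r * c i) = r *\<^sub>R T c" for r c
    proof -
      have "W (\<lambda>i. r * c i) = (\<lambda>i j. r * W c i j)" by (simp add: fun_eq_iff W_def)
      then show ?thesis by (simp add: T_def vec_bipoly_scaleR)
    qed
    show "\<forall>i. c i = 0" if c: "\<forall>i. i \<notin> ?B \<longrightarrow> c i = 0" and T: "T c = 0" for c
    proof
      fix x :: "nat \<times> nat \<times> bool"
      obtain i j b where x: "x = (i, j, b)" by (cases x)
      note z = vec_bipoly_eq_0[OF T[unfolded T_def] sW[OF c]]
      have "c (i, j, False) = 0" using fun_cong[OF fun_cong[OF z(1)]] .
      moreover have "c (i, j, True) = 0"
        using fun_cong[OF fun_cong[OF z(2)], of i j] c by (cases "i = k - 1 \<and> j = k") (auto simp: W_def)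
      ultimately show "c x = 0" by (cases b) (simp_all add: x)
    qed
  qed simp
  moreover have "card ?B = 2 * (k + 1)^2 - 3"
  proof -
    have "card ?X = 3" using k by auto
    then show ?thesis using k by (subst card_Diff_subset) (auto simp: power2_eq_square)
  qed
  ultimately show ?thesis by simp
qed

lemma sym_bipoly_add: "sym_bipoly k (\<lambda>i j. c i j + c' i j) (\<lambda>i j. d i j + d' i j) (\<lambda>i j. e i j + e' i j) = sym_bipoly k c d e + sym_bipoly k c' d' e'"
  unfolding sym_bipoly_def plus_fld.abs_eq by (simp add: bipoly_add vec_eq_iff forall_2 on_K_eq_iff)

lemma sym_bipoly_scaleR: "sym_bipoly k (\<lambda>i j. r * c i j) (\<lambda>i j. r * d i j) (\<lambda>i j. r * e i j) = r *\<^sub>R sym_bipoly k c d e"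
  unfolding sym_bipoly_def scaleR_fld.abs_eq by (simp add: bipoly_cmult vec_eq_iff forall_2 on_K_eq_iff)

lemma span_3: "span {a, b, c :: 'v::real_vector} = {x *\<^sub>R a + y *\<^sub>R b + z *\<^sub>R c |x y z. True}"
proof (intro equalityI subsetI)
  fix v assume "v \<in> span {a, b, c}"
  then obtain x y z where "v - x *\<^sub>R a - y *\<^sub>R b - z *\<^sub>R c = 0" by (auto simp: span_insert)
  then have "v = x *\<^sub>R a + y *\<^sub>R b + z *\<^sub>R c" by (simp add: algebra_simps)
  then show "v \<in> {x *\<^sub>R a + y *\<^sub>R b + z *\<^sub>R c |x y z. True}" by blast
next
  fix v assume "v \<in> {x *\<^sub>R a + y *\<^sub>R b + z *\<^sub>R c |x y z. True}"
  then show "v \<in> span {a, b, c}" by (force intro!: span_add span_scale intro: span_base)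
qed

definition fillV_xx :: "nat \<Rightarrow> (nat \<Rightarrow> real) \<Rightarrow> nat \<Rightarrow> nat \<Rightarrow> real" where
  "fillV_xx k c i j = (if i = k + 1 \<and> j = k - 1 then c 0 else if i = k + 1 \<and> j = k then c 1 else 0)"
definition fillV_yy :: "nat \<Rightarrow> (nat \<Rightarrow> real) \<Rightarrow> nat \<Rightarrow> nat \<Rightarrow> real" where
  "fillV_yy k c i j = (if i = k \<and> j = k + 1 then c 2 else 0)"

lemma bipoly_single:
  assumes "a \<le> N" "b \<le> N"
  shows "bipoly N (\<lambda>i j. if i = a \<and> j = b then r else 0) p = r * (p$1)^a * (p$2)^b"
proof -
  have "bipoly N (\<lambda>i j. if i = a \<and> j = b then r else 0) p =
    (\<Sum>i\<le>N. \<Sum>j\<le>N. if j = b then if i = a then r * (p$1)^a * (p$2)^b else 0 else 0)"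
    unfolding bipoly_def by (intro sum.cong refl) auto
  then show ?thesis using assms by simp
qed

definition fillV_field :: "nat \<Rightarrow> (nat \<Rightarrow> real) \<Rightarrow> (real^2^2) fld" where
  "fillV_field k c = sym_bipoly (k + 1) (fillV_xx k c) (\<lambda>i j. 0) (fillV_yy k c)"

lemma fillV_field_add: "k \<ge> 1 \<Longrightarrow> fillV_field k (\<lambda>i. c i + d i) = fillV_field k c + fillV_field k d"
proof -
  have "fillV_xx k (\<lambda>i. c i + d i) = (\<lambda>i j. fillV_xx k c i j + fillV_xx k d i j)" "fillV_yy k (\<lambda>i. c i + d i) = (\<lambda>i j. fillV_yy k c i j + fillV_yy k d i j)"
    by (simp_all add: fun_eq_iff fillV_xx_def fillV_yy_def)
  then show ?thesis using sym_bipoly_add[of "k + 1" "fillV_xx k c" "fillV_xx k d" "\<lambda>i j. 0" "\<lambda>i j. 0"] by (simp add: fillV_field_def)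
qed

lemma fillV_field_scaleR: "fillV_field k (\<lambda>i. r * c i) = r *\<^sub>R fillV_field k c"
proof -
  have "fillV_xx k (\<lambda>i. r * c i) = (\<lambda>i j. r * fillV_xx k c i j)" "fillV_yy k (\<lambda>i. r * c i) = (\<lambda>i j. r * fillV_yy k c i j)"
    by (simp_all add: fun_eq_iff fillV_xx_def fillV_yy_def)
  then show ?thesis using sym_bipoly_scaleR[of "k + 1" r "fillV_xx k c" "\<lambda>i j. 0"] by (simp add: fillV_field_def)
qed

lemma fillV_eq:
  assumes k: "k \<ge> 1"
  shows "fillV k = {fillV_field k c |c. \<forall>i. i \<notin> {0, 1, 2} \<longrightarrow> c i = 0}"
proof -
  define e where "e l i = (if i = l then 1 else 0 :: real)" for l i :: nat
  have z: "bipoly N (\<lambda>i j. 0) p = 0" for N p by (simp add: bipoly_def)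
  have x0: "fillV_xx k (e 0) = (\<lambda>i j. if i = k + 1 \<and> j = k - 1 then 1 else 0)" "fillV_yy k (e 0) = (\<lambda>i j. 0)"
    and x1: "fillV_xx k (e 1) = (\<lambda>i j. if i = k + 1 \<and> j = k then 1 else 0)" "fillV_yy k (e 1) = (\<lambda>i j. 0)"
    and x2: "fillV_xx k (e 2) = (\<lambda>i j. 0)" "fillV_yy k (e 2) = (\<lambda>i j. if i = k \<and> j = k + 1 then 1 else 0)"
    using k by (auto simp: fun_eq_iff fillV_xx_def fillV_yy_def e_def)
  have g: "on_K (\<lambda>p. vector [vector [(p$1)^(k + 1) * (p$2)^(k - 1), 0], vector [0, 0]]) = fillV_field k (e 0)"
    "on_K (\<lambda>p. vector [vector [(p$1)^(k + 1) * (p$2)^k, 0], vector [0, 0]]) = fillV_field k (e 1)"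
    "on_K (\<lambda>p. vector [vector [0, 0], vector [0, (p$1)^k * (p$2)^(k + 1)]]) = fillV_field k (e 2)"
    unfolding fillV_field_def sym_bipoly_def x0 x1 x2 by (simp_all add: bipoly_single z del: power_Suc)
  have comb: "x *\<^sub>R fillV_field k (e 0) + y *\<^sub>R fillV_field k (e 1) + w *\<^sub>R fillV_field k (e 2) = fillV_field k (\<lambda>i. x * e 0 i + y * e 1 i + w * e 2 i)" for x y w
    by (simp only: fillV_field_add[OF k] fillV_field_scaleR)
  show ?thesis
    unfolding fillV_def g span_3 comb
  proof (intro equalityI subsetI)
    fix t assume "t \<in> {fillV_field k (\<lambda>i. x * e 0 i + y * e 1 i + w * e 2 i) |x y w. True}"
    then show "t \<in> {fillV_field k c |c. \<forall>i. i \<notin> {0, 1, 2} \<longrightarrow> c i = 0}" by (auto simp: e_def)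
  next
    fix t assume "t \<in> {fillV_field k c |c. \<forall>i. i \<notin> {0, 1, 2} \<longrightarrow> c i = 0}"
    then obtain c where c: "t = fillV_field k c" "\<forall>i. i \<notin> {0, 1, 2} \<longrightarrow> c i = 0" by blast
    have "c = (\<lambda>i. c 0 * e 0 i + c 1 * e 1 i + c 2 * e 2 i)" using c(2) by (auto simp: fun_eq_iff e_def)
    then have "t = fillV_field k (\<lambda>i. c 0 * e 0 i + c 1 * e 1 i + c 2 * e 2 i)" unfolding c(1) by (rule arg_cong)
    then show "t \<in> {fillV_field k (\<lambda>i. x * e 0 i + y * e 1 i + w * e 2 i) |x y w. True}" by blast
  qed
qed

lemma bipoly_supp_Suc: "supp k c \<Longrightarrow> bipoly (k + 1) c = bipoly k c"
  by (simp add: fun_eq_iff bipoly_def supp_def)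

lemma fillV_field_wdiv:
  assumes k: "k \<ge> 1"
  shows "wdiv (fillV_field k c) = vec_bipoly k (dX (fillV_xx k c)) (dY (fillV_yy k c))" "supp k (dX (fillV_xx k c))" "supp k (dY (fillV_yy k c))"
    "ntrace (fillV_field k c) \<in> Mspace k"
proof -
  show s: "supp k (dX (fillV_xx k c))" "supp k (dY (fillV_yy k c))"
    by (auto simp: supp_def dX_def dY_def fillV_xx_def fillV_yy_def)
  have s1: "supp (k + 1) (fillV_xx k c)" "supp (k + 1) (\<lambda>i j. 0)" "supp (k + 1) (fillV_yy k c)"
    by (auto simp: supp_def fillV_xx_def fillV_yy_def)
  have "wdiv (fillV_field k c) = vec_bipoly (k + 1) (dX (fillV_xx k c)) (dY (fillV_yy k c))"
    using sym_bipoly_wdiv_ntrace(1)[OF s1] by (simp add: fillV_field_def dX_def[of "\<lambda>i j. 0"] dY_def[of "\<lambda>i j. 0"])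
  then show "wdiv (fillV_field k c) = vec_bipoly k (dX (fillV_xx k c)) (dY (fillV_yy k c))"
    unfolding vec_bipoly_def bipoly_supp_Suc[OF s(1)] bipoly_supp_Suc[OF s(2)] .
  have "degree (sym_bipoly_trace (k + 1) (fillV_xx k c) (\<lambda>i j. 0) (fillV_yy k c) i l) \<le> k" for i l
  proof (rule degree_le, intro allI impI)
    fix n assume n: "k < n"
    have "fillV_xx k c 0 n = 0" "fillV_yy k c n 0 = 0" using n by (auto simp: fillV_xx_def fillV_yy_def)
    moreover have "(\<Sum>i\<le>k + 1. fillV_xx k c i n) = 0" "(\<Sum>j\<le>k + 1. fillV_yy k c n j) = 0"
      using n by (auto intro!: sum.neutral simp: fillV_xx_def fillV_yy_def)
    ultimately show "coeff (sym_bipoly_trace (k + 1) (fillV_xx k c) (\<lambda>i j. 0) (fillV_yy k c) i l) n = 0"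
      unfolding sym_bipoly_trace_def by (simp add: coeff_upoly del: sum.atMost_Suc)
  qed
  then show "ntrace (fillV_field k c) \<in> Mspace k"
    using sym_bipoly_wdiv_ntrace(2)[OF s1] unfolding Mspace_eq fillV_field_def by blast
qed

lemma fillV_properties:
  assumes k: "k \<ge> 1"
  shows "wdiv ` fillV k \<subseteq> V_g k" "wdiv ` fillV k \<inter> wdiv ` Sigma_g k = {0}" "ntrace ` fillV k \<subseteq> Mspace k"
    "dim (fillV k) = 3" "dim (wdiv ` fillV k) = 3"
proof -
  note w = fillV_field_wdiv[OF k]
  show "wdiv ` fillV k \<subseteq> V_g k" "ntrace ` fillV k \<subseteq> Mspace k"
  proof safe
    fix \<tau> assume "\<tau> \<in> fillV k"
    then obtain c where c: "\<tau> = fillV_field k c" unfolding fillV_eq[OF k] by blast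
    show "ntrace \<tau> \<in> Mspace k" unfolding c by (rule w(4))
    show "wdiv \<tau> \<in> V_g k" unfolding c w(1) V_g_eq using w(2,3) by blast
  qed
  have vals: "dX (fillV_xx k c) k k = real (k + 1) * c 1" "dX (fillV_xx k c) k (k - 1) = real (k + 1) * c 0" "dY (fillV_yy k c) k k = real (k + 1) * c 2"
    "dY (fillV_yy k c) (k - 1) k = 0" for c using k by (auto simp: dX_def dY_def fillV_xx_def fillV_yy_def)
  have inj: "\<forall>i. c i = 0" if c0: "\<forall>i. i \<notin> {0, 1, 2} \<longrightarrow> c i = 0" and c1: "vec_bipoly k (dX (fillV_xx k c)) (dY (fillV_yy k c)) \<in> wdiv ` Sigma_g k" for c
  proof -
    obtain v w' where e: "vec_bipoly k (dX (fillV_xx k c)) (dY (fillV_yy k c)) = vec_bipoly k v w'" "supp k v" "supp k w'" "v k k = 0" "w' k k = 0" "v k (k - 1) = w' (k - 1) k"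
      using c1 unfolding wdiv_Sigma_g[OF k] by blast
    from vec_bipoly_inj[OF e(1) w(2,3) e(2,3)] e(4-6) vals[of c] have "c 0 = 0" "c 1 = 0" "c 2 = 0" by auto
    then have "i \<in> {0, 1, 2} \<Longrightarrow> c i = 0" for i by blast
    then show ?thesis using c0 by blast
  qed
  have zero: "0 \<in> wdiv ` Sigma_g k"
    using vec_bipoly_scaleR[of k 0 "\<lambda>i j. 0" "\<lambda>i j. 0"] unfolding wdiv_Sigma_g[OF k]
    by (intro CollectI exI[of _ "\<lambda>i j. 0"] conjI) (auto simp: supp_def)
  have T0: "fillV_field k (\<lambda>i. 0) = 0" using fillV_field_scaleR[of k 0 "\<lambda>i. 0"] by simp
  have wadd: "wdiv (fillV_field k (\<lambda>i. c i + d i)) = wdiv (fillV_field k c) + wdiv (fillV_field k d)" for c d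
  proof -
    have "dX (fillV_xx k (\<lambda>i. c i + d i)) = (\<lambda>i j. dX (fillV_xx k c) i j + dX (fillV_xx k d) i j)"
      "dY (fillV_yy k (\<lambda>i. c i + d i)) = (\<lambda>i j. dY (fillV_yy k c) i j + dY (fillV_yy k d) i j)"
      by (simp_all add: fun_eq_iff dX_def dY_def fillV_xx_def fillV_yy_def algebra_simps)
    then show ?thesis by (simp add: w(1) vec_bipoly_add)
  qed
  have wscale: "wdiv (fillV_field k (\<lambda>i. r * c i)) = r *\<^sub>R wdiv (fillV_field k c)" for r c
  proof -
    have "dX (fillV_xx k (\<lambda>i. r * c i)) = (\<lambda>i j. r * dX (fillV_xx k c) i j)" "dY (fillV_yy k (\<lambda>i. r * c i)) = (\<lambda>i j. r * dY (fillV_yy k c) i j)"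
      by (simp_all add: fun_eq_iff dX_def dY_def fillV_xx_def fillV_yy_def algebra_simps)
    then show ?thesis by (simp add: w(1) vec_bipoly_scaleR)
  qed
  have w0: "wdiv (fillV_field k (\<lambda>i. 0)) = 0" using wscale[of 0 "\<lambda>i. 0"] by simp
  show "wdiv ` fillV k \<inter> wdiv ` Sigma_g k = {0}"
  proof (intro equalityI subsetI)
    fix u assume u: "u \<in> wdiv ` fillV k \<inter> wdiv ` Sigma_g k"
    then obtain c where c: "u = wdiv (fillV_field k c)" "\<forall>i. i \<notin> {0, 1, 2} \<longrightarrow> c i = 0" unfolding fillV_eq[OF k] by blast
    with u have "\<forall>i. c i = 0" by (intro inj) (auto simp: w(1))
    then have "c = (\<lambda>i. 0)" by auto
    then show "u \<in> {0}" using c(1) w0 by simp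
  next
    fix u assume "u \<in> {0 :: (real^2) fld}"
    moreover have "fillV_field k (\<lambda>i. 0) \<in> fillV k" unfolding fillV_eq[OF k] by blast
    ultimately show "u \<in> wdiv ` fillV k \<inter> wdiv ` Sigma_g k" using zero w0 by (auto intro: rev_image_eqI)
  qed
  have "dim {fillV_field k c |c. \<forall>i. i \<notin> {0, 1, 2} \<longrightarrow> c i = 0} = card {0, 1, 2 :: nat}"
  proof (rule dim_param)
    show "\<forall>i. c i = 0" if "\<forall>i. i \<notin> {0, 1, 2} \<longrightarrow> c i = 0" "fillV_field k c = 0" for c
      using inj[OF that(1)] w(1)[of c] w0 T0 that(2) zero by simp
  qed (auto simp: fillV_field_add[OF k] fillV_field_scaleR)
  then show "dim (fillV k) = 3" by (simp add: fillV_eq[OF k])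
  have "dim {wdiv (fillV_field k c) |c. \<forall>i. i \<notin> {0, 1, 2} \<longrightarrow> c i = 0} = card {0, 1, 2 :: nat}"
  proof (rule dim_param)
    show "\<forall>i. c i = 0" if "\<forall>i. i \<notin> {0, 1, 2} \<longrightarrow> c i = 0" "wdiv (fillV_field k c) = 0" for c
      using inj[OF that(1)] w(1)[of c] that(2) zero by simp
  qed (auto simp: wadd wscale)
  moreover have "wdiv ` fillV k = {wdiv (fillV_field k c) |c. \<forall>i. i \<notin> {0, 1, 2} \<longrightarrow> c i = 0}"
    unfolding fillV_eq[OF k] by blast
  ultimately show "dim (wdiv ` fillV k) = 3" by simp
qed

lemma has_wpd_C1:
  assumes f: "f \<in> C1"
  shows "has_wpd j (on_K f) (on_K (pd j f))"
proof -
  note c = C1_partial(3-6)[OF f]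
  have C: "L2_rep (on_K f) (\<lambda>z. indicator Q z * f (vec2 z))" "L2_rep (on_K (pd j f)) (\<lambda>z. indicator Q z * pd j f (vec2 z))"
    using c(3,4) by (auto intro!: L2_rep_on_K intro: continuous_on_subset)
  have I: "integrable lborel (\<lambda>z. indicator Q z * \<phi> z)" if "continuous_on UNIV \<phi>" for \<phi> :: "real \<times> real \<Rightarrow> real"
    by (rule integrable_Q_mult[OF _ _ that]) (auto intro!: integrable_real_indicator simp: emeasure_Q)
  show ?thesis
    unfolding has_wpd_iff[OF C]
  proof
    fix \<psi> assume \<psi>: "\<psi> \<in> C1c"
    note p = C1_partial[OF C1c_C1[OF \<psi>]]
    have cc: "continuous_on UNIV (\<lambda>z. f (vec2 z) * pd j \<psi> (vec2 z) + pd j f (vec2 z) * \<psi> (vec2 z))"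
      by (intro continuous_intros c(1,2) p(3,4))
    have I0: "I01 (\<lambda>s. 0) = 0" by (simp add: I01_def)
    have "(LINT z|lborel. indicator Q z * (f (vec2 z) * pd j \<psi> (vec2 z) + pd j f (vec2 z) * \<psi> (vec2 z))) = 0"
    proof (cases "j = 1")
      case True
      have "(LINT z|lborel. indicator Q z * (f (vec2 z) * pd j \<psi> (vec2 z) + pd j f (vec2 z) * \<psi> (vec2 z)))
        = I01 (\<lambda>y. f (vec2 (1, y)) * \<psi> (vec2 (1, y)) - f (vec2 (0, y)) * \<psi> (vec2 (0, y)))"
        using DERIV_mult[OF C1_partial(1)[OF f] p(1)] True by (intro divergence_x[where F="\<lambda>z. f (vec2 z) * \<psi> (vec2 z)"] cc) (simp add: algebra_simps)
      then show ?thesis by (simp add: C1c_boundary[OF \<psi>] I0)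
    next
      case False
      then have j: "j = 2" using exhaust_2[of j] by auto
      have "(LINT z|lborel. indicator Q z * (f (vec2 z) * pd j \<psi> (vec2 z) + pd j f (vec2 z) * \<psi> (vec2 z)))
        = I01 (\<lambda>x. f (vec2 (x, 1)) * \<psi> (vec2 (x, 1)) - f (vec2 (x, 0)) * \<psi> (vec2 (x, 0)))"
        using DERIV_mult[OF C1_partial(2)[OF f] p(2)] j by (intro divergence_y[where F="\<lambda>z. f (vec2 z) * \<psi> (vec2 z)"] cc) (simp add: algebra_simps)
      then show ?thesis by (simp add: C1c_boundary[OF \<psi>] I0)
    qed
    moreover have "(LINT z|lborel. indicator Q z * (f (vec2 z) * pd j \<psi> (vec2 z) + pd j f (vec2 z) * \<psi> (vec2 z))) =
      (LINT z|lborel. indicator Q z * (f (vec2 z) * pd j \<psi> (vec2 z))) + (LINT z|lborel. indicator Q z * (pd j f (vec2 z) * \<psi> (vec2 z)))"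
      unfolding distrib_left by (intro Bochner_Integration.integral_add I continuous_on_mult c(1,2) p(3,4))
    ultimately show "(LINT z|lborel. indicator Q z * f (vec2 z) * pd j \<psi> (vec2 z)) = - (LINT z|lborel. indicator Q z * pd j f (vec2 z) * \<psi> (vec2 z))"
      by (simp add: mult.assoc)
  qed
qed

lemma symgrad_vec_bipoly:
  assumes "supp k c" "supp k d"
  shows "symgrad (vec_bipoly k c d) = 0 \<longleftrightarrow> dX c = (\<lambda>i j. 0) \<and> dY d = (\<lambda>i j. 0) \<and> (\<lambda>i j. dY c i j + dX d i j) = (\<lambda>i j. 0)"
proof -
  have e: "on_K (\<lambda>q. rep_fld (vec_bipoly k c d) q $ 1) = on_K (bipoly k c)" "on_K (\<lambda>q. rep_fld (vec_bipoly k c d) q $ 2) = on_K (bipoly k d)"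
    unfolding on_K_eq_iff vec_bipoly_def using rep_on_K_AE[of "\<lambda>p. vector [bipoly k c p, bipoly k d p] :: real^2"]
    by (eventually_elim, simp)+
  have w: "wpd 1 (on_K (bipoly k c)) = on_K (bipoly k (dX c))" "wpd 2 (on_K (bipoly k c)) = on_K (bipoly k (dY c))"
    "wpd 1 (on_K (bipoly k d)) = on_K (bipoly k (dX d))" "wpd 2 (on_K (bipoly k d)) = on_K (bipoly k (dY d))"
    using wpd_eq[OF has_wpd_C1[OF bipoly_C1(1)[OF assms(1)]]] wpd_eq[OF has_wpd_C1[OF bipoly_C1(1)[OF assms(2)]]]
      bipoly_C1(2,3)[OF assms(1)] bipoly_C1(2,3)[OF assms(2)] by simp_all
  note ae = rep_on_K_AE[of "bipoly k (dX c)"] rep_on_K_AE[of "bipoly k (dY c)"] rep_on_K_AE[of "bipoly k (dX d)"] rep_on_K_AE[of "bipoly k (dY d)"]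
  have "symgrad (vec_bipoly k c d) = on_K (\<lambda>p. vector [vector [bipoly k (dX c) p, bipoly k (\<lambda>i j. dY c i j + dX d i j) p / 2],
      vector [bipoly k (\<lambda>i j. dY c i j + dX d i j) p / 2, bipoly k (dY d) p]])"
    unfolding symgrad_def on_K_eq_iff using ae
    by eventually_elim (simp add: vec_eq_iff forall_2 e w bipoly_add)
  also have "\<dots> = sym_bipoly k (dX c) (\<lambda>i j. 1/2 * (dY c i j + dX d i j)) (dY d)"
    unfolding sym_bipoly_def bipoly_cmult by simp
  finally have eq: "symgrad (vec_bipoly k c d) = sym_bipoly k (dX c) (\<lambda>i j. 1/2 * (dY c i j + dX d i j)) (dY d)" .
  have s: "supp k (dX c)" "supp k (\<lambda>i j. 1/2 * (dY c i j + dX d i j))" "supp k (dY d)"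
    using assms by (auto simp: supp_def dX_def dY_def)
  have z: "sym_bipoly k (\<lambda>i j. 0) (\<lambda>i j. 0) (\<lambda>i j. 0) = 0" using sym_bipoly_scaleR[of k 0 "\<lambda>i j. 0" "\<lambda>i j. 0" "\<lambda>i j. 0"] by simp
  show ?thesis
  proof
    assume "symgrad (vec_bipoly k c d) = 0"
    then have "on_K (\<lambda>p. vector [vector [bipoly k (dX c) p, bipoly k (\<lambda>i j. 1/2 * (dY c i j + dX d i j)) p],
        vector [bipoly k (\<lambda>i j. 1/2 * (dY c i j + dX d i j)) p, bipoly k (dY d) p]] :: real^2^2) = on_K (\<lambda>p. 0)"
      using eq by (simp add: sym_bipoly_def zero_fld_def)
    then have ae: "AE p in lebesgue_on K. (vector [vector [bipoly k (dX c) p, bipoly k (\<lambda>i j. 1/2 * (dY c i j + dX d i j)) p],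
        vector [bipoly k (\<lambda>i j. 1/2 * (dY c i j + dX d i j)) p, bipoly k (dY d) p]] :: real^2^2) = 0"
      by (simp only: on_K_eq_iff)
    have "vec_bipoly k (dX c) (\<lambda>i j. 1/2 * (dY c i j + dX d i j)) = 0" "vec_bipoly k (dY d) (dY d) = 0"
      unfolding vec_bipoly_def zero_fld_def on_K_eq_iff using ae
      by (eventually_elim; simp add: vec_eq_iff forall_2)+
    from vec_bipoly_eq_0[OF this(1) s(1,2)] vec_bipoly_eq_0[OF this(2) s(3,3)]
    show "dX c = (\<lambda>i j. 0) \<and> dY d = (\<lambda>i j. 0) \<and> (\<lambda>i j. dY c i j + dX d i j) = (\<lambda>i j. 0)"
      by (simp add: fun_eq_iff)
  next
    assume a: "dX c = (\<lambda>i j. 0) \<and> dY d = (\<lambda>i j. 0) \<and> (\<lambda>i j. dY c i j + dX d i j) = (\<lambda>i j. 0)"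
    then have "(\<lambda>i j. 1/2 * (dY c i j + dX d i j)) = (\<lambda>i j. 0)" by (simp add: fun_eq_iff)
    with a show "symgrad (vec_bipoly k c d) = 0" unfolding eq using z by simp
  qed
qed

lemma restr_bd_eq:
  assumes "continuous_on (closure K) f"
  shows "restr_bd (on_K f) = on_bd f"
proof -
  define g where "g = (SOME g. continuous_on (closure K) g \<and> on_K g = on_K f)"
  have g: "continuous_on (closure K) g \<and> on_K g = on_K f"
    unfolding g_def by (rule someI[of _ f]) (use assms in simp)
  have "g (edge j t) = f (edge j t)" if "0 < t" "t < 1" for j t
  proof -
    have "edge j t \<in> closure K" unfolding edge_eq closure_K_vec2 using that
      by (auto simp: edge_coords_def edge_param_def)
    then show ?thesis using on_K_continuous_eqD[of g f] g assms by blast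
  qed
  then have "on_bd g = on_bd f" unfolding on_bd_eq_iff ae_eq_bd_def AE_01_iff by auto
  then show ?thesis unfolding restr_bd_def g_def[symmetric] .
qed

definition rigid_trace :: "(nat \<Rightarrow> real) \<Rightarrow> 4 \<Rightarrow> 2 \<Rightarrow> real poly" where
  "rigid_trace c i l = (if i = 1 then (if l = 1 then [:c 0, c 2:] else [:c 1:])
     else if i = 2 then (if l = 1 then [:c 0:] else [:c 1, - c 2:])
     else if i = 3 then (if l = 1 then [:c 0, c 2:] else [:c 1 - c 2:])
     else (if l = 1 then [:c 0 + c 2:] else [:c 1, - c 2:]))"

lemma dim_rigid_motions:
  assumes k: "k \<ge> 1"
  shows "dim (restr_bd ` {v \<in> V_g k. symgrad v = 0}) = 3"
proof -
  define cx where "cx c i j = (if i = 0 \<and> j = 0 then c 0 else if i = 0 \<and> j = 1 then c 2 else 0)" for c :: "nat \<Rightarrow> real" and i j :: nat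
  define cy where "cy c i j = (if i = 0 \<and> j = 0 then c 1 else if i = 1 \<and> j = 0 then - c 2 else 0)" for c :: "nat \<Rightarrow> real" and i j :: nat
  have s: "supp k (cx c)" "supp k (cy c)" for c using k by (auto simp: supp_def cx_def cy_def)
  have pfx: "bipoly k (cx c) p = c 0 + c 2 * p $ 2" "bipoly k (cy c) p = c 1 - c 2 * p $ 1" for c p
  proof -
    have "cx c = (\<lambda>i j. (if i = 0 \<and> j = 0 then c 0 else 0) + (if i = 0 \<and> j = 1 then c 2 else 0))"
      "cy c = (\<lambda>i j. (if i = 0 \<and> j = 0 then c 1 else 0) + (if i = 1 \<and> j = 0 then - c 2 else 0))"
      by (auto simp: fun_eq_iff cx_def cy_def)
    then show "bipoly k (cx c) p = c 0 + c 2 * p $ 2" "bipoly k (cy c) p = c 1 - c 2 * p $ 1"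
      using k by (simp_all add: bipoly_add bipoly_single del: One_nat_def)
  qed
  have r: "restr_bd (vec_bipoly k (cx c) (cy c)) = bd_poly (rigid_trace c)" for c
  proof -
    have "restr_bd (vec_bipoly k (cx c) (cy c)) = on_bd (\<lambda>p. vector [bipoly k (cx c) p, bipoly k (cy c) p])"
      unfolding vec_bipoly_def by (intro restr_bd_eq continuous_vector2 continuous_bipoly)
    also have "\<dots> = bd_poly (rigid_trace c)"
      unfolding bd_poly_def on_bd_eq_iff ae_eq_bd_def AE_01_iff
    proof (intro allI AE_I2 impI)
      fix j :: 4 and t :: real assume t: "t \<in> {0<..<1}"
      have "bd_poly_fun (rigid_trace c) (edge j t) $ l = poly (rigid_trace c j l) (edge_param j t)" for l using t by (simp add: bd_poly_fun_edge)
      then show "vector [bipoly k (cx c) (edge j t), bipoly k (cy c) (edge j t)] = bd_poly_fun (rigid_trace c) (edge j t)"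
        unfolding vec_eq_iff forall_2 pfx edge_eq using exhaust_4[of j]
        by (elim disjE) (simp_all add: pfx edge_coords_def edge_param_def rigid_trace_def algebra_simps)
    qed
    finally show ?thesis .
  qed
  have "{v \<in> V_g k. symgrad v = 0} = {vec_bipoly k (cx c) (cy c) |c. \<forall>i. i \<notin> {0, 1, 2} \<longrightarrow> c i = 0}"
  proof (intro equalityI subsetI)
    fix v assume "v \<in> {v \<in> V_g k. symgrad v = 0}"
    then obtain c d where v: "v = vec_bipoly k c d" "supp k c" "supp k d" "symgrad (vec_bipoly k c d) = 0" by (auto simp: V_g_eq)
    with symgrad_vec_bipoly[of k c d] have z: "dX c = (\<lambda>i j. 0)" "dY d = (\<lambda>i j. 0)" "(\<lambda>i j. dY c i j + dX d i j) = (\<lambda>i j. 0)" by auto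
    have c0: "c (Suc i) j = 0" for i j using fun_cong[OF fun_cong[OF z(1)], of i j] by (simp add: dX_def del: of_nat_Suc)
    have d0: "d i (Suc j) = 0" for i j using fun_cong[OF fun_cong[OF z(2)], of i j] by (simp add: dY_def del: of_nat_Suc)
    have cd: "real (Suc j) * c i (Suc j) + real (Suc i) * d (Suc i) j = 0" for i j
      using fun_cong[OF fun_cong[OF z(3)], of i j] by (simp add: dX_def dY_def del: of_nat_Suc)
    have c1: "c 0 (Suc (Suc j)) = 0" for j using cd[of "Suc j" 0] d0 by (simp del: of_nat_Suc)
    have d1: "d (Suc (Suc i)) 0 = 0" for i using cd[of 0 "Suc i"] c0 by (simp del: of_nat_Suc)
    have cd0: "d 1 0 = - c 0 1" using cd[of 0 0] by simp
    define e where "e i = (if i = 0 then c 0 0 else if i = 1 then d 0 0 else if i = 2 then c 0 1 else 0)" for i :: nat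
    have "cx e i j = c i j" "cy e i j = d i j" for i j
      using c0[of "i - 1" j] c1[of "j - 2"] d0[of i "j - 1"] d1[of "i - 2"] cd0
      by (cases i; cases j; cases "i - 1"; cases "j - 1"; simp add: cx_def cy_def e_def)+
    then have "cx e = c" "cy e = d" by (auto simp: fun_eq_iff)
    then have "v = vec_bipoly k (cx e) (cy e)" "\<forall>i. i \<notin> {0, 1, 2} \<longrightarrow> e i = 0" by (auto simp: v(1) e_def)
    then show "v \<in> {vec_bipoly k (cx c) (cy c) |c. \<forall>i. i \<notin> {0, 1, 2} \<longrightarrow> c i = 0}" by blast
  next
    fix v assume "v \<in> {vec_bipoly k (cx c) (cy c) |c. \<forall>i. i \<notin> {0, 1, 2} \<longrightarrow> c i = 0}"
    then obtain c where v: "v = vec_bipoly k (cx c) (cy c)" by blast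
    have "dX (cx c) = (\<lambda>i j. 0)" "dY (cy c) = (\<lambda>i j. 0)" "(\<lambda>i j. dY (cx c) i j + dX (cy c) i j) = (\<lambda>i j. 0)"
      by (auto simp: fun_eq_iff dX_def dY_def cx_def cy_def)
    then have "symgrad v = 0" using symgrad_vec_bipoly[OF s] by (simp add: v)
    then show "v \<in> {v \<in> V_g k. symgrad v = 0}" using s by (auto simp: v V_g_eq)
  qed
  then have "restr_bd ` {v \<in> V_g k. symgrad v = 0} = {bd_poly (rigid_trace c) |c. \<forall>i. i \<notin> {0, 1, 2} \<longrightarrow> c i = 0}"
    by (simp add: setcompr_eq_image image_image r)
  moreover have "dim {bd_poly (rigid_trace c) |c. \<forall>i. i \<notin> {0, 1, 2 :: nat} \<longrightarrow> c i = 0} = card {0, 1, 2 :: nat}"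
  proof (rule dim_param)
    show "bd_poly (rigid_trace (\<lambda>i. c i + d i)) = bd_poly (rigid_trace c) + bd_poly (rigid_trace d)" for c d
    proof -
      have "rigid_trace (\<lambda>i. c i + d i) = (\<lambda>i l. rigid_trace c i l + rigid_trace d i l)" by (auto simp: fun_eq_iff rigid_trace_def)
      then show ?thesis by (simp add: bd_poly_add)
    qed
    show "bd_poly (rigid_trace (\<lambda>i. r * c i)) = r *\<^sub>R bd_poly (rigid_trace c)" for r c
    proof -
      have "rigid_trace (\<lambda>i. r * c i) = (\<lambda>i l. smult r (rigid_trace c i l))" by (auto simp: fun_eq_iff rigid_trace_def algebra_simps)
      then show ?thesis by (simp add: bd_poly_scaleR)
    qed
    show "\<forall>i. c i = 0" if "\<forall>i. i \<notin> {0, 1, 2} \<longrightarrow> c i = 0" "bd_poly (rigid_trace c) = 0" for c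
    proof -
      have "rigid_trace c = (\<lambda>i l. 0)" by (rule bd_poly_inj) (use that in \<open>simp add: bd_poly_0\<close>)
      then have "rigid_trace c 1 1 = 0" "rigid_trace c 1 2 = 0" by auto
      then have "[:c 0, c 2:] = 0" "[:c 1:] = 0" unfolding rigid_trace_def by simp_all
      then have "c 0 = 0" "c 1 = 0" "c 2 = 0" by (simp_all del: One_nat_def)
      then have "i \<in> {0, 1, 2} \<Longrightarrow> c i = 0" for i by blast
      then show ?thesis using that(1) by blast
    qed
  qed simp
  ultimately show ?thesis by simp
qed

lemma I_S_value: "k \<ge> 1 \<Longrightarrow> I_S (Sigma_g k) (V_g k) = 3"
proof -
  assume k: "k \<ge> 1"
  have "(k + 1)^2 \<ge> 2^2" using k by (intro power_mono) auto
  then show ?thesis by (simp add: I_S_def dim_V_g dim_wdiv_Sigma_g[OF k])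
qed

lemma I_M_value:
  assumes k: "k \<ge> 1"
  shows "I_M (Mspace k) (Sigma_g k) (V_g k) = (if k = 1 then 6 else if k = 2 then 9 else 10)"
proof -
  have I: "I_M (Mspace k) (Sigma_g k) (V_g k) = int (8 * (k + 1)) - int ((k + 1)^2 + 3 - (k - 3)^2) - 3"
    unfolding I_M_def dim_Mspace dim_ntrace_divfree[OF k] dim_rigid_motions[OF k] by simp
  consider "k = 1" | "k = 2" | "k = (k - 3) + 3" using k by linarith
  then show ?thesis
  proof cases
    case 1
    show ?thesis unfolding I by (simp add: 1)
  next
    case 2
    show ?thesis unfolding I by (simp add: 2)
  next
    case 3
    then obtain m where m: "k = m + 3" by blast
    have "(k + 1)^2 + 3 - (k - 3)^2 = 8 * m + 19" by (simp add: m power2_eq_square algebra_simps)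
    then show ?thesis unfolding I by (simp add: m)
  qed
qed

section \<open>The space \<open>fillM\<close>\<close>

definition good_jet :: "(real^2 \<Rightarrow> real) \<Rightarrow> (4 \<Rightarrow> real poly) \<Rightarrow> (4 \<Rightarrow> real poly) \<Rightarrow> bool" where
  "good_jet \<phi> a b \<longleftrightarrow> on_K \<phi> \<in> H2 \<and> continuous_on (closure K) \<phi> \<and> edge_jet \<phi> a b"

lemma good_jet_0: "good_jet (\<lambda>p. 0) (\<lambda>j. 0) (\<lambda>j. 0)"
  using zero_in_H2 by (simp add: good_jet_def edge_jet_def zero_fld_def)

lemma good_jet_add:
  assumes "good_jet \<phi> a b" "good_jet \<psi> a' b'"
  shows "good_jet (\<lambda>p. \<phi> p + \<psi> p) (\<lambda>j. a j + a' j) (\<lambda>j. b j + b' j)"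
proof -
  have "on_K (\<lambda>p. \<phi> p + \<psi> p) \<in> H2" "continuous_on (closure K) (\<lambda>p. \<phi> p + \<psi> p)"
    using assms H2_add[of "on_K \<phi>" "on_K \<psi>"] by (auto simp: good_jet_def plus_fld.abs_eq intro: continuous_on_add)
  moreover have "edge_jet (\<lambda>p. \<phi> p + \<psi> p) (\<lambda>j. a j + a' j) (\<lambda>j. b j + b' j)"
  proof -
    have e: "edge_jet \<phi> a b" "edge_jet \<psi> a' b'" using assms by (auto simp: good_jet_def)
    show ?thesis
      unfolding edge_jet_def
    proof (rule conjI)
      show "\<forall>j. \<forall>s\<in>{0..1}. \<phi> (vec2 (edge_coords j s)) + \<psi> (vec2 (edge_coords j s)) = poly (a j + a' j) s"
        using e by (simp add: edge_jet_def)
      show "AE s in lborel. s \<in> {0<..<1} \<longrightarrow>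
        ((\<lambda>x. \<phi> (vec2 (x, s)) + \<psi> (vec2 (x, s))) has_real_derivative poly (b 1 + b' 1) s) (at_right 0) \<and>
        ((\<lambda>y. \<phi> (vec2 (s, y)) + \<psi> (vec2 (s, y))) has_real_derivative poly (b 2 + b' 2) s) (at_right 0) \<and>
        ((\<lambda>x. \<phi> (vec2 (x, s)) + \<psi> (vec2 (x, s))) has_real_derivative poly (b 3 + b' 3) s) (at_left 1) \<and>
        ((\<lambda>y. \<phi> (vec2 (s, y)) + \<psi> (vec2 (s, y))) has_real_derivative poly (b 4 + b' 4) s) (at_left 1)"
        using e[unfolded edge_jet_def, THEN conjunct2]
        by eventually_elim (auto intro!: DERIV_add simp: poly_add)
    qed
  qed
  ultimately show ?thesis by (simp add: good_jet_def)
qed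

lemma good_jet_cmult:
  assumes "good_jet \<phi> a b"
  shows "good_jet (\<lambda>p. r * \<phi> p) (\<lambda>j. smult r (a j)) (\<lambda>j. smult r (b j))"
proof -
  have "on_K (\<lambda>p. r * \<phi> p) \<in> H2" "continuous_on (closure K) (\<lambda>p. r * \<phi> p)"
    using assms H2_scaleR[of "on_K \<phi>" r] by (auto simp: good_jet_def scaleR_fld.abs_eq intro: continuous_on_mult_left)
  moreover have "edge_jet (\<lambda>p. r * \<phi> p) (\<lambda>j. smult r (a j)) (\<lambda>j. smult r (b j))"
  proof -
    have e: "edge_jet \<phi> a b" using assms by (auto simp: good_jet_def)
    show ?thesis
      unfolding edge_jet_def
    proof (rule conjI)
      show "\<forall>j. \<forall>s\<in>{0..1}. r * \<phi> (vec2 (edge_coords j s)) = poly (smult r (a j)) s"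
        using e by (simp add: edge_jet_def)
      show "AE s in lborel. s \<in> {0<..<1} \<longrightarrow>
        ((\<lambda>x. r * \<phi> (vec2 (x, s))) has_real_derivative poly (smult r (b 1)) s) (at_right 0) \<and>
        ((\<lambda>y. r * \<phi> (vec2 (s, y))) has_real_derivative poly (smult r (b 2)) s) (at_right 0) \<and>
        ((\<lambda>x. r * \<phi> (vec2 (x, s))) has_real_derivative poly (smult r (b 3)) s) (at_left 1) \<and>
        ((\<lambda>y. r * \<phi> (vec2 (s, y))) has_real_derivative poly (smult r (b 4)) s) (at_left 1)"
        using e[unfolded edge_jet_def, THEN conjunct2]
        by eventually_elim (auto intro!: DERIV_cmult simp: poly_smult)
    qed
  qed
  ultimately show ?thesis by (simp add: good_jet_def)
qed

lemma span_param:
  fixes u :: "nat \<Rightarrow> 'v::real_vector"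
  shows "span (u ` {..<N}) = {\<Sum>i<N. c i *\<^sub>R u i |c. \<forall>i. i \<notin> {..<N} \<longrightarrow> c i = 0}"
proof (intro equalityI subsetI)
  fix v assume "v \<in> span (u ` {..<N})"
  then show "v \<in> {\<Sum>i<N. c i *\<^sub>R u i |c. \<forall>i. i \<notin> {..<N} \<longrightarrow> c i = 0}"
  proof (induction rule: span_induct_alt)
    case base
    show ?case by (auto intro!: exI[of _ "\<lambda>_. 0"])
  next
    case (step r x y)
    from step.hyps obtain m where m: "m < N" "x = u m" by auto
    from step.IH obtain c where c: "y = (\<Sum>i<N. c i *\<^sub>R u i)" "\<forall>i. i \<notin> {..<N} \<longrightarrow> c i = 0" by blast
    have "r *\<^sub>R x = (\<Sum>i<N. (if i = m then r else 0) *\<^sub>R u i)"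
      using m by (simp add: if_distrib[where f="\<lambda>x. x *\<^sub>R _"] sum.delta cong: if_cong)
    then have "r *\<^sub>R x + y = (\<Sum>i<N. ((if i = m then r else 0) + c i) *\<^sub>R u i)"
      by (simp add: c(1) sum.distrib scaleR_add_left)
    moreover have "\<forall>i. i \<notin> {..<N} \<longrightarrow> (if i = m then r else 0) + c i = 0" using c(2) m by auto
    ultimately show ?case by (intro CollectI exI[of _ "\<lambda>i. (if i = m then r else 0) + c i"] conjI)
  qed
next
  fix v assume "v \<in> {\<Sum>i<N. c i *\<^sub>R u i |c. \<forall>i. i \<notin> {..<N} \<longrightarrow> c i = 0}"
  then show "v \<in> span (u ` {..<N})" by (auto intro!: span_sum span_scale intro: span_base)
qed

definition comb :: "nat \<Rightarrow> (nat \<Rightarrow> real) \<Rightarrow> (nat \<Rightarrow> 'j \<Rightarrow> real poly) \<Rightarrow> 'j \<Rightarrow> real poly" where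
  "comb N c A j = (\<Sum>i<N. smult (c i) (A i j))"

lemma fill_space_from_jets:
  fixes G :: "nat \<Rightarrow> real^2 \<Rightarrow> real"
  assumes G: "\<And>i. i < N \<Longrightarrow> good_jet (G i) (A i) (B i)"
    and deg: "\<And>i j. i < N \<Longrightarrow> degree (A i j) \<le> k + 2" "\<And>i j. i < N \<Longrightarrow> degree (B i j) \<le> k + 1"
    and indep: "\<And>c d. \<forall>a b. (a, b) \<notin> potential_exps k \<longrightarrow> d a b = 0 \<Longrightarrow>
      airy_trace (comb N c A) (comb N c B) = airy_trace (bipoly_val (Suc (Suc k)) d) (bipoly_der (Suc (Suc k)) d) \<Longrightarrow> \<forall>i<N. c i = 0"
    and k: "k \<ge> 1" and S: "S = airy ` span ((\<lambda>i. on_K (G i)) ` {..<N})"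
  shows "wdiv ` S = {0}" "ntrace ` S \<subseteq> Mspace k" "ntrace ` S \<inter> ntrace ` divfree (Sigma_g k) = {0}"
    "dim S = N" "dim (ntrace ` S) = N"
proof -
  define F where "F c p = (\<Sum>i<N. c i * G i p)" for c p
  have good: "good_jet (F c) (comb N c A) (comb N c B)" for c
  proof -
    have "good_jet (\<lambda>p. \<Sum>i<n. c i * G i p) (comb n c A) (comb n c B)" if "n \<le> N" for n
      using that
    proof (induction n)
      case 0
      show ?case using good_jet_0 by (simp add: comb_def[abs_def])
    next
      case (Suc n)
      then have "good_jet (\<lambda>p. (\<Sum>i<n. c i * G i p) + c n * G n p) (\<lambda>j. comb n c A j + smult (c n) (A n j)) (\<lambda>j. comb n c B j + smult (c n) (B n j))"
        by (intro good_jet_add good_jet_cmult G) auto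
      then show ?case by (simp add: comb_def[abs_def])
    qed
    then show ?thesis unfolding F_def[abs_def] by blast
  qed
  define U where "U c = on_K (F c)" for c
  have U: "U c = (\<Sum>i<N. c i *\<^sub>R on_K (G i))" for c
  proof -
    have "on_K (\<lambda>p. \<Sum>i<n. c i * G i p) = (\<Sum>i<n. c i *\<^sub>R on_K (G i))" for n
    proof (induction n)
      case (Suc n)
      have "on_K (\<lambda>p. (\<Sum>i<n. c i * G i p) + c n *\<^sub>R G n p) = on_K (\<lambda>p. \<Sum>i<n. c i * G i p) + c n *\<^sub>R on_K (G n)"
        by (simp only: plus_fld.abs_eq scaleR_fld.abs_eq)
      then show ?case by (simp add: Suc.IH)
    qed (simp add: zero_fld_def)
    then show ?thesis by (simp add: U_def F_def[abs_def])
  qed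
  have Uadd: "U (\<lambda>i. c i + d i) = U c + U d" for c d by (simp add: U scaleR_add_left sum.distrib)
  have Uscale: "U (\<lambda>i. r * c i) = r *\<^sub>R U c" for r c by (simp add: U scaleR_sum_right)
  have H2: "U c \<in> H2" for c using good[of c] by (simp add: good_jet_def U_def)
  define P where "P c = airy_trace (comb N c A) (comb N c B)" for c
  have nt: "wdiv (airy (U c)) = 0" "ntrace (airy (U c)) = bd_poly (P c)" for c
    using good[of c] airy_wdiv_ntrace[of "F c" "comb N c A" "comb N c B"] by (simp_all add: good_jet_def U_def P_def)
  have Padd: "P (\<lambda>i. c i + d i) = (\<lambda>j l. P c j l + P d j l)" for c d
    unfolding P_def airy_trace_add[symmetric] by (simp add: comb_def[abs_def] smult_add_left sum.distrib)
  have Pscale: "P (\<lambda>i. r * c i) = (\<lambda>j l. smult r (P c j l))" for r c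
  proof -
    have "comb N (\<lambda>i. r * c i) X = (\<lambda>j. smult r (comb N c X j))" for X :: "nat \<Rightarrow> 4 \<Rightarrow> real poly"
      by (auto simp: comb_def coeff_sum sum_distrib_left mult.assoc intro!: poly_eqI)
    then show ?thesis unfolding P_def airy_trace_smult[symmetric] by simp
  qed
  have P0: "P (\<lambda>i. 0) = (\<lambda>j l. 0)" using Pscale[of 0 "\<lambda>i. 0"] by simp
  have A0: "airy (U (\<lambda>i. 0)) = 0" using Uscale[of 0 "\<lambda>i. 0"] airy_scaleR[OF H2, of 0 "\<lambda>i. 0"] by simp
  have S': "S = {airy (U c) |c. \<forall>i. i \<notin> {..<N} \<longrightarrow> c i = 0}"
    unfolding S span_param U[symmetric] by blast
  have zero: "0 \<in> S" unfolding S' using A0 by (intro CollectI exI[of _ "\<lambda>i. 0"]) simp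
  have nt0: "ntrace 0 = (0 :: (real^2) bdfld)" using nt(2)[of "\<lambda>i. 0"] by (simp add: A0 P0 bd_poly_0)
  show "wdiv ` S = {0}"
  proof
    show "wdiv ` S \<subseteq> {0}" unfolding S' using nt(1) by blast
    show "{0} \<subseteq> wdiv ` S" using nt(1)[of "\<lambda>i. 0"] zero A0 by (auto intro: rev_image_eqI)
  qed
  show "ntrace ` S \<subseteq> Mspace k"
  proof
    fix m assume "m \<in> ntrace ` S"
    then obtain c where m: "m = bd_poly (P c)" unfolding S' using nt(2) by blast
    have "degree (comb N c A j) \<le> k + 2" "degree (comb N c B j) \<le> k + 1" for j
      unfolding comb_def using deg by (auto intro!: degree_sum_le intro: order_trans[OF degree_smult_le])
    then have "degree (pderiv (pderiv (comb N c A j))) \<le> k" "degree (pderiv (comb N c B j)) \<le> k" for j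
      unfolding degree_pderiv by (simp_all add: le_diff_conv)
    then have "degree (P c i l) \<le> k" for i l by (simp add: P_def airy_trace_def)
    then show "m \<in> Mspace k" unfolding Mspace_eq m by blast
  qed
  have key: "\<forall>i. c i = 0" if "\<forall>i. i \<notin> {..<N} \<longrightarrow> c i = 0" "\<forall>a b. (a, b) \<notin> potential_exps k \<longrightarrow> d a b = 0" "bd_poly (P c) = airy_bipoly_trace (Suc (Suc k)) d" for c d
  proof -
    have "\<forall>i<N. c i = 0"
      using indep[OF that(2)] bd_poly_inj[OF that(3)[unfolded airy_bipoly_trace_def]] by (simp add: P_def)
    then show ?thesis using that(1) by (metis lessThan_iff)
  qed
  have j0: "airy_bipoly_trace (Suc (Suc k)) (\<lambda>a b. 0) = 0"
    using airy_bipoly_trace_add[of "Suc (Suc k)" "\<lambda>a b. 0" "\<lambda>a b. 0"] by simp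
  show "ntrace ` S \<inter> ntrace ` divfree (Sigma_g k) = {0}"
  proof (intro equalityI subsetI)
    fix m assume m: "m \<in> ntrace ` S \<inter> ntrace ` divfree (Sigma_g k)"
    then obtain c where c: "m = bd_poly (P c)" "\<forall>i. i \<notin> {..<N} \<longrightarrow> c i = 0" unfolding S' using nt(2) by blast
    obtain d where d: "m = airy_bipoly_trace (Suc (Suc k)) d" "\<forall>a b. (a, b) \<notin> potential_exps k \<longrightarrow> d a b = 0"
      using m unfolding ntrace_divfree[OF k] by blast
    have "bd_poly (P c) = airy_bipoly_trace (Suc (Suc k)) d" using c(1) d(1) by simp
    from key[OF c(2) d(2) this] have "\<forall>i. c i = 0" .
    then have "c = (\<lambda>i. 0)" by auto
    then show "m \<in> {0}" using c(1) by (simp add: P0 bd_poly_0)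
  next
    fix m :: "(real^2) bdfld" assume "m \<in> {0}"
    moreover have "0 \<in> ntrace ` S" using zero nt0 by (auto intro: rev_image_eqI)
    moreover have "0 \<in> ntrace ` divfree (Sigma_g k)"
      unfolding ntrace_divfree[OF k] using j0 by (intro CollectI exI[of _ "\<lambda>a b. 0"]) simp
    ultimately show "m \<in> ntrace ` S \<inter> ntrace ` divfree (Sigma_g k)" by simp
  qed
  have "dim {airy (U c) |c. \<forall>i. i \<notin> {..<N} \<longrightarrow> c i = 0} = card {..<N}"
  proof (rule dim_param)
    show "airy (U (\<lambda>i. c i + d i)) = airy (U c) + airy (U d)" for c d
      unfolding Uadd by (rule airy_add[OF H2 H2])
    show "airy (U (\<lambda>i. r * c i)) = r *\<^sub>R airy (U c)" for r c
      unfolding Uscale by (rule airy_scaleR[OF H2])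
    show "\<forall>i. c i = 0" if "\<forall>i. i \<notin> {..<N} \<longrightarrow> c i = 0" "airy (U c) = 0" for c
      using key[OF that(1), of "\<lambda>a b. 0"] nt(2)[of c] nt0 j0 that(2) by simp
  qed simp
  then show "dim S = N" by (simp add: S')
  have "dim {bd_poly (P c) |c. \<forall>i. i \<notin> {..<N} \<longrightarrow> c i = 0} = card {..<N}"
  proof (rule dim_param)
    show "\<forall>i. c i = 0" if "\<forall>i. i \<notin> {..<N} \<longrightarrow> c i = 0" "bd_poly (P c) = 0" for c
      using key[OF that(1), of "\<lambda>a b. 0"] j0 that(2) by simp
  qed (simp_all add: Padd Pscale bd_poly_add bd_poly_scaleR)
  moreover have "ntrace ` S = {bd_poly (P c) |c. \<forall>i. i \<notin> {..<N} \<longrightarrow> c i = 0}"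
    unfolding S' nt(2)[symmetric] by blast
  ultimately show "dim (ntrace ` S) = N" by simp
qed

lemma poly_pderiv_upoly: "poly (pderiv (upoly N f)) 1 = (\<Sum>i\<le>N. real i * f i)"
  "N \<ge> 1 \<Longrightarrow> poly (pderiv (upoly N f)) 0 = f 1"
proof -
  show "poly (pderiv (upoly N f)) 1 = (\<Sum>i\<le>N. real i * f i)"
  proof (induction N)
    case (Suc N)
    have "upoly (Suc N) f = upoly N f + monom (f (Suc N)) (Suc N)" by (simp add: upoly_def)
    then show ?case by (simp add: Suc.IH pderiv_add pderiv_monom poly_monom del: of_nat_Suc)
  qed (simp add: upoly_def pderiv_monom)
  show "N \<ge> 1 \<Longrightarrow> poly (pderiv (upoly N f)) 0 = f 1"
    by (simp add: poly_0_coeff_0 coeff_pderiv_upoly)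
qed

lemma coeff_eq_if_pderiv_eq:
  fixes p q :: "real poly"
  shows "pderiv p = pderiv q \<Longrightarrow> coeff p (Suc n) = coeff q (Suc n)"
    "pderiv (pderiv p) = pderiv (pderiv q) \<Longrightarrow> coeff p (Suc (Suc n)) = coeff q (Suc (Suc n))"
proof -
  have 1: "pderiv p = pderiv q \<Longrightarrow> coeff p (Suc n) = coeff q (Suc n)" for p q :: "real poly" and n
  proof -
    assume "pderiv p = pderiv q"
    then have "coeff (pderiv p) n = coeff (pderiv q) n" by (rule arg_cong)
    then show "coeff p (Suc n) = coeff q (Suc n)" unfolding coeff_pderiv by (simp del: of_nat_Suc)
  qed
  show "pderiv p = pderiv q \<Longrightarrow> coeff p (Suc n) = coeff q (Suc n)" by (rule 1)
  assume "pderiv (pderiv p) = pderiv (pderiv q)"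
  then have "coeff (pderiv p) (Suc n) = coeff (pderiv q) (Suc n)" by (rule 1)
  then show "coeff p (Suc (Suc n)) = coeff q (Suc (Suc n))" unfolding coeff_pderiv by (simp del: of_nat_Suc)
qed

text \<open>The last four conditions say that the mixed derivative takes one value at each vertex; the others
  hold because a monomial of the potential of degree above k in one variable is at most linear in the other.\<close>

lemma airy_bipoly_trace_conditions:
  assumes k: "k \<ge> 1" and d: "\<forall>a b. (a, b) \<notin> potential_exps k \<longrightarrow> d a b = 0"
    and eq: "airy_trace a b = airy_trace (bipoly_val (Suc (Suc k)) d) (bipoly_der (Suc (Suc k)) d)"
  shows "coeff (a 4) (Suc (Suc k)) = coeff (a 2) (Suc (Suc k))" "coeff (a 3) (Suc (Suc k)) = coeff (a 1) (Suc (Suc k))"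
    "coeff (b 4) (Suc k) = coeff (b 2) (Suc k)" "coeff (b 3) (Suc k) = coeff (b 1) (Suc k)"
    "coeff (a 4) (Suc k) = coeff (a 2) (Suc k) + coeff (b 2) (Suc k)"
    "coeff (a 3) (Suc k) = coeff (a 1) (Suc k) + coeff (b 1) (Suc k)"
    "poly (pderiv (b 2)) 0 = poly (pderiv (b 1)) 0" "poly (pderiv (b 2)) 1 = poly (pderiv (b 3)) 0"
    "poly (pderiv (b 4)) 0 = poly (pderiv (b 1)) 1" "poly (pderiv (b 4)) 1 = poly (pderiv (b 3)) 1"
proof -
  let ?N = "Suc (Suc k)"
  have e: "airy_trace a b j l = airy_trace (bipoly_val ?N d) (bipoly_der ?N d) j l" for j l by (simp add: eq)
  have b: "pderiv (b j) = pderiv (bipoly_der ?N d j)" and a: "pderiv (pderiv (a j)) = pderiv (pderiv (bipoly_val ?N d j))" for j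
    using e[of j 1] e[of j 2] exhaust_4[of j] by (auto simp: airy_trace_def)
  have cb: "coeff (b j) (Suc k) = coeff (bipoly_der ?N d j) (Suc k)" for j by (rule coeff_eq_if_pderiv_eq(1)[OF b])
  have ca2: "coeff (a j) (Suc (Suc k)) = coeff (bipoly_val ?N d j) (Suc (Suc k))" for j by (rule coeff_eq_if_pderiv_eq(2)[OF a])
  have ca: "coeff (a j) (Suc k) = coeff (bipoly_val ?N d j) (Suc k)" for j
    using coeff_eq_if_pderiv_eq(2)[OF a, of j "k - 1"] k by simp
  have d0: "d ?N (Suc i) = 0" "d (Suc i) ?N = 0" "d (Suc k) (Suc (Suc i)) = 0" "d (Suc (Suc i)) (Suc k) = 0" for i
    using k by (auto intro!: d[rule_format] simp: potential_exps_def)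
  have s2: "(\<Sum>i\<le>?N. f i) = f 0 + (\<Sum>i\<le>Suc k. f (Suc i))" "(\<Sum>i\<le>Suc k. f i) = f 0 + (\<Sum>i\<le>k. f (Suc i))" for f :: "nat \<Rightarrow> real"
    by (rule sum.atMost_Suc_shift)+
  have t: "(\<Sum>j\<le>?N. d ?N j) = d ?N 0" "(\<Sum>j\<le>?N. d j ?N) = d 0 ?N"
    "(\<Sum>j\<le>?N. d (Suc k) j) = d (Suc k) 0 + d (Suc k) 1" "(\<Sum>j\<le>?N. d j (Suc k)) = d 0 (Suc k) + d 1 (Suc k)"
    "(\<Sum>j\<le>?N. real j * d (Suc k) j) = d (Suc k) 1" "(\<Sum>j\<le>?N. real j * d j (Suc k)) = d 1 (Suc k)"
    unfolding s2 using d0 by (simp_all del: sum.atMost_Suc)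
  note defs = bipoly_val_def bipoly_der_def coeff_upoly t
  show "coeff (a 4) (Suc (Suc k)) = coeff (a 2) (Suc (Suc k))" "coeff (a 3) (Suc (Suc k)) = coeff (a 1) (Suc (Suc k))"
    unfolding ca2 by (simp_all add: defs del: sum.atMost_Suc)
  show "coeff (b 4) (Suc k) = coeff (b 2) (Suc k)" "coeff (b 3) (Suc k) = coeff (b 1) (Suc k)"
    unfolding cb by (simp_all add: defs del: sum.atMost_Suc)
  show "coeff (a 4) (Suc k) = coeff (a 2) (Suc k) + coeff (b 2) (Suc k)"
    "coeff (a 3) (Suc k) = coeff (a 1) (Suc k) + coeff (b 1) (Suc k)"
    unfolding ca cb by (simp_all add: defs del: sum.atMost_Suc)
  note pp = poly_pderiv_upoly(1) poly_pderiv_upoly(2)[of ?N]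
  have "(\<Sum>i\<le>?N. real i * (\<Sum>j\<le>?N. real j * d i j)) = (\<Sum>i\<le>?N. real i * (\<Sum>j\<le>?N. real j * d j i))"
    unfolding sum_distrib_left by (subst sum.swap) (simp only: mult.left_commute)
  then show "poly (pderiv (b 2)) 0 = poly (pderiv (b 1)) 0" "poly (pderiv (b 2)) 1 = poly (pderiv (b 3)) 0"
    "poly (pderiv (b 4)) 0 = poly (pderiv (b 1)) 1" "poly (pderiv (b 4)) 1 = poly (pderiv (b 3)) 1"
    unfolding b by (simp_all add: bipoly_der_def pp del: sum.atMost_Suc)
qed

lemma has_nderiv_mult:
  assumes "has_nderiv j \<phi> g" "has_nderiv j \<psi> h"
  shows "has_nderiv j (\<lambda>p. \<phi> p * \<psi> p) (\<lambda>p. g p * \<psi> p + h p * \<phi> p)"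
  using assms unfolding has_nderiv_def
proof eventually_elim
  case (elim t)
  from DERIV_mult[OF elim] show ?case by simp
qed

lemma has_nderiv_power:
  assumes "has_nderiv j \<phi> g"
  shows "has_nderiv j (\<lambda>p. \<phi> p ^ n) (\<lambda>p. real n * (g p * \<phi> p ^ (n - 1)))"
  using assms unfolding has_nderiv_def
proof eventually_elim
  case (elim t)
  from DERIV_power[OF elim, of n] show ?case by simp
qed

lemma has_nderiv_coord: "has_nderiv j (\<lambda>p. p $ l) (\<lambda>p. nrm j $ l)" "has_nderiv j (\<lambda>p. 1 - p $ l) (\<lambda>p. - nrm j $ l)"
  unfolding has_nderiv_def by (rule AE_I2, auto intro!: derivative_eq_intros)+

lemma cond_L_edge:
  assumes L: "cond_L 4 \<xi>" and s: "s \<in> {0..1}"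
  shows "\<xi> (vec2 (edge_coords j s)) = (if j = 3 \<or> j = 4 then s else 0)"
proof -
  obtain q where q: "degree q \<le> 1" "\<And>t. t \<in> {0<..<1} \<Longrightarrow> \<xi> (edge j t) = poly q t"
    using L unfolding cond_L_def Ppoly_edge_def by blast
  have im: "edge j ` {0..1} \<subseteq> closure K" unfolding edge_eq
    using closure_K_vec2 by (auto simp: edge_coords_def edge_param_def)
  have ce: "continuous_on {0..1} (edge j)" unfolding edge_def[abs_def] by (intro continuous_intros)
  have "continuous_on (closure K) \<xi>" using L unfolding cond_L_def by blast
  from continuous_on_compose2[OF this ce im] have c: "continuous_on {0..1} (\<lambda>t. \<xi> (edge j t))" .
  have "\<xi> (edge j t) - poly q t = 0" if "t \<in> {0..1}" for t
  proof (rule continuous_constant_on_closure[of "{0<..<1}" "\<lambda>t. \<xi> (edge j t) - poly q t"])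
    show "continuous_on (closure {0<..<1}) (\<lambda>t. \<xi> (edge j t) - poly q t)"
      using c by (auto intro!: continuous_intros)
  qed (use q that in auto)
  then have v: "\<xi> (edge j t) = poly q t" if "t \<in> {0..1}" for t using that by auto
  have "q = [:coeff q 0, coeff q 1:]"
    using q(1) by (intro poly_eqI) (auto simp: coeff_pCons coeff_eq_0 split: nat.splits)
  then obtain u w where uw: "q = [:u, w:]" by blast
  have uv: "u = \<xi> (vertex j)" "u + w = \<xi> (vertex (j + 1))"
    using v[of 0] v[of 1] by (simp_all add: uw edge_def)
  have vv: "\<xi> (vertex i) = (if i = 4 then 1 else 0)" for i using L unfolding cond_L_def by blast
  have u: "u = (if j = 4 then 1 else 0)" "u + w = (if j + 1 = 4 then 1 else 0)"
    by (rule trans[OF uv(1) vv], rule trans[OF uv(2) vv])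
  have "edge_param j s \<in> {0..1}" "vec2 (edge_coords j s) = edge j (edge_param j s)" using s by (auto simp: edge_param_def edge_eq)
  then have e: "\<xi> (vec2 (edge_coords j s)) = u + edge_param j s * w" using v[of "edge_param j s"] by (simp add: uw)
  have "w = (if j + 1 = 4 then 1 else 0) - u" using u(2) by linarith
  then have w: "w = (if j + 1 = 4 then 1 else 0) - (if j = 4 then 1 else 0)" unfolding u(1) .
  show ?thesis
  proof (cases "j = 3")
    case True
    then show ?thesis unfolding e w u(1) edge_param_def by simp
  next
    case False
    note j3 = this
    show ?thesis
    proof (cases "j = 4")
      case True
      then show ?thesis unfolding e w u(1) edge_param_def by simp
    next
      case False
      with j3 exhaust_4[of j] have "j + 1 \<noteq> 4" by auto
      then show ?thesis unfolding e w u(1) using False j3 by simp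
    qed
  qed
qed

lemma cond_L_nderiv:
  assumes L: "cond_L 4 \<xi>"
  shows "\<exists>g m. \<forall>j. has_nderiv j \<xi> (g j) \<and> (\<forall>s\<in>{0<..<1}. g j (vec2 (edge_coords j s)) = m j)"
proof -
  have "\<exists>g m. has_nderiv j \<xi> g \<and> (\<forall>s\<in>{0<..<1}. g (vec2 (edge_coords j s)) = m)" for j
  proof -
    obtain g q where g: "has_nderiv j \<xi> g" "degree q \<le> 0" "\<And>t. t \<in> {0<..<1} \<Longrightarrow> g (edge j t) = poly q t"
      using L unfolding cond_L_def Ppoly_edge_def by blast
    from g(2) have "degree q = 0" by simp
    then obtain m where m: "q = [:m:]" by (rule degree_eq_zeroE)
    have "g (vec2 (edge_coords j s)) = m" if "s \<in> {0<..<1}" for s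
    proof -
      have "edge_param j s \<in> {0<..<1}" "edge j (edge_param j s) = vec2 (edge_coords j s)" using that by (auto simp: edge_param_def edge_eq)
      then show ?thesis using g(3)[of "edge_param j s"] by (simp add: m)
    qed
    then show ?thesis using g(1) by blast
  qed
  then have "\<forall>j. \<exists>g m. has_nderiv j \<xi> g \<and> (\<forall>s\<in>{0<..<1}. g (vec2 (edge_coords j s)) = m)" by blast
  from choice[OF this] obtain g where "\<forall>j. \<exists>m. has_nderiv j \<xi> (g j) \<and> (\<forall>s\<in>{0<..<1}. g j (vec2 (edge_coords j s)) = m)" by blast
  from choice[OF this] show ?thesis by blast
qed

abbreviation "one_minus_X \<equiv> [:1, -1:] :: real poly"

definition xi_val :: "nat \<Rightarrow> nat \<Rightarrow> 4 \<Rightarrow> real poly" where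
  "xi_val a b j = (if j = 3 \<and> a = 0 then [:0, 0, 1:] * one_minus_X ^ b else if j = 4 \<and> b = 0 then [:0, 0, 1:] * one_minus_X ^ a else 0)"

definition xi_der :: "(4 \<Rightarrow> real) \<Rightarrow> nat \<Rightarrow> nat \<Rightarrow> 4 \<Rightarrow> real poly" where
  "xi_der m a b j = (if j = 3 then (if a = 0 then [:0, 2 * m 3:] * one_minus_X ^ b else if a = 1 then [:0, 0, -1:] * one_minus_X ^ b else 0)
     else if j = 4 then (if b = 0 then [:0, 2 * m 4:] * one_minus_X ^ a else if b = 1 then [:0, 0, -1:] * one_minus_X ^ a else 0) else 0)"

definition B_der :: "4 \<Rightarrow> 4 \<Rightarrow> real poly" where
  "B_der i j = (if j = i then smult (outward_sign i) [:0, 1, -1:] else 0)"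

definition Bx_der :: "4 \<Rightarrow> real poly" where
  "Bx_der j = (if j = 4 then [:0, 0, 1, -1:] else 0)"

lemma edge_jet_xi:
  assumes L: "cond_L 4 \<xi>"
  shows "\<exists>m. \<forall>a b. edge_jet (\<lambda>p. (\<xi> p)\<^sup>2 * (1 - p$1)^a * (1 - p$2)^b) (xi_val a b) (xi_der m a b)"
proof -
  from cond_L_nderiv[OF L] obtain m g where
    gm: "\<forall>j. has_nderiv j \<xi> (g j) \<and> (\<forall>s\<in>{0<..<1}. g j (vec2 (edge_coords j s)) = m j)" by blast
  have g: "has_nderiv j \<xi> (g j)" "s \<in> {0<..<1} \<Longrightarrow> g j (vec2 (edge_coords j s)) = m j" for j s using gm by blast+
  note v = cond_L_edge[OF L]
  have "edge_jet (\<lambda>p. (\<xi> p)\<^sup>2 * (1 - p$1)^a * (1 - p$2)^b) (xi_val a b) (xi_der m a b)" for a b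
  proof (rule edge_jetI)
    define D where "D j p = (real 2 * (g j p * \<xi> p ^ (2 - 1)) * (1 - p$1)^a + real a * (- nrm j $ 1 * (1 - p$1)^(a - 1)) * (\<xi> p)\<^sup>2) * (1 - p$2)^b
      + real b * (- nrm j $ 2 * (1 - p$2)^(b - 1)) * ((\<xi> p)\<^sup>2 * (1 - p$1)^a)" for j p
    show "(\<xi> (vec2 (edge_coords j s)))\<^sup>2 * (1 - vec2 (edge_coords j s) $ 1) ^ a * (1 - vec2 (edge_coords j s) $ 2) ^ b = poly (xi_val a b j) s"
      if "s \<in> {0..1}" for j s
    proof -
      consider "j = 1" | "j = 2" | "j = 3" | "j = 4" using exhaust_4 by blast
      then show ?thesis unfolding v[OF that]
        by cases (simp_all add: xi_val_def edge_coords_def power2_eq_square power_0_left)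
    qed
    show "has_nderiv j (\<lambda>p. (\<xi> p)\<^sup>2 * (1 - p$1)^a * (1 - p$2)^b)
      (D j)" for j
      unfolding D_def[abs_def] by (intro has_nderiv_mult has_nderiv_power has_nderiv_coord g(1))
    have "D j p = outward_sign j * poly (xi_der m a b j) s"
      if "s \<in> {0<..<1}" "p = vec2 (edge_coords j s)" for j s p
    proof -
      have x: "\<xi> p = (if j = 3 \<or> j = 4 then s else 0)" "g j p = m j" using v[of s j] g(2) that by auto
      have z: "real n * (- 1 * 0 ^ (n - 1)) = (if n = 1 then - 1 else 0)" for n by (cases n) (simp_all add: power_0_left)
      consider "j = 1" | "j = 2" | "j = 3" | "j = 4" using exhaust_4 by blast
      then show ?thesis
      proof cases
        case 3
        then show ?thesis unfolding D_def x unfolding that(2)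
          by (simp add: z xi_der_def edge_coords_def outward_sign_def nrm_def power_0_left power2_eq_square del: mult_minus1)
      next
        case 4
        then show ?thesis unfolding D_def x unfolding that(2)
          by (simp add: z xi_der_def edge_coords_def outward_sign_def nrm_def power_0_left power2_eq_square del: mult_minus1)
      qed (simp_all add: D_def x xi_der_def)
    qed
    then show "s \<in> {0<..<1} \<Longrightarrow> D j (vec2 (edge_coords j s)) = outward_sign j * poly (xi_der m a b j) s" for j s by blast
  qed
  then show ?thesis by blast
qed

lemma lam_edge: "i \<in> {2, 3, 4} \<Longrightarrow> lam (i - 1) (vec2 (edge_coords i s)) * lam (i + 1) (vec2 (edge_coords i s)) = s * (1 - s)"
  by (auto simp: lam_def edge_coords_def)

lemma edge_jet_B:
  assumes H: "cond_H i B" and i: "i \<in> {2, 3, 4}"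
  shows "edge_jet B (\<lambda>j. 0) (B_der i)"
proof (rule edge_jetI)
  show "B (vec2 (edge_coords j s)) = poly 0 s" if "s \<in> {0..1}" for j s
  proof -
    have "edge_param j s \<in> {0..1}" "edge j (edge_param j s) = vec2 (edge_coords j s)" using that by (auto simp: edge_param_def edge_eq)
    moreover have "\<forall>j. \<forall>t\<in>{0..1}. B (edge j t) = 0" using H unfolding cond_H_def by blast
    ultimately show ?thesis by (metis poly_0)
  qed
  show "has_nderiv j B (if j = i then \<lambda>p. lam (i - 1) p * lam (i + 1) p else (\<lambda>p. 0))" for j
    using H unfolding cond_H_def by (cases "j = i") (simp_all only: if_True if_False refl simp_thms)
  show "(if j = i then \<lambda>p. lam (i - 1) p * lam (i + 1) p else (\<lambda>p. 0)) (vec2 (edge_coords j s)) = outward_sign j * poly (B_der i j) s" for j s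
  proof (cases "j = i")
    case True
    have "outward_sign i = 1 \<or> outward_sign i = -1" by (simp add: outward_sign_def)
    then show ?thesis using lam_edge[OF i, of s] by (elim disjE) (simp_all add: True B_der_def algebra_simps)
  qed (simp add: B_der_def)
qed

lemma edge_jet_Bx:
  assumes H: "cond_H 4 B"
  shows "edge_jet (\<lambda>p. B p * p$1) (\<lambda>j. 0) Bx_der"
proof (rule edge_jetI)
  have e: "edge_jet B (\<lambda>j. 0) (B_der 4)" by (rule edge_jet_B[OF H]) simp
  then have v: "B (vec2 (edge_coords j s)) = 0" if "s \<in> {0..1}" for j s using that by (simp add: edge_jet_def)
  show "B (vec2 (edge_coords j s)) * vec2 (edge_coords j s) $ 1 = poly 0 s" if "s \<in> {0..1}" for j s
    using v[OF that] by simp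
  show "has_nderiv j (\<lambda>p. B p * p$1) (\<lambda>p. (if j = 4 then \<lambda>p. lam (4 - 1) p * lam (4 + 1) p else (\<lambda>p. 0)) p * p $ 1 + nrm j $ 1 * B p)" for j
  proof (intro has_nderiv_mult has_nderiv_coord)
    show "has_nderiv j B (if j = 4 then \<lambda>p. lam (4 - 1) p * lam (4 + 1) p else (\<lambda>p. 0))"
      using H unfolding cond_H_def by (cases "j = 4") (simp_all only: if_True if_False refl simp_thms)
  qed
  show "(if j = 4 then \<lambda>p. lam (4 - 1) p * lam (4 + 1) p else (\<lambda>p. 0)) (vec2 (edge_coords j s)) * vec2 (edge_coords j s) $ 1 + nrm j $ 1 * B (vec2 (edge_coords j s)) = outward_sign j * poly (Bx_der j) s"
    if "s \<in> {0<..<1}" for j s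
  proof (cases "j = 4")
    case True
    have l: "lam (4 - 1) (vec2 (edge_coords 4 s)) * lam (4 + 1) (vec2 (edge_coords 4 s)) = s * (1 - s)" by (rule lam_edge) simp
    show ?thesis using v[of s 4] that unfolding True simp_thms if_True l
      by (simp add: Bx_der_def outward_sign_def edge_coords_def algebra_simps)
  next
    case False
    then show ?thesis using v[of s j] that by (simp add: Bx_der_def)
  qed
qed

lemma coeff_one_minus_X: "coeff (one_minus_X ^ n) n = (-1)^n" "n < m \<Longrightarrow> coeff (one_minus_X ^ n) m = 0"
proof -
  have d: "degree (one_minus_X ^ n) = n" by (simp add: degree_power_eq)
  then show "coeff (one_minus_X ^ n) n = (-1)^n" using lead_coeff_power[of one_minus_X n] by simp
  show "n < m \<Longrightarrow> coeff (one_minus_X ^ n) m = 0" by (rule coeff_eq_0) (simp add: d)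
qed

lemma degree_xi_val_xi_der:
  assumes "a = 0 \<Longrightarrow> b \<le> k" "a = 1 \<Longrightarrow> b + 1 \<le> k" "b = 0 \<Longrightarrow> a \<le> k" "b = 1 \<Longrightarrow> a + 1 \<le> k"
  shows "degree (xi_val a b j) \<le> k + 2" "degree (xi_der m a b j) \<le> k + 1"
proof -
  have "degree (r * one_minus_X ^ n) \<le> degree r + n" for r n
    using degree_mult_le[of r "one_minus_X ^ n"] by (simp add: degree_power_eq)
  from order_trans[OF this] assms show "degree (xi_val a b j) \<le> k + 2" "degree (xi_der m a b j) \<le> k + 1"
    by (auto simp: xi_val_def xi_der_def)
qed

lemma degree_B_der: "k \<ge> 1 \<Longrightarrow> degree (B_der i j) \<le> k + 1" "k \<ge> 2 \<Longrightarrow> degree (Bx_der j) \<le> k + 1"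
  by (simp_all add: B_der_def Bx_der_def outward_sign_def)

definition xi_gen :: "(real^2 \<Rightarrow> real) \<Rightarrow> nat \<Rightarrow> nat \<Rightarrow> real^2 \<Rightarrow> real" where
  "xi_gen \<xi> a b = (\<lambda>p. (\<xi> p)\<^sup>2 * (1 - p$1)^a * (1 - p$2)^b)"

lemma good_jets:
  assumes "cond_L 4 \<xi>" and m: "\<forall>a b. edge_jet (\<lambda>p. (\<xi> p)\<^sup>2 * (1 - p$1)^a * (1 - p$2)^b) (xi_val a b) (xi_der m a b)"
    and "cond_H 2 (B 2)" "cond_H 3 (B 3)" "cond_H 4 (B 4)"
  shows "i \<in> {2, 3, 4} \<Longrightarrow> on_K (B i) \<in> H2 \<Longrightarrow> good_jet (B i) (\<lambda>j. 0) (B_der i)"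
    "on_K (\<lambda>p. B 4 p * p$1) \<in> H2 \<Longrightarrow> good_jet (\<lambda>p. B 4 p * p$1) (\<lambda>j. 0) Bx_der"
    "on_K (xi_gen \<xi> a b) \<in> H2 \<Longrightarrow> good_jet (xi_gen \<xi> a b) (xi_val a b) (xi_der m a b)"
proof -
  have c: "continuous_on (closure K) \<xi>" using assms(1) unfolding cond_L_def by blast
  have cB: "continuous_on (closure K) (B i)" "cond_H i (B i)" if "i \<in> {2, 3, 4}" for i
  proof -
    show "cond_H i (B i)" using that assms(3-5) by blast
    then show "continuous_on (closure K) (B i)" unfolding cond_H_def by (rule conjunct1)
  qed
  have cl: "continuous_on (closure K) (\<lambda>p. p $ l)" for l by (intro continuous_intros)
  show "good_jet (B i) (\<lambda>j. 0) (B_der i)" if "i \<in> {2, 3, 4}" "on_K (B i) \<in> H2"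
    unfolding good_jet_def using that cB[OF that(1)] edge_jet_B by blast
  show "good_jet (\<lambda>p. B 4 p * p$1) (\<lambda>j. 0) Bx_der" if "on_K (\<lambda>p. B 4 p * p$1) \<in> H2"
    unfolding good_jet_def using that edge_jet_Bx[OF assms(5)] continuous_on_mult[OF cB(1)[of 4] cl[of 1]] by simp
  show "good_jet (xi_gen \<xi> a b) (xi_val a b) (xi_der m a b)" if "on_K (xi_gen \<xi> a b) \<in> H2"
  proof -
    have "continuous_on (closure K) (xi_gen \<xi> a b)" unfolding xi_gen_def by (intro continuous_intros c cl)
    then show ?thesis unfolding good_jet_def using that m unfolding xi_gen_def by blast
  qed
qed

definition fill_exps :: "nat \<Rightarrow> (nat \<times> nat) list" where
  "fill_exps k = (if k = 1 then [(0, 0), (1, 0), (0, 1)]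
     else if k = 2 then [(1, 0), (0, 1), (1, 1), (2, 0), (0, 2)]
     else [(k - 1, 0), (0, k - 1), (k - 1, 1), (1, k - 1), (k, 0), (0, k)])"

definition num_B :: "nat \<Rightarrow> nat" where "num_B k = (if k = 1 then 3 else 4)"

definition num_fill :: "nat \<Rightarrow> nat" where "num_fill k = (if k = 1 then 6 else if k = 2 then 9 else 10)"

definition fill_fun :: "nat \<Rightarrow> (real^2 \<Rightarrow> real) \<Rightarrow> (4 \<Rightarrow> real^2 \<Rightarrow> real) \<Rightarrow> nat \<Rightarrow> real^2 \<Rightarrow> real" where
  "fill_fun k \<xi> B i = (if i = 0 then B 2 else if i = 1 then B 3 else if i = 2 then B 4
     else if i < num_B k then (\<lambda>p. B 4 p * p$1)
     else xi_gen \<xi> (fst (fill_exps k ! (i - num_B k))) (snd (fill_exps k ! (i - num_B k))))"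

definition fill_val :: "nat \<Rightarrow> nat \<Rightarrow> 4 \<Rightarrow> real poly" where
  "fill_val k i = (if i < num_B k then (\<lambda>j. 0) else xi_val (fst (fill_exps k ! (i - num_B k))) (snd (fill_exps k ! (i - num_B k))))"

definition fill_der :: "nat \<Rightarrow> (4 \<Rightarrow> real) \<Rightarrow> nat \<Rightarrow> 4 \<Rightarrow> real poly" where
  "fill_der k m i = (if i = 0 then B_der 2 else if i = 1 then B_der 3 else if i = 2 then B_der 4
     else if i < num_B k then Bx_der
     else xi_der m (fst (fill_exps k ! (i - num_B k))) (snd (fill_exps k ! (i - num_B k))))"

lemma fillM_gen_eq:
  assumes k: "k \<ge> 1"
  shows "fillM_gen k \<xi> B = (\<lambda>i. on_K (fill_fun k \<xi> B i)) ` {..<num_fill k}"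
proof -
  have l: "{..<6::nat} = {0, 1, 2, 3, 4, 5}" "{..<9::nat} = {0, 1, 2, 3, 4, 5, 6, 7, 8}"
    "{..<10::nat} = {0, 1, 2, 3, 4, 5, 6, 7, 8, 9}" by auto
  consider "k = 1" | "k = 2" | "k \<ge> 3" using k by linarith
  then show ?thesis
  proof cases
    case 1
    show ?thesis unfolding 1 fillM_gen_def num_fill_def
      by (simp add: l fill_fun_def num_B_def fill_exps_def xi_gen_def numeral_2_eq_2[symmetric] nth_Cons' del: One_nat_def)
  next
    case 2
    show ?thesis unfolding 2 fillM_gen_def num_fill_def
      by (simp add: l fill_fun_def num_B_def fill_exps_def xi_gen_def nth_Cons' del: One_nat_def)
  next
    case 3
    then have k: "k \<noteq> 1" "k \<noteq> 2" by auto
    show ?thesis unfolding fillM_gen_def num_fill_def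
      by (simp add: k l fill_fun_def num_B_def fill_exps_def xi_gen_def nth_Cons' del: One_nat_def)
  qed
qed

lemma fill_exps_bounds:
  assumes "k \<ge> 1" "num_B k \<le> i" "i < num_fill k" "fill_exps k ! (i - num_B k) = (a, b)"
  shows "(a = 0 \<longrightarrow> b \<le> k) \<and> (a = 1 \<longrightarrow> b + 1 \<le> k) \<and> (b = 0 \<longrightarrow> a \<le> k) \<and> (b = 1 \<longrightarrow> a + 1 \<le> k)"
proof -
  have "length (fill_exps k) = num_fill k - num_B k" by (simp add: fill_exps_def num_fill_def num_B_def)
  then have "fill_exps k ! (i - num_B k) \<in> set (fill_exps k)" using assms(2,3) by (intro nth_mem) linarith
  then have "(a, b) \<in> set (fill_exps k)" using assms(4) by simp
  then show ?thesis using assms(1) by (auto simp: fill_exps_def split: if_splits)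
qed

lemma fillM_indep:
  assumes k: "k \<ge> 1" and d: "\<forall>a b. (a, b) \<notin> potential_exps k \<longrightarrow> d a b = 0"
    and eq: "airy_trace (comb (num_fill k) c (fill_val k)) (comb (num_fill k) c (fill_der k m)) = airy_trace (bipoly_val (Suc (Suc k)) d) (bipoly_der (Suc (Suc k)) d)"
  shows "\<forall>i<num_fill k. c i = 0"
proof -
  let ?A = "comb (num_fill k) c (fill_val k)" and ?B = "comb (num_fill k) c (fill_der k m)"
  note C = airy_bipoly_trace_conditions[OF k d eq]
  have Sum: "(\<Sum>i<6. f i) = f 0 + f 1 + f 2 + f 3 + f 4 + f 5"
    "(\<Sum>i<9. f i) = f 0 + f 1 + f 2 + f 3 + f 4 + f 5 + f 6 + f 7 + f 8"
    "(\<Sum>i<10. f i) = f 0 + f 1 + f 2 + f 3 + f 4 + f 5 + f 6 + f 7 + f 8 + f 9" for f :: "nat \<Rightarrow> real poly"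
    by (simp_all add: eval_nat_numeral)
  consider "k = 1" | "k = 2" | "k = (k - 3) + 3" using k by linarith
  then show ?thesis
  proof cases
    case 1
    have A: "?A 1 = 0" "?A 2 = 0" "?A 3 = smult (c 3) [:0, 0, 1:] + smult (c 5) ([:0, 0, 1:] * one_minus_X)"
      "?A 4 = smult (c 3) [:0, 0, 1:] + smult (c 4) ([:0, 0, 1:] * one_minus_X)"
      by (simp_all add: 1 comb_def num_fill_def Sum fill_val_def num_B_def fill_exps_def xi_val_def nth_Cons' del: One_nat_def)
    have B: "?B 1 = 0" "?B 2 = smult (c 0) [:0, -1, 1:]" 
      "?B 3 = smult (c 1) [:0, 1, -1:] + smult (c 3) [:0, 2 * m 3:] + smult (c 4) [:0, 0, -1:] + smult (c 5) ([:0, 2 * m 3:] * one_minus_X)"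
      "?B 4 = smult (c 2) [:0, 1, -1:] + smult (c 3) [:0, 2 * m 4:] + smult (c 4) ([:0, 2 * m 4:] * one_minus_X) + smult (c 5) [:0, 0, -1:]"
      by (simp_all add: 1 comb_def num_fill_def Sum fill_der_def num_B_def fill_exps_def xi_der_def B_der_def outward_sign_def nth_Cons' del: One_nat_def)
    note C' = C[unfolded A B]
    have c0: "c 0 = 0" using C'(7) by (simp add: pderiv_pCons)
    have c4: "c 4 = 0" "c 5 = 0" using C'(1,2) by (simp_all add: 1 coeff_pCons)
    have c3: "c 3 = 0" using C'(5) by (simp add: 1 coeff_pCons c0 c4)
    have "c 1 = 0" "c 2 = 0" using C'(8,9) by (simp_all add: pderiv_pCons c0 c3 c4)
    with c0 c3 c4 show ?thesis by (auto simp: num_fill_def 1 less_Suc_eq eval_nat_numeral)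
  next
    case 2
    have A: "?A 1 = 0" "?A 2 = 0" "?A 3 = smult (c 5) ([:0, 0, 1:] * one_minus_X) + smult (c 8) ([:0, 0, 1:] * one_minus_X^2)"
      "?A 4 = smult (c 4) ([:0, 0, 1:] * one_minus_X) + smult (c 7) ([:0, 0, 1:] * one_minus_X^2)"
      by (simp_all add: 2 comb_def num_fill_def Sum fill_val_def num_B_def fill_exps_def xi_val_def nth_Cons' del: One_nat_def mult_pCons_left mult_pCons_right)
    have B: "?B 1 = 0" "?B 2 = smult (c 0) [:0, -1, 1:]"
      "?B 3 = smult (c 1) [:0, 1, -1:] + smult (c 4) [:0, 0, -1:] + smult (c 5) ([:0, 2 * m 3:] * one_minus_X)
         + smult (c 6) ([:0, 0, -1:] * one_minus_X) + smult (c 8) ([:0, 2 * m 3:] * one_minus_X^2)"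
      "?B 4 = smult (c 2) [:0, 1, -1:] + smult (c 3) [:0, 0, 1, -1:] + smult (c 4) ([:0, 2 * m 4:] * one_minus_X) + smult (c 5) [:0, 0, -1:]
         + smult (c 6) ([:0, 0, -1:] * one_minus_X) + smult (c 7) ([:0, 2 * m 4:] * one_minus_X^2)"
      by (simp_all add: 2 comb_def num_fill_def Sum fill_der_def num_B_def fill_exps_def xi_der_def B_der_def Bx_der_def outward_sign_def nth_Cons' del: One_nat_def mult_pCons_left mult_pCons_right)
    note C' = C[unfolded A B]
    have c7: "c 7 = 0" "c 8 = 0" using C'(1,2) by (simp_all add: 2 coeff_pCons power2_eq_square)
    have c4: "c 4 = 0" "c 5 = 0" using C'(5,6) by (simp_all add: 2 coeff_pCons c7)
    have c6: "c 6 = 0" using C'(4) by (simp add: 2 coeff_pCons c7 c4)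
    have c3: "c 3 = 0" using C'(3) by (simp add: 2 coeff_pCons c7 c4 c6)
    have c0: "c 0 = 0" using C'(7) by (simp add: pderiv_pCons)
    have "c 1 = 0" "c 2 = 0" using C'(8,9) by (simp_all add: pderiv_pCons c0 c3 c4 c6 c7)
    with c0 c3 c4 c6 c7 show ?thesis by (auto simp: num_fill_def 2 less_Suc_eq eval_nat_numeral)
  next
    case 3
    then obtain n where n: "k = Suc (Suc (Suc n))" by (metis add.commute eval_nat_numeral(3) numeral_2_eq_2 plus_nat.simps(2) add_0)
    have A: "?A 1 = 0" "?A 2 = 0"
      "?A 3 = smult (c 5) ([:0, 0, 1:] * one_minus_X^Suc (Suc n)) + smult (c 9) ([:0, 0, 1:] * one_minus_X^k)"
      "?A 4 = smult (c 4) ([:0, 0, 1:] * one_minus_X^Suc (Suc n)) + smult (c 8) ([:0, 0, 1:] * one_minus_X^k)"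
      by (simp_all add: n comb_def num_fill_def Sum fill_val_def num_B_def fill_exps_def xi_val_def nth_Cons' del: power_Suc mult_pCons_left mult_pCons_right)
    have B: "?B 1 = 0" "?B 2 = smult (c 0) [:0, -1, 1:]"
      "?B 3 = smult (c 1) [:0, 1, -1:] + smult (c 5) ([:0, 2 * m 3:] * one_minus_X^Suc (Suc n))
         + smult (c 7) ([:0, 0, -1:] * one_minus_X^Suc (Suc n)) + smult (c 9) ([:0, 2 * m 3:] * one_minus_X^k)"
      "?B 4 = smult (c 2) [:0, 1, -1:] + smult (c 3) [:0, 0, 1, -1:] + smult (c 4) ([:0, 2 * m 4:] * one_minus_X^Suc (Suc n))
         + smult (c 6) ([:0, 0, -1:] * one_minus_X^Suc (Suc n)) + smult (c 8) ([:0, 2 * m 4:] * one_minus_X^k)"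
      by (simp_all add: n comb_def num_fill_def Sum fill_der_def num_B_def fill_exps_def xi_der_def B_der_def Bx_der_def outward_sign_def nth_Cons' del: power_Suc mult_pCons_left mult_pCons_right)
    note C' = C[unfolded A B]
    have c8: "c 8 = 0" "c 9 = 0" using C'(1,2)
      by (simp_all add: n coeff_one_minus_X del: power_Suc)
    have c4: "c 4 = 0" "c 5 = 0" using C'(5,6) by (simp_all add: n coeff_one_minus_X c8 del: power_Suc)
    have c6: "c 6 = 0" "c 7 = 0" using C'(3,4) by (simp_all add: n coeff_one_minus_X c8 c4 del: power_Suc)
    have c0: "c 0 = 0" using C'(7) by (simp add: pderiv_pCons)
    have c1: "c 1 = 0" "c 2 = 0" using C'(8,9) by (simp_all add: pderiv_pCons c0 c4 c6 c8)
    have "c 3 = 0" using C'(10) by (simp add: pderiv_pCons c0 c1 c4 c6 c8 del: One_nat_def)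
    with c0 c1 c4 c6 c8 show ?thesis by (auto simp: num_fill_def n less_Suc_eq eval_nat_numeral)
  qed
qed

lemma fillM_properties:
  assumes k: "k \<ge> 1" and L: "cond_L 4 \<xi>" and H: "cond_H 2 (B 2)" "cond_H 3 (B 3)" "cond_H 4 (B 4)"
    and H2: "fillM_gen k \<xi> B \<subseteq> H2"
  shows "wdiv ` fillM k \<xi> B = {0}" "ntrace ` fillM k \<xi> B \<subseteq> Mspace k"
    "ntrace ` fillM k \<xi> B \<inter> ntrace ` divfree (Sigma_g k) = {0}"
    "dim (fillM k \<xi> B) = num_fill k" "dim (ntrace ` fillM k \<xi> B) = num_fill k"
proof -
  from edge_jet_xi[OF L] obtain m where
    m: "\<forall>a b. edge_jet (\<lambda>p. (\<xi> p)\<^sup>2 * (1 - p$1)^a * (1 - p$2)^b) (xi_val a b) (xi_der m a b)" by blast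
  note J = good_jets[OF L m H]
  have h: "on_K (fill_fun k \<xi> B i) \<in> H2" if "i < num_fill k" for i
    using H2 that unfolding fillM_gen_eq[OF k] by blast
  have good: "good_jet (fill_fun k \<xi> B i) (fill_val k i) (fill_der k m i)" if "i < num_fill k" for i
  proof -
    have n: "3 \<le> num_B k" "num_B k \<le> 4" by (simp_all add: num_B_def)
    consider "i = 0" | "i = 1" | "i = 2" | "3 \<le> i" "i < num_B k" | "num_B k \<le> i" using n by linarith
    then show ?thesis
      using h[OF that] n by cases (simp_all add: fill_fun_def fill_val_def fill_der_def J)
  qed
  have deg: "degree (fill_val k i j) \<le> k + 2" "degree (fill_der k m i j) \<le> k + 1" if i: "i < num_fill k" for i j
  proof -
    have "num_B k \<le> i \<Longrightarrow> degree (xi_val (fst (fill_exps k ! (i - num_B k))) (snd (fill_exps k ! (i - num_B k))) j) \<le> k + 2 \<and>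
      degree (xi_der m (fst (fill_exps k ! (i - num_B k))) (snd (fill_exps k ! (i - num_B k))) j) \<le> k + 1"
      using fill_exps_bounds[OF k _ i] degree_xi_val_xi_der[of "fst (fill_exps k ! (i - num_B k))" "snd (fill_exps k ! (i - num_B k))" k]
      by (metis prod.collapse)
    moreover have "3 < num_B k \<Longrightarrow> 2 \<le> k" using k by (simp add: num_B_def split: if_splits)
    ultimately show "degree (fill_val k i j) \<le> k + 2" "degree (fill_der k m i j) \<le> k + 1"
      using degree_B_der(1)[OF k] degree_B_der(2)[of k] by (auto simp: fill_val_def fill_der_def)
  qed
  have S: "fillM k \<xi> B = airy ` span ((\<lambda>i. on_K (fill_fun k \<xi> B i)) ` {..<num_fill k})"
    unfolding fillM_def fillM_gen_eq[OF k] ..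
  show "wdiv ` fillM k \<xi> B = {0}" "ntrace ` fillM k \<xi> B \<subseteq> Mspace k"
    "ntrace ` fillM k \<xi> B \<inter> ntrace ` divfree (Sigma_g k) = {0}"
    "dim (fillM k \<xi> B) = num_fill k" "dim (ntrace ` fillM k \<xi> B) = num_fill k"
    by (rule fill_space_from_jets[where G = "fill_fun k \<xi> B" and A = "fill_val k" and B = "fill_der k m", OF good deg fillM_indep[OF k] k S]; assumption)+
qed

theorem theorem4p1:
  fixes k :: nat
  assumes "k \<ge> 1"
  shows
    "I_M (Mspace k) (Sigma_g k) (V_g k) = (if k = 1 then 6 else if k = 2 then 9 else 10) \<and>
     I_S (Sigma_g k) (V_g k) = 3 \<and>
     (\<forall>(\<xi>\<^sub>4 :: real^2 \<Rightarrow> real) (B :: 4 \<Rightarrow> real^2 \<Rightarrow> real).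
        cond_L 4 \<xi>\<^sub>4 \<and> cond_H 2 (B 2) \<and> cond_H 3 (B 3) \<and> cond_H 4 (B 4) \<and>
        fillM_gen k \<xi>\<^sub>4 B \<subseteq> H2 \<longrightarrow>
          wdiv ` fillM k \<xi>\<^sub>4 B = {0} \<and>
          ntrace ` fillM k \<xi>\<^sub>4 B \<subseteq> Mspace k \<and>
          ntrace ` fillM k \<xi>\<^sub>4 B \<inter> ntrace ` divfree (Sigma_g k) = {0} \<and>
          dim (fillM k \<xi>\<^sub>4 B) = dim (ntrace ` fillM k \<xi>\<^sub>4 B) \<and>
          int (dim (ntrace ` fillM k \<xi>\<^sub>4 B)) = I_M (Mspace k) (Sigma_g k) (V_g k)) \<and>
     (wdiv ` fillV k \<subseteq> V_g k \<and>
      wdiv ` fillV k \<inter> wdiv ` Sigma_g k = {0} \<and>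
      ntrace ` fillV k \<subseteq> Mspace k \<and>
      dim (fillV k) = dim (wdiv ` fillV k) \<and>
      int (dim (wdiv ` fillV k)) = I_S (Sigma_g k) (V_g k))"
proof -
  note k = assms
  have M: "int (num_fill k) = I_M (Mspace k) (Sigma_g k) (V_g k)" unfolding I_M_value[OF k] by (simp add: num_fill_def)
  note V = fillV_properties[OF k]
  show ?thesis
  proof (intro conjI allI impI; (elim conjE)?)
    fix \<xi> :: "real^2 \<Rightarrow> real" and B :: "4 \<Rightarrow> real^2 \<Rightarrow> real"
    assume "cond_L 4 \<xi>" "cond_H 2 (B 2)" "cond_H 3 (B 3)" "cond_H 4 (B 4)" "fillM_gen k \<xi> B \<subseteq> H2"
    note F = fillM_properties[OF k this]
    show "wdiv ` fillM k \<xi> B = {0}" "ntrace ` fillM k \<xi> B \<subseteq> Mspace k"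
      "ntrace ` fillM k \<xi> B \<inter> ntrace ` divfree (Sigma_g k) = {0}"
      by (fact F(1), fact F(2), fact F(3))
    show "dim (fillM k \<xi> B) = dim (ntrace ` fillM k \<xi> B)" unfolding F(4,5) ..
    show "int (dim (ntrace ` fillM k \<xi> B)) = I_M (Mspace k) (Sigma_g k) (V_g k)" unfolding F(5) by (rule M)
  next
    show "dim (fillV k) = dim (wdiv ` fillV k)" unfolding V(4,5) ..
    show "int (dim (wdiv ` fillV k)) = I_S (Sigma_g k) (V_g k)" unfolding V(5) I_S_value[OF k] by simp
  qed (fact I_M_value[OF k] I_S_value[OF k] V(1-3))+
qed

end
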